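(* Let $G$ be a Lie group and $H$ any dense subgroup of $G$. Then the induced space $\operatorname{Ind}_H^G\{0\}=(T^*G)/\!\!/H$, with its reduced $2$-form, and the diffeological cotangent space $T^*(G/H)$, with its $2$-form $d\,\mathrm{Liouv}$, are isomorphic as parasymplectic Hamiltonian $G$-spaces.
   Context: Diffeology: notions (plot, smooth map, subset and quotient diffeology) are those of Souriau and Iglesias-Zemmour. A differential form $\alpha$ on a diffeological space assigns to each plot $P:U\to X$ an ordinary form $P^*\alpha$ on $U$, with $(P\circ f)^*\alpha=f^*(P^*\alpha)$ for all smooth $f:V\to U$ between open subsets of Euclidean spaces; forms are pulled back by smooth maps in the obvious way. An arbitrary subgroup $H\subset G$ is endowed with its canonical Lie group structure (Bourbaki, Lie Groups III.4.5), with Lie algebra $\mathfrak h=\{Z\in\mathfrak g:e^{tZ}\in H\ \forall t\in\mathbf R\}$ and underlying diffeology the subset diffeology of $H$ in $G$. $G/H$ has the quotient diffeology and the $G$-action by left translations. Translations: for $g,q\in G$, $v\in T_qG$, $p\in T_q^*G$, $gv$ and $vg$ denote the images of $v$ under the derivatives of left and right translation by $g$, and $gp\in T^*_{gq}G$, $pg\in T^*_{qg}G$ are defined by $\langle gp,v\rangle=\langle p,g^{-1}v\rangle$, $\langle pg,v\rangle=\langle p,vg^{-1}\rangle$. Identify $\mathfrak g^*=T^*_eG$. Induced space: $(T^*G)/\!\!/H:=\psi^{-1}(0)/H$, where $\psi:T^*G\to\mathfrak h^*$, $\psi(p)=-(q^{-1}p)|_{\mathfrak h}$ for $p\in T^*_qG$,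 and $H$ acts by $h(p)=ph^{-1}$; it has the subquotient diffeology (subset diffeology on $\psi^{-1}(0)$, then quotient diffeology). Its reduced $2$-form is the unique diffeological $2$-form whose pull-back to $\psi^{-1}(0)$ is the restriction of $d\varpi_{T^*G}$ to $\psi^{-1}(0)$, where $\varpi_{T^*G}(\delta p)=\langle p,\delta q\rangle$ is the canonical $1$-form ($\delta q\in T_qG$ the image of $\delta p\in T_p(T^*G)$); this $2$-form exists (taken as known here). The $G$-action on $(T^*G)/\!\!/H$ is induced by $g(p)=gp$, and the moment map $(T^*G)/\!\!/H\to\mathfrak g^*$ is induced by $\phi(p)=pq^{-1}$ ($p\in T_q^*G$). Diffeological cotangent space (Iglesias-Zemmour): for a diffeological space $X$, $\Omega^1(X)$ is the space of diffeological $1$-forms on $X$ with its functional diffeology (a map $A:U\to\Omega^1(X)$ is a plot iff for every plot $P:V\to X$ the map $(u,v)\mapsto (P^*A(u))_v$ is smooth on $U\times V$). A form $\alpha\in\Omega^1(X)$ vanishes at $x$ if $(P^*\alpha)_0=0$ for every plot $P:U\to X$ with $0\in U$, $P(0)=x$. $T^*_x(X)=\Omega^1(X)/\{\text{1-forms vanishing at }x\}$ and $T^*(X)=\{(x,a):x\in X,\ a\in T_x^*(X)\}$, with the quotient diffeology of $X\times\Omega^1(X)$. $\mathrm{Liouv}$ is the $1$-form on $T^*(X)$ whose pull-back to $X\times\Omega^1(X)$ is the $1$-form $\mathrm{Taut}$ given by $((P\times A)^*\mathrm{Taut})(\delta u)=P^*(A(u))(\delta u)$ for $\delta u\in T_uU$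 and all plots $P\times A:U\to X\times\Omega^1(X)$. A group $G$ acting smoothly on $X$ acts on $T^*(X)$, preserving $\mathrm{Liouv}$, by the action induced by $g(x,\alpha)=(g(x),g_*(\alpha))$, where $g_*$ is push-forward, $g_*=(g^{-1})^*$. The moment map $\Phi:T^*(X)\to\mathfrak g^*$ is: $\Phi(y)$ is the value at $e$ of the $1$-form $\hat y^*\mathrm{Liouv}\in\Omega^1(G)$, where $\hat y:G\to T^*(X)$, $\hat y(g)=g(y)$. A parasymplectic Hamiltonian $G$-space is here a diffeological space with a closed diffeological $2$-form, a smooth $G$-action preserving it, and a moment map to $\mathfrak g^*$; an isomorphism of two such is a $G$-equivariant diffeomorphism that relates the $2$-forms (by pull-back) and the moment maps (by composition). *)

theory Defs
  imports "HOL-Analysis.Analysis" "HOL-Algebra.Coset"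
begin

section \<open>Smooth maps between open subsets of Euclidean spaces\<close>

text \<open>
  Plots have domains in all the spaces \<open>R\<^sup>n\<close>, so \<open>n\<close> has to be a term and not a type:
  \<open>R\<^sup>n\<close> is the library's \<^const>\<open>Euclidean_space\<close> \<open>n\<close>, made of the real sequences that
  vanish from index \<open>n\<close> on. In particular \<open>n = 0\<close> is allowed.
\<close>

abbreviation Rn :: "nat \<Rightarrow> (nat \<Rightarrow> real) set"
  where "Rn n \<equiv> topspace (Euclidean_space n)"

definition evec :: "nat \<Rightarrow> nat \<Rightarrow> real"
  where "evec i = (\<lambda>j. if j = i then 1 else 0)"

definition partial :: "nat \<Rightarrow> ((nat \<Rightarrow> real) \<Rightarrow> real) \<Rightarrow> (nat \<Rightarrow> real) \<Rightarrow> real"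
  where "partial i f x = deriv (\<lambda>t. f (x(i := t))) (x i)"

text \<open>Only used for \<open>U\<close> open in \<open>R\<^sup>m\<close>, where it is the usual class \<open>C\<^sup>k\<close>.\<close>

fun Ck_on :: "nat \<Rightarrow> nat \<Rightarrow> (nat \<Rightarrow> real) set \<Rightarrow> ((nat \<Rightarrow> real) \<Rightarrow> real) \<Rightarrow> bool"
  where
    "Ck_on m 0 U f \<longleftrightarrow> continuous_on U f"
  | "Ck_on m (Suc k) U f \<longleftrightarrow> continuous_on U f \<and>
       (\<forall>i<m. (\<forall>x\<in>U. (\<lambda>t. f (x(i := t))) differentiable (at (x i))) \<and> Ck_on m k U (partial i f))"

definition smooth_on :: "nat \<Rightarrow> (nat \<Rightarrow> real) set \<Rightarrow> ((nat \<Rightarrow> real) \<Rightarrow> real) \<Rightarrow> bool"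
  where "smooth_on m U f \<longleftrightarrow> (\<forall>k. Ck_on m k U f)"

definition smooth_map ::
  "nat \<Rightarrow> (nat \<Rightarrow> real) set \<Rightarrow> nat \<Rightarrow> (nat \<Rightarrow> real) set \<Rightarrow> ((nat \<Rightarrow> real) \<Rightarrow> (nat \<Rightarrow> real)) \<Rightarrow> bool"
  where "smooth_map m V n U f \<longleftrightarrow>
    openin (Euclidean_space m) V \<and> openin (Euclidean_space n) U \<and> f ` V \<subseteq> U \<and>
    (\<forall>j<n. smooth_on m V (\<lambda>x. f x j))"

definition dirderiv :: "nat \<Rightarrow> ((nat \<Rightarrow> real) \<Rightarrow> real) \<Rightarrow> (nat \<Rightarrow> real) \<Rightarrow> (nat \<Rightarrow> real) \<Rightarrow> real"
  where "dirderiv m f u v = (\<Sum>i<m. partial i f u * v i)"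

text \<open>The derivative \<open>Df(u)(v)\<close>, for \<open>f\<close> defined on an open subset of \<open>R\<^sup>m\<close>.\<close>

definition jac ::
  "nat \<Rightarrow> ((nat \<Rightarrow> real) \<Rightarrow> (nat \<Rightarrow> real)) \<Rightarrow> (nat \<Rightarrow> real) \<Rightarrow> (nat \<Rightarrow> real) \<Rightarrow> (nat \<Rightarrow> real)"
  where "jac m f u v = (\<lambda>j. dirderiv m (\<lambda>x. f x j) u v)"

text \<open>The identification \<open>R\<^bsup>m+n\<^esup> = R\<^sup>m \<times> R\<^sup>n\<close>.\<close>

definition fst_part :: "nat \<Rightarrow> (nat \<Rightarrow> real) \<Rightarrow> (nat \<Rightarrow> real)"
  where "fst_part m z = (\<lambda>i. if i < m then z i else 0)"

definition snd_part :: "nat \<Rightarrow> (nat \<Rightarrow> real) \<Rightarrow> (nat \<Rightarrow> real)"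
  where "snd_part m z = (\<lambda>i. z (m + i))"

definition join :: "nat \<Rightarrow> (nat \<Rightarrow> real) \<Rightarrow> (nat \<Rightarrow> real) \<Rightarrow> (nat \<Rightarrow> real)"
  where "join m x y = (\<lambda>i. if i < m then x i else y (i - m))"

definition prod_dom ::
  "nat \<Rightarrow> nat \<Rightarrow> (nat \<Rightarrow> real) set \<Rightarrow> (nat \<Rightarrow> real) set \<Rightarrow> (nat \<Rightarrow> real) set"
  where "prod_dom m n U V = {z \<in> Rn (m + n). fst_part m z \<in> U \<and> snd_part m z \<in> V}"


section \<open>Differential forms on open subsets of Euclidean spaces\<close>

definition vecs :: "nat \<Rightarrow> nat \<Rightarrow> (nat \<Rightarrow> real) list set"
  where "vecs n k = {vs. length vs = k \<and> set vs \<subseteq> Rn n}"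

text \<open>
  A \<open>k\<close>-form on \<open>U\<close> maps a point and a list of \<open>k\<close> vectors to a number. It is required to be \<open>0\<close>
  on all other arguments, so that equality of forms is equality of functions.
\<close>

definition smooth_form ::
  "nat \<Rightarrow> nat \<Rightarrow> (nat \<Rightarrow> real) set \<Rightarrow> ((nat \<Rightarrow> real) \<Rightarrow> (nat \<Rightarrow> real) list \<Rightarrow> real) \<Rightarrow> bool"
  where "smooth_form n k U \<omega> \<longleftrightarrow>
    (\<forall>u vs. \<not> (u \<in> U \<and> vs \<in> vecs n k) \<longrightarrow> \<omega> u vs = 0) \<and>
    (\<forall>vs\<in>vecs n k. smooth_on n U (\<lambda>u. \<omega> u vs)) \<and>
    (\<forall>u\<in>U. \<forall>vs\<in>vecs n k. \<forall>i<k. \<forall>x\<in>Rn n. \<forall>y\<in>Rn n. \<forall>a b.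
       \<omega> u (vs[i := (\<lambda>j. a * x j + b * y j)]) = a * \<omega> u (vs[i := x]) + b * \<omega> u (vs[i := y])) \<and>
    (\<forall>u\<in>U. \<forall>vs\<in>vecs n k. \<forall>i<k. \<forall>j<k. i \<noteq> j \<and> vs ! i = vs ! j \<longrightarrow> \<omega> u vs = 0)"

text \<open>
  \<open>d\<omega>(v\<^sub>0, \<dots>, v\<^sub>k) = \<Sum>\<^sub>i (-1)\<^sup>i D\<^bsub>v\<^sub>i\<^esub>(\<omega>(\<dots>, v\<^sub>i omitted, \<dots>))\<close> for constant vectors \<open>v\<^sub>i\<close>.
\<close>

definition ext_deriv ::
  "nat \<Rightarrow> nat \<Rightarrow> (nat \<Rightarrow> real) set \<Rightarrow> ((nat \<Rightarrow> real) \<Rightarrow> (nat \<Rightarrow> real) list \<Rightarrow> real)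
     \<Rightarrow> (nat \<Rightarrow> real) \<Rightarrow> (nat \<Rightarrow> real) list \<Rightarrow> real"
  where "ext_deriv n k U \<omega> u vs =
    (if u \<in> U \<and> vs \<in> vecs n (Suc k)
     then \<Sum>i\<le>k. (-1) ^ i * dirderiv n (\<lambda>x. \<omega> x (take i vs @ drop (Suc i) vs)) u (vs ! i)
     else 0)"


section \<open>Diffeological spaces\<close>

text \<open>
  \<open>Plots X n U P\<close> says that \<open>U\<close> is open in \<open>R\<^sup>n\<close> and that the restriction of \<open>P\<close> to \<open>U\<close> is a
  plot of \<open>X\<close>; the values of \<open>P\<close> outside \<open>U\<close> are irrelevant.
\<close>

record 'x diffeology =
  Pts :: "'x set"
  Plots :: "nat \<Rightarrow> (nat \<Rightarrow> real) set \<Rightarrow> ((nat \<Rightarrow> real) \<Rightarrow> 'x) \<Rightarrow> bool"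

definition diffeological_space :: "'x diffeology \<Rightarrow> bool"
  where "diffeological_space X \<longleftrightarrow>
    (\<forall>n U P. Plots X n U P \<longrightarrow> openin (Euclidean_space n) U \<and> P ` U \<subseteq> Pts X) \<and>
    (\<forall>n U. \<forall>x\<in>Pts X. openin (Euclidean_space n) U \<longrightarrow> Plots X n U (\<lambda>_. x)) \<and>
    (\<forall>n U P. openin (Euclidean_space n) U \<and>
       (\<forall>u\<in>U. \<exists>V. openin (Euclidean_space n) V \<and> u \<in> V \<and> V \<subseteq> U \<and> Plots X n V P)
       \<longrightarrow> Plots X n U P) \<and>
    (\<forall>n U P m V f Q. Plots X n U P \<and> smooth_map m V n U f \<and> (\<forall>v\<in>V. Q v = P (f v))
       \<longrightarrow> Plots X m V Q)"

definition diffeo_smooth :: "'x diffeology \<Rightarrow> 'y diffeology \<Rightarrow> ('x \<Rightarrow> 'y) \<Rightarrow> bool"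
  where "diffeo_smooth X Y F \<longleftrightarrow>
    F ` Pts X \<subseteq> Pts Y \<and> (\<forall>n U P. Plots X n U P \<longrightarrow> Plots Y n U (F \<circ> P))"

definition subset_diffeology :: "'x diffeology \<Rightarrow> 'x set \<Rightarrow> 'x diffeology"
  where "subset_diffeology X S =
    \<lparr>Pts = S, Plots = (\<lambda>n U P. Plots X n U P \<and> P ` U \<subseteq> S)\<rparr>"

definition prod_diffeology :: "'x diffeology \<Rightarrow> 'y diffeology \<Rightarrow> ('x \<times> 'y) diffeology"
  where "prod_diffeology X Y =
    \<lparr>Pts = Pts X \<times> Pts Y, Plots = (\<lambda>n U R. Plots X n U (fst \<circ> R) \<and> Plots Y n U (snd \<circ> R))\<rparr>"

text \<open>The quotient of \<open>X\<close> is given by its projection \<open>\<pi>\<close>.\<close>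

definition quotient_diffeology :: "'x diffeology \<Rightarrow> ('x \<Rightarrow> 'y) \<Rightarrow> 'y diffeology"
  where "quotient_diffeology X \<pi> =
    \<lparr>Pts = \<pi> ` Pts X,
     Plots = (\<lambda>n U P. openin (Euclidean_space n) U \<and>
       (\<forall>u\<in>U. \<exists>V Q. openin (Euclidean_space n) V \<and> u \<in> V \<and> V \<subseteq> U \<and>
          Plots X n V Q \<and> (\<forall>v\<in>V. P v = \<pi> (Q v))))\<rparr>"

text \<open>The map induced on the quotient \<open>\<pi> ` S\<close> by a map \<open>f\<close> that is constant on the fibres.\<close>

definition descend :: "'x set \<Rightarrow> ('x \<Rightarrow> 'y) \<Rightarrow> ('x \<Rightarrow> 'z) \<Rightarrow> 'y \<Rightarrow> 'z"
  where "descend S \<pi> f y = the_elem (f ` {s \<in> S. \<pi> s = y})"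


section \<open>Differential forms on diffeological spaces\<close>

text \<open>The ordinary form \<open>P\<^sup>*\<alpha>\<close> on \<open>U \<subseteq> R\<^sup>n\<close> is written \<open>\<alpha> n U P\<close>; it is \<open>0\<close> if \<open>P\<close> is not a plot.\<close>

type_synonym 'x form =
  "nat \<Rightarrow> (nat \<Rightarrow> real) set \<Rightarrow> ((nat \<Rightarrow> real) \<Rightarrow> 'x) \<Rightarrow> (nat \<Rightarrow> real) \<Rightarrow> (nat \<Rightarrow> real) list \<Rightarrow> real"

definition is_form :: "'x diffeology \<Rightarrow> nat \<Rightarrow> 'x form \<Rightarrow> bool"
  where "is_form X k \<alpha> \<longleftrightarrow>
    (\<forall>n U P. Plots X n U P \<longrightarrow> smooth_form n k U (\<alpha> n U P)) \<and>
    (\<forall>n U P. \<not> Plots X n U P \<longrightarrow> \<alpha> n U P = (\<lambda>_ _. 0)) \<and>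
    (\<forall>n U P m V f Q. Plots X n U P \<and> smooth_map m V n U f \<and> (\<forall>v\<in>V. Q v = P (f v)) \<longrightarrow>
       (\<forall>v\<in>V. \<forall>vs\<in>vecs m k. \<alpha> m V Q v vs = \<alpha> n U P (f v) (map (jac m f v) vs)))"

definition pullback :: "'x diffeology \<Rightarrow> ('x \<Rightarrow> 'y) \<Rightarrow> 'y form \<Rightarrow> 'x form"
  where "pullback X F \<alpha> = (\<lambda>n U P. if Plots X n U P then \<alpha> n U (F \<circ> P) else (\<lambda>_ _. 0))"

definition ext_d :: "'x diffeology \<Rightarrow> nat \<Rightarrow> 'x form \<Rightarrow> 'x form"
  where "ext_d X k \<alpha> =
    (\<lambda>n U P. if Plots X n U P then ext_deriv n k U (\<alpha> n U P) else (\<lambda>_ _. 0))"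


section \<open>Lie groups\<close>

type_synonym 'g chart = "'g set \<times> ('g \<Rightarrow> nat \<Rightarrow> real)"

abbreviation chart_inv :: "'g chart \<Rightarrow> (nat \<Rightarrow> real) \<Rightarrow> 'g"
  where "chart_inv c \<equiv> inv_into (fst c) (snd c)"

definition atlas_topology :: "nat \<Rightarrow> 'g set \<Rightarrow> 'g chart set \<Rightarrow> 'g topology"
  where "atlas_topology n M A = topology (\<lambda>W. W \<subseteq> M \<and>
    (\<forall>c\<in>A. openin (Euclidean_space n) (snd c ` (W \<inter> fst c))))"

definition smooth_manifold :: "nat \<Rightarrow> 'g set \<Rightarrow> 'g chart set \<Rightarrow> bool"
  where "smooth_manifold n M A \<longleftrightarrow>
    (\<Union>c\<in>A. fst c) = M \<and>
    (\<forall>c\<in>A. inj_on (snd c) (fst c) \<and> openin (Euclidean_space n) (snd c ` fst c)) \<and>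
    (\<forall>c\<in>A. \<forall>c'\<in>A. smooth_map n (snd c ` (fst c \<inter> fst c')) n (snd c' ` (fst c \<inter> fst c'))
       (snd c' \<circ> chart_inv c)) \<and>
    Hausdorff_space (atlas_topology n M A)"

text \<open>The plots of a manifold are the smooth maps into it.\<close>

definition manifold_diffeology :: "'g set \<Rightarrow> 'g chart set \<Rightarrow> 'g diffeology"
  where "manifold_diffeology M A =
    \<lparr>Pts = M,
     Plots = (\<lambda>m U P. openin (Euclidean_space m) U \<and> P ` U \<subseteq> M \<and>
       (\<forall>c\<in>A. openin (Euclidean_space m) {u \<in> U. P u \<in> fst c} \<and>
          (\<forall>j. smooth_on m {u \<in> U. P u \<in> fst c} (\<lambda>u. snd c (P u) j))))\<rparr>"

record 'g lie = "'g monoid" +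
  ldim :: nat
  charts :: "'g chart set"

definition lie_topology :: "('g, 'm) lie_scheme \<Rightarrow> 'g topology"
  where "lie_topology G = atlas_topology (ldim G) (carrier G) (charts G)"

definition lie_diffeology :: "('g, 'm) lie_scheme \<Rightarrow> 'g diffeology"
  where "lie_diffeology G = manifold_diffeology (carrier G) (charts G)"

text \<open>
  As in Bourbaki, no countability axiom is imposed. A product of manifolds carries the product
  diffeology, and maps between manifolds are smooth iff they are so diffeologically.
\<close>

definition lie_group :: "('g, 'm) lie_scheme \<Rightarrow> bool"
  where "lie_group G \<longleftrightarrow> Group.group G \<and>
    smooth_manifold (ldim G) (carrier G) (charts G) \<and>
    diffeo_smooth (prod_diffeology (lie_diffeology G) (lie_diffeology G)) (lie_diffeology G)
      (\<lambda>(x, y). x \<otimes>\<^bsub>G\<^esub> y) \<and>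
    diffeo_smooth (lie_diffeology G) (lie_diffeology G) (\<lambda>x. inv\<^bsub>G\<^esub> x)"


section \<open>Tangent and cotangent vectors of a Lie group\<close>

text \<open>
  A tangent vector at \<open>q\<close> is the family of its coordinate vectors in the charts around \<open>q\<close>
  (extended by \<open>0\<close> to all other arguments), which correspond to each other under the derivatives
  of the coordinate changes. \<open>velocity G m P u w\<close> is the tangent vector \<open>DP(u)(w)\<close> at \<open>P u\<close>, for
  a smooth map \<open>P\<close> defined on an open subset of \<open>R\<^sup>m\<close>.
\<close>

type_synonym 'g tvec = "'g chart \<Rightarrow> nat \<Rightarrow> real"
type_synonym 'g covec = "'g tvec \<Rightarrow> real"

definition velocity ::
  "('g, 'm) lie_scheme \<Rightarrow> nat \<Rightarrow> ((nat \<Rightarrow> real) \<Rightarrow> 'g) \<Rightarrow> (nat \<Rightarrow> real) \<Rightarrow> (nat \<Rightarrow> real) \<Rightarrow> 'g tvec"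
  where "velocity G m P u w =
    (\<lambda>c. if c \<in> charts G \<and> P u \<in> fst c then jac m (snd c \<circ> P) u w else (\<lambda>_. 0))"

definition tangent_space :: "('g, 'm) lie_scheme \<Rightarrow> 'g \<Rightarrow> 'g tvec set"
  where "tangent_space G q = {v. \<forall>c\<in>charts G. q \<in> fst c \<longrightarrow>
    v c \<in> Rn (ldim G) \<and> v = velocity G (ldim G) (chart_inv c) (snd c q) (v c)}"

definition chart_at :: "('g, 'm) lie_scheme \<Rightarrow> 'g \<Rightarrow> 'g chart"
  where "chart_at G q = (SOME c. c \<in> charts G \<and> q \<in> fst c)"

text \<open>The derivative of a smooth map \<open>F\<close> from \<open>G\<close> to itself at \<open>q\<close>; the chart does not matter.\<close>

definition tangent_map :: "('g, 'm) lie_scheme \<Rightarrow> ('g \<Rightarrow> 'g) \<Rightarrow> 'g \<Rightarrow> 'g tvec \<Rightarrow> 'g tvec"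
  where "tangent_map G F q v =
    (let c = chart_at G q in velocity G (ldim G) (F \<circ> chart_inv c) (snd c q) (v c))"

definition cotangent_space :: "('g, 'm) lie_scheme \<Rightarrow> 'g \<Rightarrow> 'g covec set"
  where "cotangent_space G q = {p. (\<forall>v. v \<notin> tangent_space G q \<longrightarrow> p v = 0) \<and>
    (\<forall>v\<in>tangent_space G q. \<forall>w\<in>tangent_space G q. \<forall>a b.
       p (\<lambda>c i. a * v c i + b * w c i) = a * p v + b * p w)}"

definition cotangent_bundle :: "('g, 'm) lie_scheme \<Rightarrow> ('g \<times> 'g covec) set"
  where "cotangent_bundle G = {(q, p). q \<in> carrier G \<and> p \<in> cotangent_space G q}"

text \<open>
  A chart \<open>c\<close> of \<open>G\<close> gives the chart \<open>(q, p) \<mapsto> (c(q), \<langle>p, \<partial>/\<partial>c\<^sub>1\<rangle>, \<dots>, \<langle>p, \<partial>/\<partial>c\<^sub>n\<rangle>)\<close> of \<open>T\<^sup>*G\<close>, with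
  values in \<open>R\<^bsup>2n\<^esup>\<close>.
\<close>

definition cotangent_chart :: "('g, 'm) lie_scheme \<Rightarrow> 'g chart \<Rightarrow> ('g \<times> 'g covec) chart"
  where "cotangent_chart G c =
    ({x \<in> cotangent_bundle G. fst x \<in> fst c},
     (\<lambda>(q, p). join (ldim G) (snd c q)
        (\<lambda>i. if i < ldim G then p (velocity G (ldim G) (chart_inv c) (snd c q) (evec i)) else 0)))"

definition cotangent_bundle_diffeology :: "('g, 'm) lie_scheme \<Rightarrow> ('g \<times> 'g covec) diffeology"
  where "cotangent_bundle_diffeology G =
    manifold_diffeology (cotangent_bundle G) (cotangent_chart G ` charts G)"

text \<open>
  The canonical \<open>1\<close>-form. If \<open>\<delta>p = DR(u)(w)\<close> for a smooth map \<open>R\<close> into \<open>T\<^sup>*G\<close>, then \<open>\<delta>q\<close> is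
  the derivative in the direction \<open>w\<close> of the base point \<open>fst \<circ> R\<close>.
\<close>

definition canonical_form :: "('g, 'm) lie_scheme \<Rightarrow> ('g \<times> 'g covec) form"
  where "canonical_form G = (\<lambda>n U R. if Plots (cotangent_bundle_diffeology G) n U R
    then (\<lambda>u vs. if u \<in> U \<and> vs \<in> vecs n 1 then snd (R u) (velocity G n (fst \<circ> R) u (hd vs)) else 0)
    else (\<lambda>_ _. 0))"

text \<open>The covectors \<open>gp\<close> and \<open>pg\<close>, with their base points.\<close>

definition left_tr :: "('g, 'm) lie_scheme \<Rightarrow> 'g \<Rightarrow> 'g \<times> 'g covec \<Rightarrow> 'g \<times> 'g covec"
  where "left_tr G g = (\<lambda>(q, p). (g \<otimes>\<^bsub>G\<^esub> q,
    (\<lambda>v. if v \<in> tangent_space G (g \<otimes>\<^bsub>G\<^esub> q)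
         then p (tangent_map G (\<lambda>x. inv\<^bsub>G\<^esub> g \<otimes>\<^bsub>G\<^esub> x) (g \<otimes>\<^bsub>G\<^esub> q) v) else 0)))"

definition right_tr :: "('g, 'm) lie_scheme \<Rightarrow> 'g \<times> 'g covec \<Rightarrow> 'g \<Rightarrow> 'g \<times> 'g covec"
  where "right_tr G = (\<lambda>(q, p) g. (q \<otimes>\<^bsub>G\<^esub> g,
    (\<lambda>v. if v \<in> tangent_space G (q \<otimes>\<^bsub>G\<^esub> g)
         then p (tangent_map G (\<lambda>x. x \<otimes>\<^bsub>G\<^esub> inv\<^bsub>G\<^esub> g) (q \<otimes>\<^bsub>G\<^esub> g) v) else 0)))"

definition one_parameter_subgroup ::
  "('g, 'm) lie_scheme \<Rightarrow> 'g tvec \<Rightarrow> (real \<Rightarrow> 'g) \<Rightarrow> bool"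
  where "one_parameter_subgroup G Z \<gamma> \<longleftrightarrow>
    (\<forall>s t. \<gamma> (s + t) = \<gamma> s \<otimes>\<^bsub>G\<^esub> \<gamma> t) \<and>
    Plots (lie_diffeology G) 1 (Rn 1) (\<lambda>x. \<gamma> (x 0)) \<and>
    velocity G 1 (\<lambda>x. \<gamma> (x 0)) (\<lambda>_. 0) (evec 0) = Z"

definition lie_exp :: "('g, 'm) lie_scheme \<Rightarrow> 'g tvec \<Rightarrow> 'g"
  where "lie_exp G Z = (THE \<gamma>. one_parameter_subgroup G Z \<gamma>) 1"

definition subgroup_algebra :: "('g, 'm) lie_scheme \<Rightarrow> 'g set \<Rightarrow> 'g tvec set"
  where "subgroup_algebra G H =
    {Z \<in> tangent_space G \<one>\<^bsub>G\<^esub>. \<forall>t::real. lie_exp G (\<lambda>c i. t * Z c i) \<in> H}"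

text \<open>The value at \<open>q\<close> of a diffeological \<open>1\<close>-form on \<open>G\<close>; the chart does not matter.\<close>

definition form_value :: "('g, 'm) lie_scheme \<Rightarrow> 'g form \<Rightarrow> 'g \<Rightarrow> 'g covec"
  where "form_value G \<beta> q = (\<lambda>v. if v \<in> tangent_space G q
    then let c = chart_at G q in \<beta> (ldim G) (snd c ` fst c) (chart_inv c) (snd c q) [v c]
    else 0)"


section \<open>Parasymplectic Hamiltonian spaces\<close>

record ('g, 'x) ham_space =
  hspace :: "'x diffeology"
  hform :: "'x form"
  hact :: "'g \<Rightarrow> 'x \<Rightarrow> 'x"
  hmoment :: "'x \<Rightarrow> 'g covec"

definition smooth_action ::
  "('g, 'm) lie_scheme \<Rightarrow> 'x diffeology \<Rightarrow> ('g \<Rightarrow> 'x \<Rightarrow> 'x) \<Rightarrow> bool"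
  where "smooth_action G X \<rho> \<longleftrightarrow>
    (\<forall>x\<in>Pts X. \<rho> \<one>\<^bsub>G\<^esub> x = x) \<and>
    (\<forall>g\<in>carrier G. \<forall>h\<in>carrier G. \<forall>x\<in>Pts X. \<rho> (g \<otimes>\<^bsub>G\<^esub> h) x = \<rho> g (\<rho> h x)) \<and>
    diffeo_smooth (prod_diffeology (lie_diffeology G) X) X (\<lambda>(g, x). \<rho> g x)"

text \<open>
  A moment map is a smooth map \<open>\<Phi>\<close> to \<open>g\<^sup>*\<close> with \<open>\<omega>(Z\<^sub>X, \<cdot>) = - d\<langle>\<Phi>, Z\<rangle>\<close> for all \<open>Z\<close> in the Lie
  algebra. Along a plot \<open>P\<close> of \<open>X\<close>, the left-hand side is read off at \<open>t = 0\<close> from the plot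
  \<open>(t, u) \<mapsto> e\<^bsup>tZ\<^esup>(P(u))\<close>.
\<close>

definition moment_map ::
  "('g, 'm) lie_scheme \<Rightarrow> 'x diffeology \<Rightarrow> 'x form \<Rightarrow> ('g \<Rightarrow> 'x \<Rightarrow> 'x) \<Rightarrow> ('x \<Rightarrow> 'g covec) \<Rightarrow> bool"
  where "moment_map G X \<omega> \<rho> \<Phi> \<longleftrightarrow>
    (\<forall>x\<in>Pts X. \<Phi> x \<in> cotangent_space G \<one>\<^bsub>G\<^esub>) \<and>
    (\<forall>Z\<in>tangent_space G \<one>\<^bsub>G\<^esub>. \<forall>n U P. Plots X n U P \<longrightarrow>
       smooth_on n U (\<lambda>u. \<Phi> (P u) Z) \<and>
       (\<forall>u\<in>U. \<forall>w\<in>Rn n.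
          \<omega> (1 + n) (prod_dom 1 n (Rn 1) U)
            (\<lambda>z. \<rho> (lie_exp G (\<lambda>c i. z 0 * Z c i)) (P (snd_part 1 z)))
            (join 1 (\<lambda>_. 0) u) [evec 0, join 1 (\<lambda>_. 0) w]
          = - dirderiv n (\<lambda>x. \<Phi> (P x) Z) u w))"

definition parasymplectic_hamiltonian :: "('g, 'm) lie_scheme \<Rightarrow> ('g, 'x) ham_space \<Rightarrow> bool"
  where "parasymplectic_hamiltonian G S \<longleftrightarrow>
    diffeological_space (hspace S) \<and>
    is_form (hspace S) 2 (hform S) \<and>
    ext_d (hspace S) 2 (hform S) = (\<lambda>_ _ _ _ _. 0) \<and>
    smooth_action G (hspace S) (hact S) \<and>
    (\<forall>g\<in>carrier G. pullback (hspace S) (hact S g) (hform S) = hform S) \<and>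
    moment_map G (hspace S) (hform S) (hact S) (hmoment S)"

definition ham_isomorphic ::
  "('g, 'm) lie_scheme \<Rightarrow> ('g, 'x) ham_space \<Rightarrow> ('g, 'y) ham_space \<Rightarrow> bool"
  where "ham_isomorphic G S T \<longleftrightarrow>
    parasymplectic_hamiltonian G S \<and> parasymplectic_hamiltonian G T \<and>
    (\<exists>F. bij_betw F (Pts (hspace S)) (Pts (hspace T)) \<and>
       diffeo_smooth (hspace S) (hspace T) F \<and>
       diffeo_smooth (hspace T) (hspace S) (inv_into (Pts (hspace S)) F) \<and>
       (\<forall>g\<in>carrier G. \<forall>x\<in>Pts (hspace S). F (hact S g x) = hact T g (F x)) \<and>
       pullback (hspace S) F (hform T) = hform S \<and>
       (\<forall>x\<in>Pts (hspace S). hmoment T (F x) = hmoment S x))"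


section \<open>The induced space\<close>

definition psi :: "('g, 'm) lie_scheme \<Rightarrow> 'g set \<Rightarrow> 'g \<times> 'g covec \<Rightarrow> 'g covec"
  where "psi G H x =
    (\<lambda>Z. if Z \<in> subgroup_algebra G H then - snd (left_tr G (inv\<^bsub>G\<^esub> (fst x)) x) Z else 0)"

definition psi_zero :: "('g, 'm) lie_scheme \<Rightarrow> 'g set \<Rightarrow> ('g \<times> 'g covec) set"
  where "psi_zero G H = {x \<in> cotangent_bundle G. psi G H x = (\<lambda>_. 0)}"

definition psi_zero_diffeology ::
  "('g, 'm) lie_scheme \<Rightarrow> 'g set \<Rightarrow> ('g \<times> 'g covec) diffeology"
  where "psi_zero_diffeology G H =
    subset_diffeology (cotangent_bundle_diffeology G) (psi_zero G H)"

definition H_orbit ::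
  "('g, 'm) lie_scheme \<Rightarrow> 'g set \<Rightarrow> 'g \<times> 'g covec \<Rightarrow> ('g \<times> 'g covec) set"
  where "H_orbit G H x = (\<lambda>h. right_tr G x (inv\<^bsub>G\<^esub> h)) ` H"

definition induced_diffeology ::
  "('g, 'm) lie_scheme \<Rightarrow> 'g set \<Rightarrow> ('g \<times> 'g covec) set diffeology"
  where "induced_diffeology G H = quotient_diffeology (psi_zero_diffeology G H) (H_orbit G H)"

definition reduced_form :: "('g, 'm) lie_scheme \<Rightarrow> 'g set \<Rightarrow> ('g \<times> 'g covec) set form"
  where "reduced_form G H = (THE \<omega>. is_form (induced_diffeology G H) 2 \<omega> \<and>
    pullback (psi_zero_diffeology G H) (H_orbit G H) \<omega> =
    pullback (psi_zero_diffeology G H) (\<lambda>x. x)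
      (ext_d (cotangent_bundle_diffeology G) 1 (canonical_form G)))"

definition induced_space ::
  "('g, 'm) lie_scheme \<Rightarrow> 'g set \<Rightarrow> ('g, ('g \<times> 'g covec) set) ham_space"
  where "induced_space G H =
    \<lparr>hspace = induced_diffeology G H,
     hform = reduced_form G H,
     hact = (\<lambda>g. descend (psi_zero G H) (H_orbit G H) (\<lambda>x. H_orbit G H (left_tr G g x))),
     hmoment = descend (psi_zero G H) (H_orbit G H)
       (\<lambda>x. snd (right_tr G x (inv\<^bsub>G\<^esub> (fst x))))\<rparr>"


section \<open>The diffeological cotangent space\<close>

definition Omega1 :: "'x diffeology \<Rightarrow> 'x form diffeology"
  where "Omega1 X =
    \<lparr>Pts = {\<alpha>. is_form X 1 \<alpha>},
     Plots = (\<lambda>m U A. openin (Euclidean_space m) U \<and> A ` U \<subseteq> {\<alpha>. is_form X 1 \<alpha>} \<and>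
       (\<forall>n V P. Plots X n V P \<longrightarrow> (\<forall>w\<in>Rn n. smooth_on (m + n) (prod_dom m n U V)
          (\<lambda>z. A (fst_part m z) n V P (snd_part m z) [w]))))\<rparr>"

definition vanishes_at :: "'x diffeology \<Rightarrow> 'x form \<Rightarrow> 'x \<Rightarrow> bool"
  where "vanishes_at X \<alpha> x \<longleftrightarrow>
    (\<forall>n U P. Plots X n U P \<and> (\<lambda>_. 0) \<in> U \<and> P (\<lambda>_. 0) = x \<longrightarrow>
       (\<forall>w\<in>Rn n. \<alpha> n U P (\<lambda>_. 0) [w] = 0))"

definition cot_proj :: "'x diffeology \<Rightarrow> 'x \<times> 'x form \<Rightarrow> 'x \<times> 'x form set"
  where "cot_proj X = (\<lambda>(x, \<alpha>). (x,
    {\<beta> \<in> Pts (Omega1 X). vanishes_at X (\<lambda>n U P u vs. \<beta> n U P u vs - \<alpha> n U P u vs) x}))"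

abbreviation XOmega1 :: "'x diffeology \<Rightarrow> ('x \<times> 'x form) diffeology"
  where "XOmega1 X \<equiv> prod_diffeology X (Omega1 X)"

definition cot_diffeology :: "'x diffeology \<Rightarrow> ('x \<times> 'x form set) diffeology"
  where "cot_diffeology X = quotient_diffeology (XOmega1 X) (cot_proj X)"

definition Taut :: "'x diffeology \<Rightarrow> ('x \<times> 'x form) form"
  where "Taut X = (\<lambda>n U R. if Plots (XOmega1 X) n U R
    then (\<lambda>u vs. if u \<in> U then snd (R u) n U (fst \<circ> R) u vs else 0)
    else (\<lambda>_ _. 0))"

definition Liouv :: "'x diffeology \<Rightarrow> ('x \<times> 'x form set) form"
  where "Liouv X = (THE \<theta>. is_form (cot_diffeology X) 1 \<theta> \<and>
    pullback (XOmega1 X) (cot_proj X) \<theta> = Taut X)"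

definition cot_action ::
  "('g, 'm) lie_scheme \<Rightarrow> 'x diffeology \<Rightarrow> ('g \<Rightarrow> 'x \<Rightarrow> 'x)
     \<Rightarrow> 'g \<Rightarrow> 'x \<times> 'x form set \<Rightarrow> 'x \<times> 'x form set"
  where "cot_action G X \<rho> g = descend (Pts (XOmega1 X)) (cot_proj X)
    (\<lambda>(x, \<alpha>). cot_proj X (\<rho> g x, pullback X (\<rho> (inv\<^bsub>G\<^esub> g)) \<alpha>))"

definition diffeological_cotangent ::
  "('g, 'm) lie_scheme \<Rightarrow> 'x diffeology \<Rightarrow> ('g \<Rightarrow> 'x \<Rightarrow> 'x)
     \<Rightarrow> ('g, 'x \<times> 'x form set) ham_space"
  where "diffeological_cotangent G X \<rho> =
    \<lparr>hspace = cot_diffeology X,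
     hform = ext_d (cot_diffeology X) 1 (Liouv X),
     hact = cot_action G X \<rho>,
     hmoment = (\<lambda>y. form_value G
       (pullback (lie_diffeology G) (\<lambda>g. cot_action G X \<rho> g y) (Liouv X)) \<one>\<^bsub>G\<^esub>)\<rparr>"

definition coset_diffeology :: "('g, 'm) lie_scheme \<Rightarrow> 'g set \<Rightarrow> 'g set diffeology"
  where "coset_diffeology G H = quotient_diffeology (lie_diffeology G) (\<lambda>q. q <#\<^bsub>G\<^esub> H)"

text \<open>\<open>G\<close> acts on left cosets by left translation: \<open>g <# (q <# H) = gq <# H\<close>.\<close>

definition cotangent_of_quotient ::
  "('g, 'm) lie_scheme \<Rightarrow> 'g set \<Rightarrow> ('g, 'g set \<times> 'g set form set) ham_space"
  where "cotangent_of_quotient G H =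
    diffeological_cotangent G (coset_diffeology G H) (\<lambda>g C. g <#\<^bsub>G\<^esub> C)"

end

theory Submission
  imports Defs
begin

text \<open>
  Both spaces are quotients of the model \<open>G \<times> \<hh>\<^sup>\<bottom>\<close> by \<open>(q, \<mu>) \<sim> (qh, \<mu>)\<close>, with the \<open>2\<close>-form descended from
  \<open>d\<lambda>\<close>, where \<open>\<lambda>(\<delta>q, \<delta>\<mu>) = \<langle>\<mu>, \<delta>q q\<^sup>-\<^sup>1\<rangle>\<close>, with \<open>g(q, \<mu>) = (gq, Ad\<^sup>*(g) \<mu>)\<close> and with moment map \<open>\<mu>\<close>.
  By density of \<open>H\<close>, the annihilator \<open>\<hh>\<^sup>\<bottom>\<close> is invariant under \<open>G\<close>; so \<open>\<lambda>\<close> descends, because smooth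
  \<open>H\<close>-valued maps have their velocities in \<open>\<hh>\<close>, and \<open>\<psi>\<^sup>-\<^sup>1(0)\<close> is \<open>G \<times> \<hh>\<^sup>\<bottom>\<close> in the right trivialization of
  \<open>T\<^sup>*G\<close>. On the other side, a \<open>1\<close>-form on \<open>G/H\<close> pulls back to a form on \<open>G\<close> that is right \<open>H\<close>-invariant,
  hence right \<open>G\<close>-invariant by density: it is given by an element of \<open>\<hh>\<^sup>\<bottom>\<close>, and vanishes at a point only if
  that element is \<open>0\<close>. Thus \<open>T\<^sup>*(G/H) = G/H \<times> \<hh>\<^sup>\<bottom>\<close>.
\<close>

subsection \<open>Differential calculus\<close>

text \<open>The obstacle is that \<open>H\<close> is an arbitrary subgroup. It need be neither
  closed nor a submanifold of \<open>G\<close>, and membership in its Lie algebra says only that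
  \<open>exp(tZ)\<close> stays in \<open>H\<close>; but two lifts of a plot of a quotient differ by
  a map that is smooth into \<open>G\<close> and merely takes its values in \<open>H\<close>.
  Showing that such maps have velocities in \<hh> is the hard step. It takes existence for ordinary
  differential equations and a rank argument, and much of the calculus is built for it.

  The right trivialization is chosen because right translation by \<open>H\<close>, by which both
  quotients are taken, then moves only the base point and leaves the covector alone. Once both
  spaces are quotients of one model with the same fibres, the isomorphism is formal.

  By density every smooth function on \<open>G/H\<close> is constant, yet one-forms abound: they are
  as rigid as right-invariant forms on \<open>G\<close>. This rigidity makes each fibre of the
  cotangent space a copy of the space of all one-forms on \<open>G/H\<close>.\<close>

definition cube :: "nat \<Rightarrow> (nat \<Rightarrow> real) \<Rightarrow> real \<Rightarrow> (nat \<Rightarrow> real) set"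
  where "cube m x r = {y \<in> Rn m. \<forall>i<m. \<bar>y i - x i\<bar> < r}"

lemma mem_Rn: "x \<in> Rn m \<longleftrightarrow> (\<forall>i\<ge>m. x i = 0)"
  by (simp add: topspace_Euclidean_space)

lemma zero_mem_Rn [simp]: "(\<lambda>_. 0) \<in> Rn m"
  by (simp add: mem_Rn)

lemma Rn_upd: "x \<in> Rn m \<Longrightarrow> i < m \<Longrightarrow> x(i := t) \<in> Rn m"
  by (auto simp: mem_Rn)

lemma Rn_lincomb: "x \<in> Rn m \<Longrightarrow> y \<in> Rn m \<Longrightarrow> (\<lambda>j. a * x j + b * y j) \<in> Rn m"
  by (simp add: mem_Rn)

lemma evec_Rn: "i < m \<Longrightarrow> evec i \<in> Rn m"
  by (simp add: mem_Rn evec_def)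

lemma Rn_ext: "x \<in> Rn m \<Longrightarrow> y \<in> Rn m \<Longrightarrow> (\<And>i. i < m \<Longrightarrow> x i = y i) \<Longrightarrow> x = y"
  by (rule ext) (metis mem_Rn not_le)

text \<open>The right-hand side refers to the topology of the function type, for which
  \<open>continuous_on\<close> is defined; openness in \<open>Euclidean_space m\<close> is
  translated through this equation.\<close>

lemma Euclidean_space_eq: "Euclidean_space m = top_of_set (Rn m)"
  by (simp add: Euclidean_space_def euclidean_product_topology topspace_Euclidean_space)

lemma openin_Euclidean: "openin (Euclidean_space m) U \<longleftrightarrow> openin (top_of_set (Rn m)) U"
  using Euclidean_space_eq by metis

lemma openin_EuclideanE:
  assumes "openin (Euclidean_space m) U"
  obtains T where "open T" "U = Rn m \<inter> T"
  using assms unfolding openin_Euclidean openin_open by blast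

lemma openin_subset_Rn: "openin (Euclidean_space m) U \<Longrightarrow> u \<in> U \<Longrightarrow> u \<in> Rn m"
  by (meson openin_subset subsetD)

lemma openin_cube [simp]: "openin (Euclidean_space m) (cube m x r)"
proof -
  have "open (\<Inter>i\<in>{..<m}. {y::nat\<Rightarrow>real. \<bar>y i - x i\<bar> < r})"
    by (intro open_INT finite_lessThan ballI open_Collect_less continuous_intros)
       (auto intro: continuous_on_product_coordinates)
  moreover have "cube m x r = Rn m \<inter> (\<Inter>i\<in>{..<m}. {y. \<bar>y i - x i\<bar> < r})"
    by (auto simp: cube_def)
  ultimately show ?thesis
    unfolding openin_Euclidean by (simp add: openin_open_Int)
qed

text \<open>On \<open>Rn m\<close> only the first \<open>m\<close> coordinates vary, so the least of
  \<open>m\<close> radii works whatever the other factors of a basic open set are. Cubes replace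
  balls because they can be crossed one coordinate at a time.\<close>

lemma openin_Rn_iff:
  "openin (Euclidean_space m) U \<longleftrightarrow> U \<subseteq> Rn m \<and> (\<forall>u\<in>U. \<exists>r>0. cube m u r \<subseteq> U)"
proof safe
  fix u assume U: "openin (Euclidean_space m) U" and u: "u \<in> U"
  from U obtain T where T: "open T" "U = Rn m \<inter> T"
    by (rule openin_EuclideanE)
  have "openin (product_topology (\<lambda>_. euclideanreal) UNIV) T"
    using T(1) by (simp add: euclidean_product_topology)
  from product_topology_open_contains_basis[OF this, of u] obtain X where
    X: "u \<in> Pi\<^sub>E UNIV X" "\<And>i. open (X i)" "Pi\<^sub>E UNIV X \<subseteq> T"
    using u T by auto
  have "\<forall>i. \<exists>r>0. \<forall>t. \<bar>t - u i\<bar> < r \<longrightarrow> t \<in> X i"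
    using X(1,2) unfolding open_dist dist_real_def by (force simp: PiE_iff)
  then obtain r where r: "\<And>i. r i > 0" "\<And>i t. \<bar>t - u i\<bar> < r i \<Longrightarrow> t \<in> X i" by metis
  \<comment> \<open>The extra 1 keeps the minimum defined for \<open>m = 0\<close>.\<close>
  define s where "s = Min (insert 1 (r ` {..<m}))"
  have s: "s > 0" "\<And>i. i < m \<Longrightarrow> s \<le> r i"
    using r(1) by (auto simp: s_def)
  have um: "u \<in> Rn m" using u T by auto
  have "cube m u s \<subseteq> U"
  proof
    fix y assume y: "y \<in> cube m u s"
    have "y i \<in> X i" for i
    proof (cases "i < m")
      case True
      then show ?thesis using y s(2)[OF True] by (intro r(2)) (force simp: cube_def)
    next
      case False
      then have "y i = u i" using y um by (auto simp: cube_def mem_Rn)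
      then show ?thesis using X(1) by (auto simp: PiE_iff)
    qed
    then show "y \<in> U" using X(3) T(2) y by (auto simp: cube_def)
  qed
  then show "\<exists>r>0. cube m u r \<subseteq> U" using s by blast
next
  fix x assume "openin (Euclidean_space m) U" "x \<in> U"
  then show "x \<in> Rn m" by (rule openin_subset_Rn)
next
  assume a: "U \<subseteq> Rn m" "\<forall>u\<in>U. \<exists>r>0. cube m u r \<subseteq> U"
  show "openin (Euclidean_space m) U"
  proof (subst openin_subopen, safe)
    fix x assume x: "x \<in> U"
    then obtain r where "r > 0" "cube m x r \<subseteq> U" using a by blast
    moreover have "x \<in> cube m x r" using x a \<open>r>0\<close> by (auto simp: cube_def)
    ultimately show "\<exists>T. openin (Euclidean_space m) T \<and> x \<in> T \<and> T \<subseteq> U"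
      using openin_cube by blast
  qed
qed

lemma openin_Rn [simp]: "openin (Euclidean_space m) (Rn m)"
  by simp

lemma openin_cubeE:
  assumes "openin (Euclidean_space m) U" "u \<in> U"
  obtains r where "r > 0" "cube m u r \<subseteq> U"
  using assms openin_Rn_iff by blast

lemma openin_preimage:
  assumes "continuous_on U g" "openin (Euclidean_space m) U" "openin (Euclidean_space n) W"
    "g ` U \<subseteq> Rn n"
  shows "openin (Euclidean_space m) {u \<in> U. g u \<in> W}"
proof -
  obtain T where "open T" "W = Rn n \<inter> T"
    using openin_EuclideanE[OF assms(3)] .
  then have "{u \<in> U. g u \<in> W} = U \<inter> g -` T" using assms(4) by auto
  moreover have "openin (top_of_set U) (U \<inter> g -` T)"
    using continuous_openin_preimage_gen[OF assms(1) \<open>open T\<close>] by simp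
  ultimately show ?thesis
    unfolding openin_Euclidean by (metis openin_trans[OF _ assms(2)[unfolded openin_Euclidean]])
qed

lemma openin_preimage_real:
  assumes "continuous_on U g" "openin (Euclidean_space m) U" "open (W::real set)"
  shows "openin (Euclidean_space m) {u \<in> U. g u \<in> W}"
proof -
  have "{u \<in> U. g u \<in> W} = U \<inter> g -` W" by auto
  moreover have "openin (top_of_set U) (U \<inter> g -` W)"
    using continuous_openin_preimage_gen[OF assms(1,3)] by simp
  ultimately show ?thesis
    unfolding openin_Euclidean by (metis openin_trans[OF _ assms(2)[unfolded openin_Euclidean]])
qed

lemma continuous_cube:
  assumes "continuous_on U f" "openin (Euclidean_space m) U" "u \<in> U" "e > 0"
  shows "\<exists>r>0. cube m u r \<subseteq> U \<and> (\<forall>y\<in>cube m u r. \<bar>f y - f u\<bar> < (e::real))"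
proof -
  have "openin (Euclidean_space m) {y \<in> U. f y \<in> ball (f u) e}"
    by (intro openin_preimage_real assms open_ball)
  then obtain r where "r > 0" "cube m u r \<subseteq> {y \<in> U. f y \<in> ball (f u) e}"
    using openin_cubeE[of m _ u] assms by (metis (mono_tags, lifting) centre_in_ball mem_Collect_eq)
  then show ?thesis by (intro exI[of _ r]) (auto simp: dist_real_def subset_iff abs_minus_commute)
qed

lemma eventually_line:
  assumes "openin (Euclidean_space m) U" "x \<in> U" "i < m"
  shows "\<forall>\<^sub>F t in nhds (x i). x(i := t) \<in> U"
proof -
  obtain r where r: "r > 0" "cube m x r \<subseteq> U" using openin_cubeE assms by blast
  have "x \<in> Rn m" using assms openin_subset_Rn by blast
  then have "\<forall>t. \<bar>t - x i\<bar> < r \<longrightarrow> x(i := t) \<in> U"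
    using r assms(3) by (auto simp: cube_def Rn_upd subset_iff)
  then show ?thesis using r(1)
    unfolding eventually_nhds_metric dist_real_def by blast
qed

section \<open>Partial derivatives and the classes C^k\<close>

abbreviation has_partial :: "nat \<Rightarrow> ((nat \<Rightarrow> real) \<Rightarrow> real) \<Rightarrow> (nat \<Rightarrow> real) \<Rightarrow> real \<Rightarrow> bool"
  where "has_partial i f x D \<equiv> ((\<lambda>t. f (x(i := t))) has_real_derivative D) (at (x i))"

lemma has_partial_imp_partial: "has_partial i f x D \<Longrightarrow> partial i f x = D"
  by (simp add: partial_def DERIV_imp_deriv)

lemma has_partial_cong:
  assumes "openin (Euclidean_space m) U" "x \<in> U" "i < m" "\<And>y. y \<in> U \<Longrightarrow> f y = g y"
  shows "has_partial i f x D \<longleftrightarrow> has_partial i g x D"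
  by (rule DERIV_cong_ev)
     (use eventually_mono[OF eventually_line[OF assms(1-3)]] assms(4) in auto)

lemma partial_cong:
  assumes "openin (Euclidean_space m) U" "x \<in> U" "i < m" "\<And>y. y \<in> U \<Longrightarrow> f y = g y"
  shows "partial i f x = partial i g x"
  unfolding partial_def
  by (rule deriv_cong_ev)
     (use eventually_mono[OF eventually_line[OF assms(1-3)]] assms(4) in auto)

lemma Ck_SucD:
  assumes "Ck_on m (Suc k) U f"
  shows "continuous_on U f" "\<And>i. i < m \<Longrightarrow> Ck_on m k U (partial i f)"
    "\<And>i x. i < m \<Longrightarrow> x \<in> U \<Longrightarrow> has_partial i f x (partial i f x)"
  using assms
  by (auto simp: partial_def) (metis DERIV_deriv_iff_real_differentiable)

text \<open>Functions are total here, but derivatives at points of the open set \<open>U\<close> see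
  only the values on \<open>U\<close>. Every later replacement of a smooth function by a formula
  valid on its domain rests on this.\<close>

lemma Ck_cong:
  assumes "openin (Euclidean_space m) U" "\<And>x. x \<in> U \<Longrightarrow> f x = g x" "Ck_on m k U f"
  shows "Ck_on m k U g"
  using assms
proof (induction k arbitrary: f g)
  case 0
  then show ?case by (simp cong: continuous_on_cong)
next
  case (Suc k)
  have "continuous_on U g"
    using Ck_SucD(1)[OF Suc.prems(3)] Suc.prems(2) by (simp cong: continuous_on_cong)
  moreover have "(\<lambda>t. g (x(i := t))) differentiable at (x i)" if "i < m" "x \<in> U" for i x
    using Ck_SucD(3)[OF Suc.prems(3) that] has_partial_cong[OF Suc.prems(1) that(2,1), of f g]
      Suc.prems(2) real_differentiable_def by blast
  moreover have "Ck_on m k U (partial i g)" if "i < m" for i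
    by (rule Suc.IH[OF Suc.prems(1) _ Ck_SucD(2)[OF Suc.prems(3) that]])
       (rule partial_cong[OF Suc.prems(1) _ that Suc.prems(2)])
  ultimately show ?case by simp
qed

text \<open>Derivatives may be supplied by formulas \<open>f' i\<close> that are correct on
  \<open>U\<close> without being literally \<open>partial i f\<close>. With this rule, products,
  inverses and composites are settled by induction on \<open>k\<close>.\<close>

lemma Ck_SucI:
  assumes "openin (Euclidean_space m) U" "continuous_on U f"
    "\<And>i x. i < m \<Longrightarrow> x \<in> U \<Longrightarrow> has_partial i f x (f' i x)"
    "\<And>i. i < m \<Longrightarrow> Ck_on m k U (f' i)"
  shows "Ck_on m (Suc k) U f"
proof -
  have "Ck_on m k U (partial i f)" if "i < m" for i
  proof -
    have "f' i y = partial i f y" if "y \<in> U" for y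
      using has_partial_imp_partial[OF assms(3)[OF \<open>i < m\<close> that]] by simp
    from Ck_cong[OF assms(1) this assms(4)[OF that]] show ?thesis .
  qed
  then show ?thesis using assms(2,3) by (auto simp: real_differentiable_def)
qed

lemma Ck_continuous: "Ck_on m k U f \<Longrightarrow> continuous_on U f"
  by (cases k) auto

lemma Ck_Suc_imp: "Ck_on m (Suc k) U f \<Longrightarrow> Ck_on m k U f"
  by (induction k arbitrary: f) auto

lemma Ck_le: "k \<le> l \<Longrightarrow> Ck_on m l U f \<Longrightarrow> Ck_on m k U f"
  by (induction rule: dec_induct) (use Ck_Suc_imp in blast)+

lemma Ck_subset: "Ck_on m k U f \<Longrightarrow> V \<subseteq> U \<Longrightarrow> Ck_on m k V f"
  by (induction k arbitrary: f) (auto intro: continuous_on_subset)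

lemma Ck_const: "Ck_on m k U (\<lambda>_. c)"
proof (induction k arbitrary: c)
  case (Suc k)
  have "partial i (\<lambda>_. c) = (\<lambda>_. 0)" for i by (auto simp: partial_def)
  then show ?case using Suc by simp
qed simp

lemma Ck_coord:
  assumes "openin (Euclidean_space m) U" shows "Ck_on m k U (\<lambda>x. x j)"
proof (cases k)
  case 0
  then show ?thesis by (simp add: continuous_on_subset[OF continuous_on_product_coordinates])
next
  case (Suc l)
  show ?thesis unfolding Suc
    by (rule Ck_SucI[OF assms, where f' = "\<lambda>i _. if i = j then 1 else 0"])
       (auto intro!: Ck_const derivative_eq_intros continuous_on_subset[OF continuous_on_product_coordinates])
qed

lemma Ck_add:
  assumes "openin (Euclidean_space m) U" "Ck_on m k U f" "Ck_on m k U g"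
  shows "Ck_on m k U (\<lambda>x. f x + g x)"
  using assms
proof (induction k arbitrary: f g)
  case 0
  then show ?case by (simp add: continuous_on_add)
next
  case (Suc k)
  note f = Ck_SucD[OF Suc.prems(2)] and g = Ck_SucD[OF Suc.prems(3)]
  show ?case
    by (rule Ck_SucI[where f' = "\<lambda>i x. partial i f x + partial i g x"])
       (use f g Suc.IH Suc.prems(1) in \<open>auto intro!: continuous_on_add DERIV_add\<close>)
qed

lemma Ck_mult:
  assumes "openin (Euclidean_space m) U" "Ck_on m k U f" "Ck_on m k U g"
  shows "Ck_on m k U (\<lambda>x. f x * g x)"
  using assms
proof (induction k arbitrary: f g)
  case 0
  then show ?case by (simp add: continuous_on_mult)
next
  case (Suc k)
  note f = Ck_SucD[OF Suc.prems(2)] and g = Ck_SucD[OF Suc.prems(3)]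
  note m = Ck_Suc_imp[OF Suc.prems(2)] Ck_Suc_imp[OF Suc.prems(3)]
  show ?case
  proof (rule Ck_SucI[where f' = "\<lambda>i x. f x * partial i g x + partial i f x * g x"])
    show "has_partial i (\<lambda>x. f x * g x) x (f x * partial i g x + partial i f x * g x)"
      if "i < m" "x \<in> U" for i x
      using DERIV_mult'[OF f(3)[OF that] g(3)[OF that]] by (simp only: fun_upd_triv)
  qed (use f g m Suc.IH Suc.prems(1) in \<open>auto intro!: continuous_on_mult Ck_add\<close>)
qed

lemma Ck_sum:
  assumes "openin (Euclidean_space m) U" "\<And>j. j \<in> J \<Longrightarrow> Ck_on m k U (f j)"
  shows "Ck_on m k U (\<lambda>x. \<Sum>j\<in>J. f j x)"
  using assms(2)
  by (induction J rule: infinite_finite_induct) (auto intro!: Ck_const Ck_add assms(1))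

lemma Ck_inverse:
  assumes "openin (Euclidean_space m) U" "Ck_on m k U f" "\<And>x. x \<in> U \<Longrightarrow> f x \<noteq> 0"
  shows "Ck_on m k U (\<lambda>x. inverse (f x))"
  using assms
proof (induction k arbitrary: f)
  case 0
  then show ?case by (simp add: continuous_on_inverse)
next
  case (Suc k)
  note f = Ck_SucD[OF Suc.prems(2)]
  have i: "Ck_on m k U (\<lambda>x. inverse (f x))"
    using Suc.IH Ck_Suc_imp Suc.prems by blast
  show ?case
  proof (rule Ck_SucI[where f' = "\<lambda>i x. (-1) * (inverse (f x) * partial i f x * inverse (f x))"])
    show "has_partial i (\<lambda>x. inverse (f x)) x ((-1) * (inverse (f x) * partial i f x * inverse (f x)))"
      if "i < m" "x \<in> U" for i x
      using DERIV_inverse'[OF f(3)[OF that]] Suc.prems(3)[OF that(2)]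
      by (simp only: fun_upd_triv mult_minus1 not_False_eq_True)
    show "continuous_on U (\<lambda>x. inverse (f x))"
      using f(1) Suc.prems by (simp add: continuous_on_inverse)
    show "Ck_on m k U (\<lambda>x. (-1) * (inverse (f x) * partial i f x * inverse (f x)))" if "i < m" for i
      using f(2)[OF that] by (intro Ck_mult Ck_const i Suc.prems(1))
  qed (rule Suc.prems(1))
qed

section \<open>Mean value estimates and the chain rule\<close>

lemma mvt_between:
  fixes f :: "real \<Rightarrow> real"
  assumes "\<And>t. min a b \<le> t \<Longrightarrow> t \<le> max a b \<Longrightarrow> DERIV f t :> f' t"
  shows "\<exists>t. min a b \<le> t \<and> t \<le> max a b \<and> f b - f a = f' t * (b - a)"
proof (cases "a = b")
  case False
  then consider "a < b" | "b < a" by linarith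
  then show ?thesis
  proof cases
    case 1
    from MVT2[OF 1, of f f'] assms 1 obtain z where "a < z" "z < b" "f b - f a = (b - a) * f' z"
      by auto
    then show ?thesis using 1 by (intro exI[of _ z]) (auto simp: mult.commute)
  next
    case 2
    from MVT2[OF 2, of f f'] assms 2 obtain z where "b < z" "z < a" "f a - f b = (a - b) * f' z"
      by auto
    then show ?thesis using 2 by (intro exI[of _ z]) (auto simp: algebra_simps)
  qed
qed auto

text \<open>Walk from \<open>z\<close> to \<open>y\<close> by changing one coordinate at a time and
  apply the one-variable mean value theorem to each leg. The intermediate points stay in the closed
  cube of radius \<open>r\<close> about \<open>w\<close>, which serves both differentiability along
  curves and Lipschitz bounds.\<close>

lemma cube_mvt:
  assumes C: "Ck_on n (Suc 0) U f" and y: "y \<in> Rn n" and z: "z \<in> Rn n"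
    and U: "\<And>x. x \<in> Rn n \<Longrightarrow> (\<And>i. i < n \<Longrightarrow> \<bar>x i - w i\<bar> \<le> r) \<Longrightarrow> x \<in> U"
    and yw: "\<And>i. i < n \<Longrightarrow> \<bar>y i - w i\<bar> \<le> r" and zw: "\<And>i. i < n \<Longrightarrow> \<bar>z i - w i\<bar> \<le> r"
  shows "\<exists>\<xi>. (\<forall>i<n. \<xi> i \<in> Rn n \<and> (\<forall>j<n. \<bar>\<xi> i j - w j\<bar> \<le> r)) \<and>
     f y - f z = (\<Sum>i<n. partial i f (\<xi> i) * (y i - z i))"
proof -
  \<comment> \<open>\<open>h i\<close> has its first \<open>i\<close> coordinates taken from
    \<open>y\<close> and the others from \<open>z\<close>.\<close>
  define h where "h = (\<lambda>i j. if j < i then y j else z j)"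
  have hn: "h n = y" "h 0 = z" using y z by (auto simp: h_def mem_Rn fun_eq_iff not_less)
  have hS: "h (Suc i) = (h i)(i := y i)" "h i = (h i)(i := z i)" for i
    by (auto simp: h_def fun_eq_iff less_Suc_eq)
  have hR: "h i \<in> Rn n" for i using y z by (auto simp: h_def mem_Rn)
  have hb: "\<bar>h i j - w j\<bar> \<le> r" if "j < n" for i j using yw zw that by (auto simp: h_def)
  have "\<exists>t. min (z i) (y i) \<le> t \<and> t \<le> max (z i) (y i) \<and>
     f (h (Suc i)) - f (h i) = partial i f ((h i)(i := t)) * (y i - z i)" if i: "i < n" for i
  proof -
    have "DERIV (\<lambda>t. f ((h i)(i := t))) t :> partial i f ((h i)(i := t))"
      if "min (z i) (y i) \<le> t" "t \<le> max (z i) (y i)" for t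
    proof -
      have "(h i)(i := t) \<in> U"
      proof (rule U)
        show "(h i)(i := t) \<in> Rn n" using Rn_upd hR i by blast
        show "\<bar>((h i)(i := t)) j - w j\<bar> \<le> r" if "j < n" for j
          using hb[OF that] yw[OF i] zw[OF i] \<open>min _ _ \<le> t\<close> \<open>t \<le> _\<close> by auto
      qed
      from Ck_SucD(3)[OF C i this] show ?thesis by simp
    qed
    from mvt_between[OF this] show ?thesis by (metis hS)
  qed
  then obtain t where t: "\<And>i. i < n \<Longrightarrow> min (z i) (y i) \<le> t i \<and> t i \<le> max (z i) (y i) \<and>
     f (h (Suc i)) - f (h i) = partial i f ((h i)(i := t i)) * (y i - z i)" by metis
  have "f y - f z = (\<Sum>i<n. f (h (Suc i)) - f (h i))"
    by (subst sum_lessThan_telescope) (simp add: hn)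
  also have "\<dots> = (\<Sum>i<n. partial i f ((h i)(i := t i)) * (y i - z i))"
    using t by (intro sum.cong) auto
  finally have "f y - f z = \<dots>" .
  moreover have "\<bar>((h i)(i := t i)) j - w j\<bar> \<le> r" if "i < n" "j < n" for i j
    using t[OF that(1)] hb[OF that(2)] yw[OF that(1)] zw[OF that(1)] by (auto simp: min_def max_def split: if_splits)
  moreover have "(h i)(i := t i) \<in> Rn n" if "i < n" for i using Rn_upd hR that by blast
  ultimately show ?thesis by (intro exI[of _ "\<lambda>i. (h i)(i := t i)"]) auto
qed

text \<open>By \<open>cube_mvt\<close> the difference quotient is a sum of partial derivatives at
  intermediate points times difference quotients of the coordinates of \<open>c\<close>. The
  intermediate points tend to \<open>c t0\<close>, and the partial derivatives are
  continuous.\<close>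

lemma chain_curve:
  assumes C: "Ck_on n (Suc 0) U f" and U: "openin (Euclidean_space n) U"
    and c: "\<forall>\<^sub>F t in nhds t0. c t \<in> U"
    and d: "\<And>j. j < n \<Longrightarrow> ((\<lambda>t. c t j) has_real_derivative d j) (at t0)"
  shows "((\<lambda>t. f (c t)) has_real_derivative (\<Sum>j<n. partial j f (c t0) * d j)) (at t0)"
proof -
  let ?x = "c t0"
  have x: "?x \<in> U" using eventually_nhds_x_imp_x[OF c] .
  have xR: "?x \<in> Rn n" using openin_subset_Rn[OF U x] .
  obtain r0 where r0: "r0 > 0" "cube n ?x r0 \<subseteq> U" using openin_cubeE[OF U x] .
  \<comment> \<open>Distance to \<open>?x\<close> in the maximum norm; the 0 covers
    \<open>n = 0\<close>.\<close>
  define m where "m = (\<lambda>y. Max (insert 0 ((\<lambda>i. \<bar>y i - ?x i\<bar>) ` {..<n})))"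
  have m: "\<bar>y i - ?x i\<bar> \<le> m y" if "i < n" for y i
    unfolding m_def using that by (intro Max_ge) auto
  have mr: "m y < r \<longleftrightarrow> (\<forall>i<n. \<bar>y i - ?x i\<bar> < r)" if "r > 0" for y r
    unfolding m_def using that by (subst Max_less_iff) auto
  let ?P = "\<lambda>y \<xi>. (\<forall>i<n. \<xi> i \<in> Rn n \<and> (\<forall>j<n. \<bar>\<xi> i j - ?x j\<bar> \<le> m y)) \<and>
     f y - f ?x = (\<Sum>i<n. partial i f (\<xi> i) * (y i - ?x i))"
  have ex: "\<exists>\<xi>. y \<in> cube n ?x r0 \<longrightarrow> ?P y \<xi>" for y
  proof (cases "y \<in> cube n ?x r0")
    case True
    then have my: "m y < r0" using mr r0 by (auto simp: cube_def)
    have m0: "0 \<le> m y" unfolding m_def by (intro Max_ge) auto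
    have "\<exists>\<xi>. ?P y \<xi>"
    proof (rule cube_mvt[OF C _ xR])
      show "y \<in> Rn n" using True by (simp add: cube_def)
      show "x \<in> U" if "x \<in> Rn n" "\<And>i. i < n \<Longrightarrow> \<bar>x i - ?x i\<bar> \<le> m y" for x
        using that my r0 by (force simp: cube_def)
    qed (use m m0 in auto)
    then show ?thesis by blast
  qed auto
  \<comment> \<open>The intermediate points are chosen as a function of the end point, so that they
    can be followed along the curve.\<close>
  have "\<exists>\<xi>. \<forall>y. y \<in> cube n ?x r0 \<longrightarrow> ?P y (\<xi> y)"
    by (rule choice) (use ex in blast)
  then obtain \<xi> where xi: "\<And>y. y \<in> cube n ?x r0 \<Longrightarrow> ?P y (\<xi> y)" by blast
  have cont: "\<forall>\<^sub>F t in at t0. c t \<in> cube n ?x r" if "r > 0" for r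
  proof -
    have "\<forall>\<^sub>F t in at t0. \<bar>c t j - ?x j\<bar> < r" if "j < n" for j
      using DERIV_isCont[OF d[OF that]] \<open>r > 0\<close> unfolding isCont_def tendsto_iff dist_real_def by auto
    then have "\<forall>\<^sub>F t in at t0. \<forall>j\<in>{..<n}. \<bar>c t j - ?x j\<bar> < r"
      by (intro eventually_ball_finite) auto
    moreover have "\<forall>\<^sub>F t in at t0. c t \<in> U"
      using c by (simp add: eventually_nhds_conv_at)
    ultimately show ?thesis
      by eventually_elim (use openin_subset_Rn[OF U] in \<open>simp add: cube_def\<close>)
  qed
  have g: "((\<lambda>t. partial j f (\<xi> (c t) j)) \<longlongrightarrow> partial j f ?x) (at t0)" if j: "j < n" for j
  proof (rule tendstoI)
    fix e :: real assume "e > 0"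
    have pc: "continuous_on U (partial j f)" using Ck_SucD(2)[OF C j] by simp
    obtain r where
      r: "r > 0" "cube n ?x r \<subseteq> U" "\<And>y. y \<in> cube n ?x r \<Longrightarrow> \<bar>partial j f y - partial j f ?x\<bar> < e"
      using continuous_cube[OF pc U x \<open>e>0\<close>] by blast
    have "\<forall>\<^sub>F t in at t0. c t \<in> cube n ?x (min r r0)" using cont r(1) r0(1) by simp
    then show "\<forall>\<^sub>F t in at t0. dist (partial j f (\<xi> (c t) j)) (partial j f ?x) < e"
    proof eventually_elim
      case (elim t)
      then have 1: "c t \<in> cube n ?x r0" and 2: "m (c t) < r"
        using mr[OF r(1)] by (auto simp: cube_def)
      have "\<xi> (c t) j \<in> cube n ?x r" using xi[OF 1] j 2 by (force simp: cube_def)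
      then show ?case using r(3) by (simp add: dist_real_def)
    qed
  qed
  have "((\<lambda>t. \<Sum>j<n. partial j f (\<xi> (c t) j) * ((c t j - ?x j) / (t - t0))) \<longlongrightarrow> (\<Sum>j<n. partial j f ?x * d j)) (at t0)"
    using g d unfolding has_field_derivative_iff by (intro tendsto_sum tendsto_mult) auto
  moreover have "\<forall>\<^sub>F t in at t0. (f (c t) - f ?x) / (t - t0) = (\<Sum>j<n. partial j f (\<xi> (c t) j) * ((c t j - ?x j) / (t - t0)))"
    using cont[OF r0(1)]
    by eventually_elim (use xi in \<open>simp add: sum_divide_distrib\<close>)
  ultimately show ?thesis
    unfolding has_field_derivative_iff by (subst tendsto_cong)
qed

lemma continuous_on_coords:
  assumes "g ` V \<subseteq> Rn n" "\<And>j. j < n \<Longrightarrow> continuous_on V (\<lambda>x. g x j)"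
  shows "continuous_on V g"
proof (rule continuous_on_coordinatewise_then_product)
  fix j
  show "continuous_on V (\<lambda>x. g x j)"
  proof (cases "j < n")
    case False
    then have "\<And>x. x \<in> V \<Longrightarrow> g x j = 0" using assms(1) by (auto simp: mem_Rn image_subset_iff)
    then show ?thesis by (simp cong: continuous_on_cong)
  qed (rule assms(2))
qed

lemma has_partial_compose:
  assumes V: "openin (Euclidean_space m) V" and U: "openin (Euclidean_space n) U"
    and g: "g ` V \<subseteq> U" "\<And>j. j < n \<Longrightarrow> Ck_on m (Suc k) V (\<lambda>x. g x j)"
    and f: "Ck_on n (Suc k) U f" and x: "x \<in> V" and i: "i < m"
  shows "has_partial i (\<lambda>x. f (g x)) x (\<Sum>j<n. partial j f (g x) * partial i (\<lambda>x. g x j) x)"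
proof -
  have "((\<lambda>t. f (g (x(i := t)))) has_real_derivative
     (\<Sum>j<n. partial j f (g (x(i := x i))) * partial i (\<lambda>x. g x j) x)) (at (x i))"
  proof (rule chain_curve[OF Ck_le[OF _ f] U])
    show "\<forall>\<^sub>F t in nhds (x i). g (x(i := t)) \<in> U"
      using eventually_line[OF V x i] by eventually_elim (use g in auto)
    show "has_partial i (\<lambda>x. g x j) x (partial i (\<lambda>x. g x j) x)" if "j < n" for j
      using Ck_SucD(3)[OF g(2)[OF that] i x] .
  qed simp
  then show ?thesis by simp
qed

text \<open>The derivative of the composite is a sum of products of
  \<open>partial j f (g x)\<close>, of class \<open>k\<close> by induction, and partial derivatives
  of \<open>g\<close>, of class \<open>k\<close> by assumption.\<close>

lemma Ck_compose:
  assumes "openin (Euclidean_space m) V" "openin (Euclidean_space n) U"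
    "g ` V \<subseteq> U" "\<And>j. j < n \<Longrightarrow> Ck_on m k V (\<lambda>x. g x j)" "Ck_on n k U f"
  shows "Ck_on m k V (\<lambda>x. f (g x))"
  using assms
proof (induction k arbitrary: f)
  case 0
  have "g ` V \<subseteq> Rn n" using 0 openin_subset_Rn by blast
  then have "continuous_on V g" using 0 by (intro continuous_on_coords) auto
  then show ?case using 0 continuous_on_compose2 by (metis Ck_on.simps(1))
next
  case (Suc k)
  have g: "g ` V \<subseteq> Rn n" using Suc.prems openin_subset_Rn by blast
  have "continuous_on V g" using Suc.prems(4) by (intro continuous_on_coords[OF g]) auto
  then have 1: "continuous_on V (\<lambda>x. f (g x))"
    using Suc.prems Ck_SucD(1)[OF Suc.prems(5)] continuous_on_compose2 by metis
  show ?case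
  proof (rule Ck_SucI[OF Suc.prems(1) 1])
    fix i assume i: "i < m"
    show "has_partial i (\<lambda>x. f (g x)) x (\<Sum>j<n. partial j f (g x) * partial i (\<lambda>x. g x j) x)"
      if "x \<in> V" for x
      by (rule has_partial_compose[OF Suc.prems that i])
    show "Ck_on m k V (\<lambda>x. \<Sum>j<n. partial j f (g x) * partial i (\<lambda>x. g x j) x)"
    proof (rule Ck_sum[OF Suc.prems(1)])
      fix j assume "j \<in> {..<n}"
      then have j: "j < n" by simp
      show "Ck_on m k V (\<lambda>x. partial j f (g x) * partial i (\<lambda>x. g x j) x)"
        by (rule Ck_mult[OF Suc.prems(1) Suc.IH[OF Suc.prems(1-3) _ Ck_SucD(2)[OF Suc.prems(5) j]]
              Ck_SucD(2)[OF Suc.prems(4)[OF j] i]])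
           (rule Ck_Suc_imp[OF Suc.prems(4)])
    qed
  qed
qed

text \<open>Needed because plots of a quotient lift only locally, and because smoothness of maps
  into a manifold is tested chart by chart.\<close>

lemma Ck_local:
  assumes "openin (Euclidean_space m) U"
    "\<And>u. u \<in> U \<Longrightarrow> \<exists>V. openin (Euclidean_space m) V \<and> u \<in> V \<and> V \<subseteq> U \<and> Ck_on m k V f"
  shows "Ck_on m k U f"
  using assms
proof (induction k arbitrary: f)
  case 0
  show ?case unfolding Ck_on.simps continuous_on_topological
  proof safe
    fix x B assume x: "x \<in> U" and B: "open B" "f x \<in> B"
    obtain V where V: "openin (Euclidean_space m) V" "x \<in> V" "V \<subseteq> U" "continuous_on V f"
      using 0(2)[OF x] by auto
    obtain T where T: "open T" "V = Rn m \<inter> T"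
      using openin_EuclideanE[OF V(1)] .
    obtain A where A: "open A" "x \<in> A" "\<forall>y\<in>V. y \<in> A \<longrightarrow> f y \<in> B"
      using V(2,4) B unfolding continuous_on_topological by metis
    have "open (A \<inter> T)" using A T by blast
    moreover have "\<forall>y\<in>U. y \<in> A \<inter> T \<longrightarrow> f y \<in> B"
      using A(3) T(2) openin_subset_Rn[OF 0(1)] by auto
    ultimately show "\<exists>A. open A \<and> x \<in> A \<and> (\<forall>y\<in>U. y \<in> A \<longrightarrow> f y \<in> B)"
      using A(2) V(2) T(2) by (intro exI[of _ "A \<inter> T"]) auto
  qed
next
  case (Suc k)
  have "Ck_on m 0 U f"
  proof -
    have "\<exists>V. openin (Euclidean_space m) V \<and> u \<in> V \<and> V \<subseteq> U \<and> Ck_on m k V f" if "u \<in> U" for u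
      using Suc.prems(2)[OF that] Ck_Suc_imp by blast
    then have "Ck_on m k U f" using Suc.IH[OF Suc.prems(1)] by blast
    then show ?thesis using Ck_le[of 0] by blast
  qed
  moreover have "(\<lambda>t. f (x(i := t))) differentiable at (x i)" if "i < m" "x \<in> U" for i x
    using Suc.prems(2)[OF that(2)] that(1) by auto
  moreover have "Ck_on m k U (partial i f)" if "i < m" for i
  proof (rule Suc.IH[OF Suc.prems(1)])
    show "\<exists>V. openin (Euclidean_space m) V \<and> u \<in> V \<and> V \<subseteq> U \<and> Ck_on m k V (partial i f)" if "u \<in> U" for u
      using Suc.prems(2)[OF that] \<open>i < m\<close> by auto
  qed
  ultimately show ?case by simp
qed

section \<open>Symmetry of the second derivatives\<close>

lemma mixed_difference:
  assumes C: "Ck_on m (Suc (Suc 0)) U f" and ij: "i < m" "j < m" "i \<noteq> j" and h: "h > 0"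
    and sub: "cube m x (2*h) \<subseteq> U" and x: "x \<in> Rn m"
  shows "\<exists>p\<in>cube m x (2*h). partial j (partial i f) p * (h * h) =
     f (x(i := x i + h, j := x j + h)) - f (x(i := x i + h)) - f (x(j := x j + h)) + f x"
proof -
  \<comment> \<open>The radius is \<open>2 * h\<close> because the closed square of side
    \<open>h\<close> with corner \<open>x\<close> has to lie in an open cube.\<close>
  have inU: "x(i := s, j := t) \<in> cube m x (2*h)" if "x i \<le> s" "s \<le> x i + h" "x j \<le> t" "t \<le> x j + h" for s t
    using that h x ij by (auto simp: cube_def mem_Rn)
  \<comment> \<open>The mean value theorem for \<open>F\<close> in direction \<open>i\<close>,
    followed by that for \<open>partial i f\<close> in direction \<open>j\<close>, turns the second
    difference into a single value of the mixed derivative.\<close>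
  define F where "F = (\<lambda>s. f (x(j := x j + h, i := s)) - f (x(i := s)))"
  have twist: "x(j := t, i := s) = x(i := s, j := t)" for s t using ij by (auto simp: fun_eq_iff)
  have F: "DERIV F s :> partial i f (x(i := s, j := x j + h)) - partial i f (x(i := s))"
    if "x i \<le> s" "s \<le> x i + h" for s
  proof -
    have "x(j := x j + h, i := s) \<in> U" using inU[OF that, of "x j + h"] sub h by (auto simp: twist)
    from Ck_SucD(3)[OF C ij(1) this]
    have 1: "DERIV (\<lambda>s. f (x(j := x j + h, i := s))) s :> partial i f (x(i := s, j := x j + h))"
      using ij by (simp add: twist)
    have "x(i := s, j := x j) \<in> cube m x (2*h)" by (rule inU) (use that h in auto)
    moreover have "x(i := s, j := x j) = x(i := s)" using ij by (auto simp: fun_eq_iff)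
    ultimately have "x(i := s) \<in> U" using sub by auto
    from Ck_SucD(3)[OF C ij(1) this]
    have 2: "DERIV (\<lambda>s. f (x(i := s))) s :> partial i f (x(i := s))" by simp
    show ?thesis unfolding F_def by (rule DERIV_diff[OF 1 2])
  qed
  obtain s where s: "x i < s" "s < x i + h"
    and Fs: "F (x i + h) - F (x i) = h * (partial i f (x(i := s, j := x j + h)) - partial i f (x(i := s)))"
    using MVT2[of "x i" "x i + h" F "\<lambda>s. partial i f (x(i := s, j := x j + h)) - partial i f (x(i := s))"] F h by auto
  have G: "DERIV (\<lambda>t. partial i f (x(i := s, j := t))) t :> partial j (partial i f) (x(i := s, j := t))"
    if "x j \<le> t" "t \<le> x j + h" for t
  proof -
    have "x(i := s, j := t) \<in> U" using inU[of s t] that s sub by auto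
    from Ck_SucD(3)[OF Ck_SucD(2)[OF C ij(1)] ij(2) this] show ?thesis by simp
  qed
  obtain t where t: "x j < t" "t < x j + h"
    and Gt: "partial i f (x(i := s, j := x j + h)) - partial i f (x(i := s, j := x j))
       = h * partial j (partial i f) (x(i := s, j := t))"
    using MVT2[of "x j" "x j + h" "\<lambda>t. partial i f (x(i := s, j := t))" "\<lambda>t. partial j (partial i f) (x(i := s, j := t))"] G h by auto
  have e: "x(i := s, j := x j) = x(i := s)" using ij by (auto simp: fun_eq_iff)
  have "partial j (partial i f) (x(i := s, j := t)) * (h * h) = F (x i + h) - F (x i)"
    using Fs Gt by (simp add: e)
  also have "\<dots> = f (x(i := x i + h, j := x j + h)) - f (x(i := x i + h)) - f (x(j := x j + h)) + f x"
    using ij by (simp add: F_def twist) 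
  finally show ?thesis using inU[of s t] s t by (intro bexI[of _ "x(i := s, j := t)"]) auto
qed

text \<open>The second difference over a square of side \<open>h\<close> is symmetric in
  \<open>i\<close> and \<open>j\<close>, and it is \<open>h * h\<close> times a nearby value of
  either mixed derivative. So the two derivatives agree at two points arbitrarily close to
  \<open>x\<close>, and continuity concludes.\<close>

lemma partial_commute:
  assumes U: "openin (Euclidean_space m) U" and C: "Ck_on m (Suc (Suc 0)) U f"
    and ij: "i < m" "j < m" and x: "x \<in> U"
  shows "partial i (partial j f) x = partial j (partial i f) x"
proof (cases "i = j")
  case False
  have xR: "x \<in> Rn m" using openin_subset_Rn[OF U x] .
  have cont: "continuous_on U (partial i (partial j f))" "continuous_on U (partial j (partial i f))"
    using C ij by auto
  have "\<bar>partial i (partial j f) x - partial j (partial i f) x\<bar> \<le> 2 * e" if e: "e > 0" for e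
  proof -
    obtain r where r: "r > 0" "cube m x r \<subseteq> U" "\<And>y. y \<in> cube m x r \<Longrightarrow> \<bar>partial i (partial j f) y - partial i (partial j f) x\<bar> < e"
      using continuous_cube[OF cont(1) U x e] by blast
    obtain r' where r': "r' > 0" "cube m x r' \<subseteq> U" "\<And>y. y \<in> cube m x r' \<Longrightarrow> \<bar>partial j (partial i f) y - partial j (partial i f) x\<bar> < e"
      using continuous_cube[OF cont(2) U x e] by blast
    define h where "h = min r r' / 2"
    have h: "h > 0" using r r' by (simp add: h_def)
    have s: "cube m x (2*h) \<subseteq> U" "cube m x (2*h) \<subseteq> cube m x r" "cube m x (2*h) \<subseteq> cube m x r'"
      using r by (auto simp: h_def cube_def)
    obtain p where p: "p \<in> cube m x (2*h)" "partial j (partial i f) p * (h * h) =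
     f (x(i := x i + h, j := x j + h)) - f (x(i := x i + h)) - f (x(j := x j + h)) + f x"
      using mixed_difference[OF C ij False h s(1) xR] by blast
    obtain q where q: "q \<in> cube m x (2*h)" "partial i (partial j f) q * (h * h) =
     f (x(j := x j + h, i := x i + h)) - f (x(j := x j + h)) - f (x(i := x i + h)) + f x"
      using mixed_difference[OF C ij(2,1) _ h s(1) xR] False by blast
    have "x(j := x j + h, i := x i + h) = x(i := x i + h, j := x j + h)" using False by (auto simp: fun_eq_iff)
    then have "partial j (partial i f) p * (h * h) = partial i (partial j f) q * (h * h)"
      using p q by simp
    then have "partial j (partial i f) p = partial i (partial j f) q" using h by simp
    then show ?thesis using r(3)[of q] r'(3)[of p] p(1) q(1) s by (smt (verit) subsetD)
  qed
  then have "\<bar>partial i (partial j f) x - partial j (partial i f) x\<bar> \<le> 0"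
    using field_le_epsilon[of "\<bar>partial i (partial j f) x - partial j (partial i f) x\<bar>" 0]
    by (metis add_0 field_sum_of_halves half_gt_zero mult_2)
  then show ?thesis by simp
qed simp

subsection \<open>Smooth functions\<close>

lemma smooth_on_continuous: "smooth_on m U f \<Longrightarrow> continuous_on U f"
  using Ck_continuous smooth_on_def by blast

lemma smooth_on_cong:
  "openin (Euclidean_space m) U \<Longrightarrow> (\<And>x. x \<in> U \<Longrightarrow> f x = g x) \<Longrightarrow> smooth_on m U f \<longleftrightarrow> smooth_on m U g"
  unfolding smooth_on_def using Ck_cong by metis

lemma smooth_on_subset: "smooth_on m U f \<Longrightarrow> V \<subseteq> U \<Longrightarrow> smooth_on m V f"
  unfolding smooth_on_def using Ck_subset by blast

lemma smooth_on_const [simp]: "smooth_on m U (\<lambda>_. c)"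
  by (simp add: smooth_on_def Ck_const)

lemma smooth_on_coord: "openin (Euclidean_space m) U \<Longrightarrow> smooth_on m U (\<lambda>x. x j)"
  by (simp add: smooth_on_def Ck_coord)

lemma smooth_on_add:
  "openin (Euclidean_space m) U \<Longrightarrow> smooth_on m U f \<Longrightarrow> smooth_on m U g \<Longrightarrow> smooth_on m U (\<lambda>x. f x + g x)"
  by (simp add: smooth_on_def Ck_add)

lemma smooth_on_mult:
  "openin (Euclidean_space m) U \<Longrightarrow> smooth_on m U f \<Longrightarrow> smooth_on m U g \<Longrightarrow> smooth_on m U (\<lambda>x. f x * g x)"
  by (simp add: smooth_on_def Ck_mult)

lemma smooth_on_uminus:
  "openin (Euclidean_space m) U \<Longrightarrow> smooth_on m U f \<Longrightarrow> smooth_on m U (\<lambda>x. - f x)"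
  using smooth_on_mult[of m U "\<lambda>_. -1" f] by simp

lemma smooth_on_diff:
  "openin (Euclidean_space m) U \<Longrightarrow> smooth_on m U f \<Longrightarrow> smooth_on m U g \<Longrightarrow> smooth_on m U (\<lambda>x. f x - g x)"
  using smooth_on_add[of m U f "\<lambda>x. - g x"] smooth_on_uminus[of m U g] by simp

lemma smooth_on_sum:
  "openin (Euclidean_space m) U \<Longrightarrow> (\<And>j. j \<in> J \<Longrightarrow> smooth_on m U (f j)) \<Longrightarrow> smooth_on m U (\<lambda>x. \<Sum>j\<in>J. f j x)"
  by (simp add: smooth_on_def Ck_sum)

lemma smooth_on_inverse:
  "openin (Euclidean_space m) U \<Longrightarrow> smooth_on m U f \<Longrightarrow> (\<And>x. x \<in> U \<Longrightarrow> f x \<noteq> 0) \<Longrightarrow>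
   smooth_on m U (\<lambda>x. inverse (f x))"
  by (simp add: smooth_on_def Ck_inverse)

lemma smooth_on_compose:
  assumes "smooth_map m V n U g" "smooth_on n U f"
  shows "smooth_on m V (\<lambda>x. f (g x))"
  using assms unfolding smooth_map_def smooth_on_def by (metis Ck_compose)

lemma smooth_on_local:
  assumes "openin (Euclidean_space m) U"
    "\<And>u. u \<in> U \<Longrightarrow> \<exists>V. openin (Euclidean_space m) V \<and> u \<in> V \<and> V \<subseteq> U \<and> smooth_on m V f"
  shows "smooth_on m U f"
  using Ck_local[OF assms(1)] assms(2) unfolding smooth_on_def by metis

lemma smooth_on_has_partial:
  "smooth_on m U f \<Longrightarrow> i < m \<Longrightarrow> x \<in> U \<Longrightarrow> has_partial i f x (partial i f x)"
  using Ck_SucD(3) unfolding smooth_on_def by blast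

lemma smooth_on_partial: "smooth_on m U f \<Longrightarrow> i < m \<Longrightarrow> smooth_on m U (partial i f)"
  unfolding smooth_on_def using Ck_SucD(2) by blast

lemma smooth_on_partial_commute:
  assumes "openin (Euclidean_space m) U" "smooth_on m U f" "i < m" "j < m" "x \<in> U"
  shows "partial i (partial j f) x = partial j (partial i f) x"
  using partial_commute assms unfolding smooth_on_def by blast

lemma smooth_on_dirderiv:
  "openin (Euclidean_space m) U \<Longrightarrow> smooth_on m U f \<Longrightarrow> smooth_on m U (\<lambda>u. dirderiv m f u v)"
  unfolding dirderiv_def by (intro smooth_on_sum smooth_on_mult smooth_on_const smooth_on_partial) auto

lemma smooth_map_continuous:
  assumes "smooth_map m V n U f" shows "continuous_on V f"
  using assms openin_subset_Rn[of n U] unfolding smooth_map_def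
  by (intro continuous_on_coords[of _ _ n]) (auto intro: smooth_on_continuous)

text \<open>This includes the indices from \<open>n\<close> on, where points of \<open>Rn n\<close>
  vanish: it is the composite with a coordinate function, which is smooth for every index.\<close>

lemma smooth_map_coord: "smooth_map m V n U f \<Longrightarrow> smooth_on m V (\<lambda>x. f x j)"
  using smooth_on_compose[OF _ smooth_on_coord, of m V n U f j] by (simp add: smooth_map_def)

lemma smooth_map_open: "smooth_map m V n U f \<Longrightarrow> openin (Euclidean_space m) V"
  "smooth_map m V n U f \<Longrightarrow> openin (Euclidean_space n) U"
  "smooth_map m V n U f \<Longrightarrow> x \<in> V \<Longrightarrow> f x \<in> U"
  by (auto simp: smooth_map_def)

lemma smooth_map_preimage:
  assumes "smooth_map m V n U f" "openin (Euclidean_space n) W"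
  shows "openin (Euclidean_space m) {v \<in> V. f v \<in> W}"
proof -
  have "f ` V \<subseteq> Rn n" using assms(1) openin_subset_Rn[of n U] by (auto simp: smooth_map_def)
  then show ?thesis
    using openin_preimage[OF smooth_map_continuous[OF assms(1)] _ assms(2)] assms(1)
    by (simp add: smooth_map_def)
qed

lemma smooth_map_restrict:
  assumes "smooth_map m V n U f" "openin (Euclidean_space m) V'" "V' \<subseteq> V"
     "openin (Euclidean_space n) U'" "f ` V' \<subseteq> U'"
  shows "smooth_map m V' n U' f"
  using assms unfolding smooth_map_def by (auto intro: smooth_on_subset)

lemma smooth_map_id: "openin (Euclidean_space m) V \<Longrightarrow> openin (Euclidean_space m) U \<Longrightarrow> V \<subseteq> U \<Longrightarrow>
  smooth_map m V m U (\<lambda>x. x)"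
  by (auto simp: smooth_map_def smooth_on_coord)

section \<open>Directional derivatives and Jacobians\<close>

lemma partial_compose:
  assumes "smooth_map m V n U g" "smooth_on n U f" "x \<in> V" "i < m"
  shows "partial i (\<lambda>x. f (g x)) x = (\<Sum>j<n. partial j f (g x) * partial i (\<lambda>x. g x j) x)"
  using assms unfolding smooth_map_def smooth_on_def
  by (intro has_partial_imp_partial has_partial_compose[of m V n U g 0 f]) blast+

lemma dirderiv_cong:
  assumes "openin (Euclidean_space m) U" "x \<in> U" "\<And>y. y \<in> U \<Longrightarrow> f y = g y"
  shows "dirderiv m f x v = dirderiv m g x v"
  unfolding dirderiv_def using partial_cong[OF assms(1,2) _ assms(3)] by (intro sum.cong) auto

lemma dirderiv_compose:
  assumes "smooth_map m V n U g" "smooth_on n U f" "x \<in> V"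
  shows "dirderiv m (\<lambda>x. f (g x)) x v = dirderiv n f (g x) (jac m g x v)"
  unfolding dirderiv_def jac_def using partial_compose[OF assms]
  by (simp add: sum_distrib_left sum_distrib_right mult.assoc sum.swap[of _ "{..<m}"])

lemma dirderiv_lincomb:
  "dirderiv m f x (\<lambda>i. a * v i + b * w i) = a * dirderiv m f x v + b * dirderiv m f x w"
  by (simp add: dirderiv_def sum_distrib_left sum.distrib algebra_simps)

lemma dirderiv_const [simp]: "dirderiv m (\<lambda>_. c) x v = 0"
  by (simp add: dirderiv_def partial_def)

lemma has_partial_coord: "has_partial i (\<lambda>x. x j) x (if i = j then 1 else 0)"
  by (auto intro!: derivative_eq_intros)

lemma partial_coord: "partial i (\<lambda>x. x j) x = (if i = j then 1 else 0)"
  using has_partial_coord by (rule has_partial_imp_partial)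

lemma dirderiv_coord: "dirderiv m (\<lambda>x. x j) x v = (if j < m then v j else 0)"
  by (simp add: dirderiv_def partial_coord if_distrib if_distribR sum.delta cong: if_cong)

lemma dirderiv_add:
  assumes "smooth_on m U f" "smooth_on m U g" "x \<in> U"
  shows "dirderiv m (\<lambda>x. f x + g x) x v = dirderiv m f x v + dirderiv m g x v"
proof -
  have "partial i (\<lambda>x. f x + g x) x = partial i f x + partial i g x" if "i < m" for i
    using smooth_on_has_partial[OF _ that assms(3)] assms by (intro has_partial_imp_partial DERIV_add) auto
  then show ?thesis by (simp add: dirderiv_def sum.distrib algebra_simps)
qed

lemma dirderiv_mult:
  assumes "smooth_on m U f" "smooth_on m U g" "x \<in> U"
  shows "dirderiv m (\<lambda>x. f x * g x) x v = f x * dirderiv m g x v + dirderiv m f x v * g x"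
proof -
  have "partial i (\<lambda>x. f x * g x) x = f x * partial i g x + partial i f x * g x" if "i < m" for i
    using DERIV_mult'[OF smooth_on_has_partial[OF assms(1) that assms(3)]
       smooth_on_has_partial[OF assms(2) that assms(3)]]
    by (intro has_partial_imp_partial) simp
  then show ?thesis
    by (simp add: dirderiv_def sum.distrib sum_distrib_left sum_distrib_right algebra_simps)
qed

lemma dirderiv_cmult:
  assumes "smooth_on m U f" "x \<in> U"
  shows "dirderiv m (\<lambda>x. c * f x) x v = c * dirderiv m f x v"
  using dirderiv_mult[OF smooth_on_const assms, of c] by simp

lemma dirderiv_sum:
  assumes "openin (Euclidean_space m) U" "\<And>j. j \<in> J \<Longrightarrow> smooth_on m U (f j)" "x \<in> U"
  shows "dirderiv m (\<lambda>x. \<Sum>j\<in>J. f j x) x v = (\<Sum>j\<in>J. dirderiv m (f j) x v)"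
  using assms(2)
proof (induction J rule: infinite_finite_induct)
  case (insert j J)
  then show ?case
    using dirderiv_add[of m U "f j" "\<lambda>x. \<Sum>j\<in>J. f j x"] assms(1,3) smooth_on_sum[of m U J f] by simp
qed auto

lemma jac_Rn: "(\<And>x. x \<in> U \<Longrightarrow> f x \<in> Rn n) \<Longrightarrow> openin (Euclidean_space m) U \<Longrightarrow> u \<in> U \<Longrightarrow> jac m f u v \<in> Rn n"
proof -
  assume a: "\<And>x. x \<in> U \<Longrightarrow> f x \<in> Rn n" "openin (Euclidean_space m) U" "u \<in> U"
  have "dirderiv m (\<lambda>x. f x j) u v = 0" if "j \<ge> n" for j
    using dirderiv_cong[OF a(2,3), of "\<lambda>x. f x j" "\<lambda>_. 0"] a(1) that by (auto simp: mem_Rn)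
  then show ?thesis by (simp add: mem_Rn jac_def)
qed

lemma jac_smooth_Rn: "smooth_map m V n U f \<Longrightarrow> u \<in> V \<Longrightarrow> jac m f u v \<in> Rn n"
  using jac_Rn[of V f n m u v] openin_subset_Rn unfolding smooth_map_def by (metis image_subset_iff)

lemma jac_compose:
  assumes "smooth_map m V n U g" "\<And>j. smooth_on n U (\<lambda>x. f x j)" "x \<in> V"
  shows "jac m (\<lambda>x. f (g x)) x v = jac n f (g x) (jac m g x v)"
  unfolding jac_def[of m "\<lambda>x. f (g x)"] jac_def[of n f]
  using dirderiv_compose[OF assms(1) assms(2) assms(3)] by simp

lemma jac_id: "v \<in> Rn m \<Longrightarrow> jac m (\<lambda>x. x) u v = v"
  by (auto simp: jac_def dirderiv_coord mem_Rn fun_eq_iff)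

lemma jac_cong:
  assumes "openin (Euclidean_space m) U" "x \<in> U" "\<And>y. y \<in> U \<Longrightarrow> f y = g y"
  shows "jac m f x v = jac m g x v"
  unfolding jac_def by (rule ext, rule dirderiv_cong[OF assms(1,2)]) (simp add: assms(3))

lemma jac_lincomb: "jac m f x (\<lambda>i. a * v i + b * w i) = (\<lambda>j. a * jac m f x v j + b * jac m f x w j)"
  by (simp add: jac_def dirderiv_lincomb)

lemma jac_const [simp]: "jac m (\<lambda>_. c) x v = (\<lambda>_. 0)"
  by (simp add: jac_def)

subsection \<open>Ordinary differential equations\<close>

text \<open>Applied below to a vector field together with its first partial derivatives: on one cube
  it bounds both the speed and the Lipschitz constant.\<close>

lemma finite_family_bounded:
  assumes W: "openin (Euclidean_space k) W" "w \<in> W" and J: "finite J"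
    and c: "\<And>g. g \<in> J \<Longrightarrow> continuous_on W g"
  shows "\<exists>r>0. \<exists>K\<ge>0. cube k w r \<subseteq> W \<and> (\<forall>g\<in>J. \<forall>y\<in>cube k w r. \<bar>g y\<bar> \<le> (K::real))"
  using J c
proof (induction J)
  case empty
  then show ?case using openin_cubeE[OF W] by (metis empty_iff order_refl)
next
  case (insert g J)
  then obtain r K where r: "r > 0" "K \<ge> 0" "cube k w r \<subseteq> W" "\<forall>g\<in>J. \<forall>y\<in>cube k w r. \<bar>g y\<bar> \<le> K"
    by auto
  obtain s where s: "s > 0" "\<forall>y\<in>cube k w s. \<bar>g y - g w\<bar> < 1"
    using continuous_cube[OF insert.prems[of g] W, of 1] by auto
  have "cube k w (min r s) \<subseteq> cube k w r" "cube k w (min r s) \<subseteq> cube k w s"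
    by (auto simp: cube_def)
  moreover have "\<bar>g y\<bar> \<le> max K (\<bar>g w\<bar> + 1)" if "y \<in> cube k w s" for y
    using s(2) that by force
  ultimately have "\<forall>h\<in>insert g J. \<forall>y\<in>cube k w (min r s). \<bar>h y\<bar> \<le> max K (\<bar>g w\<bar> + 1)" 
    using r(4) by (metis insert_iff max.coboundedI1 subset_iff)
  moreover have "cube k w (min r s) \<subseteq> W" "min r s > 0" "0 \<le> max K (\<bar>g w\<bar> + 1)"
    using \<open>cube k w (min r s) \<subseteq> cube k w r\<close> r s by auto
  ultimately show ?case by blast
qed

text \<open>A curve in \<open>R^k\<close> will be encoded as one real function on
  \<open>real \<times> nat\<close>, the second argument being the coordinate. As \<open>nat\<close>
  is discrete, continuity is checked coordinate by coordinate, and the metric space of bounded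
  continuous functions becomes available.\<close>

lemma continuous_on_times_nat:
  fixes f :: "real \<times> nat \<Rightarrow> real"
  assumes "\<And>j. continuous_on UNIV (\<lambda>t. f (t, j))"
  shows "continuous_on UNIV f"
proof -
  have "continuous_on (UNIV \<times> {j}) f" for j
  proof -
    have "continuous_on (UNIV \<times> {j}) (\<lambda>x. f (fst x, j))"
      by (rule continuous_on_compose2[OF assms]) (auto intro: continuous_intros)
    then show ?thesis by (rule continuous_on_eq) auto
  qed
  then have "continuous_on (\<Union>j. UNIV \<times> {j}) f"
    by (intro continuous_on_open_UN) (auto intro: open_Times open_discrete)
  moreover have "(\<Union>j. UNIV \<times> {j}) = (UNIV :: (real \<times> nat) set)" by auto
  ultimately show ?thesis by simp
qed

text \<open>Picard iteration: the integral operator \<open>\<Phi>\<close> is a contraction of a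
  closed ball of bounded continuous functions about the constant curve \<open>w\<close>, and the
  Banach fixed point theorem applies.\<close>

lemma ode_exists:
  assumes W: "openin (Euclidean_space k) W" "w \<in> W" and a: "\<And>j. j < k \<Longrightarrow> Ck_on k (Suc 0) W (a j)"
  shows "\<exists>e>0. \<exists>x. x 0 = w \<and> (\<forall>t. \<bar>t\<bar> < e \<longrightarrow> x t \<in> W \<and>
     (\<forall>j<k. ((\<lambda>t. x t j) has_real_derivative a j (x t)) (at t)))"
proof -
  define J where "J = a ` {..<k} \<union> (\<lambda>(i, j). partial i (a j)) ` ({..<k} \<times> {..<k})"
  have "finite J" by (simp add: J_def)
  moreover have "continuous_on W g" if "g \<in> J" for g
    using that Ck_SucD(1)[OF a] Ck_SucD(2)[OF a] by (auto simp: J_def)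
  ultimately obtain r0 K where r0: "r0 > 0" "K \<ge> 0" "cube k w r0 \<subseteq> W" "\<forall>g\<in>J. \<forall>y\<in>cube k w r0. \<bar>g y\<bar> \<le> K"
    using finite_family_bounded[OF W] by metis
  define r where "r = r0 / 2"
  have r: "r > 0" "r < r0" using r0 by (auto simp: r_def)
  have wR: "w \<in> Rn k" using openin_subset_Rn[OF W] .
  \<comment> \<open>A Lipschitz constant in the maximum norm: there are \<open>k\<close> partial
    derivatives, each at most \<open>K\<close>.\<close>
  define L where "L = real k * K"
  have L: "L \<ge> 0" using r0 by (simp add: L_def)
  \<comment> \<open>The operator contains two integrals over intervals of length at most
    \<open>2 * e\<close>. The first bound keeps the curves within distance \<open>r\<close> of
    \<open>w\<close>, the second makes the contraction factor 1/2.\<close>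
  define e where "e = min (r / (4 * (K + 1))) (1 / (8 * (L + 1)))"
  have e: "e > 0" using r r0 L by (simp add: e_def)
  have eK: "4 * e * K \<le> r"
  proof -
    have "4 * e * K \<le> 4 * (r / (4 * (K + 1))) * (K + 1)"
      using r0 e by (intro mult_mono) (auto simp: e_def)
    also have "\<dots> = r" using r0 by (simp add: field_simps)
    finally show ?thesis .
  qed
  have eL: "4 * e * L \<le> 1/2"
  proof -
    have "4 * e * L \<le> 4 * (1 / (8 * (L + 1))) * (L + 1)"
      using L e by (intro mult_mono) (auto simp: e_def)
    also have "\<dots> = 1/2" using L by (simp add: field_simps)
    finally show ?thesis .
  qed
  have lip: "\<bar>a j y - a j z\<bar> \<le> L * D" if j: "j < k" and y: "y \<in> Rn k" "\<And>i. i < k \<Longrightarrow> \<bar>y i - w i\<bar> \<le> r"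
    and z: "z \<in> Rn k" "\<And>i. i < k \<Longrightarrow> \<bar>z i - w i\<bar> \<le> r" and D: "\<And>i. i < k \<Longrightarrow> \<bar>y i - z i\<bar> \<le> D" for j y z D
  proof -
    have inW: "x \<in> W" "x \<in> cube k w r0" if "x \<in> Rn k" "\<And>i. i < k \<Longrightarrow> \<bar>x i - w i\<bar> \<le> r" for x
    proof -
      show "x \<in> cube k w r0" using that r by (force simp: cube_def)
      then show "x \<in> W" using r0 by blast
    qed
    obtain \<xi> where xi: "\<And>i. i < k \<Longrightarrow> \<xi> i \<in> Rn k" "\<And>i l. i < k \<Longrightarrow> l < k \<Longrightarrow> \<bar>\<xi> i l - w l\<bar> \<le> r"
       and eq: "a j y - a j z = (\<Sum>i<k. partial i (a j) (\<xi> i) * (y i - z i))"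
      using cube_mvt[OF a[OF j] y(1) z(1) inW(1) y(2) z(2)] by blast
    have "\<bar>a j y - a j z\<bar> \<le> (\<Sum>i<k. \<bar>partial i (a j) (\<xi> i) * (y i - z i)\<bar>)"
      unfolding eq by (rule sum_abs)
    also have "\<dots> \<le> (\<Sum>i<k. K * D)"
    proof (rule sum_mono)
      fix i assume "i \<in> {..<k}"
      then have i: "i < k" by simp
      have "\<bar>partial i (a j) (\<xi> i)\<bar> \<le> K"
        using r0(4) inW(2)[OF xi(1)[OF i] xi(2)[OF i]] i j by (auto simp: J_def)
      then show "\<bar>partial i (a j) (\<xi> i) * (y i - z i)\<bar> \<le> K * D"
        unfolding abs_mult using D[OF i] r0 by (intro mult_mono) auto
    qed
    also have "\<dots> = L * D" by (simp add: L_def)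
    finally show ?thesis .
  qed
  \<comment> \<open>The curve encoded by \<open>x\<close>, with the coordinates from
    \<open>k\<close> on reset to 0 so that it lies in \<open>Rn k\<close>.\<close>
  define yy :: "((real \<times> nat) \<Rightarrow>\<^sub>C real) \<Rightarrow> real \<Rightarrow> nat \<Rightarrow> real"
    where "yy = (\<lambda>x t j. if j < k then apply_bcontfun x (t, j) else 0)"
  \<comment> \<open>Time is clamped to the interval from \<open>-e\<close> to \<open>e\<close>, so
    that the operator produces bounded functions on the whole line.\<close>
  define c where "c = (\<lambda>t. max (- e) (min e t))"
  have c: "- e \<le> c t" "c t \<le> e" for t using e by (auto simp: c_def)
  have c_cont: "continuous_on UNIV c" unfolding c_def by (intro continuous_intros)
  \<comment> \<open>The integral from 0 to \<open>c t\<close> is written as a difference of two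
    integrals from \<open>-e\<close>, because \<open>c t\<close> may be negative and an integral
    over an empty interval is 0.\<close>
  define g where "g = (\<lambda>x (t, j). if j < k then w j + integral {-e..c t} (\<lambda>s. a j (yy x s)) - integral {-e..0} (\<lambda>s. a j (yy x s)) else 0)"
  have w: "apply_bcontfun (Bcontfun (\<lambda>(t, j). w j)) = (\<lambda>(t::real, j). w j)"
  proof (rule Bcontfun_inverse, rule bcontfun_normI)
    show "continuous_on UNIV (\<lambda>(t::real, j). w j)" by (rule continuous_on_times_nat) simp
    show "norm (case p of (t, j) \<Rightarrow> w j) \<le> Max (insert 0 ((\<lambda>j. \<bar>w j\<bar>) ` {..<k}))" for p :: "real \<times> nat"
      by (cases "snd p < k") (use wR in \<open>auto simp: mem_Rn split: prod.split\<close>)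
  qed
  define S where "S = cball (Bcontfun (\<lambda>(t::real, j). w j)) r"
  have S: "x \<in> S \<longleftrightarrow> (\<forall>t j. \<bar>apply_bcontfun x (t, j) - w j\<bar> \<le> r)" for x
  proof -
    have "x \<in> S \<longleftrightarrow> (\<forall>p. dist (apply_bcontfun x p) (apply_bcontfun (Bcontfun (\<lambda>(t::real, j). w j)) p) \<le> r)"
    proof
      show "\<forall>p. dist (apply_bcontfun x p) (apply_bcontfun (Bcontfun (\<lambda>(t::real, j). w j)) p) \<le> r" if "x \<in> S"
        using that dist_bounded order_trans unfolding S_def mem_cball by (metis dist_commute)
    qed (auto simp: S_def dist_commute[of _ x] intro: dist_bound)
    then show ?thesis by (simp add: w dist_real_def split: prod.splits)
  qed
  \<comment> \<open>A Cauchy sequence for the supremum distance is uniformly Cauchy; its uniform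
    limit is again bounded and continuous, and the ball is closed.\<close>
  have Sc: "complete S" unfolding complete_def
  proof safe
    fix f assume f: "\<forall>n. f n \<in> S" "Cauchy f"
    then obtain l where "uniform_limit UNIV f l sequentially"
      using uniformly_convergent_eq_cauchy[of "\<lambda>_. True" f]
      unfolding Cauchy_def uniform_limit_sequentially_iff
      by (metis dist_fun_lt_imp_dist_val_lt)
    from uniform_limit_bcontfunE[OF this sequentially_bot]
    obtain l' where "f \<longlonglongrightarrow> l'" by metis
    moreover from this have "l' \<in> S"
      using closed_sequentially[of S f] f by (simp add: S_def)
    ultimately show "\<exists>l\<in>S. f \<longlonglongrightarrow> l" by blast
  qed
  have yyR: "yy x t \<in> Rn k" for x t by (simp add: yy_def mem_Rn)
  have yyb: "\<bar>yy x t i - w i\<bar> \<le> r" if "x \<in> S" "i < k" for x t i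
    using that S by (auto simp: yy_def)
  have yyC: "yy x t \<in> cube k w r0" if "x \<in> S" for x t
    using yyb[OF that, of _ t] yyR[of x t] r by (force simp: cube_def)
  have aK: "\<bar>a j (yy x t)\<bar> \<le> K" if "x \<in> S" "j < k" for x t j
    using r0(4) yyC[OF that(1)] that(2) by (auto simp: J_def)
  have yy_cont: "continuous_on UNIV (yy x)" for x
  proof (rule continuous_on_coordinatewise_then_product)
    fix j
    have "continuous_on UNIV (\<lambda>t. apply_bcontfun x (t, j))"
      by (rule continuous_on_compose2[OF continuous_on_apply_bcontfun[of UNIV]]) (auto intro: continuous_intros)
    then show "continuous_on UNIV (\<lambda>t. yy x t j)" by (cases "j < k") (simp_all add: yy_def)
  qed
  have ay_cont: "continuous_on T (\<lambda>s. a j (yy x s))" if "x \<in> S" "j < k" for x j T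
    by (rule continuous_on_subset[of UNIV], rule continuous_on_compose2[OF Ck_SucD(1)[OF a[OF that(2)]] yy_cont])
      (use yyC[OF that(1)] r0 in auto)
  have int: "(\<lambda>s. a j (yy x s)) integrable_on {p..q}" if "x \<in> S" "j < k" for x j p q
    using ay_cont[OF that] by (rule integrable_continuous_interval)
  have g_cont: "continuous_on UNIV (g x)" if x: "x \<in> S" for x
  proof (rule continuous_on_times_nat)
    fix j
    have "continuous_on UNIV (\<lambda>t. integral {-e..c t} (\<lambda>s. a j (yy x s)))" if "j < k"
      by (rule continuous_on_compose2[OF indefinite_integral_continuous_1[OF int[OF x that]] c_cont])
        (use c in auto)
    then show "continuous_on UNIV (\<lambda>t. g x (t, j))"
      by (cases "j < k") (auto simp: g_def intro!: continuous_intros)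
  qed
  have ib: "\<bar>integral {-e..u} h\<bar> \<le> B * (2 * e)" if "-e \<le> u" "u \<le> e" "\<And>s. \<bar>h s\<bar> \<le> B" "continuous_on {-e..u} h" "B \<ge> 0" for u h B
  proof -
    have "norm (integral {-e..u} h) \<le> B * (u - (-e))"
      using that by (intro integral_bound) auto
    also have "\<dots> \<le> B * (2 * e)" using that by (intro mult_left_mono) auto
    finally show ?thesis by simp
  qed
  have gS: "\<bar>g x (t, j) - w j\<bar> \<le> r" if x: "x \<in> S" for x t j
  proof (cases "j < k")
    case True
    have "\<bar>integral {-e..c t} (\<lambda>s. a j (yy x s))\<bar> \<le> K * (2 * e)" "\<bar>integral {-e..0} (\<lambda>s. a j (yy x s))\<bar> \<le> K * (2 * e)"
      using c e aK[OF x True] r0 ay_cont[OF x True] by (auto intro!: ib)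
    then show ?thesis using True eK by (simp add: g_def algebra_simps)
  next
    case False
    then show ?thesis using r wR by (simp add: g_def mem_Rn)
  qed
  define \<Phi> where "\<Phi> = (\<lambda>x. Bcontfun (g x))"
  have \<Phi>: "apply_bcontfun (\<Phi> x) = g x" if x: "x \<in> S" for x
  proof -
    have "\<bar>g x p\<bar> \<le> r + Max (insert 0 ((\<lambda>j. \<bar>w j\<bar>) ` {..<k}))" for p
    proof (cases p)
      case (Pair t j)
      have "\<bar>w j\<bar> \<le> Max (insert 0 ((\<lambda>j. \<bar>w j\<bar>) ` {..<k}))"
        by (cases "j < k") (use wR in \<open>auto simp: mem_Rn\<close>)
      then show ?thesis using gS[OF x, of t j] Pair by (simp add: abs_le_iff)
    qed
    then have "g x \<in> bcontfun" using g_cont[OF x] by (intro bcontfun_normI) auto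
    then show ?thesis by (simp add: \<Phi>_def Bcontfun_inverse)
  qed
  have "\<exists>!x. x \<in> S \<and> \<Phi> x = x"
  proof (rule Banach_fix[OF Sc _ _ _ _ , of "1/2"])
    have "Bcontfun (\<lambda>(t, j). w j) \<in> S" unfolding S_def using r by simp
    then show "S \<noteq> {}" by blast
    show "\<Phi> ` S \<subseteq> S" using gS by (auto simp: \<Phi> S)
    show "dist (\<Phi> x) (\<Phi> z) \<le> 1/2 * dist x z" if xz: "x \<in> S" "z \<in> S" for x z
    proof (rule dist_bound)
      fix p :: "real \<times> nat"
      obtain t j where p: "p = (t, j)" by (cases p)
      define D where "D = dist x z"
      have D: "\<bar>yy x s i - yy z s i\<bar> \<le> D" for s i
        using dist_bounded[of x "(s, i)" z] by (simp add: yy_def D_def dist_real_def)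
      have "\<bar>g x (t, j) - g z (t, j)\<bar> \<le> 1/2 * D"
      proof (cases "j < k")
        case True
        have h: "\<bar>a j (yy x s) - a j (yy z s)\<bar> \<le> L * D" for s
          using lip[OF True yyR yyb[OF xz(1)] yyR yyb[OF xz(2)] D] .
        have D0: "L * D \<ge> 0" using L by (simp add: D_def)
        let ?h = "\<lambda>s. a j (yy x s) - a j (yy z s)"
        have hc: "continuous_on T ?h" for T
          using ay_cont[OF xz(1) True] ay_cont[OF xz(2) True] by (intro continuous_on_diff)
        have "g x (t, j) - g z (t, j) = integral {-e..c t} ?h - integral {-e..0} ?h"
          using True int[OF xz(1) True] int[OF xz(2) True] by (simp add: g_def integral_diff)
        moreover have "\<bar>integral {-e..c t} ?h\<bar> \<le> L * D * (2 * e)" "\<bar>integral {-e..0} ?h\<bar> \<le> L * D * (2 * e)"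
          using c e h D0 hc by (auto intro!: ib)
        ultimately have "\<bar>g x (t, j) - g z (t, j)\<bar> \<le> 4 * e * L * D" by (simp add: algebra_simps)
        also have "\<dots> \<le> 1/2 * D" using eL by (intro mult_right_mono) (auto simp: D_def)
        finally show ?thesis .
      qed (simp add: g_def D_def)
      then show "dist (\<Phi> x p) (\<Phi> z p) \<le> 1/2 * dist x z"
        by (simp add: \<Phi>[OF xz(1)] \<Phi>[OF xz(2)] p dist_real_def D_def)
    qed
  qed auto
  then obtain x where x: "x \<in> S" "\<Phi> x = x" by blast
  then have fix_eq: "apply_bcontfun x = g x" using \<Phi> by metis
  have yx: "yy x t j = w j + integral {-e..c t} (\<lambda>s. a j (yy x s)) - integral {-e..0} (\<lambda>s. a j (yy x s))" if "j < k" for t j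
    using that by (simp add: yy_def fix_eq) (simp add: g_def yy_def)
  have "yy x 0 = w"
  proof
    fix j show "yy x 0 j = w j"
      using yx[of j 0] wR e by (cases "j < k") (auto simp: c_def yy_def mem_Rn)
  qed
  moreover have "yy x t \<in> W" for t using yyC[OF x(1)] r0 by blast
  moreover have "((\<lambda>t. yy x t j) has_real_derivative a j (yy x t)) (at t)" if t: "\<bar>t\<bar> < e" and j: "j < k" for t j
  proof -
    have "((\<lambda>u. integral {-e..u} (\<lambda>s. a j (yy x s))) has_real_derivative a j (yy x t)) (at t within {-e..e})"
      using t by (intro integral_has_real_derivative ay_cont x j) auto
    moreover have "at t within {-e..e} = at t" using t by (intro at_within_interior) auto
    ultimately have "((\<lambda>u. w j + integral {-e..u} (\<lambda>s. a j (yy x s)) - integral {-e..0} (\<lambda>s. a j (yy x s))) has_real_derivative a j (yy x t)) (at t)"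
      by (auto intro!: derivative_eq_intros)
    then have dw: "((\<lambda>u. w j + integral {-e..u} (\<lambda>s. a j (yy x s)) - integral {-e..0} (\<lambda>s. a j (yy x s))) has_real_derivative a j (yy x t)) (at t)" .
    have ev: "\<forall>\<^sub>F u in nhds t. w j + integral {-e..u} (\<lambda>s. a j (yy x s)) - integral {-e..0} (\<lambda>s. a j (yy x s)) = yy x u j"
    proof -
      have "\<forall>\<^sub>F u in nhds t. u \<in> {-e<..<e}" using t by (intro eventually_nhds_in_open) auto
      then show ?thesis by eventually_elim (subst yx[OF j], simp add: c_def)
    qed
    show ?thesis using DERIV_cong_ev[OF refl ev refl] dw by blast
  qed
  ultimately show ?thesis using e by (intro exI[of _ e] conjI exI[of _ "yy x"]) auto
qed

text \<open>A plot needs a domain in some \<open>Rn n\<close>, so an interval of time is a set of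
  points of \<open>Rn 1\<close>.\<close>

definition interval1 :: "real \<Rightarrow> real \<Rightarrow> (nat \<Rightarrow> real) set"
  where "interval1 a b = {s \<in> Rn 1. a < s 0 \<and> s 0 < b}"

lemma openin_interval1 [simp]: "openin (Euclidean_space (Suc 0)) (interval1 a b)"
  "openin (Euclidean_space 1) (interval1 a b)"
proof -
  show "openin (Euclidean_space 1) (interval1 a b)"
    using openin_preimage_real[of "Rn 1" "\<lambda>s. s 0" 1 "{a<..<b}"]
    by (simp add: interval1_def continuous_on_subset[OF continuous_on_product_coordinates])
  then show "openin (Euclidean_space (Suc 0)) (interval1 a b)" by simp
qed

text \<open>Bootstrapping: if the solution is of class \<open>l\<close>, its derivative
  \<open>a j (x t)\<close> is a composite of class \<open>l\<close>, so the solution is of class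
  \<open>l + 1\<close>.\<close>

lemma ode_smooth:
  assumes W: "openin (Euclidean_space k) W" and a: "\<And>j. j < k \<Longrightarrow> smooth_on k W (a j)"
    and R: "\<And>t. \<bar>t\<bar> < e \<Longrightarrow> x t \<in> W"
    and d: "\<And>t j. \<bar>t\<bar> < e \<Longrightarrow> j < k \<Longrightarrow> ((\<lambda>t. x t j) has_real_derivative a j (x t)) (at t)"
  shows "smooth_map 1 (interval1 (-e) e) k W (\<lambda>s. x (s 0))"
proof -
  let ?I = "interval1 (-e) e"
  have c0: "continuous_on ?I (\<lambda>s. s 0)" by (simp add: continuous_on_subset[OF continuous_on_product_coordinates])
  have "Ck_on 1 l ?I (\<lambda>s. x (s 0) j)" if "j < k" for l j
    using that
  proof (induction l arbitrary: j)
    case 0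
    have "continuous_on {-e<..<e} (\<lambda>t. x t j)"
      using DERIV_isCont[OF d[OF _ 0]] by (intro continuous_at_imp_continuous_on) (auto simp: abs_less_iff)
    then have "continuous_on ?I (\<lambda>s. x (s 0) j)"
      by (rule continuous_on_compose2[OF _ c0]) (auto simp: interval1_def)
    then show ?case by simp
  next
    case (Suc l)
    have 0: "continuous_on ?I (\<lambda>s. x (s 0) j)" using Suc.IH[OF Suc.prems] Ck_continuous by blast
    show ?case
    proof (rule Ck_SucI[OF openin_interval1(2) 0])
      fix i :: nat assume "i < 1"
      then have i: "i = 0" by simp
      show "has_partial i (\<lambda>s. x (s 0) j) s (a j (x (s 0)))" if "s \<in> ?I" for s
        using d[of "s 0" j] that Suc.prems by (simp add: i interval1_def abs_less_iff)
      show "Ck_on 1 l ?I (\<lambda>s. a j (x (s 0)))"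
        by (rule Ck_compose[OF openin_interval1(2) W _ Suc.IH])
          (use R a[OF Suc.prems] in \<open>auto simp: interval1_def abs_less_iff smooth_on_def\<close>)
    qed
  qed
  then show ?thesis
    using W R openin_interval1 unfolding smooth_map_def smooth_on_def
    by (auto simp: interval1_def abs_less_iff simp del: One_nat_def)
qed

subsection \<open>Linear algebra\<close>

text \<open>Gaussian elimination. Unless the last equation is void, a pivot \<open>p\<close> removes
  it from the other unknowns, and one equation and one unknown are lost.\<close>

lemma linear_relation_exists:
  fixes M :: "'j \<Rightarrow> nat \<Rightarrow> real"
  assumes "finite J" "card J > n"
  shows "\<exists>c. (\<exists>j\<in>J. c j \<noteq> 0) \<and> (\<forall>i<n. (\<Sum>j\<in>J. c j * M j i) = 0)"
  using assms
proof (induction n arbitrary: J M)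
  case 0
  then obtain j where "j \<in> J" by fastforce
  then show ?case by (intro exI[of _ "\<lambda>_. 1"]) auto
next
  case (Suc n)
  show ?case
  proof (cases "\<forall>j\<in>J. M j n = 0")
    case True
    obtain c where "\<exists>j\<in>J. c j \<noteq> 0" "\<forall>i<n. (\<Sum>j\<in>J. c j * M j i) = 0"
      using Suc.IH[of J M] Suc.prems by auto
    then show ?thesis using True by (intro exI[of _ c]) (auto simp: less_Suc_eq)
  next
    case False
    then obtain p where p: "p \<in> J" "M p n \<noteq> 0" by blast
    define N where "N = (\<lambda>j i. M j i - M j n / M p n * M p i)"
    obtain c where c: "\<exists>j\<in>J-{p}. c j \<noteq> 0" "\<forall>i<n. (\<Sum>j\<in>J-{p}. c j * N j i) = 0"
    proof -
      have "card (J - {p}) > n" using Suc.prems p by (simp add: card_Diff_singleton)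
      then show ?thesis using Suc.IH[of "J - {p}" N] Suc.prems that by blast
    qed
    \<comment> \<open>The coefficient at the pivot compensates for the multiples of
      \<open>M p\<close> that were subtracted from the other vectors.\<close>
    define d where "d = c(p := - (\<Sum>j\<in>J-{p}. c j * (M j n / M p n)))"
    have "(\<Sum>j\<in>J. d j * M j i) = (\<Sum>j\<in>J-{p}. c j * N j i)" for i
    proof -
      have "(\<Sum>j\<in>J. d j * M j i) = d p * M p i + (\<Sum>j\<in>J-{p}. d j * M j i)"
        using Suc.prems p by (subst sum.remove[of J p]) auto
      also have "(\<Sum>j\<in>J-{p}. d j * M j i) = (\<Sum>j\<in>J-{p}. c j * M j i)"
        by (intro sum.cong) (auto simp: d_def)
      also have "d p * M p i = - (\<Sum>j\<in>J-{p}. c j * (M j n / M p n * M p i))"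
        by (simp add: d_def sum_distrib_right mult.assoc)
      finally show ?thesis by (simp add: N_def right_diff_distrib sum_subtractf)
    qed
    moreover have "N j n = 0" for j using p by (simp add: N_def)
    ultimately have "\<forall>i<Suc n. (\<Sum>j\<in>J. d j * M j i) = 0"
      using c(2) by (auto simp: less_Suc_eq)
    moreover have "\<exists>j\<in>J. d j \<noteq> 0" using c(1) by (auto simp: d_def)
    ultimately show ?thesis by blast
  qed
qed

lemma smooth_dual_frame:
  fixes M :: "nat \<Rightarrow> (nat \<Rightarrow> real) \<Rightarrow> nat \<Rightarrow> real" and k n :: nat
  assumes W: "openin (Euclidean_space m) W" "t0 \<in> W"
    and M: "\<And>j i. j < k \<Longrightarrow> i < n \<Longrightarrow> smooth_on m W (\<lambda>t. M j t i)"
    and ind: "\<And>c. (\<forall>i<n. (\<Sum>j<k. c j * M j t0 i) = 0) \<Longrightarrow> (\<forall>j<k. c j = (0::real))"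
  shows "\<exists>V L. openin (Euclidean_space m) V \<and> t0 \<in> V \<and> V \<subseteq> W \<and>
     (\<forall>j<k. \<forall>i<n. smooth_on m V (\<lambda>t. L j t i)) \<and>
     (\<forall>t\<in>V. \<forall>j<k. \<forall>l<k. (\<Sum>i<n. L j t i * M l t i) = (if j = l then 1 else 0))"
  using M ind
proof (induction k)
  case 0
  show ?case using W by (intro exI[of _ W]) auto
next
  case (Suc k)
  have ind': "\<forall>j<k. c j = 0" if c: "\<forall>i<n. (\<Sum>j<k. c j * M j t0 i) = 0" for c
  proof -
    have "\<forall>j<Suc k. (c(k := 0)) j = 0" by (rule Suc.prems(2)) (use c in simp)
    then show ?thesis by (metis fun_upd_other less_SucI less_irrefl)
  qed
  have "\<exists>V L. openin (Euclidean_space m) V \<and> t0 \<in> V \<and> V \<subseteq> W \<and>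
     (\<forall>j<k. \<forall>i<n. smooth_on m V (\<lambda>t. L j t i)) \<and>
     (\<forall>t\<in>V. \<forall>j<k. \<forall>l<k. (\<Sum>i<n. L j t i * M l t i) = (if j = l then 1 else 0))"
    by (rule Suc.IH[OF Suc.prems(1)[OF less_SucI] ind'])
  then obtain V L where VL: "openin (Euclidean_space m) V \<and> t0 \<in> V \<and> V \<subseteq> W \<and>
     (\<forall>j<k. \<forall>i<n. smooth_on m V (\<lambda>t. L j t i)) \<and>
     (\<forall>t\<in>V. \<forall>j<k. \<forall>l<k. (\<Sum>i<n. L j t i * M l t i) = (if j = l then 1 else 0))"
    by (elim exE)
  then have V: "openin (Euclidean_space m) V" "t0 \<in> V" "V \<subseteq> W"
    and L: "\<And>j i. j < k \<Longrightarrow> i < n \<Longrightarrow> smooth_on m V (\<lambda>t. L j t i)"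
    and dual: "\<And>t j l. t \<in> V \<Longrightarrow> j < k \<Longrightarrow> l < k \<Longrightarrow> (\<Sum>i<n. L j t i * M l t i) = (if j = l then 1 else 0)"
    by simp_all
  \<comment> \<open>\<open>b\<close> gives the coefficients of \<open>M k\<close> along the earlier
    vectors and \<open>r\<close> the remainder, which the earlier dual vectors annihilate. By
    independence the remainder is nonzero at \<open>t0\<close>.\<close>
  define b where "b = (\<lambda>j t. \<Sum>i<n. L j t i * M k t i)"
  define r where "r = (\<lambda>t i. M k t i - (\<Sum>j<k. b j t * M j t i))"
  have MV: "smooth_on m V (\<lambda>t. M j t i)" if "j \<le> k" "i < n" for i j
    using Suc.prems(1)[of j i] that V smooth_on_subset by auto
  have bs: "smooth_on m V (b j)" if "j < k" for j
    unfolding b_def using that by (intro smooth_on_sum smooth_on_mult V L MV) auto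
  have rs: "smooth_on m V (\<lambda>t. r t i)" if "i < n" for i
    unfolding r_def using that by (intro smooth_on_diff smooth_on_sum smooth_on_mult V bs MV) auto
  obtain p where p: "p < n" "r t0 p \<noteq> 0"
  proof -
    have "\<exists>p<n. r t0 p \<noteq> 0"
    proof (rule ccontr)
      assume a: "\<not> ?thesis"
      define c where "c = (\<lambda>j. - b j t0)(k := 1)"
      have "(\<Sum>j<k. c j * M j t0 i) = - (\<Sum>j<k. b j t0 * M j t0 i)" for i
        by (subst sum_negf[symmetric], intro sum.cong) (auto simp: c_def)
      then have "\<forall>i<n. (\<Sum>j<Suc k. c j * M j t0 i) = 0" using a by (auto simp: r_def c_def)
      then have "c k = 0" using Suc.prems(2)[of c] by blast
      then show False by (simp add: c_def)
    qed
    then show ?thesis using that by blast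
  qed
  define V' where "V' = {t \<in> V. r t p \<in> - {0}}"
  have V': "openin (Euclidean_space m) V'" "t0 \<in> V'" "V' \<subseteq> V" "\<And>t. t \<in> V' \<Longrightarrow> r t p \<noteq> 0"
    unfolding V'_def using openin_preimage_real[OF smooth_on_continuous[OF rs[OF p(1)]] V(1), of "- {0}"] p V
    by auto
  \<comment> \<open>As a functional, \<open>\<kappa>\<close> takes the entry \<open>p\<close> of
    what is left of a vector after removing its components along the earlier \<open>M j\<close>, and
    divides it by the entry \<open>p\<close> of \<open>r\<close>. So it kills the earlier vectors
    and is 1 on \<open>M k\<close>.\<close>
  define \<kappa> where "\<kappa> = (\<lambda>t i. ((if i = p then 1 else 0) - (\<Sum>j<k. L j t i * M j t p)) * inverse (r t p))"
  define N where "N = (\<lambda>j t i. if j < k then L j t i - b j t * \<kappa> t i else \<kappa> t i)"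
  have sub: "smooth_on m V f \<Longrightarrow> smooth_on m V' f" for f using smooth_on_subset V'(3) by blast
  have ks: "smooth_on m V' (\<lambda>t. \<kappa> t i)" if "i < n" for i
    unfolding \<kappa>_def using that p(1) V'(4)
    by (intro smooth_on_mult smooth_on_diff smooth_on_const smooth_on_sum V'(1) smooth_on_inverse sub L MV rs) auto
  have Ns: "smooth_on m V' (\<lambda>t. N j t i)" if "j < Suc k" "i < n" for j i
    unfolding N_def using that ks[OF that(2)] sub L bs
    by (cases "j < k") (auto intro!: smooth_on_diff smooth_on_mult V')
  have kM: "(\<Sum>i<n. \<kappa> t i * M l t i) = (if l = k then 1 else 0)" if t: "t \<in> V'" and l: "l < Suc k" for t l
  proof -
    have "(\<Sum>i<n. ((if i = p then 1 else 0) - (\<Sum>j<k. L j t i * M j t p)) * M l t i)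
       = (\<Sum>i<n. (if i = p then M l t i else 0)) - (\<Sum>i<n. \<Sum>j<k. L j t i * M j t p * M l t i)"
      unfolding left_diff_distrib sum_subtractf sum_distrib_right
      by (intro arg_cong2[of _ _ _ _ "(-)"] sum.cong) auto
    also have "(\<Sum>i<n. \<Sum>j<k. L j t i * M j t p * M l t i) = (\<Sum>j<k. (\<Sum>i<n. L j t i * M l t i) * M j t p)"
      by (subst sum.swap) (simp add: sum_distrib_left sum_distrib_right mult_ac)
    also have "(\<Sum>i<n. (if i = p then M l t i else 0)) = M l t p"
      using p(1) by simp
    finally have e: "(\<Sum>i<n. ((if i = p then 1 else 0) - (\<Sum>j<k. L j t i * M j t p)) * M l t i)
       = M l t p - (\<Sum>j<k. (\<Sum>i<n. L j t i * M l t i) * M j t p)" .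
    have "\<dots> = (if l = k then r t p else 0)"
    proof (cases "l = k")
      case True
      then show ?thesis by (simp add: r_def b_def)
    next
      case False
      then have "l < k" using l by simp
      then have "(\<Sum>j<k. (\<Sum>i<n. L j t i * M l t i) * M j t p) = (\<Sum>j<k. if j = l then M j t p else 0)"
        using dual t V'(3) by (intro sum.cong) auto
      then show ?thesis using False \<open>l < k\<close> by simp
    qed
    moreover have "(\<Sum>i<n. \<kappa> t i * M l t i) = (\<Sum>i<n. ((if i = p then 1 else 0) - (\<Sum>j<k. L j t i * M j t p)) * M l t i) * inverse (r t p)"
      unfolding sum_distrib_right \<kappa>_def by (intro sum.cong) (auto simp: mult_ac)
    ultimately show ?thesis using V'(4)[OF t] e by simp
  qed
  have "(\<Sum>i<n. N j t i * M l t i) = (if j = l then 1 else 0)" if t: "t \<in> V'" and j: "j < Suc k" and l: "l < Suc k" for t j l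
  proof (cases "j < k")
    case True
    have "(\<Sum>i<n. N j t i * M l t i) = (\<Sum>i<n. L j t i * M l t i) - b j t * (\<Sum>i<n. \<kappa> t i * M l t i)"
      using True by (simp add: N_def left_diff_distrib sum_subtractf sum_distrib_left mult.assoc)
    then show ?thesis using kM[OF t l] dual[of t j l] True l t V'(3)
      by (cases "l = k") (auto simp: b_def)
  next
    case False
    then show ?thesis using kM[OF t l] j by (auto simp: N_def less_Suc_eq)
  qed
  then show ?case using V' V(3) Ns by (intro exI[of _ V'] exI[of _ N]) auto
qed

subsection \<open>Products of Euclidean domains\<close>

lemma join_Rn: "x \<in> Rn m \<Longrightarrow> y \<in> Rn n \<Longrightarrow> join m x y \<in> Rn (m + n)"
  by (auto simp: mem_Rn join_def)

lemma fst_part_join: "x \<in> Rn m \<Longrightarrow> fst_part m (join m x y) = x"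
  by (auto simp: mem_Rn join_def fst_part_def fun_eq_iff)

lemma snd_part_join [simp]: "snd_part m (join m x y) = y"
  by (auto simp: join_def snd_part_def fun_eq_iff)

lemma join_lt: "i < m \<Longrightarrow> join m x y i = x i"
  by (auto simp: join_def)

lemma fst_part_Rn: "fst_part m z \<in> Rn m"
  by (auto simp: mem_Rn fst_part_def)

lemma snd_part_Rn: "z \<in> Rn (m + n) \<Longrightarrow> snd_part m z \<in> Rn n"
  by (auto simp: mem_Rn snd_part_def)

lemma prod_dom_join:
  "openin (Euclidean_space m) U \<Longrightarrow> openin (Euclidean_space n) V \<Longrightarrow> x \<in> U \<Longrightarrow> y \<in> V \<Longrightarrow>
   join m x y \<in> prod_dom m n U V"
  unfolding prod_dom_def using openin_subset_Rn[of m U x] openin_subset_Rn[of n V y]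
  by (simp add: join_Rn fst_part_join)

lemma openin_prod_dom:
  assumes "openin (Euclidean_space m) U" "openin (Euclidean_space n) V"
  shows "openin (Euclidean_space (m + n)) (prod_dom m n U V)"
proof -
  have c: "continuous_on (Rn (m+n)) (\<lambda>z. z i)" for i
    by (simp add: continuous_on_subset[OF continuous_on_product_coordinates])
  have "continuous_on (Rn (m+n)) (fst_part m)"
    using fst_part_Rn c by (intro continuous_on_coords[of _ _ m]) (blast, simp add: fst_part_def)
  moreover have "continuous_on (Rn (m+n)) (snd_part m)"
    using snd_part_Rn c by (intro continuous_on_coords[of _ _ n]) (blast, simp add: snd_part_def)
  ultimately have "openin (Euclidean_space (m + n)) {z \<in> Rn (m+n). fst_part m z \<in> U}"
     "openin (Euclidean_space (m + n)) {z \<in> Rn (m+n). snd_part m z \<in> V}"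
    using assms by (auto intro!: openin_preimage simp: fst_part_Rn snd_part_Rn)
  moreover have "prod_dom m n U V = {z \<in> Rn (m+n). fst_part m z \<in> U} \<inter> {z \<in> Rn (m+n). snd_part m z \<in> V}"
    by (auto simp: prod_dom_def)
  ultimately show ?thesis by auto
qed

lemma smooth_map_fst_part:
  "openin (Euclidean_space m) U \<Longrightarrow> openin (Euclidean_space n) V \<Longrightarrow>
   smooth_map (m + n) (prod_dom m n U V) m U (fst_part m)"
  using openin_prod_dom[of m U n V]
  by (auto simp: smooth_map_def fst_part_def smooth_on_coord) (auto simp: prod_dom_def fst_part_def)

lemma smooth_map_snd_part:
  "openin (Euclidean_space m) U \<Longrightarrow> openin (Euclidean_space n) V \<Longrightarrow>
   smooth_map (m + n) (prod_dom m n U V) n V (snd_part m)"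
  using openin_prod_dom[of m U n V]
  by (auto simp: smooth_map_def snd_part_def smooth_on_coord) (auto simp: prod_dom_def snd_part_def)

lemma smooth_map_join:
  assumes "smooth_map k W m U f" "smooth_map k W n V g"
  shows "smooth_map k W (m + n) (prod_dom m n U V) (\<lambda>x. join m (f x) (g x))"
proof -
  have "smooth_on k W (\<lambda>x. join m (f x) (g x) j)" for j
    using smooth_map_coord[OF assms(1), of j] smooth_map_coord[OF assms(2), of "j - m"]
    by (cases "j < m") (simp_all add: join_def)
  then show ?thesis
    using assms openin_prod_dom[of m U n V] by (auto simp: smooth_map_def intro!: prod_dom_join)
qed

lemma smooth_map_const: "openin (Euclidean_space m) V \<Longrightarrow> openin (Euclidean_space n) U \<Longrightarrow> c \<in> U \<Longrightarrow>
  smooth_map m V n U (\<lambda>_. c)"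
  by (auto simp: smooth_map_def)

lemma jac_join: "jac k (\<lambda>x. join m (f x) (g x)) u v = join m (jac k f u v) (jac k g u v)"
  by (rule ext) (simp add: jac_def join_def)

lemma jac_fst_part: "v \<in> Rn (m + n) \<Longrightarrow> jac (m + n) (fst_part m) z v = fst_part m v"
  by (rule ext) (auto simp: jac_def fst_part_def dirderiv_coord)

lemma jac_snd_part: "v \<in> Rn (m + n) \<Longrightarrow> jac (m + n) (snd_part m) z v = snd_part m v"
  by (rule ext) (auto simp: jac_def snd_part_def dirderiv_coord mem_Rn)

subsection \<open>Exterior derivatives\<close>

lemma mem_vecs1: "vs \<in> vecs n 1 \<longleftrightarrow> (\<exists>w\<in>Rn n. vs = [w])"
  by (auto simp: vecs_def length_Suc_conv)

lemma vecs1 [simp]: "[w] \<in> vecs n 1 \<longleftrightarrow> w \<in> Rn n" "[w] \<in> vecs n (Suc 0) \<longleftrightarrow> w \<in> Rn n"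
  by (auto simp: vecs_def)

lemma mem_vecs2: "vs \<in> vecs n 2 \<longleftrightarrow> (\<exists>v\<in>Rn n. \<exists>w\<in>Rn n. vs = [v, w])"
  by (auto simp: vecs_def length_Suc_conv numeral_2_eq_2)

lemma mem_vecs3: "vs \<in> vecs n 3 \<longleftrightarrow> (\<exists>u\<in>Rn n. \<exists>v\<in>Rn n. \<exists>w\<in>Rn n. vs = [u, v, w])"
  by (auto simp: vecs_def length_Suc_conv numeral_3_eq_3)

lemma linear_expansion:
  assumes L: "\<And>x y a b. x \<in> Rn n \<Longrightarrow> y \<in> Rn n \<Longrightarrow> L (\<lambda>j. a * x j + b * y j) = a * L x + b * (L y :: real)"
    and w: "w \<in> Rn n"
  shows "L w = (\<Sum>i<n. w i * L (evec i))"
proof -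
  have "L (\<lambda>j. if j < k then w j else 0) = (\<Sum>i<k. w i * L (evec i))" if "k \<le> n" for k
    using that
  proof (induction k)
    case 0
    show ?case using L[OF w w, of 0 0] by simp
  next
    case (Suc k)
    have "(\<lambda>j. if j < Suc k then w j else 0) = (\<lambda>j. 1 * (if j < k then w j else 0) + w k * evec k j)"
      by (auto simp: evec_def less_Suc_eq)
    moreover have "L \<dots> = 1 * L (\<lambda>j. if j < k then w j else 0) + w k * L (evec k)"
      using Suc.prems by (intro L) (auto simp: mem_Rn evec_def)
    ultimately show ?case using Suc by simp
  qed
  moreover have "(\<lambda>j. if j < n then w j else 0) = w" using w by (auto simp: mem_Rn fun_eq_iff)
  ultimately show ?thesis by (metis le_refl)
qed

lemma smooth_form_linear:
  "smooth_form n k U \<omega> \<Longrightarrow> u \<in> U \<Longrightarrow> vs \<in> vecs n k \<Longrightarrow> i < k \<Longrightarrow> x \<in> Rn n \<Longrightarrow> y \<in> Rn n \<Longrightarrow>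
   \<omega> u (vs[i := (\<lambda>j. a * x j + b * y j)]) = a * \<omega> u (vs[i := x]) + b * \<omega> u (vs[i := y])"
  by (simp add: smooth_form_def)

lemma smooth_form_alternating:
  "smooth_form n k U \<omega> \<Longrightarrow> u \<in> U \<Longrightarrow> vs \<in> vecs n k \<Longrightarrow> i < k \<Longrightarrow> j < k \<Longrightarrow> i \<noteq> j \<Longrightarrow> vs ! i = vs ! j \<Longrightarrow> \<omega> u vs = 0"
  unfolding smooth_form_def by blast

lemma smooth_form1_linear:
  assumes "smooth_form n 1 U \<omega>" "u \<in> U" "x \<in> Rn n" "y \<in> Rn n"
  shows "\<omega> u [\<lambda>j. a * x j + b * y j] = a * \<omega> u [x] + b * \<omega> u [y]"
  using smooth_form_linear[OF assms(1,2) _ _ assms(3,4), of "[x]" 0 a b] assms(3) by simp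

lemma smooth_form1_expansion:
  assumes "smooth_form n 1 U \<omega>" "u \<in> U" "w \<in> Rn n"
  shows "\<omega> u [w] = (\<Sum>i<n. w i * \<omega> u [evec i])"
  using linear_expansion[of n "\<lambda>w. \<omega> u [w]", OF smooth_form1_linear[OF assms(1,2)] assms(3)] .

lemma smooth_form_smooth: "smooth_form n k U \<omega> \<Longrightarrow> vs \<in> vecs n k \<Longrightarrow> smooth_on n U (\<lambda>u. \<omega> u vs)"
  by (simp add: smooth_form_def)

lemma smooth_form1_smooth: "smooth_form n 1 U \<omega> \<Longrightarrow> w \<in> Rn n \<Longrightarrow> smooth_on n U (\<lambda>u. \<omega> u [w])"
  by (simp add: smooth_form_def)

lemma smooth_form_zero: "smooth_form n k U \<omega> \<Longrightarrow> \<not> (u \<in> U \<and> vs \<in> vecs n k) \<Longrightarrow> \<omega> u vs = 0"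
  by (simp add: smooth_form_def)

lemma ext_deriv_outside: "\<not> (u \<in> U \<and> vs \<in> vecs n (Suc k)) \<Longrightarrow> ext_deriv n k U \<omega> u vs = 0"
  unfolding ext_deriv_def by (simp only: if_False)

lemma ext_deriv1:
  "u \<in> U \<Longrightarrow> v \<in> Rn n \<Longrightarrow> w \<in> Rn n \<Longrightarrow>
   ext_deriv n 1 U \<omega> u [v, w] = dirderiv n (\<lambda>x. \<omega> x [w]) u v - dirderiv n (\<lambda>x. \<omega> x [v]) u w"
  by (simp add: ext_deriv_def vecs_def)

lemma ext_deriv2:
  "u \<in> U \<Longrightarrow> a \<in> Rn n \<Longrightarrow> b \<in> Rn n \<Longrightarrow> c \<in> Rn n \<Longrightarrow>
   ext_deriv n 2 U \<omega> u [a, b, c] = dirderiv n (\<lambda>x. \<omega> x [b, c]) u a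
     - dirderiv n (\<lambda>x. \<omega> x [a, c]) u b + dirderiv n (\<lambda>x. \<omega> x [a, b]) u c"
  by (simp add: ext_deriv_def vecs_def numeral_2_eq_2)

lemma dirderiv_commute:
  assumes U: "openin (Euclidean_space m) U" and f: "smooth_on m U f" and u: "u \<in> U"
  shows "dirderiv m (\<lambda>u. dirderiv m f u v) u w = dirderiv m (\<lambda>u. dirderiv m f u w) u v"
proof -
  have e: "dirderiv m (\<lambda>u. dirderiv m f u v) u w = (\<Sum>i<m. \<Sum>j<m. partial j (partial i f) u * v i * w j)" for v w
  proof -
    have "dirderiv m (\<lambda>u. dirderiv m f u v) u w = (\<Sum>i<m. dirderiv m (\<lambda>u. partial i f u * v i) u w)"
      unfolding dirderiv_def[of m f]
      by (rule dirderiv_sum[OF U _ u]) (use smooth_on_partial[OF f] in \<open>auto intro!: smooth_on_mult U\<close>)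
    also have "\<dots> = (\<Sum>i<m. v i * dirderiv m (partial i f) u w)"
      using dirderiv_cmult[OF smooth_on_partial[OF f] u] by (intro sum.cong) (auto simp: mult.commute)
    finally show ?thesis by (simp add: dirderiv_def sum_distrib_left mult_ac)
  qed
  show ?thesis unfolding e[of v w] e[of w v]
    by (subst sum.swap) (intro sum.cong refl, use smooth_on_partial_commute[OF U f _ _ u] in auto)
qed

lemma dirderiv_diff:
  assumes U: "openin (Euclidean_space m) U" and f: "smooth_on m U f" "smooth_on m U g" and u: "u \<in> U"
  shows "dirderiv m (\<lambda>x. f x - g x) u v = dirderiv m f u v - dirderiv m g u v"
  using dirderiv_add[OF f(1) smooth_on_uminus[OF U f(2)] u] dirderiv_cmult[OF f(2) u, of "-1"] by simp

lemma smooth_form_ext_deriv: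
  assumes U: "openin (Euclidean_space n) U" and \<omega>: "smooth_form n 1 U \<omega>"
  shows "smooth_form n 2 U (ext_deriv n 1 U \<omega>)"
  unfolding smooth_form_def
proof (intro conjI allI ballI impI)
  fix u vs assume "\<not> (u \<in> U \<and> vs \<in> vecs n 2)"
  then show "ext_deriv n 1 U \<omega> u vs = 0" by (auto simp: ext_deriv_def numeral_2_eq_2)
next
  fix vs assume "vs \<in> vecs n 2"
  then obtain v w where vw: "v \<in> Rn n" "w \<in> Rn n" "vs = [v, w]" by (auto simp: mem_vecs2)
  have sm: "smooth_on n U (\<lambda>u. dirderiv n (\<lambda>x. \<omega> x [w]) u v - dirderiv n (\<lambda>x. \<omega> x [v]) u w)"
    using smooth_form1_smooth[OF \<omega>] vw by (intro smooth_on_diff smooth_on_dirderiv U)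
  have e: "ext_deriv n 1 U \<omega> u vs = dirderiv n (\<lambda>x. \<omega> x [w]) u v - dirderiv n (\<lambda>x. \<omega> x [v]) u w"
    if "u \<in> U" for u
    unfolding vw(3) by (rule ext_deriv1[OF that vw(1,2)])
  show "smooth_on n U (\<lambda>u. ext_deriv n 1 U \<omega> u vs)"
    by (rule iffD2[OF smooth_on_cong[OF U e] sm])
next
  fix u vs i x y and a b :: real
  assume u: "u \<in> U" and vs: "vs \<in> vecs n 2" and i: "i < (2::nat)" and x: "x \<in> Rn n" and y: "y \<in> Rn n"
  obtain v w where vw: "v \<in> Rn n" "w \<in> Rn n" "vs = [v, w]" using vs by (auto simp: mem_vecs2)
  have xy: "(\<lambda>j. a * x j + b * y j) \<in> Rn n" using Rn_lincomb x y by blast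
  have lin: "dirderiv n (\<lambda>z. \<omega> z [\<lambda>j. a * x j + b * y j]) u c =
     a * dirderiv n (\<lambda>z. \<omega> z [x]) u c + b * dirderiv n (\<lambda>z. \<omega> z [y]) u c" for c
  proof -
    note s = smooth_form1_smooth[OF \<omega> x] smooth_form1_smooth[OF \<omega> y]
    have "dirderiv n (\<lambda>z. \<omega> z [\<lambda>j. a * x j + b * y j]) u c = dirderiv n (\<lambda>z. a * \<omega> z [x] + b * \<omega> z [y]) u c"
      using smooth_form1_linear[OF \<omega> _ x y] by (intro dirderiv_cong[OF U u])
    also have "\<dots> = dirderiv n (\<lambda>z. a * \<omega> z [x]) u c + dirderiv n (\<lambda>z. b * \<omega> z [y]) u c"
      by (rule dirderiv_add[OF smooth_on_mult[OF U smooth_on_const s(1)] smooth_on_mult[OF U smooth_on_const s(2)] u])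
    finally show ?thesis by (simp add: dirderiv_cmult[OF s(1) u] dirderiv_cmult[OF s(2) u])
  qed
  from i consider "i = 0" | "i = 1" by linarith
  then show "ext_deriv n 1 U \<omega> u (vs[i := (\<lambda>j. a * x j + b * y j)]) =
     a * ext_deriv n 1 U \<omega> u (vs[i := x]) + b * ext_deriv n 1 U \<omega> u (vs[i := y])"
  proof cases
    case 1
    then show ?thesis using vw x y xy
      by (simp add: ext_deriv1[OF u, unfolded One_nat_def] lin dirderiv_lincomb algebra_simps)
  next
    case 2
    then show ?thesis using vw x y xy
      by (simp add: ext_deriv1[OF u, unfolded One_nat_def] lin dirderiv_lincomb algebra_simps)
  qed
next
  fix u vs and i j :: nat
  assume u: "u \<in> U" and vs: "vs \<in> vecs n 2" and ij: "i < 2" "j < 2" "i \<noteq> j \<and> vs ! i = vs ! j"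
  obtain v w where vw: "v \<in> Rn n" "w \<in> Rn n" "vs = [v, w]" using vs by (auto simp: mem_vecs2)
  have "v = w" using ij vw by (auto simp: less_2_cases_iff)
  then show "ext_deriv n 1 U \<omega> u vs = 0" using ext_deriv1[OF u vw(1,2), of \<omega>] vw by simp
qed

text \<open>The second derivatives of \<open>f\<close> cancel by symmetry.\<close>

lemma ext_deriv_natural:
  assumes f: "smooth_map m V n U f" and \<omega>: "smooth_form n 1 U \<omega>"
    and \<eta>: "\<And>v x. v \<in> V \<Longrightarrow> x \<in> Rn m \<Longrightarrow> \<eta> v [x] = \<omega> (f v) [jac m f v x]"
    and v: "v \<in> V" and x: "x \<in> Rn m" and y: "y \<in> Rn m"
  shows "ext_deriv m 1 V \<eta> v [x, y] = ext_deriv n 1 U \<omega> (f v) [jac m f v x, jac m f v y]"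
proof -
  note V = smooth_map_open(1)[OF f] and U = smooth_map_open(2)[OF f]
  have fv: "f v \<in> U" using smooth_map_open(3)[OF f v] .
  define cf where "cf = (\<lambda>i u. \<omega> u [evec i])"
  have os: "smooth_on n U (cf i)" if "i < n" for i
    unfolding cf_def using smooth_form1_smooth[OF \<omega> evec_Rn[OF that]] .
  have fs: "smooth_on m V (\<lambda>u. jac m f u x i)" for i x
    unfolding jac_def by (intro smooth_on_dirderiv V smooth_map_coord[OF f])
  have D: "dirderiv m (\<lambda>u. \<eta> u [y]) v x =
    (\<Sum>i<n. jac m f v y i * dirderiv n (cf i) (f v) (jac m f v x)) + (\<Sum>i<n. dirderiv m (\<lambda>u. jac m f u y i) v x * cf i (f v))"
    if x: "x \<in> Rn m" and y: "y \<in> Rn m" for x y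
  proof -
    have "\<eta> u [y] = (\<Sum>i<n. jac m f u y i * cf i (f u))" if "u \<in> V" for u
      unfolding \<eta>[OF that y] cf_def
      using smooth_form1_expansion[OF \<omega> smooth_map_open(3)[OF f that] jac_smooth_Rn[OF f that]] .
    then have "dirderiv m (\<lambda>u. \<eta> u [y]) v x = dirderiv m (\<lambda>u. \<Sum>i<n. jac m f u y i * cf i (f u)) v x"
      by (rule dirderiv_cong[OF V v])
    also have "\<dots> = (\<Sum>i<n. dirderiv m (\<lambda>u. jac m f u y i * cf i (f u)) v x)"
      using smooth_on_compose[OF f os] by (intro dirderiv_sum[OF V _ v] smooth_on_mult V fs) auto
    also have "\<dots> = (\<Sum>i<n. jac m f v y i * dirderiv n (cf i) (f v) (jac m f v x) + dirderiv m (\<lambda>u. jac m f u y i) v x * cf i (f v))"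
    proof (rule sum.cong[OF refl])
      fix i assume "i \<in> {..<n}"
      then have i: "i < n" by simp
      show "dirderiv m (\<lambda>u. jac m f u y i * cf i (f u)) v x =
        jac m f v y i * dirderiv n (cf i) (f v) (jac m f v x) + dirderiv m (\<lambda>u. jac m f u y i) v x * cf i (f v)"
        using dirderiv_mult[OF fs smooth_on_compose[OF f os[OF i]] v] dirderiv_compose[OF f os[OF i] v] by simp
    qed
    finally show ?thesis by (simp add: sum.distrib)
  qed
  have E: "dirderiv n (\<lambda>u. \<omega> u [b]) (f v) a = (\<Sum>i<n. b i * dirderiv n (cf i) (f v) a)" if b: "b \<in> Rn n" for a b
  proof -
    have "dirderiv n (\<lambda>u. \<omega> u [b]) (f v) a = dirderiv n (\<lambda>u. \<Sum>i<n. b i * cf i u) (f v) a"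
      unfolding cf_def using smooth_form1_expansion[OF \<omega> _ b] by (intro dirderiv_cong[OF U fv])
    also have "\<dots> = (\<Sum>i<n. dirderiv n (\<lambda>u. b i * cf i u) (f v) a)"
      using os by (intro dirderiv_sum[OF U _ fv] smooth_on_mult U) auto
    finally show ?thesis using dirderiv_cmult[OF os fv] by simp
  qed
  have S: "dirderiv m (\<lambda>u. jac m f u y i) v x = dirderiv m (\<lambda>u. jac m f u x i) v y" for i
    unfolding jac_def by (rule dirderiv_commute[OF V smooth_map_coord[OF f] v])
  show ?thesis
    unfolding ext_deriv1[OF v x y] ext_deriv1[OF fv jac_smooth_Rn[OF f v] jac_smooth_Rn[OF f v]]
      D[OF x y] D[OF y x] E[OF jac_smooth_Rn[OF f v]] S by simp
qed

text \<open>Each of the three terms contributes two second derivatives, and the six cancel in pairs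
  by symmetry.\<close>

lemma ext_deriv_ext_deriv:
  assumes U: "openin (Euclidean_space n) U" and \<omega>: "smooth_form n 1 U \<omega>"
  shows "ext_deriv n 2 U (ext_deriv n 1 U \<omega>) = (\<lambda>_ _. 0)"
proof (intro ext)
  fix u vs
  show "ext_deriv n 2 U (ext_deriv n 1 U \<omega>) u vs = 0"
  proof (cases "u \<in> U \<and> vs \<in> vecs n 3")
    case True
    then have u: "u \<in> U" by blast
    obtain a b c where abc: "a \<in> Rn n" "b \<in> Rn n" "c \<in> Rn n" "vs = [a, b, c]"
      using True by (auto simp: mem_vecs3)
    note s = smooth_form1_smooth[OF \<omega>]
    have D: "dirderiv n (\<lambda>x. ext_deriv n 1 U \<omega> x [p, q]) u r =
      dirderiv n (\<lambda>x. dirderiv n (\<lambda>x. \<omega> x [q]) x p) u r - dirderiv n (\<lambda>x. dirderiv n (\<lambda>x. \<omega> x [p]) x q) u r"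
      if "p \<in> Rn n" "q \<in> Rn n" for p q r
    proof -
      have "dirderiv n (\<lambda>x. ext_deriv n 1 U \<omega> x [p, q]) u r =
        dirderiv n (\<lambda>x. dirderiv n (\<lambda>x. \<omega> x [q]) x p - dirderiv n (\<lambda>x. \<omega> x [p]) x q) u r"
        by (rule dirderiv_cong[OF U u]) (rule ext_deriv1[OF _ that])
      then show ?thesis using dirderiv_diff[OF U smooth_on_dirderiv[OF U s] smooth_on_dirderiv[OF U s] u] that by simp
    qed
    show ?thesis
      unfolding abc(4) ext_deriv2[OF u abc(1-3)] D[OF abc(1,2)] D[OF abc(1,3)] D[OF abc(2,3)]
      using dirderiv_commute[OF U s[OF abc(1)] u] dirderiv_commute[OF U s[OF abc(2)] u]
        dirderiv_commute[OF U s[OF abc(3)] u] by simp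
  next
    case False
    then show ?thesis using ext_deriv_outside[of u U vs n 2] by (simp add: eval_nat_numeral)
  qed
qed

subsection \<open>Diffeological spaces\<close>

context
  fixes X :: "'x diffeology"
  assumes X: "diffeological_space X"
begin

lemmas diffeological_axioms = X[unfolded diffeological_space_def]

lemma plot_open: "Plots X n U P \<Longrightarrow> openin (Euclidean_space n) U"
  using conjunct1[OF diffeological_axioms] by blast

lemma plot_in: "Plots X n U P \<Longrightarrow> u \<in> U \<Longrightarrow> P u \<in> Pts X"
  using conjunct1[OF diffeological_axioms] by blast

lemma plot_const: "x \<in> Pts X \<Longrightarrow> openin (Euclidean_space n) U \<Longrightarrow> Plots X n U (\<lambda>_. x)"
  using conjunct1[OF conjunct2[OF diffeological_axioms]] by blast

lemma plot_local:
  assumes "openin (Euclidean_space n) U"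
   "\<And>u. u \<in> U \<Longrightarrow> \<exists>V. openin (Euclidean_space n) V \<and> u \<in> V \<and> V \<subseteq> U \<and> Plots X n V P"
  shows "Plots X n U P"
  using conjunct1[OF conjunct2[OF conjunct2[OF diffeological_axioms]], rule_format,
      OF conjI[OF assms(1) ballI[OF assms(2)]]] .

lemma plot_compose:
  assumes "Plots X n U P" "smooth_map m V n U f" "\<And>v. v \<in> V \<Longrightarrow> Q v = P (f v)"
  shows "Plots X m V Q"
  using conjunct2[OF conjunct2[OF conjunct2[OF diffeological_axioms]], rule_format,
      OF conjI[OF assms(1) conjI[OF assms(2) ballI[OF assms(3)]]]] .

end

text \<open>Precomposition with the inclusion of \<open>V\<close>. As the values of a plot off its
  domain do not count, \<open>P\<close> may be exchanged at the same time for any \<open>Q\<close>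
  that agrees with it on \<open>V\<close>.\<close>

lemma plot_restrict:
  assumes "diffeological_space X" "Plots X n U P" "openin (Euclidean_space n) V" "V \<subseteq> U" "\<And>v. v \<in> V \<Longrightarrow> Q v = P v"
  shows "Plots X n V Q"
  using plot_compose[OF assms(1,2) smooth_map_id[OF assms(3) plot_open[OF assms(1,2)] assms(4)]] assms(5) by blast

lemma plot_cong:
  assumes "diffeological_space X" "\<And>u. u \<in> U \<Longrightarrow> P u = Q u"
  shows "Plots X n U P \<longleftrightarrow> Plots X n U Q"
  using plot_restrict[OF assms(1) _ _ order_refl] plot_open[OF assms(1)] assms(2) by metis

lemma diffeo_smoothD:
  "diffeo_smooth X Y F \<Longrightarrow> Plots X n U P \<Longrightarrow> Plots Y n U (F \<circ> P)"
  "diffeo_smooth X Y F \<Longrightarrow> x \<in> Pts X \<Longrightarrow> F x \<in> Pts Y"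
  by (auto simp: diffeo_smooth_def)

lemma Pts_quotient [simp]: "Pts (quotient_diffeology X \<pi>) = \<pi> ` Pts X"
  by (simp add: quotient_diffeology_def)

lemma Plots_quotient:
  "Plots (quotient_diffeology X \<pi>) n U P \<longleftrightarrow> openin (Euclidean_space n) U \<and>
       (\<forall>u\<in>U. \<exists>V Q. openin (Euclidean_space n) V \<and> u \<in> V \<and> V \<subseteq> U \<and>
          Plots X n V Q \<and> (\<forall>v\<in>V. P v = \<pi> (Q v)))"
  by (simp add: quotient_diffeology_def)

lemma quotient_plotI:
  assumes "diffeological_space X" "Plots X n U Q" "\<And>v. v \<in> U \<Longrightarrow> P v = \<pi> (Q v)"
  shows "Plots (quotient_diffeology X \<pi>) n U P"
  unfolding Plots_quotient using plot_open[OF assms(1,2)] assms(2,3) by blast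

lemma quotient_plotD:
  assumes "Plots (quotient_diffeology X \<pi>) n U P" "u \<in> U"
  shows "\<exists>V Q. openin (Euclidean_space n) V \<and> u \<in> V \<and> V \<subseteq> U \<and> Plots X n V Q \<and> (\<forall>v\<in>V. P v = \<pi> (Q v))"
  using assms unfolding Plots_quotient by blast

lemma diffeo_smooth_quotient: "diffeological_space X \<Longrightarrow> diffeo_smooth X (quotient_diffeology X \<pi>) \<pi>"
  by (auto simp: diffeo_smooth_def intro: quotient_plotI)

lemma diffeological_quotient:
  assumes X: "diffeological_space X"
  shows "diffeological_space (quotient_diffeology X \<pi>)"
  unfolding diffeological_space_def
proof (intro conjI allI impI ballI)
  fix n U P assume P: "Plots (quotient_diffeology X \<pi>) n U P"
  then show "openin (Euclidean_space n) U" by (simp add: Plots_quotient)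
  show "P ` U \<subseteq> Pts (quotient_diffeology X \<pi>)"
  proof
    fix x assume "x \<in> P ` U"
    then obtain u where u: "u \<in> U" "x = P u" by blast
    obtain V Q where "u \<in> V" "Plots X n V Q" "\<forall>v\<in>V. P v = \<pi> (Q v)"
      using quotient_plotD[OF P u(1)] by blast
    then show "x \<in> Pts (quotient_diffeology X \<pi>)" using plot_in[OF X] u(2) by simp
  qed
next
  fix n U x assume "x \<in> Pts (quotient_diffeology X \<pi>)" and U: "openin (Euclidean_space n) U"
  then obtain y where y: "y \<in> Pts X" "x = \<pi> y" by auto
  show "Plots (quotient_diffeology X \<pi>) n U (\<lambda>_. x)"
    by (rule quotient_plotI[OF X plot_const[OF X y(1) U]]) (rule y(2))
next
  fix n U P
  assume a: "openin (Euclidean_space n) U \<and>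
       (\<forall>u\<in>U. \<exists>V. openin (Euclidean_space n) V \<and> u \<in> V \<and> V \<subseteq> U \<and> Plots (quotient_diffeology X \<pi>) n V P)"
  have "\<exists>V Q. openin (Euclidean_space n) V \<and> u \<in> V \<and> V \<subseteq> U \<and> Plots X n V Q \<and> (\<forall>v\<in>V. P v = \<pi> (Q v))"
    if u: "u \<in> U" for u
  proof -
    obtain V where V: "openin (Euclidean_space n) V" "u \<in> V" "V \<subseteq> U" "Plots (quotient_diffeology X \<pi>) n V P"
      using a u by blast
    from quotient_plotD[OF V(4,2)] V(3) show ?thesis by (meson subset_trans)
  qed
  then show "Plots (quotient_diffeology X \<pi>) n U P" using a by (simp add: Plots_quotient)
next
  fix n U P m V f Q
  assume a: "Plots (quotient_diffeology X \<pi>) n U P \<and> smooth_map m V n U f \<and> (\<forall>v\<in>V. Q v = P (f v))"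
  then have f: "smooth_map m V n U f" by blast
  have "\<exists>W R. openin (Euclidean_space m) W \<and> v \<in> W \<and> W \<subseteq> V \<and> Plots X m W R \<and> (\<forall>w\<in>W. Q w = \<pi> (R w))"
    if v: "v \<in> V" for v
  proof -
    have fv: "f v \<in> U" using smooth_map_open(3)[OF f v] .
    have P: "Plots (quotient_diffeology X \<pi>) n U P" using a by blast
    obtain W R where W: "openin (Euclidean_space n) W" "f v \<in> W" "W \<subseteq> U" "Plots X n W R" "\<forall>w\<in>W. P w = \<pi> (R w)"
      using quotient_plotD[OF P fv] by blast
    let ?V = "{v \<in> V. f v \<in> W}"
    have o: "openin (Euclidean_space m) ?V" by (rule smooth_map_preimage[OF f W(1)])
    have "smooth_map m ?V n W f" by (rule smooth_map_restrict[OF f o _ W(1)]) auto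
    from plot_compose[OF X W(4) this refl] have "Plots X m ?V (\<lambda>v. R (f v))" .
    then show ?thesis using o v W a by (intro exI[of _ ?V] exI[of _ "\<lambda>v. R (f v)"]) auto
  qed
  then show "Plots (quotient_diffeology X \<pi>) m V Q"
    using smooth_map_open(1)[OF f] by (simp add: Plots_quotient)
qed

lemma Pts_prod [simp]: "Pts (prod_diffeology X Y) = Pts X \<times> Pts Y"
  by (simp add: prod_diffeology_def)

lemma Plots_prod: "Plots (prod_diffeology X Y) n U R \<longleftrightarrow> Plots X n U (fst \<circ> R) \<and> Plots Y n U (snd \<circ> R)"
  by (simp add: prod_diffeology_def)

section \<open>Differential forms on diffeological spaces\<close>

lemma is_formD:
  assumes "is_form X k \<alpha>"
  shows "Plots X n U P \<Longrightarrow> smooth_form n k U (\<alpha> n U P)"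
    and "\<not> Plots X n U P \<Longrightarrow> \<alpha> n U P = (\<lambda>_ _. 0)"
  using assms by (simp_all add: is_form_def)

lemma form_natural:
  assumes "is_form X k \<alpha>" "Plots X n U P" "smooth_map m V n U f" "\<And>v. v \<in> V \<Longrightarrow> Q v = P (f v)"
   "v \<in> V" "vs \<in> vecs m k"
  shows "\<alpha> m V Q v vs = \<alpha> n U P (f v) (map (jac m f v) vs)"
  using conjunct2[OF conjunct2[OF assms(1)[unfolded is_form_def]], rule_format,
      OF conjI[OF assms(2) conjI[OF assms(3) ballI[OF assms(4)]]] assms(5,6)] .

lemma form_natural1:
  "is_form X 1 \<alpha> \<Longrightarrow> Plots X n U P \<Longrightarrow> smooth_map m V n U f \<Longrightarrow> (\<And>v. v \<in> V \<Longrightarrow> Q v = P (f v)) \<Longrightarrow>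
   v \<in> V \<Longrightarrow> w \<in> Rn m \<Longrightarrow> \<alpha> m V Q v [w] = \<alpha> n U P (f v) [jac m f v w]"
  using form_natural[of X 1 \<alpha> n U P m V f Q v "[w]"] by simp

lemma form_zero: "is_form X k \<alpha> \<Longrightarrow> \<not> (u \<in> U \<and> vs \<in> vecs n k) \<Longrightarrow> \<alpha> n U P u vs = 0"
  using is_formD[of X k \<alpha> n U P] smooth_form_zero by metis

text \<open>Naturality along the inclusion of \<open>V\<close>, whose Jacobian is the identity.
  Forms are therefore local, and can be computed on local lifts of a plot.\<close>

lemma form_restrict:
  assumes \<alpha>: "is_form X k \<alpha>" and P: "Plots X n U P" and V: "openin (Euclidean_space n) V" "V \<subseteq> U"
    "openin (Euclidean_space n) U" and Q: "\<And>v. v \<in> V \<Longrightarrow> Q v = P v" and v: "v \<in> V"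
  shows "\<alpha> n V Q v vs = \<alpha> n U P v vs"
proof (cases "vs \<in> vecs n k")
  case True
  have "map (jac n (\<lambda>x. x) v) vs = vs"
    using True by (intro map_idI jac_id) (auto simp: vecs_def)
  then show ?thesis
    using form_natural[OF \<alpha> P smooth_map_id[OF V(1,3,2)] Q v True] by simp
qed (simp add: form_zero[OF \<alpha>])

lemma form_cong:
  assumes X: "diffeological_space X" and \<alpha>: "is_form X k \<alpha>" and e: "\<And>u. u \<in> U \<Longrightarrow> P u = Q u"
  shows "\<alpha> n U P = \<alpha> n U Q"
proof (cases "Plots X n U P")
  case True
  note U = plot_open[OF X True]
  show ?thesis
  proof (intro ext)
    fix u vs show "\<alpha> n U P u vs = \<alpha> n U Q u vs"
      using form_restrict[OF \<alpha> True U order_refl U, of Q u vs] e form_zero[OF \<alpha>] by metis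
  qed
next
  case False
  moreover have "Plots X n U P \<longleftrightarrow> Plots X n U Q" by (rule plot_cong[OF X e])
  ultimately show ?thesis using is_formD(2)[OF \<alpha>] by simp
qed

lemma pullback_apply: "Plots X n U P \<Longrightarrow> pullback X F \<alpha> n U P = \<alpha> n U (F \<circ> P)"
  by (simp add: pullback_def)

lemma is_form_pullback:
  assumes X: "diffeological_space X" and F: "diffeo_smooth X Y F" and \<alpha>: "is_form Y k \<alpha>"
  shows "is_form X k (pullback X F \<alpha>)"
  unfolding is_form_def
proof (intro conjI allI impI ballI)
  fix n U P assume "Plots X n U P"
  then show "smooth_form n k U (pullback X F \<alpha> n U P)"
    using is_formD(1)[OF \<alpha>] diffeo_smoothD(1)[OF F] by (simp add: pullback_def)
next
  fix n U P assume "\<not> Plots X n U P"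
  then show "pullback X F \<alpha> n U P = (\<lambda>_ _. 0)" by (simp add: pullback_def)
next
  fix n U P m V f Q v vs
  assume a: "Plots X n U P \<and> smooth_map m V n U f \<and> (\<forall>v\<in>V. Q v = P (f v))" and v: "v \<in> V" "vs \<in> vecs m k"
  then have "Plots X m V Q" using plot_compose[OF X] by blast
  then show "pullback X F \<alpha> m V Q v vs = pullback X F \<alpha> n U P (f v) (map (jac m f v) vs)"
    using form_natural[OF \<alpha>, of n U "F \<circ> P" m V f "F \<circ> Q" v vs] a v diffeo_smoothD(1)[OF F]
    by (simp add: pullback_def)
qed

lemma is_form_ext_d:
  assumes X: "diffeological_space X" and \<alpha>: "is_form X 1 \<alpha>"
  shows "is_form X 2 (ext_d X 1 \<alpha>)"
  unfolding is_form_def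
proof (intro conjI allI impI ballI)
  fix n U P assume "Plots X n U P"
  then show "smooth_form n 2 U (ext_d X 1 \<alpha> n U P)"
    using is_formD(1)[OF \<alpha>] plot_open[OF X] smooth_form_ext_deriv unfolding ext_d_def by auto
next
  fix n U P assume "\<not> Plots X n U P"
  then show "ext_d X 1 \<alpha> n U P = (\<lambda>_ _. 0)" by (simp add: ext_d_def)
next
  fix n U P m V f Q v vs
  assume a: "Plots X n U P \<and> smooth_map m V n U f \<and> (\<forall>v\<in>V. Q v = P (f v))" and v: "v \<in> V" "vs \<in> vecs m 2"
  then have Q: "Plots X m V Q" using plot_compose[OF X] by blast
  obtain x y where xy: "x \<in> Rn m" "y \<in> Rn m" "vs = [x, y]" using v(2) by (auto simp: mem_vecs2)
  have f: "smooth_map m V n U f" using a by blast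
  have "ext_deriv m 1 V (\<alpha> m V Q) v [x, y] = ext_deriv n 1 U (\<alpha> n U P) (f v) [jac m f v x, jac m f v y]"
    by (rule ext_deriv_natural[OF f is_formD(1)[OF \<alpha>] form_natural1[OF \<alpha>] v(1) xy(1,2)]) (use a in auto)
  then show "ext_d X 1 \<alpha> m V Q v vs = ext_d X 1 \<alpha> n U P (f v) (map (jac m f v) vs)"
    using Q a xy by (simp add: ext_d_def)
qed

lemma ext_d_ext_d:
  assumes X: "diffeological_space X" and \<alpha>: "is_form X 1 \<alpha>"
  shows "ext_d X 2 (ext_d X 1 \<alpha>) = (\<lambda>_ _ _ _ _. 0)"
proof (intro ext)
  fix n U P u vs
  show "ext_d X 2 (ext_d X 1 \<alpha>) n U P u vs = 0"
    using ext_deriv_ext_deriv[OF plot_open[OF X] is_formD(1)[OF \<alpha>], of n U P]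
    by (simp add: ext_d_def)
qed

lemma pullback_ext_d:
  "diffeo_smooth X Y F \<Longrightarrow> pullback X F (ext_d Y k \<alpha>) = ext_d X k (pullback X F \<alpha>)"
  by (intro ext) (simp add: pullback_def ext_d_def diffeo_smoothD(1))

text \<open>Every plot of the quotient lifts to \<open>X\<close> near each point, and forms are
  local; so pull-back along \<open>\<pi>\<close> is injective. This settles the uniqueness in the
  definite descriptions of the reduced form and of the Liouville form.\<close>

lemma form_unique_quotient:
  assumes X: "diffeological_space X" and \<alpha>: "is_form (quotient_diffeology X \<pi>) k \<alpha>" and \<beta>: "is_form (quotient_diffeology X \<pi>) k \<beta>"
    and e: "pullback X \<pi> \<alpha> = pullback X \<pi> \<beta>"
  shows "\<alpha> = \<beta>"
proof (intro ext)
  fix n U P u vs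
  let ?Y = "quotient_diffeology X \<pi>"
  show "\<alpha> n U P u vs = \<beta> n U P u vs"
  proof (cases "Plots ?Y n U P \<and> u \<in> U")
    case True
    then have P: "Plots ?Y n U P" and u: "u \<in> U" by auto
    obtain V Q where V: "openin (Euclidean_space n) V" "u \<in> V" "V \<subseteq> U" "Plots X n V Q" "\<forall>v\<in>V. P v = \<pi> (Q v)"
      using quotient_plotD[OF P u] by blast
    have "\<gamma> n V (\<pi> \<circ> Q) u vs = \<gamma> n U P u vs" if "is_form ?Y k \<gamma>" for \<gamma>
      using form_restrict[OF that P V(1,3) plot_open[OF diffeological_quotient[OF X] P] _ V(2), of "\<pi> \<circ> Q"] V(5) by simp
    moreover have "\<alpha> n V (\<pi> \<circ> Q) = \<beta> n V (\<pi> \<circ> Q)" using e pullback_apply[OF V(4)] by metis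
    ultimately show ?thesis using \<alpha> \<beta> by metis
  next
    case False
    then show ?thesis using is_formD(2)[OF \<alpha>] is_formD(2)[OF \<beta>] form_zero[OF \<alpha>] form_zero[OF \<beta>] by metis
  qed
qed

text \<open>The value on a plot of the quotient is computed from any local lift. By
  \<open>compat\<close> two lifts of the same plot give the same value where both are defined, so
  the choice does not matter and the axioms of a form can be checked near each point.\<close>

lemma form_descends:
  assumes X: "diffeological_space X" and \<beta>: "is_form X k \<beta>"
    and compat: "\<And>n U P Q. Plots X n U P \<Longrightarrow> Plots X n U Q \<Longrightarrow> (\<And>u. u \<in> U \<Longrightarrow> \<pi> (P u) = \<pi> (Q u)) \<Longrightarrow> \<beta> n U P = \<beta> n U Q"
  shows "\<exists>\<alpha>. is_form (quotient_diffeology X \<pi>) k \<alpha> \<and> pullback X \<pi> \<alpha> = \<beta>"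
proof -
  let ?Y = "quotient_diffeology X \<pi>"
  note Y = diffeological_quotient[OF X, of \<pi>]
  \<comment> \<open>A lift at \<open>u\<close> is a neighbourhood with a plot of \<open>X\<close>
    over it. One is selected for each point separately, since there need be none over the whole
    domain.\<close>
  define lift where "lift = (\<lambda>n (P :: _ \<Rightarrow> 'b) u (V, Q). openin (Euclidean_space n) V \<and> u \<in> V \<and> Plots X n V Q \<and> (\<forall>v\<in>V. P v = \<pi> (Q v)))"
  define \<alpha> where "\<alpha> = (\<lambda>n U P u vs. if Plots ?Y n U P \<and> u \<in> U
     then (case (SOME l. lift n P u l) of (V, Q) \<Rightarrow> \<beta> n V Q u vs) else 0)"
  have indep: "\<beta> n V Q u vs = \<beta> n V' Q' u vs" if "lift n P u (V, Q)" "lift n P u (V', Q')" for n P u V Q V' Q' vs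
  proof -
    have l: "openin (Euclidean_space n) V" "u \<in> V" "Plots X n V Q" "\<And>v. v \<in> V \<Longrightarrow> P v = \<pi> (Q v)"
      and l': "openin (Euclidean_space n) V'" "u \<in> V'" "Plots X n V' Q'" "\<And>v. v \<in> V' \<Longrightarrow> P v = \<pi> (Q' v)"
      using that by (auto simp: lift_def)
    let ?W = "V \<inter> V'"
    have W: "openin (Euclidean_space n) ?W" using l l' by blast
    have "\<pi> (Q w) = \<pi> (Q' w)" if "w \<in> ?W" for w
      using l(4)[of w] l'(4)[of w] that by auto
    from compat[OF plot_restrict[OF X l(3) W Int_lower1 refl] plot_restrict[OF X l'(3) W Int_lower2 refl] this]
    have "\<beta> n ?W Q = \<beta> n ?W Q'" .
    moreover have "\<beta> n ?W Q u vs = \<beta> n V Q u vs"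
      by (rule form_restrict[OF \<beta> l(3) W _ l(1)]) (use l l' in auto)
    moreover have "\<beta> n ?W Q' u vs = \<beta> n V' Q' u vs"
      by (rule form_restrict[OF \<beta> l'(3) W _ l'(1)]) (use l l' in auto)
    ultimately show ?thesis by metis
  qed
  have \<alpha>_eq: "\<alpha> n U P u vs = \<beta> n V Q u vs" if "Plots ?Y n U P" "u \<in> U" "lift n P u (V, Q)" for n U P u V Q vs
  proof -
    obtain V' Q' where VQ: "(SOME l. lift n P u l) = (V', Q')" by fastforce
    have "lift n P u (V', Q')" using someI[of "lift n P u" "(V, Q)", OF that(3)] VQ by simp
    from indep[OF this that(3)] show ?thesis using that(1,2) VQ by (simp add: \<alpha>_def)
  qed
  have ex: "\<exists>V Q. V \<subseteq> U \<and> (\<forall>v\<in>V. lift n P v (V, Q)) \<and> u \<in> V" if Pu: "Plots ?Y n U P" "u \<in> U" for n U P u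
  proof -
    obtain V Q where "openin (Euclidean_space n) V" "u \<in> V" "V \<subseteq> U" "Plots X n V Q" "\<forall>v\<in>V. P v = \<pi> (Q v)"
      using quotient_plotD[OF Pu] by blast
    then show ?thesis by (intro exI[of _ V] exI[of _ Q]) (auto simp: lift_def)
  qed
  have "is_form ?Y k \<alpha>" unfolding is_form_def
  proof (intro conjI allI impI ballI)
    fix n U P assume P: "Plots ?Y n U P"
    note U = plot_open[OF Y P]
    have loc: "\<exists>V Q. openin (Euclidean_space n) V \<and> u \<in> V \<and> V \<subseteq> U \<and> smooth_form n k V (\<beta> n V Q) \<and> (\<forall>v\<in>V. \<forall>vs. \<alpha> n U P v vs = \<beta> n V Q v vs)"
      if u: "u \<in> U" for u
    proof -
      obtain V Q where V: "V \<subseteq> U" "\<And>v. v \<in> V \<Longrightarrow> lift n P v (V, Q)" "u \<in> V" using ex[OF P u] by blast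
      have "openin (Euclidean_space n) V" "Plots X n V Q" using V(2)[OF V(3)] by (auto simp: lift_def)
      then show ?thesis using V \<alpha>_eq[OF P] is_formD(1)[OF \<beta>] by (intro exI[of _ V] exI[of _ Q]) blast
    qed
    show "smooth_form n k U (\<alpha> n U P)" unfolding smooth_form_def
    proof (intro conjI allI impI ballI)
      fix u vs assume "\<not> (u \<in> U \<and> vs \<in> vecs n k)"
      then show "\<alpha> n U P u vs = 0"
        using loc[of u] smooth_form_zero by (metis \<alpha>_def)
    next
      fix vs assume vs: "vs \<in> vecs n k"
      show "smooth_on n U (\<lambda>u. \<alpha> n U P u vs)"
      proof (rule smooth_on_local[OF U])
        fix u assume "u \<in> U"
        from loc[OF this] obtain V Q where V: "openin (Euclidean_space n) V" "u \<in> V" "V \<subseteq> U" "smooth_form n k V (\<beta> n V Q)"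
          "\<And>v vs. v \<in> V \<Longrightarrow> \<alpha> n U P v vs = \<beta> n V Q v vs" by blast
        then show "\<exists>V. openin (Euclidean_space n) V \<and> u \<in> V \<and> V \<subseteq> U \<and> smooth_on n V (\<lambda>u. \<alpha> n U P u vs)"
          using smooth_on_cong[OF V(1), of "\<lambda>u. \<alpha> n U P u vs" "\<lambda>u. \<beta> n V Q u vs"] smooth_form_smooth[OF V(4) vs] by blast
      qed
    next
      fix u vs i x y and a b :: real
      assume u: "u \<in> U" and r: "vs \<in> vecs n k" "i < k" "x \<in> Rn n" "y \<in> Rn n"
      from loc[OF u] obtain V Q where V: "u \<in> V" "smooth_form n k V (\<beta> n V Q)" "\<And>vs. \<alpha> n U P u vs = \<beta> n V Q u vs" by blast
      then show "\<alpha> n U P u (vs[i := (\<lambda>j. a * x j + b * y j)]) = a * \<alpha> n U P u (vs[i := x]) + b * \<alpha> n U P u (vs[i := y])"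
        using smooth_form_linear[OF V(2,1) r] by simp
    next
      fix u vs i j
      assume u: "u \<in> U" and r: "vs \<in> vecs n k" "i < k" "j < k" "i \<noteq> j \<and> vs ! i = vs ! j"
      from loc[OF u] obtain V Q where V: "u \<in> V" "smooth_form n k V (\<beta> n V Q)" "\<And>vs. \<alpha> n U P u vs = \<beta> n V Q u vs" by blast
      then show "\<alpha> n U P u vs = 0" using smooth_form_alternating[OF V(2,1) r(1-3)] r(4) by simp
    qed
  next
    fix n U P assume "\<not> Plots ?Y n U P"
    then show "\<alpha> n U P = (\<lambda>_ _. 0)" by (simp add: \<alpha>_def)
  next
    fix n U P m V f Q v vs
    assume a: "Plots ?Y n U P \<and> smooth_map m V n U f \<and> (\<forall>v\<in>V. Q v = P (f v))" and v: "v \<in> V" and vs: "vs \<in> vecs m k"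
    then have f: "smooth_map m V n U f" and P: "Plots ?Y n U P" and Qf: "\<And>v. v \<in> V \<Longrightarrow> Q v = P (f v)" by auto
    have Q: "Plots ?Y m V Q" using plot_compose[OF Y P f Qf] .
    have fv: "f v \<in> U" using smooth_map_open(3)[OF f v] .
    obtain W R where W: "W \<subseteq> U" "\<And>v. v \<in> W \<Longrightarrow> lift n P v (W, R)" "f v \<in> W" using ex[OF P fv] by blast
    have l: "openin (Euclidean_space n) W" "Plots X n W R" "\<And>v. v \<in> W \<Longrightarrow> P v = \<pi> (R v)"
      using W(2)[OF W(3)] by (auto simp: lift_def)
    let ?V = "{v \<in> V. f v \<in> W}"
    have o: "openin (Euclidean_space m) ?V" by (rule smooth_map_preimage[OF f l(1)])
    have fr: "smooth_map m ?V n W f" by (rule smooth_map_restrict[OF f o _ l(1)]) auto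
    from plot_compose[OF X l(2) fr refl] have R: "Plots X m ?V (\<lambda>v. R (f v))" .
    then have "lift m Q v (?V, \<lambda>v. R (f v))" using o v W(3) l(3) Qf by (auto simp: lift_def)
    from \<alpha>_eq[OF Q v this] have "\<alpha> m V Q v vs = \<beta> m ?V (\<lambda>v. R (f v)) v vs" .
    also have "\<dots> = \<beta> n W R (f v) (map (jac m f v) vs)"
      by (rule form_natural[OF \<beta> l(2) fr]) (use v W(3) vs in auto)
    also have "\<dots> = \<alpha> n U P (f v) (map (jac m f v) vs)" using \<alpha>_eq[OF P fv W(2)[OF W(3)]] by simp
    finally show "\<alpha> m V Q v vs = \<alpha> n U P (f v) (map (jac m f v) vs)" .
  qed
  moreover have "pullback X \<pi> \<alpha> = \<beta>"
  proof (intro ext)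
    fix n U P u vs
    show "pullback X \<pi> \<alpha> n U P u vs = \<beta> n U P u vs"
    proof (cases "Plots X n U P \<and> u \<in> U")
      case True
      then have P: "Plots X n U P" by blast
      have "lift n (\<pi> \<circ> P) u (U, P)" using True plot_open[OF X P] by (auto simp: lift_def)
      from \<alpha>_eq[OF diffeo_smoothD(1)[OF diffeo_smooth_quotient[OF X] P] _ this] show ?thesis
        using True by (simp add: pullback_def)
    next
      case False
      then show ?thesis using is_formD(2)[OF \<beta>] form_zero[OF \<beta>] by (auto simp: pullback_def \<alpha>_def)
    qed
  qed
  ultimately show ?thesis by blast
qed

subsection \<open>Manifolds\<close>

lemma Pts_manifold [simp]: "Pts (manifold_diffeology M A) = M"
  by (simp add: manifold_diffeology_def)

lemma Plots_manifold:
  "Plots (manifold_diffeology M A) m U P \<longleftrightarrow> openin (Euclidean_space m) U \<and> P ` U \<subseteq> M \<and>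
       (\<forall>c\<in>A. openin (Euclidean_space m) {u \<in> U. P u \<in> fst c} \<and>
          (\<forall>j. smooth_on m {u \<in> U. P u \<in> fst c} (\<lambda>u. snd c (P u) j)))"
  by (simp add: manifold_diffeology_def)

lemma openin_local:
  assumes "\<And>u. u \<in> U \<Longrightarrow> \<exists>V. openin T V \<and> u \<in> V \<and> V \<subseteq> U"
  shows "openin T U"
  using assms by (subst openin_subopen) blast

lemma diffeological_manifold: "diffeological_space (manifold_diffeology M A)"
  unfolding diffeological_space_def Pts_manifold
proof (intro conjI allI impI ballI)
  fix n U P assume P: "Plots (manifold_diffeology M A) n U P"
  then show "openin (Euclidean_space n) U" "P ` U \<subseteq> M" by (simp_all add: Plots_manifold)
next
  fix n U x assume x: "x \<in> M" and U: "openin (Euclidean_space n) U"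
  show "Plots (manifold_diffeology M A) n U (\<lambda>_. x)"
    unfolding Plots_manifold
  proof (intro conjI ballI allI)
    fix c :: "'a set \<times> ('a \<Rightarrow> nat \<Rightarrow> real)"
    show "openin (Euclidean_space n) {u \<in> U. x \<in> fst c}" using U by (cases "x \<in> fst c") auto
  qed (use x U in auto)
next
  fix n U P
  assume a: "openin (Euclidean_space n) U \<and>
       (\<forall>u\<in>U. \<exists>V. openin (Euclidean_space n) V \<and> u \<in> V \<and> V \<subseteq> U \<and> Plots (manifold_diffeology M A) n V P)"
  show "Plots (manifold_diffeology M A) n U P"
    unfolding Plots_manifold
  proof (intro conjI ballI allI)
    show "openin (Euclidean_space n) U" using a by blast
    show "P ` U \<subseteq> M" using a by (auto simp: Plots_manifold)
    fix c assume c: "c \<in> A"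
    have loc: "\<exists>V. openin (Euclidean_space n) V \<and> u \<in> V \<and> V \<subseteq> {u \<in> U. P u \<in> fst c} \<and> (\<forall>j. smooth_on n V (\<lambda>u. snd c (P u) j))"
      if u: "u \<in> {u \<in> U. P u \<in> fst c}" for u
    proof -
      obtain V where V: "u \<in> V" "V \<subseteq> U" "Plots (manifold_diffeology M A) n V P" using a u by blast
      then show ?thesis using u c by (intro exI[of _ "{v \<in> V. P v \<in> fst c}"]) (auto simp: Plots_manifold)
    qed
    show o: "openin (Euclidean_space n) {u \<in> U. P u \<in> fst c}"
      by (rule openin_local) (use loc in blast)
    show "smooth_on n {u \<in> U. P u \<in> fst c} (\<lambda>u. snd c (P u) j)" for j
      by (rule smooth_on_local[OF o]) (use loc in blast)
  qed
next
  fix n U P m V f Q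
  assume a: "Plots (manifold_diffeology M A) n U P \<and> smooth_map m V n U f \<and> (\<forall>v\<in>V. Q v = P (f v))"
  then have f: "smooth_map m V n U f" by blast
  show "Plots (manifold_diffeology M A) m V Q"
    unfolding Plots_manifold
  proof (intro conjI ballI allI)
    show "openin (Euclidean_space m) V" using smooth_map_open(1)[OF f] .
    show "Q ` V \<subseteq> M" using a smooth_map_open(3)[OF f] by (auto simp: Plots_manifold)
    fix c assume c: "c \<in> A"
    let ?W = "{u \<in> U. P u \<in> fst c}"
    have W: "openin (Euclidean_space n) ?W" "\<And>j. smooth_on n ?W (\<lambda>u. snd c (P u) j)"
      using a c by (auto simp: Plots_manifold)
    have e: "{v \<in> V. Q v \<in> fst c} = {v \<in> V. f v \<in> ?W}" using a smooth_map_open(3)[OF f] by auto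
    show o: "openin (Euclidean_space m) {v \<in> V. Q v \<in> fst c}"
      unfolding e by (rule smooth_map_preimage[OF f W(1)])
    have fr: "smooth_map m {v \<in> V. Q v \<in> fst c} n ?W f"
      by (rule smooth_map_restrict[OF f o _ W(1)]) (use a smooth_map_open(3)[OF f] in auto)
    have "smooth_on m {v \<in> V. Q v \<in> fst c} (\<lambda>v. snd c (P (f v)) j)" for j
      by (rule smooth_on_compose[OF fr W(2)])
    moreover have "snd c (Q v) j = snd c (P (f v)) j" if "v \<in> {v \<in> V. Q v \<in> fst c}" for v j
      using a that by simp
    ultimately show "smooth_on m {v \<in> V. Q v \<in> fst c} (\<lambda>v. snd c (Q v) j)" for j
      using smooth_on_cong[OF o, of "\<lambda>v. snd c (Q v) j" "\<lambda>v. snd c (P (f v)) j"] by blast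
  qed
qed

subsection \<open>Lie groups\<close>

locale lie =
  fixes G :: "('g, 'm) lie_scheme" (structure)
  assumes lie_group: "lie_group G"
begin

sublocale group G
  using lie_group by (simp add: lie_group_def)

abbreviation "dm \<equiv> ldim G"
abbreviation "LP \<equiv> Plots (lie_diffeology G)"
abbreviation "img c \<equiv> snd c ` fst c"
abbreviation "TS \<equiv> tangent_space G"
abbreviation "CS \<equiv> cotangent_space G"
abbreviation "vel \<equiv> velocity G"

lemma diffeological_lie: "diffeological_space (lie_diffeology G)"
  unfolding lie_diffeology_def by (rule diffeological_manifold)

lemmas LP_open = plot_open[OF diffeological_lie] and LP_const = plot_const[OF diffeological_lie]
  and LP_local = plot_local[OF diffeological_lie] and LP_compose = plot_compose[OF diffeological_lie]
  and LP_restrict = plot_restrict[OF diffeological_lie] and LP_cong = plot_cong[OF diffeological_lie]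

lemma Pts_lie [simp]: "Pts (lie_diffeology G) = carrier G"
  by (simp add: lie_diffeology_def)

lemma LP_carrier: "LP m U P \<Longrightarrow> u \<in> U \<Longrightarrow> P u \<in> carrier G"
  using plot_in[OF diffeological_lie] by simp

lemma manifold: "smooth_manifold dm (carrier G) (charts G)"
  using lie_group by (simp add: lie_group_def)

lemma chart_carrier: "c \<in> charts G \<Longrightarrow> q \<in> fst c \<Longrightarrow> q \<in> carrier G"
  using manifold unfolding smooth_manifold_def by blast

lemma chart_ex: "q \<in> carrier G \<Longrightarrow> \<exists>c\<in>charts G. q \<in> fst c"
  using manifold unfolding smooth_manifold_def by blast

lemma chart_inj: "c \<in> charts G \<Longrightarrow> inj_on (snd c) (fst c)"
  using manifold unfolding smooth_manifold_def by blast

lemma chart_open: "c \<in> charts G \<Longrightarrow> openin (Euclidean_space dm) (img c)"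
  using manifold unfolding smooth_manifold_def by blast

lemma chart_inv_eq: "c \<in> charts G \<Longrightarrow> q \<in> fst c \<Longrightarrow> chart_inv c (snd c q) = q"
  by (simp add: chart_inj)

lemma chart_eq: "x \<in> img c \<Longrightarrow> snd c (chart_inv c x) = x"
  by (rule f_inv_into_f)

lemma chart_inv_in: "x \<in> img c \<Longrightarrow> chart_inv c x \<in> fst c"
  by (rule inv_into_into)

lemma transition:
  "c \<in> charts G \<Longrightarrow> c' \<in> charts G \<Longrightarrow>
   smooth_map dm (snd c ` (fst c \<inter> fst c')) dm (snd c' ` (fst c \<inter> fst c')) (\<lambda>x. snd c' (chart_inv c x))"
  using manifold unfolding smooth_manifold_def comp_def by blast

lemma chart_at: "q \<in> carrier G \<Longrightarrow> chart_at G q \<in> charts G \<and> q \<in> fst (chart_at G q)"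
  unfolding chart_at_def using chart_ex[of q] by (metis (mono_tags, lifting) someI)

lemma LP_chart:
  assumes "LP m U P" "c \<in> charts G"
  shows "openin (Euclidean_space m) {u \<in> U. P u \<in> fst c}"
    and "smooth_map m {u \<in> U. P u \<in> fst c} dm (img c) (\<lambda>u. snd c (P u))"
proof -
  have *: "openin (Euclidean_space m) {u \<in> U. P u \<in> fst c}"
    "\<And>j. smooth_on m {u \<in> U. P u \<in> fst c} (\<lambda>u. snd c (P u) j)"
    using bspec[OF conjunct2[OF conjunct2[OF
          assms(1)[unfolded lie_diffeology_def Plots_manifold]]] assms(2)] by simp_all
  show "openin (Euclidean_space m) {u \<in> U. P u \<in> fst c}" by (rule *(1))
  have "(\<lambda>u. snd c (P u)) ` {u \<in> U. P u \<in> fst c} \<subseteq> img c"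
    by (rule image_subsetI) simp
  then show "smooth_map m {u \<in> U. P u \<in> fst c} dm (img c) (\<lambda>u. snd c (P u))"
    unfolding smooth_map_def by (intro conjI allI impI *(1) chart_open[OF assms(2)]) (assumption, rule *(2))
qed

lemma LP_chart_inv: "c \<in> charts G \<Longrightarrow> LP dm (img c) (chart_inv c)"
  unfolding lie_diffeology_def Plots_manifold
proof (intro conjI ballI allI)
  assume c: "c \<in> charts G"
  show "openin (Euclidean_space dm) (img c)" by (rule chart_open[OF c])
  show "chart_inv c ` img c \<subseteq> carrier G" by (rule image_subsetI) (rule chart_carrier[OF c chart_inv_in])
  fix c' assume c': "c' \<in> charts G"
  have e: "{u \<in> img c. chart_inv c u \<in> fst c'} = snd c ` (fst c \<inter> fst c')"
    using chart_inv_eq[OF c] by auto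
  show "openin (Euclidean_space dm) {u \<in> img c. chart_inv c u \<in> fst c'}"
    unfolding e using smooth_map_open(1)[OF transition[OF c c']] .
  show "smooth_on dm {u \<in> img c. chart_inv c u \<in> fst c'} (\<lambda>u. snd c' (chart_inv c u) j)" for j
    unfolding e using smooth_map_coord[OF transition[OF c c']] .
qed

section \<open>Velocities and tangent vectors\<close>

lemma velocity_chain:
  assumes P: "LP n U P" and f: "smooth_map m V n U f" and v: "v \<in> V"
  shows "vel m (\<lambda>x. P (f x)) v w = vel n P (f v) (jac m f v w)"
proof -
  have "jac m (snd c \<circ> (\<lambda>x. P (f x))) v w = jac n (snd c \<circ> P) (f v) (jac m f v w)"
    if c: "c \<in> charts G" "P (f v) \<in> fst c" for c
  proof -
    note W = LP_chart[OF P c(1)]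
    let ?V = "{x \<in> V. f x \<in> {u \<in> U. P u \<in> fst c}}"
    have fr: "smooth_map m ?V n {u \<in> U. P u \<in> fst c} f"
      by (rule smooth_map_restrict[OF f smooth_map_preimage[OF f W(1)] _ W(1)]) auto
    have "v \<in> ?V" using v c smooth_map_open(3)[OF f v] by simp
    from jac_compose[OF fr smooth_map_coord[OF W(2)] this] show ?thesis by (simp add: comp_def)
  qed
  then show ?thesis unfolding velocity_def by (intro ext) simp
qed

lemma velocity_cong:
  assumes "openin (Euclidean_space m) U" "u \<in> U" "\<And>x. x \<in> U \<Longrightarrow> P x = Q x"
  shows "vel m P u w = vel m Q u w"
proof -
  have "jac m (snd c \<circ> P) u w = jac m (snd c \<circ> Q) u w" for c :: "'g chart"
    by (rule jac_cong[OF assms(1,2)]) (simp add: assms(3))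
  then show ?thesis using assms(3)[OF assms(2)] unfolding velocity_def by (intro ext) simp
qed

lemma velocity_lincomb:
  "vel m P u (\<lambda>i. a * v i + b * w i) = (\<lambda>c i. a * vel m P u v c i + b * vel m P u w c i)"
  unfolding velocity_def by (intro ext) (simp add: jac_lincomb)

lemma velocity_const [simp]: "vel m (\<lambda>_. q) u w = (\<lambda>_ _. 0)"
  unfolding velocity_def comp_def by (intro ext) simp

text \<open>Near \<open>u\<close> the plot \<open>P\<close> factors as \<open>chart_inv c\<close>
  after its coordinate expression, so the velocity of \<open>F \<circ> P\<close> depends on that of
  \<open>P\<close> only through the component in one chart. With \<open>F\<close> the identity this
  makes velocities tangent vectors; in general it makes \<open>tangent_map\<close> independent of
  the chart.\<close>

lemma velocity_chart_factor:
  assumes P: "LP m U P" and u: "u \<in> U" and c: "c \<in> charts G" "P u \<in> fst c" and F: "\<And>n V Q. LP n V Q \<Longrightarrow> LP n V (\<lambda>x. F (Q x))"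
  shows "vel m (\<lambda>x. F (P x)) u w = vel dm (\<lambda>x. F (chart_inv c x)) (snd c (P u)) (vel m P u w c)"
proof -
  note W = LP_chart[OF P c(1)]
  have uW: "u \<in> {u \<in> U. P u \<in> fst c}" using u c by simp
  have "vel m (\<lambda>x. F (P x)) u w = vel m (\<lambda>x. F (chart_inv c (snd c (P x)))) u w"
    by (rule velocity_cong[OF W(1) uW]) (simp add: chart_inv_eq[OF c(1)])
  also have "\<dots> = vel dm (\<lambda>x. F (chart_inv c x)) (snd c (P u)) (jac m (\<lambda>x. snd c (P x)) u w)"
    by (rule velocity_chain[OF F[OF LP_chart_inv[OF c(1)]] W(2) uW])
  also have "jac m (\<lambda>x. snd c (P x)) u w = vel m P u w c" using c by (simp add: velocity_def comp_def)
  finally show ?thesis .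
qed

lemma velocity_chart_Rn:
  assumes P: "LP m U P" and u: "u \<in> U" and c: "c \<in> charts G"
  shows "vel m P u w c \<in> Rn dm"
proof (cases "P u \<in> fst c")
  case True
  then show ?thesis using jac_smooth_Rn[OF LP_chart(2)[OF P c], of u w] u c by (simp add: velocity_def comp_def)
qed (simp add: velocity_def)

lemma velocity_tangent:
  assumes P: "LP m U P" and u: "u \<in> U"
  shows "vel m P u w \<in> TS (P u)"
  unfolding tangent_space_def
  using velocity_chart_factor[OF P u, where F = "\<lambda>x. x"] velocity_chart_Rn[OF P u] by auto

lemma tangent_velocity:
  assumes "v \<in> TS q" "c \<in> charts G" "q \<in> fst c"
  shows "v = vel dm (chart_inv c) (snd c q) (v c)" "v c \<in> Rn dm"
  using assms unfolding tangent_space_def by blast+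

text \<open>The form in which \<open>tangent_map\<close> is used: the derivative of \<open>F\<close>
  is computed on the velocity of any plot through the point, and charts no longer appear.\<close>

lemma tangent_map_velocity:
  assumes P: "LP m U P" and u: "u \<in> U" and F: "\<And>n V Q. LP n V Q \<Longrightarrow> LP n V (\<lambda>x. F (Q x))" and q: "q = P u"
  shows "tangent_map G F q (vel m P u w) = vel m (\<lambda>x. F (P x)) u w"
  using velocity_chart_factor[where F = F and c = "chart_at G q" and w = w, OF P u _ _ F] chart_at[OF LP_carrier[OF P u]]
  unfolding tangent_map_def Let_def q by (simp add: comp_def)

lemma tangent_velocity_chart_at:
  assumes "v \<in> TS q" "q \<in> carrier G"
  shows "v = vel dm (chart_inv (chart_at G q)) (snd (chart_at G q) q) (v (chart_at G q))"
    "LP dm (img (chart_at G q)) (chart_inv (chart_at G q))" "snd (chart_at G q) q \<in> img (chart_at G q)"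
    "chart_inv (chart_at G q) (snd (chart_at G q) q) = q"
  using tangent_velocity[OF assms(1)] chart_at[OF assms(2)] LP_chart_inv chart_inv_eq by blast+

lemma tangent_lincomb:
  assumes v: "v \<in> TS q" and w: "w \<in> TS q"
  shows "(\<lambda>c i. a * v c i + b * w c i) \<in> TS q"
  unfolding tangent_space_def
proof (intro CollectI ballI impI conjI)
  fix c assume c: "c \<in> charts G" "q \<in> fst c"
  note v' = tangent_velocity[OF v c] and w' = tangent_velocity[OF w c]
  show "(\<lambda>i. a * v c i + b * w c i) \<in> Rn dm" using v'(2) w'(2) by (rule Rn_lincomb)
  show "(\<lambda>c i. a * v c i + b * w c i) = vel dm (chart_inv c) (snd c q) (\<lambda>i. a * v c i + b * w c i)"
    unfolding velocity_lincomb using v'(1) w'(1) by simp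
qed

lemma tangent_map_lincomb:
  "tangent_map G F q (\<lambda>c i. a * v c i + b * w c i) = (\<lambda>c i. a * tangent_map G F q v c i + b * tangent_map G F q w c i)"
  unfolding tangent_map_def Let_def velocity_lincomb ..

lemma covector_lincomb:
  "p \<in> CS q \<Longrightarrow> v \<in> TS q \<Longrightarrow> w \<in> TS q \<Longrightarrow> p (\<lambda>c i. a * v c i + b * w c i) = a * p v + b * p w"
  by (simp add: cotangent_space_def)

lemma covector_outside: "p \<in> CS q \<Longrightarrow> v \<notin> TS q \<Longrightarrow> p v = 0"
  by (simp add: cotangent_space_def)

lemma covector_add: "p \<in> CS q \<Longrightarrow> v \<in> TS q \<Longrightarrow> w \<in> TS q \<Longrightarrow> p (\<lambda>c i. v c i + w c i) = p v + p w"
  using covector_lincomb[of p q v w 1 1] by simp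

lemma covector_ext: "p \<in> CS q \<Longrightarrow> p' \<in> CS q \<Longrightarrow> (\<And>v. v \<in> TS q \<Longrightarrow> p v = p' v) \<Longrightarrow> p = p'"
  by (rule ext) (metis covector_outside)

section \<open>Group operations on plots and the product rule\<close>

lemma LP_mult: assumes "LP m U P" "LP m U Q" shows "LP m U (\<lambda>u. P u \<otimes> Q u)"
proof -
  have "Plots (prod_diffeology (lie_diffeology G) (lie_diffeology G)) m U (\<lambda>u. (P u, Q u))"
    using assms by (simp add: Plots_prod comp_def)
  then show ?thesis using lie_group diffeo_smoothD(1) unfolding lie_group_def by (fastforce simp: comp_def)
qed

lemma LP_inv: "LP m U P \<Longrightarrow> LP m U (\<lambda>u. inv (P u))"
  using lie_group diffeo_smoothD(1) unfolding lie_group_def by (fastforce simp: comp_def)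

lemma LP_lmult: "g \<in> carrier G \<Longrightarrow> LP m U P \<Longrightarrow> LP m U (\<lambda>u. g \<otimes> P u)"
  using LP_mult[OF LP_const] LP_open by simp

lemma LP_rmult: "g \<in> carrier G \<Longrightarrow> LP m U P \<Longrightarrow> LP m U (\<lambda>u. P u \<otimes> g)"
  using LP_mult[OF _ LP_const] LP_open by simp

lemma velocity_pair:
  assumes M: "LP (m + k) (prod_dom m k U V) M" and U: "openin (Euclidean_space m) U" and V: "openin (Euclidean_space k) V"
    and u: "u \<in> U" and v: "v \<in> V"
  shows "w \<in> Rn m \<Longrightarrow> vel (m + k) M (join m u v) (join m w (\<lambda>_. 0)) = vel m (\<lambda>x. M (join m x v)) u w"
    and "w' \<in> Rn k \<Longrightarrow> vel (m + k) M (join m u v) (join m (\<lambda>_. 0) w') = vel k (\<lambda>y. M (join m u y)) v w'"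
proof -
  assume w: "w \<in> Rn m"
  have "smooth_map m U (m + k) (prod_dom m k U V) (\<lambda>x. join m x v)"
    by (rule smooth_map_join[OF smooth_map_id[OF U U order_refl] smooth_map_const[OF U V v]])
  from velocity_chain[OF M this u, of w]
  show "vel (m + k) M (join m u v) (join m w (\<lambda>_. 0)) = vel m (\<lambda>x. M (join m x v)) u w"
    by (simp add: jac_join jac_id[OF w])
next
  assume w: "w' \<in> Rn k"
  have "smooth_map k V (m + k) (prod_dom m k U V) (\<lambda>y. join m u y)"
    by (rule smooth_map_join[OF smooth_map_const[OF V U u] smooth_map_id[OF V V order_refl]])
  from velocity_chain[OF M this v, of w']
  show "vel (m + k) M (join m u v) (join m (\<lambda>_. 0) w') = vel k (\<lambda>y. M (join m u y)) v w'"
    by (simp add: jac_join jac_id[OF w])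
qed

lemma velocity_sum:
  "vel (m + k) M z (join m w w') = (\<lambda>c i. vel (m + k) M z (join m w (\<lambda>_. 0)) c i + vel (m + k) M z (join m (\<lambda>_. 0) w') c i)"
proof -
  have "join m w w' = (\<lambda>i. 1 * join m w (\<lambda>_. 0) i + 1 * join m (\<lambda>_. 0) w' i)" by (auto simp: join_def)
  then show ?thesis using velocity_lincomb[of "m + k" M z 1 "join m w (\<lambda>_. 0)" 1 "join m (\<lambda>_. 0) w'"] by simp
qed

lemma LP_fst:
  assumes P: "LP m U P" and V: "openin (Euclidean_space k) V"
  shows "LP (m + k) (prod_dom m k U V) (\<lambda>z. P (fst_part m z))"
  by (rule LP_compose[OF P smooth_map_fst_part[OF LP_open[OF P] V] refl])

lemma LP_snd:
  assumes P: "LP k V P" and U: "openin (Euclidean_space m) U"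
  shows "LP (m + k) (prod_dom m k U V) (\<lambda>z. P (snd_part m z))"
  by (rule LP_compose[OF P smooth_map_snd_part[OF U LP_open[OF P]] refl])

lemma smooth_map_diag:
  "openin (Euclidean_space m) U \<Longrightarrow> smooth_map m U (m + m) (prod_dom m m U U) (\<lambda>x. join m x x)"
  by (rule smooth_map_join[OF smooth_map_id smooth_map_id]) auto

text \<open>Differentiate the map \<open>M\<close> of two variables along the diagonal: its velocity
  in the direction \<open>(w, w)\<close> is the sum of the two partial velocities.\<close>

lemma velocity_mult:
  assumes P: "LP m U P" and Q: "LP m U Q" and u: "u \<in> U" and w: "w \<in> Rn m"
  shows "vel m (\<lambda>x. P x \<otimes> Q x) u w = (\<lambda>c i. vel m (\<lambda>x. P x \<otimes> Q u) u w c i + vel m (\<lambda>x. P u \<otimes> Q x) u w c i)"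
proof -
  note U = LP_open[OF P]
  define M where "M = (\<lambda>z. P (fst_part m z) \<otimes> Q (snd_part m z))"
  have M: "LP (m + m) (prod_dom m m U U) M" unfolding M_def by (intro LP_mult LP_fst[OF P U] LP_snd[OF Q U])
  have Mj: "M (join m x y) = P x \<otimes> Q y" if "x \<in> U" for x y
    using openin_subset_Rn[OF U that] by (simp add: M_def fst_part_join)
  have "vel m (\<lambda>x. P x \<otimes> Q x) u w = vel m (\<lambda>x. M (join m x x)) u w"
    by (rule velocity_cong[OF U u]) (simp add: Mj)
  also have "\<dots> = vel (m + m) M (join m u u) (join m w w)"
    using velocity_chain[OF M smooth_map_diag[OF U] u] by (simp add: jac_join jac_id[OF w])
  also have "\<dots> = (\<lambda>c i. vel m (\<lambda>x. M (join m x u)) u w c i + vel m (\<lambda>x. M (join m u x)) u w c i)"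
    unfolding velocity_sum[of m m M _ w w] velocity_pair[OF M U U u u w] ..
  also have "vel m (\<lambda>x. M (join m x u)) u w = vel m (\<lambda>x. P x \<otimes> Q u) u w"
    by (rule velocity_cong[OF U u]) (simp add: Mj)
  also have "vel m (\<lambda>x. M (join m u x)) u w = vel m (\<lambda>x. P u \<otimes> Q x) u w"
    by (rule velocity_cong[OF U u]) (simp add: Mj u)
  finally show ?thesis .
qed

lemma smooth_velocity:
  assumes M: "LP k W M" and c: "c \<in> charts G"
  shows "smooth_on k {z \<in> W. M z \<in> fst c} (\<lambda>z. vel k M z w c j)"
proof -
  note V = LP_chart[OF M c]
  have "smooth_on k {z \<in> W. M z \<in> fst c} (\<lambda>z. dirderiv k (\<lambda>x. snd c (M x) j) z w)"
    by (rule smooth_on_dirderiv[OF V(1) smooth_map_coord[OF V(2)]])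
  then show ?thesis
    by (subst smooth_on_cong[OF V(1)]) (auto simp: velocity_def c jac_def)
qed

subsection \<open>Right trivialization\<close>

text \<open>The right logarithmic derivative: \<open>DP(u)(w)\<close> carried to the identity by
  right translation with the inverse of \<open>P u\<close>. Translating the plot before
  differentiating keeps tangent maps out of the definition.\<close>

definition rlog :: "nat \<Rightarrow> ((nat \<Rightarrow> real) \<Rightarrow> 'g) \<Rightarrow> (nat \<Rightarrow> real) \<Rightarrow> (nat \<Rightarrow> real) \<Rightarrow> 'g tvec"
  where "rlog m P u w = vel m (\<lambda>x. P x \<otimes> inv (P u)) u w"

definition Ad :: "'g \<Rightarrow> 'g tvec \<Rightarrow> 'g tvec"
  where "Ad g = tangent_map G (\<lambda>x. g \<otimes> x \<otimes> inv g) \<one>"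

abbreviation "c1 \<equiv> chart_at G \<one>"
abbreviation "y1 \<equiv> snd c1 \<one>"

lemma c1: "c1 \<in> charts G" "\<one> \<in> fst c1" "y1 \<in> img c1" "chart_inv c1 y1 = \<one>" "LP dm (img c1) (chart_inv c1)"
    "openin (Euclidean_space dm) (img c1)"
  using chart_at[OF one_closed] chart_inv_eq LP_chart_inv chart_open by auto

lemma LP_right_quotient: "LP m U P \<Longrightarrow> u \<in> U \<Longrightarrow> LP m U (\<lambda>x. P x \<otimes> inv (P u))"
  using LP_rmult LP_carrier by simp

lemma rlog_tangent: "LP m U P \<Longrightarrow> u \<in> U \<Longrightarrow> rlog m P u w \<in> TS \<one>"
  using velocity_tangent[OF LP_right_quotient, of m U P u u w] LP_carrier[of m U P u]
  by (simp add: rlog_def)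

lemma rlog_cong:
  assumes "openin (Euclidean_space m) U" "u \<in> U" "\<And>x. x \<in> U \<Longrightarrow> P x = Q x"
  shows "rlog m P u w = rlog m Q u w"
  unfolding rlog_def by (rule velocity_cong[OF assms(1,2)]) (simp add: assms)

lemma rlog_lincomb:
  "rlog m P u (\<lambda>i. a * v i + b * w i) = (\<lambda>c i. a * rlog m P u v c i + b * rlog m P u w c i)"
  unfolding rlog_def by (rule velocity_lincomb)

lemma rlog_chain:
  assumes "LP n U P" "smooth_map m V n U f" "v \<in> V"
  shows "rlog m (\<lambda>x. P (f x)) v w = rlog n P (f v) (jac m f v w)"
  unfolding rlog_def
  using velocity_chain[OF LP_right_quotient[OF assms(1) smooth_map_open(3)[OF assms(2,3)]] assms(2,3)] .

lemma rlog_const [simp]: "rlog m (\<lambda>_. q) u w = (\<lambda>_ _. 0)"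
  by (simp add: rlog_def)

lemma velocity_rlog:
  assumes P: "LP m U P" and u: "u \<in> U" and g: "g \<in> carrier G"
  shows "tangent_map G (\<lambda>x. x \<otimes> g) (P u) (vel m P u w) = vel m (\<lambda>x. P x \<otimes> g) u w"
    and "tangent_map G (\<lambda>x. x \<otimes> P u) \<one> (rlog m P u w) = vel m P u w"
proof -
  show "tangent_map G (\<lambda>x. x \<otimes> g) (P u) (vel m P u w) = vel m (\<lambda>x. P x \<otimes> g) u w"
    by (rule tangent_map_velocity[OF P u LP_rmult[OF g] refl])
  note Pu = LP_carrier[OF P u]
  have "tangent_map G (\<lambda>x. x \<otimes> P u) \<one> (rlog m P u w) = vel m (\<lambda>x. P x \<otimes> inv (P u) \<otimes> P u) u w"
    unfolding rlog_def
    by (rule tangent_map_velocity[OF LP_right_quotient[OF P u] u LP_rmult[OF Pu] r_inv[OF Pu, symmetric]])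
  also have "\<dots> = vel m P u w"
    by (rule velocity_cong[OF LP_open[OF P] u]) (use LP_carrier[OF P] Pu in \<open>simp add: m_assoc\<close>)
  finally show "tangent_map G (\<lambda>x. x \<otimes> P u) \<one> (rlog m P u w) = vel m P u w" .
qed

lemma LP_conj: "g \<in> carrier G \<Longrightarrow> LP m U P \<Longrightarrow> LP m U (\<lambda>u. g \<otimes> P u \<otimes> inv g)"
  by (intro LP_rmult LP_lmult) auto

lemma Ad_velocity:
  assumes "LP m U P" "u \<in> U" "P u = \<one>" "g \<in> carrier G"
  shows "Ad g (vel m P u w) = vel m (\<lambda>x. g \<otimes> P x \<otimes> inv g) u w"
  unfolding Ad_def by (rule tangent_map_velocity[OF assms(1,2) LP_conj[OF assms(4)] assms(3)[symmetric]])

lemma tangent_one: "Z \<in> TS \<one> \<Longrightarrow> Z = vel dm (chart_inv c1) y1 (Z c1)" "Z \<in> TS \<one> \<Longrightarrow> Z c1 \<in> Rn dm"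
  using tangent_velocity c1 by blast+

lemma Ad_eq:
  assumes "Z \<in> TS \<one>" "g \<in> carrier G"
  shows "Ad g Z = vel dm (\<lambda>x. g \<otimes> chart_inv c1 x \<otimes> inv g) y1 (Z c1)"
  using Ad_velocity[OF c1(5,3,4) assms(2), of "Z c1"] tangent_one(1)[OF assms(1)] by simp

lemma Ad_tangent: assumes "Z \<in> TS \<one>" "g \<in> carrier G" shows "Ad g Z \<in> TS \<one>"
  using velocity_tangent[OF LP_conj[OF assms(2) c1(5)] c1(3), of "Z c1"] assms
  by (simp add: Ad_eq c1(4))

lemma Ad_lincomb: "Ad g (\<lambda>c i. a * v c i + b * w c i) = (\<lambda>c i. a * Ad g v c i + b * Ad g w c i)"
  unfolding Ad_def by (rule tangent_map_lincomb)

lemma Ad_mult: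
  assumes Z: "Z \<in> TS \<one>" and g: "g \<in> carrier G" and h: "h \<in> carrier G"
  shows "Ad (g \<otimes> h) Z = Ad g (Ad h Z)"
proof -
  have "Ad g (Ad h Z) = vel dm (\<lambda>x. g \<otimes> (h \<otimes> chart_inv c1 x \<otimes> inv h) \<otimes> inv g) y1 (Z c1)"
    unfolding Ad_eq[OF Z h] by (rule Ad_velocity[OF LP_conj[OF h c1(5)] c1(3) _ g]) (simp add: c1(4) h)
  also have "\<dots> = vel dm (\<lambda>x. (g \<otimes> h) \<otimes> chart_inv c1 x \<otimes> inv (g \<otimes> h)) y1 (Z c1)"
    by (rule velocity_cong[OF c1(6,3)]) (use LP_carrier[OF c1(5)] g h in \<open>simp add: inv_mult_group m_assoc\<close>)
  also have "\<dots> = Ad (g \<otimes> h) Z" using Ad_eq[OF Z] g h by simp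
  finally show ?thesis by simp
qed

lemma Ad_one: assumes Z: "Z \<in> TS \<one>" shows "Ad \<one> Z = Z"
proof -
  have "vel dm (\<lambda>x. \<one> \<otimes> chart_inv c1 x \<otimes> inv \<one>) y1 (Z c1) = vel dm (chart_inv c1) y1 (Z c1)"
    by (rule velocity_cong[OF c1(6,3)]) (use LP_carrier[OF c1(5)] in simp)
  then show ?thesis using Ad_eq[OF Z one_closed] tangent_one(1)[OF Z] by simp
qed

text \<open>Left translation by \<open>g\<close> puts \<open>inv g\<close> on the right end of the
  quotient, so the curve through the identity is conjugated by \<open>g\<close>.\<close>

lemma rlog_left_quotient:
  assumes P: "LP m U P" and u: "u \<in> U" and g: "g \<in> carrier G"
  shows "rlog m (\<lambda>x. g \<otimes> P x) u w = Ad g (rlog m P u w)"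
proof -
  note Pu = LP_carrier[OF P u]
  have "Ad g (rlog m P u w) = vel m (\<lambda>x. g \<otimes> (P x \<otimes> inv (P u)) \<otimes> inv g) u w"
    unfolding rlog_def by (rule Ad_velocity[OF LP_right_quotient[OF P u] u _ g]) (simp add: Pu)
  also have "\<dots> = rlog m (\<lambda>x. g \<otimes> P x) u w"
    unfolding rlog_def
    by (rule velocity_cong[OF LP_open[OF P] u]) (use LP_carrier[OF P] Pu g in \<open>simp add: inv_mult_group m_assoc\<close>)
  finally show ?thesis by simp
qed

lemma rlog_right_translate:
  assumes P: "LP m U P" and u: "u \<in> U" and g: "g \<in> carrier G"
  shows "rlog m (\<lambda>x. P x \<otimes> g) u w = rlog m P u w"
  unfolding rlog_def
proof (rule velocity_cong[OF LP_open[OF P] u])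
  fix x assume x: "x \<in> U"
  have "P x \<otimes> g \<otimes> inv (P u \<otimes> g) = P x \<otimes> (g \<otimes> inv g) \<otimes> inv (P u)"
    using LP_carrier[OF P u] LP_carrier[OF P x] g by (simp only: inv_mult_group m_assoc inv_closed m_closed)
  then show "P x \<otimes> g \<otimes> inv (P u \<otimes> g) = P x \<otimes> inv (P u)"
    using LP_carrier[OF P x] g by (simp only: r_inv r_one)
qed

text \<open>The Leibniz rule for the right logarithmic derivative. It drives the uniqueness of
  integral curves, the rank argument, the descent of the one-form and the computation of the moment
  map.\<close>

lemma rlog_mult:
  assumes P: "LP m U P" and Q: "LP m U Q" and u: "u \<in> U" and w: "w \<in> Rn m"
  shows "rlog m (\<lambda>x. P x \<otimes> Q x) u w = (\<lambda>c i. rlog m P u w c i + Ad (P u) (rlog m Q u w) c i)"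
proof -
  note Pu = LP_carrier[OF P u] and Qu = LP_carrier[OF Q u]
  \<comment> \<open>A constant, the inverse of the value at \<open>u\<close>; attaching it to the
    factor \<open>Q\<close> reduces the claim to \<open>velocity_mult\<close>.\<close>
  define g where "g = inv (P u \<otimes> Q u)"
  have g: "g \<in> carrier G" using Pu Qu by (simp add: g_def)
  have "rlog m (\<lambda>x. P x \<otimes> Q x) u w = vel m (\<lambda>x. P x \<otimes> (Q x \<otimes> g)) u w"
    unfolding rlog_def g_def[symmetric]
    by (rule velocity_cong[OF LP_open[OF P] u]) (use LP_carrier[OF P] LP_carrier[OF Q] g in \<open>simp add: m_assoc\<close>)
  also have "\<dots> = (\<lambda>c i. vel m (\<lambda>x. P x \<otimes> (Q u \<otimes> g)) u w c i + vel m (\<lambda>x. P u \<otimes> (Q x \<otimes> g)) u w c i)"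
    by (rule velocity_mult[OF P LP_rmult[OF g Q] u w])
  also have "vel m (\<lambda>x. P x \<otimes> (Q u \<otimes> g)) u w = rlog m P u w"
  proof -
    have "Q u \<otimes> g = inv (P u)" unfolding g_def using Pu Qu by (simp add: inv_mult_group m_assoc[symmetric])
    then show ?thesis by (simp add: rlog_def)
  qed
  also have "vel m (\<lambda>x. P u \<otimes> (Q x \<otimes> g)) u w = rlog m (\<lambda>x. P u \<otimes> Q x) u w"
    unfolding rlog_def g_def[symmetric]
    by (rule velocity_cong[OF LP_open[OF P] u]) (use Pu LP_carrier[OF Q] g in \<open>simp add: m_assoc\<close>)
  also have "\<dots> = Ad (P u) (rlog m Q u w)" by (rule rlog_left_quotient[OF Q u Pu])
  finally show ?thesis .
qed

text \<open>A velocity that varies with a parameter is rewritten as the velocity of one fixed map of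
  more variables, evaluated along a smooth section \<open>s\<close>. All smooth dependence of
  tangent vectors on the base point is obtained in this way.\<close>

lemma smooth_along_section:
  assumes M: "LP k W M" and c: "c \<in> charts G" and s: "smooth_map m U k W s" and Mc: "\<And>u. u \<in> U \<Longrightarrow> M (s u) \<in> fst c"
  shows "smooth_on m U (\<lambda>u. vel k M (s u) w c j)"
proof -
  note V = LP_chart[OF M c]
  have "smooth_map m U k {z \<in> W. M z \<in> fst c} s"
    by (rule smooth_map_restrict[OF s smooth_map_open(1)[OF s] order_refl V(1)])
      (use Mc smooth_map_open(3)[OF s] in auto)
  from smooth_on_compose[OF this smooth_velocity[OF M c]] show ?thesis .
qed

text \<open>\<open>P x \<otimes> inv (P y)\<close> is differentiated in \<open>x\<close> only and
  then restricted to the diagonal. Its value there is the identity, so the single chart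
  \<open>c1\<close> suffices.\<close>

lemma smooth_rlog:
  assumes P: "LP m U P" and w: "w \<in> Rn m"
  shows "smooth_on m U (\<lambda>u. rlog m P u w c1 j)"
proof -
  note U = LP_open[OF P]
  define M where "M = (\<lambda>z. P (fst_part m z) \<otimes> inv (P (snd_part m z)))"
  have M: "LP (m + m) (prod_dom m m U U) M" unfolding M_def by (intro LP_mult LP_inv LP_fst[OF P U] LP_snd[OF P U])
  have Mj: "M (join m x y) = P x \<otimes> inv (P y)" if "x \<in> U" for x y
    using openin_subset_Rn[OF U that] by (simp add: M_def fst_part_join)
  have "rlog m P u w = vel (m + m) M (join m u u) (join m w (\<lambda>_. 0))" if u: "u \<in> U" for u
    unfolding velocity_pair(1)[OF M U U u u w] rlog_def
    by (rule velocity_cong[OF U u]) (simp add: Mj)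
  moreover have "smooth_on m U (\<lambda>u. vel (m + m) M (join m u u) (join m w (\<lambda>_. 0)) c1 j)"
    by (rule smooth_along_section[OF M c1(1) smooth_map_diag[OF U]]) (use Mj LP_carrier[OF P] c1(2) in simp)
  ultimately show ?thesis by (subst smooth_on_cong[OF U]) auto
qed

lemma smooth_Ad:
  assumes g: "LP m U g" and Z: "Z \<in> TS \<one>"
  shows "smooth_on m U (\<lambda>u. Ad (g u) Z c1 j)"
proof -
  note U = LP_open[OF g]
  define M where "M = (\<lambda>z. g (fst_part m z) \<otimes> chart_inv c1 (snd_part m z) \<otimes> inv (g (fst_part m z)))"
  have M: "LP (m + dm) (prod_dom m dm U (img c1)) M"
    unfolding M_def by (intro LP_mult LP_inv LP_fst[OF g c1(6)] LP_snd[OF c1(5) U])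
  have Mj: "M (join m x y) = g x \<otimes> chart_inv c1 y \<otimes> inv (g x)" if "x \<in> U" for x y
    using openin_subset_Rn[OF U that] by (simp add: M_def fst_part_join)
  have "Ad (g u) Z = vel (m + dm) M (join m u y1) (join m (\<lambda>_. 0) (Z c1))" if u: "u \<in> U" for u
    unfolding velocity_pair(2)[OF M U c1(6) u c1(3) tangent_one(2)[OF Z]] Ad_eq[OF Z LP_carrier[OF g u]]
    by (simp add: Mj u)
  moreover have "smooth_on m U (\<lambda>u. vel (m + dm) M (join m u y1) (join m (\<lambda>_. 0) (Z c1)) c1 j)"
    by (rule smooth_along_section[OF M c1(1) smooth_map_join[OF smooth_map_id[OF U U order_refl] smooth_map_const[OF U c1(6,3)]]])
      (use Mj LP_carrier[OF g] c1(2,4) in simp)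
  ultimately show ?thesis by (subst smooth_on_cong[OF U]) auto
qed

lemma covector_expansion:
  assumes p: "p \<in> CS q" and c: "c \<in> charts G" "q \<in> fst c" and Z: "Z \<in> TS q"
  shows "p Z = (\<Sum>j<dm. Z c j * p (vel dm (chart_inv c) (snd c q) (evec j)))"
proof -
  have t: "vel dm (chart_inv c) (snd c q) w \<in> TS q" for w
    using velocity_tangent[OF LP_chart_inv[OF c(1)], of "snd c q" w] c chart_inv_eq by simp
  have "p (vel dm (chart_inv c) (snd c q) (Z c)) = (\<Sum>j<dm. Z c j * p (vel dm (chart_inv c) (snd c q) (evec j)))"
  proof (rule linear_expansion)
    show "p (vel dm (chart_inv c) (snd c q) (\<lambda>j. a * x j + b * y j)) =
       a * p (vel dm (chart_inv c) (snd c q) x) + b * p (vel dm (chart_inv c) (snd c q) y)" for x y a b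
      unfolding velocity_lincomb by (rule covector_lincomb[OF p t t])
  qed (rule tangent_velocity(2)[OF Z c])
  then show ?thesis using tangent_velocity(1)[OF Z c] by simp
qed

text \<open>The Lie algebra is finite-dimensional: expanding \<open>V u\<close> in the basis given
  by \<open>c1\<close> reduces the claim to smoothness of \<open>\<mu>\<close> on fixed vectors and
  of the coordinates of \<open>V\<close>.\<close>

lemma smooth_pairing:
  assumes U: "openin (Euclidean_space m) U" and \<mu>: "\<And>u. u \<in> U \<Longrightarrow> \<mu> u \<in> CS \<one>"
    and s: "\<And>Z. Z \<in> TS \<one> \<Longrightarrow> smooth_on m U (\<lambda>u. \<mu> u Z)"
    and V: "\<And>u. u \<in> U \<Longrightarrow> V u \<in> TS \<one>" "\<And>j. smooth_on m U (\<lambda>u. V u c1 j)"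
  shows "smooth_on m U (\<lambda>u. \<mu> u (V u))"
proof -
  have t: "vel dm (chart_inv c1) y1 w \<in> TS \<one>" for w
    using velocity_tangent[OF c1(5,3)] by (simp add: c1(4))
  have "smooth_on m U (\<lambda>u. \<Sum>j<dm. V u c1 j * \<mu> u (vel dm (chart_inv c1) y1 (evec j)))"
    by (intro smooth_on_sum smooth_on_mult U V(2) s t)
  then show ?thesis
    by (subst smooth_on_cong[OF U]) (auto intro!: covector_expansion[OF \<mu> c1(1,2) V(1)])
qed

subsection \<open>Density\<close>

lemma istopology_atlas:
  "istopology (\<lambda>W. W \<subseteq> carrier G \<and> (\<forall>c\<in>charts G. openin (Euclidean_space dm) (snd c ` (W \<inter> fst c))))"
  unfolding istopology_def
proof (intro conjI allI impI ballI)
  fix S T c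
  assume S: "S \<subseteq> carrier G \<and> (\<forall>c\<in>charts G. openin (Euclidean_space dm) (snd c ` (S \<inter> fst c)))"
    and T: "T \<subseteq> carrier G \<and> (\<forall>c\<in>charts G. openin (Euclidean_space dm) (snd c ` (T \<inter> fst c)))"
  show "S \<inter> T \<subseteq> carrier G" using S by blast
  assume c: "c \<in> charts G"
  have "snd c ` (S \<inter> T \<inter> fst c) = snd c ` (S \<inter> fst c) \<inter> snd c ` (T \<inter> fst c)"
    using chart_inj[OF c] by (auto simp: inj_on_def)
  then show "openin (Euclidean_space dm) (snd c ` (S \<inter> T \<inter> fst c))" using S T c by auto
next
  fix K c
  assume K: "\<forall>S\<in>K. S \<subseteq> carrier G \<and> (\<forall>c\<in>charts G. openin (Euclidean_space dm) (snd c ` (S \<inter> fst c)))"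
  show "\<Union>K \<subseteq> carrier G" using K by blast
  assume c: "c \<in> charts G"
  have "snd c ` (\<Union>K \<inter> fst c) = (\<Union>S\<in>K. snd c ` (S \<inter> fst c))" by blast
  then show "openin (Euclidean_space dm) (snd c ` (\<Union>K \<inter> fst c))" using K c by (auto intro!: openin_Union)
qed

lemma openin_lie_topology:
  "openin (lie_topology G) W \<longleftrightarrow> W \<subseteq> carrier G \<and> (\<forall>c\<in>charts G. openin (Euclidean_space dm) (snd c ` (W \<inter> fst c)))"
  unfolding lie_topology_def atlas_topology_def using istopology_atlas by (simp add: topology_inverse')

text \<open>The set where \<open>f\<close> differs from \<open>a\<close> is open in the manifold
  topology and misses \<open>H\<close>, so density makes it empty. Every use of density passes
  through this lemma.\<close>

lemma dense_constant:
  assumes dense: "lie_topology G closure_of H = carrier G"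
    and f: "\<And>c. c \<in> charts G \<Longrightarrow> continuous_on (img c) (\<lambda>x. f (chart_inv c x))"
    and H: "\<And>h. h \<in> H \<Longrightarrow> f h = (a::real)" and g: "g \<in> carrier G"
  shows "f g = a"
proof (rule ccontr)
  assume ne: "f g \<noteq> a"
  define W where "W = {x \<in> carrier G. f x \<noteq> a}"
  have "openin (lie_topology G) W" unfolding openin_lie_topology
  proof (intro conjI ballI)
    show "W \<subseteq> carrier G" by (auto simp: W_def)
    fix c assume c: "c \<in> charts G"
    have "snd c ` (W \<inter> fst c) = {x \<in> img c. f (chart_inv c x) \<in> - {a}}"
      using chart_inv_eq[OF c] chart_carrier[OF c] by (auto simp: W_def)
    then show "openin (Euclidean_space dm) (snd c ` (W \<inter> fst c))"
      using openin_preimage_real[OF f[OF c] chart_open[OF c], of "- {a}"] by auto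
  qed
  moreover have "g \<in> lie_topology G closure_of H" using dense g by simp
  moreover have "g \<in> W" using ne g by (simp add: W_def)
  ultimately have "\<exists>h. h \<in> H \<and> h \<in> W" by (simp only: in_closure_of)
  then obtain h where "h \<in> H" "h \<in> W" by blast
  then show False using H by (simp add: W_def)
qed

end

subsection \<open>One-parameter subgroups\<close>

definition pt :: "real \<Rightarrow> nat \<Rightarrow> real"
  where "pt t = (\<lambda>i. if i = 0 then t else 0)"

lemma pt_0 [simp]: "pt t 0 = t"
  by (simp add: pt_def)

lemma pt_Rn [simp]: "pt t \<in> Rn 1" "pt t \<in> Rn (Suc 0)"
  by (auto simp: pt_def mem_Rn)

lemma pt_interval1 [simp]: "pt t \<in> interval1 a b \<longleftrightarrow> a < t \<and> t < b"
  by (simp add: interval1_def)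

lemma pt_zero: "pt 0 = (\<lambda>_. 0)"
  by (simp add: pt_def fun_eq_iff)

lemma evec0_Rn: "evec 0 \<in> Rn 1"
  by (rule evec_Rn) simp

lemma smooth_map_affine1:
  assumes "openin (Euclidean_space 1) U" "openin (Euclidean_space 1) V" "\<And>x. x \<in> V \<Longrightarrow> pt (r * x 0 + t) \<in> U"
  shows "smooth_map 1 V 1 U (\<lambda>x. pt (r * x 0 + t))"
proof -
  have "smooth_on 1 V (\<lambda>x. r * x 0 + t)"
    by (intro smooth_on_add smooth_on_mult smooth_on_const smooth_on_coord assms)
  then show ?thesis using assms by (auto simp: smooth_map_def)
qed

lemma jac_affine1: "jac 1 (\<lambda>x. pt (r * x 0 + t)) u (evec 0) = (\<lambda>j. r * evec 0 j)"
proof (rule ext)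
  fix j
  have "partial 0 (\<lambda>x. r * x 0 + t) u = r"
    by (rule has_partial_imp_partial) (auto intro!: derivative_eq_intros)
  then show "jac 1 (\<lambda>x. pt (r * x 0 + t)) u (evec 0) j = r * evec 0 j"
    by (cases "j = 0") (simp_all add: jac_def pt_def dirderiv_def evec_def partial_def)
qed

context lie
begin

lemma tangent_zero: "q \<in> carrier G \<Longrightarrow> (\<lambda>_ _. 0) \<in> TS q"
  using velocity_tangent[OF LP_const, of q 0 "Rn 0" "\<lambda>_. 0" "\<lambda>_. 0"] by simp

lemma tangent_map_zero: "tangent_map G F q (\<lambda>_ _. 0) = (\<lambda>_ _. 0)"
  using tangent_map_lincomb[of F q 0 "\<lambda>_ _. 0" 0 "\<lambda>_ _. 0"] by simp

text \<open>Translating back, a vanishing logarithmic derivative gives a vanishing velocity; in a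
  chart all coordinates then have derivative 0 on an interval, and the chart is injective.\<close>

lemma rlog_zero_locally_constant:
  assumes P: "LP 1 (interval1 a b) (\<lambda>x. \<delta> (x 0))"
    and z: "\<And>t. a < t \<Longrightarrow> t < b \<Longrightarrow> rlog 1 (\<lambda>x. \<delta> (x 0)) (pt t) (evec 0) = (\<lambda>_ _. 0)"
    and t0: "a < t0" "t0 < b"
  shows "\<exists>r>0. \<forall>t. \<bar>t - t0\<bar> < r \<longrightarrow> a < t \<and> t < b \<and> \<delta> t = \<delta> t0"
proof -
  let ?P = "\<lambda>x::nat \<Rightarrow> real. \<delta> (x 0)"
  have d0: "\<delta> t0 \<in> carrier G" using LP_carrier[OF P, of "pt t0"] t0 by simp
  obtain c where c: "c \<in> charts G" "\<delta> t0 \<in> fst c" using chart_ex[OF d0] by blast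
  let ?W = "{x \<in> interval1 a b. ?P x \<in> fst c}"
  note W = LP_chart[OF P c(1)]
  have "pt t0 \<in> ?W" using t0 c by simp
  then obtain r where r: "r > 0" "cube 1 (pt t0) r \<subseteq> ?W" using openin_cubeE[OF W(1)] by blast
  have ptW: "pt t \<in> ?W" if "\<bar>t - t0\<bar> < r" for t
  proof -
    have "pt t \<in> cube 1 (pt t0) r" using that by (simp add: cube_def)
    then show ?thesis using r(2) by blast
  qed
  have D: "DERIV (\<lambda>t. snd c (\<delta> t) j) t :> 0" if t: "\<bar>t - t0\<bar> < r" for t j
  proof -
    have tI: "pt t \<in> interval1 a b" using ptW[OF t] by blast
    have "vel 1 ?P (pt t) (evec 0) = (\<lambda>_ _. 0)"
      using velocity_rlog(2)[OF P tI one_closed, where w = "evec 0"] z[of t] tI tangent_map_zero by simp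
    then have "jac 1 (snd c \<circ> ?P) (pt t) (evec 0) = (\<lambda>_. 0)"
      using ptW[OF t] c(1) unfolding velocity_def by (auto dest!: fun_cong[of _ _ c] split: if_splits)
    then have "partial 0 (\<lambda>x. snd c (?P x) j) (pt t) = 0"
      by (auto simp: jac_def dirderiv_def evec_def comp_def dest!: fun_cong[of _ _ j])
    with smooth_on_has_partial[OF smooth_map_coord[OF W(2), of j] _ ptW[OF t], of 0] show ?thesis by simp
  qed
  have "\<delta> t = \<delta> t0" if t: "\<bar>t - t0\<bar> < r" for t
  proof -
    have "snd c (\<delta> t) j = snd c (\<delta> t0) j" for j
    proof -
      have "\<exists>k. \<forall>s\<in>ball t0 r. snd c (\<delta> s) j = k"
        by (rule has_field_derivative_zero_constant[OF convex_ball has_field_derivative_at_within[OF D]])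
          (simp add: dist_real_def abs_minus_commute)
      then obtain k where k: "\<forall>s\<in>ball t0 r. snd c (\<delta> s) j = k" by blast
      moreover have "t \<in> ball t0 r" "t0 \<in> ball t0 r"
        using t r(1) by (auto simp: dist_real_def abs_minus_commute)
      ultimately show ?thesis by metis
    qed
    moreover have "\<delta> t \<in> fst c" using ptW[OF t] by simp
    ultimately show ?thesis using inj_onD[OF chart_inj[OF c(1)] _ _ c(2)] by blast
  qed
  moreover have "a < t \<and> t < b" if "\<bar>t - t0\<bar> < r" for t
    using ptW[OF that] by simp
  ultimately show ?thesis using r(1) by blast
qed

lemma rlog_zero_constant:
  assumes P: "LP 1 (interval1 a b) (\<lambda>x. \<delta> (x 0))"
    and z: "\<And>t. a < t \<Longrightarrow> t < b \<Longrightarrow> rlog 1 (\<lambda>x. \<delta> (x 0)) (pt t) (evec 0) = (\<lambda>_ _. 0)"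
    and s: "a < s" "s < b" and t: "a < t" "t < b"
  shows "\<delta> s = \<delta> t"
proof -
  have loc: "\<exists>T. openin (top_of_set {a<..<b}) T \<and> x \<in> T \<and> (\<forall>y\<in>T. \<delta> y = \<delta> x)" if "x \<in> {a<..<b}" for x
  proof -
    from that have x: "a < x" "x < b" by auto
    have "\<exists>r>0. \<forall>t. \<bar>t - x\<bar> < r \<longrightarrow> a < t \<and> t < b \<and> \<delta> t = \<delta> x"
      by (rule rlog_zero_locally_constant[OF P _ x]) (rule z)
    then obtain r where r: "r > 0" "\<forall>t. \<bar>t - x\<bar> < r \<longrightarrow> a < t \<and> t < b \<and> \<delta> t = \<delta> x"
      by (elim exE conjE)
    have "ball x r \<subseteq> {a<..<b}"
    proof
      fix y assume "y \<in> ball x r"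
      then have "\<bar>y - x\<bar> < r" by (simp add: dist_real_def abs_minus_commute)
      then show "y \<in> {a<..<b}" using r(2) by simp
    qed
    then have o: "openin (top_of_set {a<..<b}) (ball x r)" by (rule open_subset[OF _ open_ball])
    have c: "\<forall>y\<in>ball x r. \<delta> y = \<delta> x"
    proof
      fix y assume "y \<in> ball x r"
      then have "\<bar>y - x\<bar> < r" by (simp add: dist_real_def abs_minus_commute)
      then show "\<delta> y = \<delta> x" using r(2) by blast
    qed
    have "x \<in> ball x r" using r(1) by simp
    with o c show ?thesis by (intro exI[of _ "ball x r"] conjI)
  qed
  have "connected {a<..<b}" by (rule connected_Ioo)
  from locally_constant_imp_constant[OF this, of \<delta>] loc have "\<delta> constant_on {a<..<b}" by simp
  then show ?thesis using s t by (auto simp: constant_on_def)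
qed

text \<open>Integral curves, on the open interval from \<open>a\<close> to \<open>b\<close>, of the
  right-invariant vector field with value \<open>Z\<close> at the identity.\<close>

definition icurve :: "'g tvec \<Rightarrow> real \<Rightarrow> real \<Rightarrow> (real \<Rightarrow> 'g) \<Rightarrow> bool"
  where "icurve Z a b \<gamma> \<longleftrightarrow> LP 1 (interval1 a b) (\<lambda>x. \<gamma> (x 0)) \<and>
    (\<forall>t. a < t \<and> t < b \<longrightarrow> rlog 1 (\<lambda>x. \<gamma> (x 0)) (pt t) (evec 0) = Z)"

lemma icurve_carrier: "icurve Z a b \<gamma> \<Longrightarrow> a < t \<Longrightarrow> t < b \<Longrightarrow> \<gamma> t \<in> carrier G"
  using LP_carrier[of 1 "interval1 a b" "\<lambda>x. \<gamma> (x 0)" "pt t"] by (simp add: icurve_def)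

text \<open>The quotient \<open>\<delta>\<close> of the two curves is constant: the Leibniz rule for
  \<open>\<gamma>' = \<gamma> \<otimes> \<delta>\<close> reads \<open>Z\<close> equals
  \<open>Z\<close> plus \<open>Ad (\<gamma> r)\<close> of the logarithmic derivative of
  \<open>\<delta>\<close>, and \<open>Ad (\<gamma> r)\<close> is invertible. No estimate for
  differential equations enters.\<close>

lemma icurve_unique:
  assumes g1: "icurve Z a b \<gamma>" and g2: "icurve Z a b \<gamma>'" and s: "a < s" "s < b" "\<gamma> s = \<gamma>' s" and t: "a < t" "t < b"
  shows "\<gamma> t = \<gamma>' t"
proof -
  let ?I = "interval1 a b"
  have P1: "LP 1 ?I (\<lambda>x. \<gamma> (x 0))" and P2: "LP 1 ?I (\<lambda>x. \<gamma>' (x 0))" using g1 g2 by (auto simp: icurve_def)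
  define \<delta> where "\<delta> = (\<lambda>t. inv (\<gamma> t) \<otimes> \<gamma>' t)"
  have D: "LP 1 ?I (\<lambda>x. \<delta> (x 0))" unfolding \<delta>_def by (intro LP_mult LP_inv P1 P2)
  have "\<delta> s = \<delta> t"
  proof (rule rlog_zero_constant[OF D _ s(1,2) t])
    fix r assume r: "a < r" "r < b"
    then have rI: "pt r \<in> ?I" by simp
    have g: "\<gamma> r \<in> carrier G" using icurve_carrier[OF g1 r] .
    let ?A = "rlog 1 (\<lambda>x. \<delta> (x 0)) (pt r) (evec 0)"
    have A: "?A \<in> TS \<one>" by (rule rlog_tangent[OF D rI])
    have "rlog 1 (\<lambda>x. \<gamma>' (x 0)) (pt r) (evec 0) = rlog 1 (\<lambda>x. \<gamma> (x 0) \<otimes> \<delta> (x 0)) (pt r) (evec 0)"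
    proof (rule rlog_cong[OF openin_interval1(2) rI])
      fix x assume "x \<in> ?I"
      then show "\<gamma>' (x 0) = \<gamma> (x 0) \<otimes> \<delta> (x 0)"
        using LP_carrier[OF P1] LP_carrier[OF P2] by (simp add: \<delta>_def m_assoc[symmetric])
    qed
    also have "\<dots> = (\<lambda>c i. rlog 1 (\<lambda>x. \<gamma> (x 0)) (pt r) (evec 0) c i + Ad (\<gamma> r) ?A c i)"
      using rlog_mult[OF P1 D rI evec0_Rn] by simp
    finally have "Ad (\<gamma> r) ?A = (\<lambda>_ _. 0)"
      using g1 g2 r unfolding icurve_def by (simp add: fun_eq_iff)
    then have "Ad (inv (\<gamma> r)) (Ad (\<gamma> r) ?A) = (\<lambda>_ _. 0)" by (simp add: Ad_def tangent_map_zero)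
    then show "?A = (\<lambda>_ _. 0)"
      using Ad_mult[OF A, of "inv (\<gamma> r)" "\<gamma> r"] Ad_one[OF A] g by simp
  qed
  moreover have "\<gamma> s \<in> carrier G" "\<gamma> t \<in> carrier G" "\<gamma>' t \<in> carrier G"
    using icurve_carrier[OF g1] icurve_carrier[OF g2] s t by auto
  ultimately have "\<gamma> t \<otimes> (inv (\<gamma> t) \<otimes> \<gamma>' t) = \<gamma> t" using s(3) by (simp add: \<delta>_def)
  then show ?thesis using \<open>\<gamma> t \<in> carrier G\<close> \<open>\<gamma>' t \<in> carrier G\<close> by (simp add: m_assoc[symmetric])
qed

lemma icurve_subset:
  assumes "icurve Z a b \<gamma>" "a \<le> a'" "b' \<le> b"
  shows "icurve Z a' b' \<gamma>"
  unfolding icurve_def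
proof (intro conjI allI impI)
  show "LP 1 (interval1 a' b') (\<lambda>x. \<gamma> (x 0))"
    by (rule LP_restrict[OF _ openin_interval1(2)]) (use assms in \<open>auto simp: icurve_def interval1_def\<close>)
qed (use assms in \<open>auto simp: icurve_def\<close>)

lemma LP_affine:
  assumes "LP 1 U (\<lambda>x. \<gamma> (x 0))" "smooth_map 1 V 1 U (\<lambda>x. pt (r * x 0 + t))"
  shows "LP 1 V (\<lambda>x. \<gamma> (r * x 0 + t))"
  by (rule LP_compose[OF assms]) simp

lemma velocity_affine:
  assumes "LP 1 U (\<lambda>x. \<gamma> (x 0))" "smooth_map 1 V 1 U (\<lambda>x. pt (r * x 0 + t))" "u \<in> V"
  shows "vel 1 (\<lambda>x. \<gamma> (r * x 0 + t)) u (evec 0) = (\<lambda>c i. r * vel 1 (\<lambda>x. \<gamma> (x 0)) (pt (r * u 0 + t)) (evec 0) c i)"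
proof -
  have "vel 1 (\<lambda>x. \<gamma> (pt (r * x 0 + t) 0)) u (evec 0) =
    vel 1 (\<lambda>x. \<gamma> (x 0)) (pt (r * u 0 + t)) (\<lambda>j. r * evec 0 j + 0 * evec 0 j)"
    using velocity_chain[OF assms, of "evec 0"] unfolding jac_affine1 by simp
  then show ?thesis unfolding velocity_lincomb by simp
qed

lemma rlog_affine:
  assumes "LP 1 U (\<lambda>x. \<gamma> (x 0))" "smooth_map 1 V 1 U (\<lambda>x. pt (r * x 0 + t))" "u \<in> V"
  shows "rlog 1 (\<lambda>x. \<gamma> (r * x 0 + t)) u (evec 0) = (\<lambda>c i. r * rlog 1 (\<lambda>x. \<gamma> (x 0)) (pt (r * u 0 + t)) (evec 0) c i)"
proof -
  have g: "\<gamma> (r * u 0 + t) \<in> carrier G"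
    using LP_carrier[OF LP_affine[OF assms(1,2)] assms(3)] .
  show ?thesis unfolding rlog_def pt_0
    by (rule velocity_affine[OF LP_rmult[OF inv_closed[OF g] assms(1)] assms(2,3)])
qed

lemma icurve_translate:
  assumes "icurve Z a b \<gamma>"
  shows "icurve Z (a - t) (b - t) (\<lambda>s. \<gamma> (s + t))"
proof -
  have P: "LP 1 (interval1 a b) (\<lambda>x. \<gamma> (x 0))" using assms by (simp add: icurve_def)
  have i: "smooth_map 1 (interval1 (a - t) (b - t)) 1 (interval1 a b) (\<lambda>x. pt (1 * x 0 + t))"
    by (rule smooth_map_affine1[OF openin_interval1(2) openin_interval1(2)]) (auto simp: interval1_def)
  show ?thesis unfolding icurve_def
  proof (intro conjI allI impI)
    show "LP 1 (interval1 (a - t) (b - t)) (\<lambda>x. \<gamma> (x 0 + t))"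
      using LP_affine[OF P i] by simp
    fix s assume s: "a - t < s \<and> s < b - t"
    then have "pt s \<in> interval1 (a - t) (b - t)" by simp
    then show "rlog 1 (\<lambda>x. \<gamma> (x 0 + t)) (pt s) (evec 0) = Z"
      using rlog_affine[OF P i, of "pt s"] assms s by (simp add: icurve_def)
  qed
qed

lemma icurve_rmult:
  assumes "icurve Z a b \<gamma>" "g \<in> carrier G"
  shows "icurve Z a b (\<lambda>s. \<gamma> s \<otimes> g)"
proof -
  have P: "LP 1 (interval1 a b) (\<lambda>x. \<gamma> (x 0))" using assms by (simp add: icurve_def)
  show ?thesis unfolding icurve_def
    using LP_rmult[OF assms(2) P] rlog_right_translate[OF P _ assms(2)] assms(1) by (simp add: icurve_def)
qed

text \<open>The bridge from parameter space to the group: \<open>P\<close> carries an integral curve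
  of the field \<open>a\<close> to a curve whose logarithmic derivative is the image of
  \<open>a\<close>. The cut-off at \<open>k\<close> makes the values of \<open>a\<close> a vector of
  \<open>Rn k\<close>.\<close>

lemma ode_velocity:
  assumes P: "LP k W P" and a: "\<And>j. j < k \<Longrightarrow> smooth_on k V (a j)" and V: "openin (Euclidean_space k) V" "V \<subseteq> W"
    and R: "\<And>t. \<bar>t\<bar> < e \<Longrightarrow> x t \<in> V"
    and d: "\<And>t j. \<bar>t\<bar> < e \<Longrightarrow> j < k \<Longrightarrow> ((\<lambda>t. x t j) has_real_derivative a j (x t)) (at t)"
  shows "LP 1 (interval1 (-e) e) (\<lambda>s. P (x (s 0)))"
    and "\<bar>t\<bar> < e \<Longrightarrow> rlog 1 (\<lambda>s. P (x (s 0))) (pt t) (evec 0) = rlog k P (x t) (\<lambda>j. if j < k then a j (x t) else 0)"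
proof -
  have X: "smooth_map 1 (interval1 (-e) e) k V (\<lambda>s. x (s 0))"
    by (rule ode_smooth[OF V(1) a R d])
  have PV: "LP k V P" using LP_restrict[OF P V] by blast
  show "LP 1 (interval1 (-e) e) (\<lambda>s. P (x (s 0)))" by (rule LP_compose[OF PV X refl])
  assume t: "\<bar>t\<bar> < e"
  then have tI: "pt t \<in> interval1 (-e) e" by auto
  have "jac 1 (\<lambda>s. x (s 0)) (pt t) (evec 0) = (\<lambda>j. if j < k then a j (x t) else 0)"
  proof (rule Rn_ext)
    show "jac 1 (\<lambda>s. x (s 0)) (pt t) (evec 0) \<in> Rn k" by (rule jac_smooth_Rn[OF X tI])
    fix j assume j: "j < k"
    have "partial 0 (\<lambda>s. x (s 0) j) (pt t) = a j (x t)"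
      by (rule has_partial_imp_partial) (use d[OF t j] in simp)
    then show "jac 1 (\<lambda>s. x (s 0)) (pt t) (evec 0) j = (if j < k then a j (x t) else 0)"
      using j by (simp add: jac_def dirderiv_def evec_def)
  qed (simp add: mem_Rn)
  then show "rlog 1 (\<lambda>s. P (x (s 0))) (pt t) (evec 0) = rlog k P (x t) (\<lambda>j. if j < k then a j (x t) else 0)"
    using rlog_chain[OF PV X tI, of "evec 0"] by simp
qed

text \<open>In the chart at \<open>\<one>\<close>, integrate the right-invariant vector field with value \<open>Z\<close> at \<open>\<one>\<close>.\<close>

lemma local_icurve:
  assumes Z: "Z \<in> TS \<one>"
  shows "\<exists>e>0. \<exists>\<gamma>. icurve Z (-e) e \<gamma> \<and> \<gamma> 0 = \<one>"
proof -
  define M where "M = (\<lambda>z. chart_inv c1 (fst_part dm z) \<otimes> chart_inv c1 (snd_part dm z))"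
  have M: "LP (dm + dm) (prod_dom dm dm (img c1) (img c1)) M"
    unfolding M_def by (intro LP_mult LP_fst LP_snd c1)
  have Mj: "M (join dm x y) = chart_inv c1 x \<otimes> chart_inv c1 y" if "x \<in> img c1" for x y
    using openin_subset_Rn[OF c1(6) that] by (simp add: M_def fst_part_join)
  \<comment> \<open>The coordinate vector at \<open>y\<close> of the right-invariant field: the
    derivative at \<open>y1\<close>, in direction \<open>Z\<close>, of
    \<open>chart_inv c1 z \<otimes> chart_inv c1 y\<close> in \<open>z\<close>. Written with the map
    \<open>M\<close> of two variables, its smoothness in \<open>y\<close> is an instance of
    \<open>smooth_along_section\<close>.\<close>
  define a where "a = (\<lambda>j y. vel (dm + dm) M (join dm y1 y) (join dm (Z c1) (\<lambda>_. 0)) c1 j)"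
  have s: "smooth_map dm (img c1) (dm + dm) (prod_dom dm dm (img c1) (img c1)) (\<lambda>y. join dm y1 y)"
    by (rule smooth_map_join[OF smooth_map_const[OF c1(6,6,3)] smooth_map_id[OF c1(6,6) order_refl]])
  have in1: "M (join dm y1 y) \<in> fst c1" if "y \<in> img c1" for y
    using Mj[OF c1(3)] c1(4) chart_inv_in[OF that] chart_carrier[OF c1(1)] by simp
  have as: "smooth_on dm (img c1) (a j)" for j
    unfolding a_def by (rule smooth_along_section[OF M c1(1) s in1])
  have "\<exists>e>0. \<exists>x. x 0 = y1 \<and> (\<forall>t. \<bar>t\<bar> < e \<longrightarrow> x t \<in> img c1 \<and>
     (\<forall>j<dm. ((\<lambda>t. x t j) has_real_derivative a j (x t)) (at t)))"
    by (rule ode_exists[OF c1(6,3)]) (use as in \<open>simp add: smooth_on_def del: Ck_on.simps\<close>)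
  then obtain e x where e: "e > 0" and x0: "x 0 = y1" and R: "\<And>t. \<bar>t\<bar> < e \<Longrightarrow> x t \<in> img c1"
    and d: "\<And>t j. \<bar>t\<bar> < e \<Longrightarrow> j < dm \<Longrightarrow> ((\<lambda>t. x t j) has_real_derivative a j (x t)) (at t)" by blast
  define \<gamma> where "\<gamma> = (\<lambda>t. chart_inv c1 (x t))"
  have P: "LP 1 (interval1 (-e) e) (\<lambda>s. \<gamma> (s 0))"
    and rl: "\<And>t. \<bar>t\<bar> < e \<Longrightarrow> rlog 1 (\<lambda>s. \<gamma> (s 0)) (pt t) (evec 0) = rlog dm (chart_inv c1) (x t) (\<lambda>j. if j < dm then a j (x t) else 0)"
    unfolding \<gamma>_def using ode_velocity[OF c1(5) as c1(6) order_refl R d] by blast+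
  have "rlog 1 (\<lambda>s. \<gamma> (s 0)) (pt t) (evec 0) = Z" if t: "\<bar>t\<bar> < e" for t
  proof -
    note xt = R[OF t]
    have g: "\<gamma> t \<in> fst c1" "\<gamma> t \<in> carrier G" using chart_inv_in[OF xt] chart_carrier[OF c1(1)] by (auto simp: \<gamma>_def)
    let ?V = "vel dm (\<lambda>z. chart_inv c1 z \<otimes> \<gamma> t) y1 (Z c1)"
    have PV: "LP dm (img c1) (\<lambda>z. chart_inv c1 z \<otimes> \<gamma> t)" by (rule LP_rmult[OF g(2) c1(5)])
    have "?V = vel (dm + dm) M (join dm y1 (x t)) (join dm (Z c1) (\<lambda>_. 0))"
      unfolding velocity_pair(1)[OF M c1(6,6,3) xt tangent_one(2)[OF Z]]
      by (rule velocity_cong[OF c1(6,3)]) (simp add: Mj \<gamma>_def)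
    then have aV: "a j (x t) = ?V c1 j" for j by (simp add: a_def)
    have VR: "?V c1 \<in> Rn dm" by (rule velocity_chart_Rn[OF PV c1(3,1)])
    have "(\<lambda>j. if j < dm then a j (x t) else 0) = ?V c1"
      by (rule Rn_ext[OF _ VR]) (auto simp: mem_Rn aV)
    moreover have Vt: "?V \<in> TS (\<gamma> t)"
      using velocity_tangent[OF PV c1(3), of "Z c1"] g(2) by (simp add: c1(4))
    moreover have "snd c1 (\<gamma> t) = x t" unfolding \<gamma>_def by (rule chart_eq[OF xt])
    ultimately have "vel dm (chart_inv c1) (x t) (\<lambda>j. if j < dm then a j (x t) else 0) = ?V"
      using tangent_velocity(1)[OF Vt c1(1) g(1)] by simp
    moreover have "rlog dm (chart_inv c1) (x t) w = tangent_map G (\<lambda>z. z \<otimes> inv (\<gamma> t)) (\<gamma> t) (vel dm (chart_inv c1) (x t) w)" for w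
      using velocity_rlog(1)[OF c1(5) xt inv_closed[OF g(2)]] by (simp add: rlog_def \<gamma>_def)
    ultimately have "rlog 1 (\<lambda>s. \<gamma> (s 0)) (pt t) (evec 0) = tangent_map G (\<lambda>z. z \<otimes> inv (\<gamma> t)) (\<gamma> t) ?V"
      using rl[OF t] by simp
    also have "\<dots> = vel dm (\<lambda>z. chart_inv c1 z \<otimes> \<gamma> t \<otimes> inv (\<gamma> t)) y1 (Z c1)"
    proof (rule tangent_map_velocity[OF PV c1(3) LP_rmult[OF inv_closed[OF g(2)]]])
      show "\<gamma> t = chart_inv c1 y1 \<otimes> \<gamma> t" unfolding c1(4) using g(2) by simp
    qed
    also have "\<dots> = vel dm (chart_inv c1) y1 (Z c1)"
      by (rule velocity_cong[OF c1(6,3)]) (use LP_carrier[OF c1(5)] g(2) in \<open>simp add: m_assoc\<close>)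
    also have "\<dots> = Z" using tangent_one(1)[OF Z] by simp
    finally show ?thesis .
  qed
  then have "icurve Z (-e) e \<gamma>" using P by (auto simp: icurve_def abs_less_iff)
  moreover have "\<gamma> 0 = \<one>" by (simp add: \<gamma>_def x0 c1(4))
  ultimately show ?thesis using e by blast
qed

text \<open>As functions of \<open>s\<close> both sides are integral curves of the same field, one
  by translation of time and the other by right translation in the group, and they agree at
  \<open>s = 0\<close>.\<close>

lemma icurve_hom:
  assumes g: "icurve Z (-e) e \<gamma>" "\<gamma> 0 = \<one>" and st: "\<bar>s\<bar> < e" "\<bar>t\<bar> < e" "\<bar>s + t\<bar> < e"
  shows "\<gamma> (s + t) = \<gamma> s \<otimes> \<gamma> t"
proof -
  \<comment> \<open>The times \<open>s\<close> for which both \<open>s\<close> and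
    \<open>s + t\<close> lie in the domain of \<open>\<gamma>\<close>.\<close>
  let ?a = "max (-e) (-e - t)" and ?b = "min e (e - t)"
  have gt: "\<gamma> t \<in> carrier G" using icurve_carrier[OF g(1)] st by auto
  have i1: "icurve Z ?a ?b (\<lambda>s. \<gamma> (s + t))" by (rule icurve_subset[OF icurve_translate[OF g(1)]]) auto
  have i2: "icurve Z ?a ?b (\<lambda>s. \<gamma> s \<otimes> \<gamma> t)" by (rule icurve_subset[OF icurve_rmult[OF g(1) gt]]) auto
  have i0: "\<gamma> (0 + t) = \<gamma> 0 \<otimes> \<gamma> t" using g(2) gt by simp
  show ?thesis by (rule icurve_unique[OF i1 i2 _ _ i0]) (use st in auto)
qed

lemma LP_pow: "LP m U P \<Longrightarrow> LP m U (\<lambda>u. P u [^] (k::nat))"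
proof (induction k)
  case 0
  then show ?case using LP_const[OF _ LP_open] by simp
next
  case (Suc k)
  then show ?case using LP_mult by simp
qed

lemma one_parameter_zero:
  assumes "one_parameter_subgroup G Z \<gamma>"
  shows "\<gamma> t \<in> carrier G" "\<gamma> 0 = \<one>"
proof -
  show c: "\<gamma> t \<in> carrier G" for t
    using LP_carrier[of 1 "Rn 1" "\<lambda>x. \<gamma> (x 0)" "pt t"] assms by (simp add: one_parameter_subgroup_def)
  have "\<gamma> (0 + 0) = \<gamma> 0 \<otimes> \<gamma> 0" using assms unfolding one_parameter_subgroup_def by blast
  then show "\<gamma> 0 = \<one>" using c[of 0] by (metis add_0 l_cancel_one')
qed

text \<open>Since \<open>\<gamma> s \<otimes> inv (\<gamma> t) = \<gamma> (s - t)\<close>, the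
  logarithmic derivative at every time is the velocity at time 0. So one-parameter subgroups are
  integral curves and inherit their uniqueness.\<close>

lemma one_parameter_rlog:
  assumes g: "one_parameter_subgroup G Z \<gamma>"
  shows "rlog 1 (\<lambda>x. \<gamma> (x 0)) (pt t) (evec 0) = Z"
proof -
  have P: "LP 1 (Rn 1) (\<lambda>x. \<gamma> (x 0))" and h: "\<And>s t. \<gamma> (s + t) = \<gamma> s \<otimes> \<gamma> t"
    and v: "vel 1 (\<lambda>x. \<gamma> (x 0)) (pt 0) (evec 0) = Z"
    using g by (auto simp: one_parameter_subgroup_def pt_zero)
  note c = one_parameter_zero[OF g]
  have "inv (\<gamma> t) = \<gamma> (- t)" using h[of "-t" t] c by (simp add: inv_equality)
  then have "\<gamma> s \<otimes> inv (\<gamma> t) = \<gamma> (1 * s + - t)" for s using h[of s "-t"] by simp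
  then have "rlog 1 (\<lambda>x. \<gamma> (x 0)) (pt t) (evec 0) = vel 1 (\<lambda>x. \<gamma> (1 * x 0 + - t)) (pt t) (evec 0)"
    by (simp only: rlog_def pt_0)
  also have "\<dots> = vel 1 (\<lambda>x. \<gamma> (x 0)) (pt 0) (evec 0)"
    using velocity_affine[OF P smooth_map_affine1[OF openin_Rn openin_Rn pt_Rn(1)], of "pt t" 1 "-t"] by simp
  finally show ?thesis using v by simp
qed

lemma one_parameter_icurve: "one_parameter_subgroup G Z \<gamma> \<Longrightarrow> icurve Z a b \<gamma>"
  using one_parameter_rlog[of Z \<gamma>] LP_restrict[of 1 "Rn 1" "\<lambda>x. \<gamma> (x 0)" "interval1 a b" "\<lambda>x. \<gamma> (x 0)", OF _ openin_interval1(2)]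
  by (auto simp: icurve_def one_parameter_subgroup_def interval1_def)

lemma one_parameter_unique:
  assumes "one_parameter_subgroup G Z \<gamma>" "one_parameter_subgroup G Z \<gamma>'"
  shows "\<gamma> = \<gamma>'"
proof
  fix t
  show "\<gamma> t = \<gamma>' t"
    by (rule icurve_unique[OF one_parameter_icurve[OF assms(1)] one_parameter_icurve[OF assms(2)],
          of "- \<bar>t\<bar> - 1" 0 "\<bar>t\<bar> + 1"])
       (use one_parameter_zero(2)[OF assms(1)] one_parameter_zero(2)[OF assms(2)] in auto)
qed

text \<open>A local one-parameter subgroup extends by \<open>\<gamma>(t) = \<gamma>(t / 2\<^sup>N)\<close> raised to the power \<open>2\<^sup>N\<close>.\<close>

lemma one_parameter_exists:
  assumes Z: "Z \<in> TS \<one>"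
  shows "\<exists>\<gamma>. one_parameter_subgroup G Z \<gamma>"
proof -
  obtain e \<gamma> where e: "e > 0" and g: "icurve Z (-e) e \<gamma>" "\<gamma> 0 = \<one>" using local_icurve[OF Z] by blast
  have gc: "\<gamma> t \<in> carrier G" if "\<bar>t\<bar> < e" for t using icurve_carrier[OF g(1)] that by auto
  define f where "f = (\<lambda>N t. \<gamma> (t / 2 ^ N) [^] (2 ^ N :: nat))"
  have step: "f (Suc N) t = f N t" if "\<bar>t\<bar> / 2 ^ N < e" for N t
  proof -
    let ?s = "t / 2 ^ Suc N"
    have s: "\<bar>?s\<bar> < e" "\<bar>?s + ?s\<bar> < e" using that by (auto simp: abs_divide field_simps)
    have "\<gamma> (?s + ?s) = \<gamma> ?s \<otimes> \<gamma> ?s" by (rule icurve_hom[OF g s(1,1,2)])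
    also have "\<dots> = \<gamma> ?s [^] (2::nat)" using gc[OF s(1)] by (simp add: numeral_2_eq_2)
    finally have "\<gamma> (t / 2 ^ N) = \<gamma> ?s [^] (2::nat)" by simp
    then show ?thesis using gc[OF s(1)] by (simp add: f_def nat_pow_pow)
  qed
  have mono: "\<bar>t\<bar> / 2 ^ M < e" if "\<bar>t\<bar> / 2 ^ N < e" "N \<le> M" for t N M
  proof -
    have "\<bar>t\<bar> / 2 ^ M \<le> \<bar>t\<bar> / 2 ^ N" using that(2) by (intro divide_left_mono) auto
    then show ?thesis using that by simp
  qed
  have eq: "f M t = f N t" if "\<bar>t\<bar> / 2 ^ N < e" "N \<le> M" for t N M
    using that(2)
  proof (induction M rule: dec_induct)
    case (step M)
    then show ?case using \<open>\<And>N t. \<bar>t\<bar> / 2 ^ N < e \<Longrightarrow> f (Suc N) t = f N t\<close>[OF mono[OF that(1)]] by simp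
  qed simp
  have ex: "\<exists>N. \<bar>t\<bar> / 2 ^ N < e" for t
  proof -
    obtain N where "\<bar>t\<bar> / e < 2 ^ N" using real_arch_pow[of 2 "\<bar>t\<bar> / e"] by auto
    then show ?thesis using e by (auto simp: field_simps)
  qed
  \<comment> \<open>Any scale \<open>N\<close> that brings the argument into the domain of the local
    curve will do; by \<open>eq\<close> the value does not depend on it.\<close>
  define h where "h = (\<lambda>t. f (SOME N. \<bar>t\<bar> / 2 ^ N < e) t)"
  have h: "h t = f N t" if "\<bar>t\<bar> / 2 ^ N < e" for t N
  proof -
    let ?M = "SOME N. \<bar>t\<bar> / 2 ^ N < e"
    have "\<bar>t\<bar> / 2 ^ ?M < e" using someI_ex[OF ex] .
    from eq[OF this max.cobounded1] have "f (max ?M N) t = f ?M t" .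
    moreover from eq[OF that max.cobounded2] have "f (max ?M N) t = f N t" .
    ultimately show ?thesis by (simp add: h_def)
  qed
  have "h (s + t) = h s \<otimes> h t" for s t
  proof -
    obtain N where N: "(\<bar>s\<bar> + \<bar>t\<bar>) / 2 ^ N < e" using ex[of "\<bar>s\<bar> + \<bar>t\<bar>"] by auto
    have d: "x / 2 ^ N < e" if "x \<le> \<bar>s\<bar> + \<bar>t\<bar>" for x
      using divide_right_mono[OF that, of "2 ^ N"] N by simp
    have b: "\<bar>s\<bar> / 2 ^ N < e" "\<bar>t\<bar> / 2 ^ N < e" "\<bar>s + t\<bar> / 2 ^ N < e" "\<bar>t + s\<bar> / 2 ^ N < e"
      by (rule d, linarith)+
    let ?s = "s / 2 ^ N" and ?t = "t / 2 ^ N"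
    have ab: "\<bar>x / 2 ^ N\<bar> = \<bar>x\<bar> / 2 ^ N" for x :: real by (simp add: abs_divide)
    have b': "\<bar>?s\<bar> < e" "\<bar>?t\<bar> < e" "\<bar>?s + ?t\<bar> < e" "\<bar>?t + ?s\<bar> < e"
      unfolding add_divide_distrib[symmetric] ab by (rule b)+
    have m: "\<gamma> (?s + ?t) = \<gamma> ?s \<otimes> \<gamma> ?t" by (rule icurve_hom[OF g b'(1-3)])
    moreover have "\<gamma> (?t + ?s) = \<gamma> ?t \<otimes> \<gamma> ?s" by (rule icurve_hom[OF g b'(2,1,4)])
    \<comment> \<open>The power of a product splits only for commuting factors. They commute because
      \<open>s + t = t + s\<close> in the local homomorphism property.\<close>
    ultimately have "\<gamma> ?s \<otimes> \<gamma> ?t = \<gamma> ?t \<otimes> \<gamma> ?s" by (simp add: add.commute)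
    from pow_mult_distrib[OF this gc[OF b'(1)] gc[OF b'(2)]] show ?thesis
      unfolding h[OF b(1)] h[OF b(2)] h[OF b(3)] by (simp add: f_def add_divide_distrib m)
  qed
  moreover have "LP 1 (Rn 1) (\<lambda>x. h (x 0))"
  proof (rule LP_local[OF openin_Rn])
    fix u assume u: "u \<in> Rn 1"
    obtain N where N: "(\<bar>u 0\<bar> + 1) / 2 ^ N < e" using ex[of "\<bar>u 0\<bar> + 1"] by auto
    let ?T = "\<bar>u 0\<bar> + 1"
    let ?V = "interval1 (- ?T) ?T"
    have sm: "\<bar>x 0\<bar> / 2 ^ N < e" if "x \<in> ?V" for x
    proof -
      have "\<bar>x 0\<bar> / 2 ^ N \<le> ?T / 2 ^ N" using that by (intro divide_right_mono) (auto simp: interval1_def)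
      then show ?thesis using N by simp
    qed
    have "LP 1 ?V (\<lambda>x. \<gamma> ((1 / 2 ^ N) * x 0 + 0))"
    proof (rule LP_affine)
      show "LP 1 (interval1 (-e) e) (\<lambda>x. \<gamma> (x 0))" using g by (simp add: icurve_def)
      show "smooth_map 1 ?V 1 (interval1 (-e) e) (\<lambda>x. pt (1 / 2 ^ N * x 0 + 0))"
      proof (rule smooth_map_affine1[OF openin_interval1(2) openin_interval1(2)])
        fix x assume "x \<in> ?V"
        then have "\<bar>x 0 / 2 ^ N\<bar> < e" using sm by (simp add: abs_divide)
        then have "- e < x 0 / 2 ^ N \<and> x 0 / 2 ^ N < e" by linarith
        then show "pt (1 / 2 ^ N * x 0 + 0) \<in> interval1 (- e) e" by simp
      qed
    qed
    from LP_pow[OF this, of "2 ^ N"] have "LP 1 ?V (\<lambda>x. f N (x 0))" by (simp add: f_def)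
    then have "LP 1 ?V (\<lambda>x. h (x 0))"
      using LP_cong[of ?V "\<lambda>x. h (x 0)" "\<lambda>x. f N (x 0)" 1] h sm by simp
    moreover have "u \<in> ?V" "?V \<subseteq> Rn 1" using u by (auto simp: interval1_def)
    ultimately show "\<exists>V. openin (Euclidean_space 1) V \<and> u \<in> V \<and> V \<subseteq> Rn 1 \<and> LP 1 V (\<lambda>x. h (x 0))"
      using openin_interval1(2) by blast
  qed
  moreover have "vel 1 (\<lambda>x. h (x 0)) (\<lambda>_. 0) (evec 0) = Z"
  proof -
    have I: "pt 0 \<in> interval1 (-e) e" using e by simp
    have "vel 1 (\<lambda>x. h (x 0)) (pt 0) (evec 0) = vel 1 (\<lambda>x. \<gamma> (x 0) \<otimes> inv (\<gamma> (pt 0 0))) (pt 0) (evec 0)"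
    proof (rule velocity_cong[OF openin_interval1(2) I])
      fix x assume "x \<in> interval1 (-e) e"
      then have x: "\<bar>x 0\<bar> < e" by (auto simp: interval1_def)
      then show "h (x 0) = \<gamma> (x 0) \<otimes> inv (\<gamma> (pt 0 0))" using h[of "x 0" 0] gc[OF x] g(2) by (simp add: f_def)
    qed
    also have "\<dots> = Z" using g(1) e unfolding icurve_def rlog_def by simp
    finally show ?thesis by (simp add: pt_zero)
  qed
  ultimately show ?thesis unfolding one_parameter_subgroup_def by blast
qed

definition expc :: "'g tvec \<Rightarrow> real \<Rightarrow> 'g"
  where "expc Z t = lie_exp G (\<lambda>c i. t * Z c i)"

text \<open>Rescaling time turns \<open>\<gamma>\<close> into the one-parameter subgroup with
  velocity \<open>t\<close> times \<open>Z\<close>, whose value at 1 is \<open>\<gamma> t\<close>;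
  uniqueness identifies it with the definite description in \<open>lie_exp\<close>.\<close>

lemma one_parameter_expc:
  assumes g: "one_parameter_subgroup G Z \<gamma>"
  shows "expc Z = \<gamma>"
proof
  fix t
  have P: "LP 1 (Rn 1) (\<lambda>x. \<gamma> (x 0))" and h: "\<And>s t. \<gamma> (s + t) = \<gamma> s \<otimes> \<gamma> t"
    and v: "vel 1 (\<lambda>x. \<gamma> (x 0)) (pt 0) (evec 0) = Z"
    using g by (auto simp: one_parameter_subgroup_def pt_zero)
  have "one_parameter_subgroup G (\<lambda>c i. t * Z c i) (\<lambda>s. \<gamma> (t * s + 0))"
    unfolding one_parameter_subgroup_def
  proof (intro conjI allI)
    show "\<gamma> (t * (r + s) + 0) = \<gamma> (t * r + 0) \<otimes> \<gamma> (t * s + 0)" for r s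
      using h[of "t * r" "t * s"] by (simp add: distrib_left)
    note i = smooth_map_affine1[OF openin_Rn openin_Rn pt_Rn(1), of t 0]
    show "LP 1 (Rn 1) (\<lambda>x. \<gamma> (t * x 0 + 0))" by (rule LP_affine[OF P i])
    show "vel 1 (\<lambda>x. \<gamma> (t * x 0 + 0)) (\<lambda>_. 0) (evec 0) = (\<lambda>c i. t * Z c i)"
      using velocity_affine[OF P i pt_Rn(1)[of 0]] v by (simp add: pt_zero)
  qed
  from the_equality[of "one_parameter_subgroup G (\<lambda>c i. t * Z c i)", OF this one_parameter_unique[OF _ this]]
  show "expc Z t = \<gamma> t" by (simp add: expc_def lie_exp_def)
qed

lemma expc: "Z \<in> TS \<one> \<Longrightarrow> one_parameter_subgroup G Z (expc Z)"
  using one_parameter_exists one_parameter_expc by metis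

lemma expc_facts:
  assumes Z: "Z \<in> TS \<one>"
  shows "LP 1 (Rn 1) (\<lambda>x. expc Z (x 0))" "expc Z (s + t) = expc Z s \<otimes> expc Z t" "expc Z t \<in> carrier G"
    "expc Z 0 = \<one>" "rlog 1 (\<lambda>x. expc Z (x 0)) (pt t) (evec 0) = Z"
  using expc[OF Z] one_parameter_zero[OF expc[OF Z]] one_parameter_rlog[OF expc[OF Z]]
  by (auto simp: one_parameter_subgroup_def)

lemma mem_subgroup_algebra: "Z \<in> subgroup_algebra G H \<longleftrightarrow> Z \<in> TS \<one> \<and> (\<forall>t. expc Z t \<in> H)"
  by (simp add: subgroup_algebra_def expc_def)

text \<open>A short piece of integral curve inside \<open>H\<close> is enough: it coincides with the
  exponential curve, and repeated squaring reaches every time without leaving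
  \<open>H\<close>.\<close>

lemma icurve_subgroup_algebra:
  assumes H: "subgroup H G" and Z: "Z \<in> TS \<one>" and e: "e > 0" and g: "icurve Z (-e) e \<gamma>" "\<gamma> 0 = \<one>"
    and gH: "\<And>t. \<bar>t\<bar> < e \<Longrightarrow> \<gamma> t \<in> H"
  shows "Z \<in> subgroup_algebra G H"
proof -
  have small: "expc Z t \<in> H" if "\<bar>t\<bar> < e" for t
  proof -
    have "expc Z t = \<gamma> t"
      by (rule icurve_unique[OF one_parameter_icurve[OF expc[OF Z]] g(1), of 0])
        (use e that g(2) expc_facts(4)[OF Z] in auto)
    then show ?thesis using gH[OF that] by simp
  qed
  have "expc Z t \<in> H" if "\<bar>t\<bar> < 2 ^ N * e" for N t
    using that
  proof (induction N arbitrary: t)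
    case (Suc N)
    have "expc Z (t / 2) \<in> H" using Suc by auto
    then have "expc Z (t / 2) \<otimes> expc Z (t / 2) \<in> H" using subgroup.m_closed[OF H] by blast
    then show ?case using expc_facts(2)[OF Z, of "t / 2" "t / 2"] by simp
  qed (use small in simp)
  moreover have "\<exists>N. \<bar>t\<bar> < 2 ^ N * e" for t
    using real_arch_pow[of 2 "\<bar>t\<bar> / e"] e by (auto simp: field_simps)
  ultimately have "expc Z t \<in> H" for t by blast
  then show ?thesis using Z by (simp add: mem_subgroup_algebra)
qed

text \<open>Conjugating the curve \<open>expc Z\<close> by \<open>h\<close> yields the one-parameter
  subgroup of \<open>Ad h Z\<close>, which stays in \<open>H\<close>.\<close>

lemma subgroup_algebra_Ad:
  assumes H: "subgroup H G" and h: "h \<in> H" and Z: "Z \<in> subgroup_algebra G H"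
  shows "Ad h Z \<in> subgroup_algebra G H"
proof -
  have hc: "h \<in> carrier G" using subgroup.mem_carrier[OF H h] .
  have Zt: "Z \<in> TS \<one>" and ZH: "\<And>t. expc Z t \<in> H" using Z by (auto simp: mem_subgroup_algebra)
  note x = expc_facts[OF Zt]
  have "one_parameter_subgroup G (Ad h Z) (\<lambda>t. h \<otimes> expc Z t \<otimes> inv h)"
    unfolding one_parameter_subgroup_def
  proof (intro conjI allI)
    show "h \<otimes> expc Z (s + t) \<otimes> inv h = h \<otimes> expc Z s \<otimes> inv h \<otimes> (h \<otimes> expc Z t \<otimes> inv h)" for s t
    proof -
      have "h \<otimes> expc Z s \<otimes> inv h \<otimes> (h \<otimes> expc Z t \<otimes> inv h) = h \<otimes> expc Z s \<otimes> (inv h \<otimes> h) \<otimes> expc Z t \<otimes> inv h"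
        using x(3) hc by (simp only: m_assoc inv_closed m_closed)
      then show ?thesis using x(2,3) hc by (simp add: m_assoc)
    qed
    show "LP 1 (Rn 1) (\<lambda>x. h \<otimes> expc Z (x 0) \<otimes> inv h)" by (rule LP_conj[OF hc x(1)])
    have v: "vel 1 (\<lambda>x. expc Z (x 0)) (\<lambda>_. 0) (evec 0) = Z"
      using expc[OF Zt] by (simp add: one_parameter_subgroup_def)
    show "vel 1 (\<lambda>x. h \<otimes> expc Z (x 0) \<otimes> inv h) (\<lambda>_. 0) (evec 0) = Ad h Z"
      using Ad_velocity[OF x(1) zero_mem_Rn x(4) hc, of "evec 0"] unfolding v by simp
  qed
  from one_parameter_expc[OF this] have "expc (Ad h Z) t \<in> H" for t
    using subgroup.m_closed[OF H subgroup.m_closed[OF H h ZH] subgroup.m_inv_closed[OF H h]] by simp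
  then show ?thesis using Ad_tangent[OF Zt hc] by (simp add: mem_subgroup_algebra)
qed

subsection \<open>Smooth maps with values in a subgroup\<close>

definition immersive :: "nat \<Rightarrow> ((nat \<Rightarrow> real) \<Rightarrow> 'g) \<Rightarrow> (nat \<Rightarrow> real) \<Rightarrow> bool"
  where "immersive k \<Phi> t \<longleftrightarrow> (\<forall>v\<in>Rn k. rlog k \<Phi> t v = (\<lambda>_ _. 0) \<longrightarrow> v = (\<lambda>_. 0))"

lemma tangent_one_eqI: "Z \<in> TS \<one> \<Longrightarrow> Z' \<in> TS \<one> \<Longrightarrow> (\<And>i. i < dm \<Longrightarrow> Z c1 i = Z' c1 i) \<Longrightarrow> Z = Z'"
  using tangent_one[of Z] tangent_one[of Z'] Rn_ext[of "Z c1" dm "Z' c1"] by metis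

lemma rlog_expansion:
  assumes P: "LP k W \<Phi>" and t: "t \<in> W" and v: "v \<in> Rn k"
  shows "rlog k \<Phi> t v c i = (\<Sum>j<k. v j * rlog k \<Phi> t (evec j) c i)"
  by (rule linear_expansion[OF _ v]) (simp add: rlog_lincomb)

text \<open>Injectivity becomes linear independence of the \<open>k\<close> partial logarithmic
  derivatives in the chart at the identity, the form that \<open>linear_relation_exists\<close> and
  \<open>smooth_dual_frame\<close> speak about.\<close>

lemma immersive_iff:
  assumes P: "LP k W \<Phi>" and t: "t \<in> W"
  shows "immersive k \<Phi> t \<longleftrightarrow> (\<forall>a. (\<forall>i<dm. (\<Sum>j<k. a j * rlog k \<Phi> t (evec j) c1 i) = 0) \<longrightarrow> (\<forall>j<k. a j = 0))"
proof -
  have z: "rlog k \<Phi> t v = (\<lambda>_ _. 0) \<longleftrightarrow> (\<forall>i<dm. (\<Sum>j<k. v j * rlog k \<Phi> t (evec j) c1 i) = 0)" if v: "v \<in> Rn k" for v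
  proof
    assume "\<forall>i<dm. (\<Sum>j<k. v j * rlog k \<Phi> t (evec j) c1 i) = 0"
    then show "rlog k \<Phi> t v = (\<lambda>_ _. 0)"
      using rlog_expansion[OF P t v] by (intro tangent_one_eqI rlog_tangent[OF P t] tangent_zero) auto
  qed (use rlog_expansion[OF P t v] in metis)
  show ?thesis unfolding immersive_def
  proof safe
    fix a j assume a: "\<forall>v\<in>Rn k. rlog k \<Phi> t v = (\<lambda>_ _. 0) \<longrightarrow> v = (\<lambda>_. 0)"
      and s: "\<forall>i<dm. (\<Sum>j<k. a j * rlog k \<Phi> t (evec j) c1 i) = 0" and j: "j < k"
    define v where "v = (\<lambda>j. if j < k then a j else 0)"
    have v: "v \<in> Rn k" by (simp add: v_def mem_Rn)
    have "rlog k \<Phi> t v = (\<lambda>_ _. 0)" using s z[OF v] by (simp add: v_def)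
    then have "v = (\<lambda>_. 0)" using a v by blast
    then show "a j = 0" using j by (metis v_def)
  next
    fix v assume a: "\<forall>a. (\<forall>i<dm. (\<Sum>j<k. a j * rlog k \<Phi> t (evec j) c1 i) = 0) \<longrightarrow> (\<forall>j<k. a j = 0)"
      and v: "v \<in> Rn k" "rlog k \<Phi> t v = (\<lambda>_ _. 0)"
    then have "\<forall>j<k. v j = 0" using z[OF v(1)] by blast
    then show "v = (\<lambda>_. 0)" using Rn_ext[OF v(1) zero_mem_Rn] by blast
  qed
qed

text \<open>This bound is what makes a maximal rank exist among the smooth maps with values in
  \<open>H\<close>.\<close>

lemma immersive_le:
  assumes "LP k W \<Phi>" "t \<in> W" "immersive k \<Phi> t"
  shows "k \<le> dm"
proof (rule ccontr)
  assume "\<not> k \<le> dm"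
  then obtain c where "\<exists>j\<in>{..<k}. c j \<noteq> 0" "\<forall>i<dm. (\<Sum>j<k. c j * rlog k \<Phi> t (evec j) c1 i) = 0"
    using linear_relation_exists[of "{..<k}" dm "\<lambda>j. rlog k \<Phi> t (evec j) c1"] by auto
  then show False using assms immersive_iff by blast
qed

text \<open>Take an \<open>H\<close>-valued smooth map \<open>\<Phi>\<close> of maximal rank. Multiplying it by an \<open>H\<close>-valued curve with
  velocity \<open>Z\<close> cannot increase the rank, so \<open>Z\<close> is tangent to the image of \<open>\<Phi>\<close>, and an integral curve
  of \<open>Z\<close> runs inside the image of \<open>\<Phi>\<close>, that is, inside \<open>H\<close>.\<close>

lemma curve_in_subgroup_algebra:
  assumes H: "subgroup H G" and r: "r > 0" and c: "LP 1 (interval1 (-r) r) (\<lambda>x. c (x 0))"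
    and cH: "\<And>t. \<bar>t\<bar> < r \<Longrightarrow> c t \<in> H" and c0: "c 0 = \<one>"
  shows "rlog 1 (\<lambda>x. c (x 0)) (pt 0) (evec 0) \<in> subgroup_algebra G H"
proof -
  let ?I = "interval1 (-r) r"
  let ?c = "\<lambda>x. c (x 0)"
  have I0: "pt 0 \<in> ?I" using r by simp
  define Z where "Z = rlog 1 ?c (pt 0) (evec 0)"
  have Z: "Z \<in> TS \<one>" unfolding Z_def by (rule rlog_tangent[OF c I0])
  \<comment> \<open>The ranks \<open>k\<close> attained by plots with values in \<open>H\<close>.
    The constant plot gives rank 0, and the dimension of \<open>G\<close> is an upper bound.\<close>
  define good where "good = (\<lambda>k. \<exists>W \<Phi> t0. LP k W \<Phi> \<and> \<Phi> ` W \<subseteq> H \<and> t0 \<in> W \<and> immersive k \<Phi> t0)"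
  have "good 0"
    unfolding good_def
    by (intro exI[of _ "Rn 0"] exI[of _ "\<lambda>_. \<one>"] exI[of _ "\<lambda>_. 0"])
      (auto simp: immersive_def mem_Rn subgroup.one_closed[OF H] intro!: LP_const)
  moreover have "\<forall>k. good k \<longrightarrow> k \<le> dm" unfolding good_def using immersive_le by blast
  ultimately obtain k where k: "good k" "\<And>l. good l \<Longrightarrow> l \<le> k"
    using GreatestI_nat[of good 0 dm] Greatest_le_nat[of good _ dm] that[of "Greatest good"] by blast
  from k(1) obtain W \<Phi> t0 where P: "LP k W \<Phi>" and PH: "\<Phi> ` W \<subseteq> H" and t0: "t0 \<in> W" and imm: "immersive k \<Phi> t0"
    unfolding good_def by blast
  note W = LP_open[OF P]
  define M where "M = (\<lambda>j t. rlog k \<Phi> t (evec j) c1)"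
  have Ms: "smooth_on k W (\<lambda>t. M j t i)" if "j < k" for j i
    unfolding M_def by (rule smooth_rlog[OF P evec_Rn[OF that]])
  have "\<exists>V L. openin (Euclidean_space k) V \<and> t0 \<in> V \<and> V \<subseteq> W \<and>
     (\<forall>j<k. \<forall>i<dm. smooth_on k V (\<lambda>t. L j t i)) \<and>
     (\<forall>t\<in>V. \<forall>j<k. \<forall>l<k. (\<Sum>i<dm. L j t i * M l t i) = (if j = l then 1 else 0))"
  proof (rule smooth_dual_frame[OF W t0])
    show "smooth_on k W (\<lambda>t. M j t i)" if "j < k" for j i by (rule Ms[OF that])
    show "\<forall>j<k. a j = 0" if "\<forall>i<dm. (\<Sum>j<k. a j * M j t0 i) = 0" for a
      using imm that unfolding immersive_iff[OF P t0] M_def by blast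
  qed
  then obtain V L where VL: "openin (Euclidean_space k) V \<and> t0 \<in> V \<and> V \<subseteq> W \<and>
     (\<forall>j<k. \<forall>i<dm. smooth_on k V (\<lambda>t. L j t i)) \<and>
     (\<forall>t\<in>V. \<forall>j<k. \<forall>l<k. (\<Sum>i<dm. L j t i * M l t i) = (if j = l then 1 else 0))"
    by (elim exE)
  then have V: "openin (Euclidean_space k) V" "t0 \<in> V" "V \<subseteq> W"
    and L: "\<And>j i. j < k \<Longrightarrow> i < dm \<Longrightarrow> smooth_on k V (\<lambda>t. L j t i)"
    and dual: "\<And>t j l. t \<in> V \<Longrightarrow> j < k \<Longrightarrow> l < k \<Longrightarrow> (\<Sum>i<dm. L j t i * M l t i) = (if j = l then 1 else 0)"
    by simp_all
  \<comment> \<open>The candidate for the parameter velocity that \<open>\<Phi>\<close> maps to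
    \<open>Z\<close>. It is smooth because the dual frame is; that it does map to \<open>Z\<close>
    is shown in \<open>tang\<close>.\<close>
  define a where "a = (\<lambda>j t. \<Sum>i<dm. L j t i * Z c1 i)"
  have as: "smooth_on k V (a j)" if "j < k" for j
    unfolding a_def by (intro smooth_on_sum smooth_on_mult V smooth_on_const L that) auto
  have coords: "v j = (\<Sum>i<dm. L j t i * rlog k \<Phi> t v c1 i)" if t: "t \<in> V" and v: "v \<in> Rn k" and j: "j < k" for t v j
  proof -
    have tW: "t \<in> W" using t V by blast
    have "(\<Sum>i<dm. L j t i * rlog k \<Phi> t v c1 i) = (\<Sum>i<dm. \<Sum>l<k. v l * (L j t i * M l t i))"
      unfolding rlog_expansion[OF P tW v] M_def by (simp add: sum_distrib_left mult_ac)
    also have "\<dots> = (\<Sum>l<k. v l * (\<Sum>i<dm. L j t i * M l t i))"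
      by (subst sum.swap) (simp add: sum_distrib_left)
    also have "\<dots> = (\<Sum>l<k. v l * (if j = l then 1 else 0))" using dual[OF t j] by (intro sum.cong) auto
    also have "\<dots> = v j" using j by (simp add: if_distrib cong: if_cong)
    finally show ?thesis by simp
  qed
  have tang: "rlog k \<Phi> t (\<lambda>j. if j < k then a j t else 0) = Z" if t: "t \<in> V" for t
  proof -
    have tW: "t \<in> W" using t V by blast
    define \<Psi> where "\<Psi> = (\<lambda>z. c (snd_part k z 0) \<otimes> \<Phi> (fst_part k z))"
    have P1: "LP (k + 1) (prod_dom k 1 W ?I) (\<lambda>z. \<Phi> (fst_part k z))" by (rule LP_fst[OF P openin_interval1(2)])
    have P2: "LP (k + 1) (prod_dom k 1 W ?I) (\<lambda>z. ?c (snd_part k z))" by (rule LP_snd[OF c W])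
    have P3: "LP (k + 1) (prod_dom k 1 W ?I) \<Psi>" unfolding \<Psi>_def by (rule LP_mult[OF P2 P1])
    have PsiH: "\<Psi> ` prod_dom k 1 W ?I \<subseteq> H"
    proof safe
      fix z assume "z \<in> prod_dom k 1 W ?I"
      then have "fst_part k z \<in> W" "\<bar>snd_part k z 0\<bar> < r" by (auto simp: prod_dom_def interval1_def)
      then show "\<Psi> z \<in> H" unfolding \<Psi>_def using subgroup.m_closed[OF H cH] PH by blast
    qed
    let ?z = "join k t (pt 0)"
    have z: "?z \<in> prod_dom k 1 W ?I" by (rule prod_dom_join[OF W openin_interval1(2) tW I0])
    \<comment> \<open>Otherwise the rank \<open>k + 1\<close> would be attained. The argument
      applies at every \<open>t\<close> in \<open>V\<close>, not only at \<open>t0\<close>, as the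
      differential equation below requires.\<close>
    have "\<not> immersive (k + 1) \<Psi> ?z"
      using k(2)[of "k + 1"] P3 PsiH z unfolding good_def by (metis not_less_eq_eq Suc_eq_plus1 le_refl)
    then obtain w where w: "w \<in> Rn (k + 1)" "rlog (k + 1) \<Psi> ?z w = (\<lambda>_ _. 0)" "w \<noteq> (\<lambda>_. 0)"
      unfolding immersive_def by blast
    define v s where "v = fst_part k w" and "s = w k"
    have v: "v \<in> Rn k" by (simp add: v_def fst_part_Rn)
    have sw: "snd_part k w = (\<lambda>j. s * evec 0 j + 0 * evec 0 j)"
      using w(1) by (auto simp: snd_part_def s_def evec_def mem_Rn fun_eq_iff)
    have f: "fst_part k ?z = t" using openin_subset_Rn[OF W tW] by (simp add: fst_part_join)
    have 1: "rlog (k + 1) (\<lambda>z. \<Phi> (fst_part k z)) ?z w = rlog k \<Phi> t v"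
      using rlog_chain[OF P smooth_map_fst_part[OF W openin_interval1(2)] z, of w] jac_fst_part[OF w(1)] f by (simp add: v_def)
    have "rlog (k + 1) (\<lambda>z. ?c (snd_part k z)) ?z w = rlog 1 ?c (snd_part k ?z) (jac (k + 1) (snd_part k) ?z w)"
      by (rule rlog_chain[OF c smooth_map_snd_part[OF W openin_interval1(2)] z])
    also have "\<dots> = rlog 1 ?c (pt 0) (\<lambda>j. s * evec 0 j + 0 * evec 0 j)"
      by (simp only: jac_snd_part[OF w(1)] sw snd_part_join)
    also have "\<dots> = (\<lambda>c i. s * Z c i)" unfolding rlog_lincomb Z_def by simp
    finally have 2: "rlog (k + 1) (\<lambda>z. ?c (snd_part k z)) ?z w = (\<lambda>c i. s * Z c i)" .
    have "rlog (k + 1) \<Psi> ?z w = (\<lambda>c' i. rlog (k + 1) (\<lambda>z. ?c (snd_part k z)) ?z w c' i + Ad (c (snd_part k ?z 0)) (rlog (k + 1) (\<lambda>z. \<Phi> (fst_part k z)) ?z w) c' i)"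
      unfolding \<Psi>_def by (rule rlog_mult[OF P2 P1 z w(1)])
    also have "\<dots> = (\<lambda>c' i. s * Z c' i + rlog k \<Phi> t v c' i)"
      unfolding 1 2 snd_part_join pt_0 c0 Ad_one[OF rlog_tangent[OF P tW]] ..
    finally have sum0: "s * Z c' i + rlog k \<Phi> t v c' i = 0" for c' i
      unfolding w(2) by (metis (mono_tags))
    \<comment> \<open>If \<open>s = 0\<close>, the derivative of \<open>\<Phi>\<close> at
      \<open>t\<close> kills \<open>v\<close>; the dual frame then gives \<open>v = 0\<close>, so
      \<open>w\<close> is 0 as well. Dividing by \<open>s\<close> exhibits \<open>Z\<close> as the
      image of a parameter velocity.\<close>
    have s0: "s \<noteq> 0"
    proof
      assume "s = 0"
      then have "\<forall>j<k. v j = 0" using coords[OF t v] sum0 by simp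
      have "w i = 0" for i
      proof -
        consider "i < k" | "i = k" | "i \<ge> k + 1" by linarith
        then show ?thesis
        proof cases
          case 1
          then show ?thesis using \<open>\<forall>j<k. v j = 0\<close> by (simp add: v_def fst_part_def)
        next
          case 2
          then show ?thesis using \<open>s = 0\<close> by (simp add: s_def)
        next
          case 3
          then show ?thesis using w(1) unfolding mem_Rn by blast
        qed
      qed
      then show False using w(3) by blast
    qed
    define b where "b = (\<lambda>j. (- 1 / s) * v j + 0 * v j)"
    have b: "b \<in> Rn k" unfolding b_def by (rule Rn_lincomb[OF v v])
    have bZ: "rlog k \<Phi> t b = Z"
    proof (intro ext)
      fix c' i
      have "rlog k \<Phi> t v c' i = - s * Z c' i" using sum0[of c' i] by simp
      then show "rlog k \<Phi> t b c' i = Z c' i" unfolding b_def rlog_lincomb using s0 by simp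
    qed
    have "(\<lambda>j. if j < k then a j t else 0) = b"
      by (rule Rn_ext[OF _ b]) (auto simp: mem_Rn a_def coords[OF t b] bZ)
    then show ?thesis using bZ by simp
  qed
  have "\<exists>e>0. \<exists>x. x 0 = t0 \<and> (\<forall>t. \<bar>t\<bar> < e \<longrightarrow> x t \<in> V \<and>
     (\<forall>j<k. ((\<lambda>t. x t j) has_real_derivative a j (x t)) (at t)))"
    by (rule ode_exists[OF V(1,2)]) (use as in \<open>simp add: smooth_on_def del: Ck_on.simps\<close>)
  then obtain e x where e: "e > 0" and x0: "x 0 = t0" and R: "\<And>t. \<bar>t\<bar> < e \<Longrightarrow> x t \<in> V"
    and d: "\<And>t j. \<bar>t\<bar> < e \<Longrightarrow> j < k \<Longrightarrow> ((\<lambda>t. x t j) has_real_derivative a j (x t)) (at t)" by blast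
  have "rlog 1 (\<lambda>s. \<Phi> (x (s 0))) (pt t) (evec 0) = Z" if "\<bar>t\<bar> < e" for t
  proof -
    have "rlog 1 (\<lambda>s. \<Phi> (x (s 0))) (pt t) (evec 0) = rlog k \<Phi> (x t) (\<lambda>j. if j < k then a j (x t) else 0)"
      by (rule ode_velocity(2)[where e = e, OF P as V(1,3) R d that])
    then show ?thesis using tang[OF R[OF that]] by simp
  qed
  moreover have "LP 1 (interval1 (-e) e) (\<lambda>s. \<Phi> (x (s 0)))"
    by (rule ode_velocity(1)[where e = e, OF P as V(1,3) R d])
  ultimately have ic: "icurve Z (-e) e (\<lambda>t. \<Phi> (x t))"
    unfolding icurve_def by (auto simp: abs_less_iff)
  have H0: "\<Phi> t0 \<in> H" using PH t0 by blast
  then have g0: "\<Phi> t0 \<in> carrier G" using subgroup.mem_carrier[OF H] by blast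
  have "Z \<in> subgroup_algebra G H"
  proof (rule icurve_subgroup_algebra[OF H Z e icurve_rmult[OF ic inv_closed[OF g0]]])
    show "\<Phi> (x 0) \<otimes> inv (\<Phi> t0) = \<one>" using g0 by (simp add: x0)
    show "\<Phi> (x t) \<otimes> inv (\<Phi> t0) \<in> H" if "\<bar>t\<bar> < e" for t
    proof -
      have "\<Phi> (x t) \<in> H" using PH R[OF that] V(3) by blast
      then show ?thesis using subgroup.m_closed[OF H _ subgroup.m_inv_closed[OF H H0]] by blast
    qed
  qed
  then show ?thesis by (simp add: Z_def)
qed

text \<open>Curves suffice: restrict \<open>P\<close> to the line through \<open>u\<close> in
  direction \<open>w\<close> and translate on the right so that the curve starts at the identity,
  which does not change the logarithmic derivative.\<close>

lemma rlog_in_subgroup_algebra: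
  assumes H: "subgroup H G" and P: "LP m U P" and PH: "\<And>u. u \<in> U \<Longrightarrow> P u \<in> H" and u: "u \<in> U" and w: "w \<in> Rn m"
  shows "rlog m P u w \<in> subgroup_algebra G H"
proof -
  note U = LP_open[OF P]
  have uR: "u \<in> Rn m" using openin_subset_Rn[OF U u] .
  define l where "l = (\<lambda>x::nat \<Rightarrow> real. \<lambda>j. u j + x 0 * w j)"
  have lR: "l x \<in> Rn m" for x using uR w by (simp add: l_def mem_Rn)
  have ls: "smooth_on 1 (Rn 1) (\<lambda>x. l x j)" for j
    unfolding l_def by (intro smooth_on_add smooth_on_mult smooth_on_const smooth_on_coord openin_Rn)
  have l1: "smooth_map 1 (Rn 1) m (Rn m) l" using lR ls by (auto simp: smooth_map_def)
  let ?W = "{x \<in> Rn 1. l x \<in> U}"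
  have W: "openin (Euclidean_space 1) ?W" by (rule smooth_map_preimage[OF l1 U])
  have "l (pt 0) = u" by (simp add: l_def)
  then have "pt 0 \<in> ?W" using u by simp
  then obtain r where r: "r > 0" "cube 1 (pt 0) r \<subseteq> ?W" using openin_cubeE[OF W] by blast
  let ?I = "interval1 (-r) r"
  have IW: "?I \<subseteq> ?W" using r(2) by (auto simp: interval1_def cube_def subset_iff abs_less_iff)
  have l2: "smooth_map 1 ?I m U l" by (rule smooth_map_restrict[OF l1 openin_interval1(2) _ U]) (use IW in auto)
  define c where "c = (\<lambda>t. P (l (pt t)) \<otimes> inv (P u))"
  have lpt: "l (pt (x 0)) = l x" for x by (simp add: l_def)
  have PL: "LP 1 ?I (\<lambda>x. P (l x))" by (rule LP_compose[OF P l2 refl])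
  have PuH: "P u \<in> H" using PH[OF u] .
  have Pu: "P u \<in> carrier G" using LP_carrier[OF P u] .
  have cL: "LP 1 ?I (\<lambda>x. c (x 0))" unfolding c_def lpt by (rule LP_rmult[OF _ PL]) (simp add: Pu)
  have cH: "c t \<in> H" if "\<bar>t\<bar> < r" for t
  proof -
    have "pt t \<in> ?I" using that by auto
    then have "P (l (pt t)) \<in> H" using IW PH by blast
    then show ?thesis unfolding c_def using subgroup.m_closed[OF H _ subgroup.m_inv_closed[OF H PuH]] by blast
  qed
  have c0: "c 0 = \<one>" using Pu \<open>l (pt 0) = u\<close> by (simp add: c_def)
  have I0: "pt 0 \<in> ?I" using r by simp
  have "jac 1 l (pt 0) (evec 0) = w"
  proof
    fix j
    have "partial 0 (\<lambda>x. l x j) (pt 0) = w j"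
      unfolding l_def by (rule has_partial_imp_partial) (auto intro!: derivative_eq_intros)
    then show "jac 1 l (pt 0) (evec 0) j = w j" by (simp add: jac_def dirderiv_def evec_def)
  qed
  then have "rlog 1 (\<lambda>x. P (l x)) (pt 0) (evec 0) = rlog m P u w"
    using rlog_chain[OF P l2 I0, of "evec 0"] \<open>l (pt 0) = u\<close> by simp
  moreover have "rlog 1 (\<lambda>x. c (x 0)) (pt 0) (evec 0) = rlog 1 (\<lambda>x. P (l x)) (pt 0) (evec 0)"
    unfolding c_def lpt by (rule rlog_right_translate[OF PL I0]) (simp add: Pu)
  ultimately show ?thesis using curve_in_subgroup_algebra[OF H r(1) cL cH c0] by simp
qed

end

subsection \<open>The model\<close>

locale lie_dense = lie G for G :: "('g, 'm) lie_scheme" (structure) +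
  fixes H :: "'g set"
  assumes subgroup: "subgroup H G"
    and dense: "lie_topology G closure_of H = carrier G"
begin

lemma LP_constant: "g \<in> carrier G \<Longrightarrow> openin (Euclidean_space n) U \<Longrightarrow> LP n U (\<lambda>_. g)"
  by (rule LP_const) simp_all

abbreviation lcos :: "'g \<Rightarrow> 'g set" where "lcos q \<equiv> q <# H"

lemma H_carrier: "h \<in> H \<Longrightarrow> h \<in> carrier G"
  using subgroup.mem_carrier[OF subgroup] .

lemma mem_lcos: "x \<in> lcos q \<longleftrightarrow> (\<exists>h\<in>H. x = q \<otimes> h)"
  by (auto simp: l_coset_def)

lemma lcos_eq_iff:
  assumes q: "q \<in> carrier G" and r: "r \<in> carrier G"
  shows "lcos q = lcos r \<longleftrightarrow> inv q \<otimes> r \<in> H"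
proof
  assume "lcos q = lcos r"
  moreover have "r \<in> lcos r" unfolding mem_lcos using subgroup.one_closed[OF subgroup] r by (intro bexI[of _ \<one>]) auto
  ultimately obtain h where h: "h \<in> H" "r = q \<otimes> h" using mem_lcos by blast
  then have "inv q \<otimes> r = h" using q H_carrier[OF h(1)] by (simp add: m_assoc[symmetric])
  then show "inv q \<otimes> r \<in> H" using h by simp
next
  assume h: "inv q \<otimes> r \<in> H"
  define k where "k = inv q \<otimes> r"
  have k: "k \<in> H" "k \<in> carrier G" using h H_carrier by (auto simp: k_def)
  have rq: "r = q \<otimes> k" using q r by (simp add: k_def m_assoc[symmetric])
  then have qr: "q = r \<otimes> inv k" using q k by (simp add: m_assoc)
  have ik: "inv k \<in> H" using subgroup.m_inv_closed[OF subgroup k(1)] .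
  have A: "q \<otimes> x \<in> lcos r" if x: "x \<in> H" for x
  proof -
    have "q \<otimes> x = r \<otimes> (inv k \<otimes> x)" using qr r k H_carrier[OF x] by (metis inv_closed m_assoc)
    then show ?thesis unfolding mem_lcos using subgroup.m_closed[OF subgroup ik x] by blast
  qed
  have B: "r \<otimes> x \<in> lcos q" if x: "x \<in> H" for x
  proof -
    have "r \<otimes> x = q \<otimes> (k \<otimes> x)" using rq q k H_carrier[OF x] by (metis m_assoc)
    then show ?thesis unfolding mem_lcos using subgroup.m_closed[OF subgroup k(1) x] by blast
  qed
  show "lcos q = lcos r"
  proof (intro equalityI subsetI)
    show "y \<in> lcos r" if "y \<in> lcos q" for y using that A unfolding mem_lcos[of y q] by blast
    show "y \<in> lcos q" if "y \<in> lcos r" for y using that B unfolding mem_lcos[of y r] by blast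
  qed
qed

lemma lcos_right: "q \<in> carrier G \<Longrightarrow> h \<in> H \<Longrightarrow> lcos (q \<otimes> h) = lcos q"
  using lcos_eq_iff[of q "q \<otimes> h"] H_carrier[of h] by (simp add: m_assoc[symmetric])

lemma lmult_lcos: "g \<in> carrier G \<Longrightarrow> q \<in> carrier G \<Longrightarrow> g <# lcos q = lcos (g \<otimes> q)"
  using lcos_m_assoc[of H g q] H_carrier by blast

section \<open>The annihilator of the subgroup algebra and the coadjoint action\<close>

definition hperp :: "'g covec set"
  where "hperp = {\<mu> \<in> CS \<one>. \<forall>Z\<in>subgroup_algebra G H. \<mu> Z = 0}"

lemma hperp_CS: "\<mu> \<in> hperp \<Longrightarrow> \<mu> \<in> CS \<one>"
  by (simp add: hperp_def)

lemma halg_TS: "Z \<in> subgroup_algebra G H \<Longrightarrow> Z \<in> TS \<one>"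
  by (simp add: mem_subgroup_algebra)

text \<open>Density enters here: \<open>g \<mapsto> \<langle>\<mu>, Ad(g) Z\<rangle>\<close> is continuous and vanishes on \<open>H\<close>.\<close>

lemma hperp_Ad:
  assumes \<mu>: "\<mu> \<in> hperp" and Z: "Z \<in> subgroup_algebra G H" and g: "g \<in> carrier G"
  shows "\<mu> (Ad g Z) = 0"
proof (rule dense_constant[OF dense _ _ g])
  fix c assume c: "c \<in> charts G"
  have "smooth_on dm (img c) (\<lambda>x. \<mu> (Ad (chart_inv c x) Z))"
    using smooth_pairing[OF chart_open[OF c], of "\<lambda>_. \<mu>" "\<lambda>x. Ad (chart_inv c x) Z"]
      smooth_Ad[OF LP_chart_inv[OF c] halg_TS[OF Z]] hperp_CS[OF \<mu>]
      Ad_tangent[OF halg_TS[OF Z] LP_carrier[OF LP_chart_inv[OF c]]] by simp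
  then show "continuous_on (img c) (\<lambda>x. \<mu> (Ad (chart_inv c x) Z))" by (rule smooth_on_continuous)
next
  show "\<mu> (Ad h Z) = 0" if "h \<in> H" for h
    using \<mu> subgroup_algebra_Ad[OF subgroup that Z] by (simp add: hperp_def)
qed

definition coad :: "'g \<Rightarrow> 'g covec \<Rightarrow> 'g covec"
  where "coad g \<mu> = (\<lambda>Z. if Z \<in> TS \<one> then \<mu> (Ad (inv g) Z) else 0)"

lemma coad_CS:
  assumes \<mu>: "\<mu> \<in> CS \<one>" and g: "g \<in> carrier G"
  shows "coad g \<mu> \<in> CS \<one>"
  unfolding cotangent_space_def
proof (intro CollectI conjI allI ballI impI)
  fix v w a b assume v: "v \<in> TS \<one>" and w: "w \<in> TS \<one>"
  then show "coad g \<mu> (\<lambda>c i. a * v c i + b * w c i) = a * coad g \<mu> v + b * coad g \<mu> w"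
    using tangent_lincomb[OF v w] covector_lincomb[OF \<mu> Ad_tangent[OF v] Ad_tangent[OF w]] g
    by (simp add: coad_def Ad_lincomb)
qed (simp add: coad_def)

lemma coad_hperp: "\<mu> \<in> hperp \<Longrightarrow> g \<in> carrier G \<Longrightarrow> coad g \<mu> \<in> hperp"
  using coad_CS[OF hperp_CS, of \<mu> g] hperp_Ad[of \<mu> _ "inv g"] by (simp add: hperp_def coad_def)

lemma coad_one: assumes "\<mu> \<in> CS \<one>" shows "coad \<one> \<mu> = \<mu>"
  by (rule covector_ext[OF coad_CS[OF assms one_closed] assms]) (simp add: coad_def Ad_one)

lemma coad_mult:
  assumes \<mu>: "\<mu> \<in> CS \<one>" and g: "g \<in> carrier G" and h: "h \<in> carrier G"
  shows "coad (g \<otimes> h) \<mu> = coad g (coad h \<mu>)"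
proof (rule covector_ext[OF coad_CS[OF \<mu> m_closed[OF g h]] coad_CS[OF coad_CS[OF \<mu> h] g]])
  fix v assume v: "v \<in> TS \<one>"
  then show "coad (g \<otimes> h) \<mu> v = coad g (coad h \<mu>) v"
    using Ad_mult[OF v inv_closed[OF h] inv_closed[OF g]] Ad_tangent[OF v inv_closed[OF g]] g h
    by (simp add: coad_def inv_mult_group)
qed

lemma coad_Ad:
  assumes Z: "Z \<in> TS \<one>" and g: "g \<in> carrier G"
  shows "coad g \<mu> (Ad g Z) = \<mu> Z"
  using Ad_mult[OF Z inv_closed[OF g] g] Ad_one[OF Z] Ad_tangent[OF Z g] g by (simp add: coad_def)

text \<open>The product diffeology of \<open>G\<close> and the finite-dimensional space
  \<open>hperp\<close>. No basis of the latter is chosen, so smoothness of the second component is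
  tested on each fixed vector \<open>Z\<close>.\<close>

definition MD :: "('g \<times> 'g covec) diffeology"
  where "MD = \<lparr>Pts = carrier G \<times> hperp,
    Plots = (\<lambda>n U R. LP n U (\<lambda>u. fst (R u)) \<and> (\<forall>u\<in>U. snd (R u) \<in> hperp) \<and>
      (\<forall>Z\<in>TS \<one>. smooth_on n U (\<lambda>u. snd (R u) Z)))\<rparr>"

lemma Pts_MD: "Pts MD = carrier G \<times> hperp"
  by (simp add: MD_def)

lemma Plots_MD: "Plots MD n U R \<longleftrightarrow> LP n U (\<lambda>u. fst (R u)) \<and> (\<forall>u\<in>U. snd (R u) \<in> hperp) \<and>
      (\<forall>Z\<in>TS \<one>. smooth_on n U (\<lambda>u. snd (R u) Z))"
  by (simp add: MD_def)

lemma MD_open: "Plots MD n U R \<Longrightarrow> openin (Euclidean_space n) U"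
  using LP_open Plots_MD by blast

lemma diffeological_MD: "diffeological_space MD"
  unfolding diffeological_space_def
proof (intro conjI allI impI ballI)
  fix n U R assume R: "Plots MD n U R"
  show "openin (Euclidean_space n) U" by (rule MD_open[OF R])
  show "R ` U \<subseteq> Pts MD"
    using R LP_carrier[of n U "\<lambda>u. fst (R u)"] by (simp add: Plots_MD Pts_MD mem_Times_iff image_subset_iff)
next
  fix n U x assume "x \<in> Pts MD" "openin (Euclidean_space n) U"
  then show "Plots MD n U (\<lambda>_. x)" by (auto simp: Plots_MD Pts_MD intro: LP_const)
next
  fix n U R
  assume a: "openin (Euclidean_space n) U \<and>
       (\<forall>u\<in>U. \<exists>V. openin (Euclidean_space n) V \<and> u \<in> V \<and> V \<subseteq> U \<and> Plots MD n V R)"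
  then have U: "openin (Euclidean_space n) U" by blast
  show "Plots MD n U R" unfolding Plots_MD
  proof (intro conjI ballI)
    show "LP n U (\<lambda>u. fst (R u))" by (rule LP_local[OF U]) (use a Plots_MD in blast)
    show "snd (R u) \<in> hperp" if "u \<in> U" for u using a that Plots_MD by blast
    show "smooth_on n U (\<lambda>u. snd (R u) Z)" if "Z \<in> TS \<one>" for Z
    proof (rule smooth_on_local[OF U])
      fix u assume "u \<in> U"
      then obtain V where "openin (Euclidean_space n) V" "u \<in> V" "V \<subseteq> U" "Plots MD n V R" using a by blast
      then show "\<exists>V. openin (Euclidean_space n) V \<and> u \<in> V \<and> V \<subseteq> U \<and> smooth_on n V (\<lambda>u. snd (R u) Z)"
        using that by (intro exI[of _ V]) (simp add: Plots_MD)
    qed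
  qed
next
  fix n U R m V f Q
  assume a: "Plots MD n U R \<and> smooth_map m V n U f \<and> (\<forall>v\<in>V. Q v = R (f v))"
  then have R: "Plots MD n U R" and f: "smooth_map m V n U f" and Q: "\<And>v. v \<in> V \<Longrightarrow> Q v = R (f v)" by auto
  show "Plots MD m V Q" unfolding Plots_MD
  proof (intro conjI ballI)
    show "LP m V (\<lambda>u. fst (Q u))" by (rule LP_compose[OF _ f]) (use R Q in \<open>auto simp: Plots_MD\<close>)
    show "snd (Q v) \<in> hperp" if "v \<in> V" for v using R Q[OF that] smooth_map_open(3)[OF f that] by (simp add: Plots_MD)
    show "smooth_on m V (\<lambda>v. snd (Q v) Z)" if Z: "Z \<in> TS \<one>" for Z
    proof -
      have "smooth_on m V (\<lambda>v. snd (R (f v)) Z)"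
        by (rule smooth_on_compose[OF f]) (use R Z in \<open>simp add: Plots_MD\<close>)
      then show ?thesis
        using smooth_on_cong[OF smooth_map_open(1)[OF f], of "\<lambda>v. snd (Q v) Z" "\<lambda>v. snd (R (f v)) Z"] Q by simp
    qed
  qed
qed

definition lam :: "('g \<times> 'g covec) form"
  where "lam = (\<lambda>n U R. if Plots MD n U R
    then (\<lambda>u vs. if u \<in> U \<and> vs \<in> vecs n 1 then snd (R u) (rlog n (\<lambda>x. fst (R x)) u (hd vs)) else 0)
    else (\<lambda>_ _. 0))"

lemma lam_apply: "Plots MD n U R \<Longrightarrow> u \<in> U \<Longrightarrow> w \<in> Rn n \<Longrightarrow> lam n U R u [w] = snd (R u) (rlog n (\<lambda>x. fst (R x)) u w)"
  by (simp add: lam_def vecs_def)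

lemma is_form_lam: "is_form MD 1 lam"
  unfolding is_form_def
proof (intro conjI allI impI ballI)
  fix n U R assume R: "Plots MD n U R"
  then have q: "LP n U (\<lambda>x. fst (R x))" and m: "\<And>u. u \<in> U \<Longrightarrow> snd (R u) \<in> CS \<one>"
    and s: "\<And>Z. Z \<in> TS \<one> \<Longrightarrow> smooth_on n U (\<lambda>u. snd (R u) Z)"
    by (auto simp: Plots_MD hperp_CS)
  note U = MD_open[OF R]
  show "smooth_form n 1 U (lam n U R)" unfolding smooth_form_def
  proof (intro conjI allI impI ballI)
    fix u vs assume "\<not> (u \<in> U \<and> vs \<in> vecs n 1)"
    then show "lam n U R u vs = 0" by (auto simp: lam_def)
  next
    fix vs assume "vs \<in> vecs n 1"
    then obtain w where w: "w \<in> Rn n" "vs = [w]" using mem_vecs1 by blast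
    have "smooth_on n U (\<lambda>u. snd (R u) (rlog n (\<lambda>x. fst (R x)) u w))"
      by (rule smooth_pairing[OF U m s rlog_tangent[OF q] smooth_rlog[OF q w(1)]])
    then show "smooth_on n U (\<lambda>u. lam n U R u vs)"
      using smooth_on_cong[OF U, of "\<lambda>u. lam n U R u vs" "\<lambda>u. snd (R u) (rlog n (\<lambda>x. fst (R x)) u w)"]
        lam_apply[OF R _ w(1)] w(2) by simp
  next
    fix u vs i x y and a b :: real
    assume u: "u \<in> U" and vs: "vs \<in> vecs n 1" and i: "i < (1::nat)" and x: "x \<in> Rn n" and y: "y \<in> Rn n"
    obtain w where w: "vs = [w]" using vs mem_vecs1 by blast
    have "lam n U R u [\<lambda>j. a * x j + b * y j] = a * lam n U R u [x] + b * lam n U R u [y]"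
      unfolding lam_apply[OF R u x] lam_apply[OF R u y] lam_apply[OF R u Rn_lincomb[OF x y]] rlog_lincomb
      by (rule covector_lincomb[OF m[OF u] rlog_tangent[OF q u] rlog_tangent[OF q u]])
    then show "lam n U R u (vs[i := (\<lambda>j. a * x j + b * y j)]) = a * lam n U R u (vs[i := x]) + b * lam n U R u (vs[i := y])"
      using i w by simp
  qed auto
next
  fix n U R assume "\<not> Plots MD n U R"
  then show "lam n U R = (\<lambda>_ _. 0)" by (simp add: lam_def)
next
  fix n U R m V f Q v vs
  assume a: "Plots MD n U R \<and> smooth_map m V n U f \<and> (\<forall>v\<in>V. Q v = R (f v))" and v: "v \<in> V" and vs: "vs \<in> vecs m 1"
  then have R: "Plots MD n U R" and f: "smooth_map m V n U f" and Qe: "\<And>v. v \<in> V \<Longrightarrow> Q v = R (f v)" by auto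
  have Q: "Plots MD m V Q" by (rule plot_compose[OF diffeological_MD R f Qe])
  obtain w where w: "w \<in> Rn m" "vs = [w]" using vs mem_vecs1 by blast
  have q: "LP n U (\<lambda>x. fst (R x))" using R by (simp add: Plots_MD)
  have "rlog m (\<lambda>x. fst (Q x)) v w = rlog m (\<lambda>x. fst (R (f x))) v w"
    by (rule rlog_cong[OF smooth_map_open(1)[OF f] v]) (simp add: Qe)
  also have "\<dots> = rlog n (\<lambda>x. fst (R x)) (f v) (jac m f v w)" by (rule rlog_chain[OF q f v])
  finally show "lam m V Q v vs = lam n U R (f v) (map (jac m f v) vs)"
    unfolding w(2) using lam_apply[OF Q v w(1)] lam_apply[OF R smooth_map_open(3)[OF f v] jac_smooth_Rn[OF f v]] Qe[OF v]
    by simp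
qed

definition same_fibre :: "'g \<times> 'g covec \<Rightarrow> 'g \<times> 'g covec \<Rightarrow> bool"
  where "same_fibre x y \<longleftrightarrow> lcos (fst x) = lcos (fst y) \<and> snd x = snd y"

text \<open>Write \<open>r = q \<otimes> h\<close> with \<open>h\<close> smooth and
  \<open>H\<close>-valued. The Leibniz rule adds \<open>Ad (q u)\<close> of a vector of the subgroup
  algebra, which \<open>\<mu>\<close> annihilates by \<open>hperp_Ad\<close>. Here the rank argument
  and density meet.\<close>

lemma rlog_same_fibre:
  assumes q: "LP n U q" and r: "LP n U r" and e: "\<And>u. u \<in> U \<Longrightarrow> lcos (q u) = lcos (r u)"
    and \<mu>: "\<mu> \<in> hperp" and u: "u \<in> U" and w: "w \<in> Rn n"
  shows "\<mu> (rlog n q u w) = \<mu> (rlog n r u w)"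
proof -
  define h where "h = (\<lambda>x. inv (q x) \<otimes> r x)"
  have h: "LP n U h" unfolding h_def by (intro LP_mult LP_inv q r)
  have hH: "h x \<in> H" if "x \<in> U" for x
    using e[OF that] lcos_eq_iff LP_carrier[OF q that] LP_carrier[OF r that] by (simp add: h_def)
  have "rlog n r u w = rlog n (\<lambda>x. q x \<otimes> h x) u w"
    by (rule rlog_cong[OF LP_open[OF q] u])
       (use LP_carrier[OF q] LP_carrier[OF r] in \<open>simp add: h_def m_assoc[symmetric]\<close>)
  also have "\<dots> = (\<lambda>c i. rlog n q u w c i + Ad (q u) (rlog n h u w) c i)"
    by (rule rlog_mult[OF q h u w])
  finally have "\<mu> (rlog n r u w) = \<mu> (rlog n q u w) + \<mu> (Ad (q u) (rlog n h u w))"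
    using covector_add[OF hperp_CS[OF \<mu>] rlog_tangent[OF q u] Ad_tangent[OF rlog_tangent[OF h u] LP_carrier[OF q u]]] by simp
  then show ?thesis
    using hperp_Ad[OF \<mu> rlog_in_subgroup_algebra[OF subgroup h hH u w] LP_carrier[OF q u]] by simp
qed

lemma lam_same_fibre:
  assumes R: "Plots MD n U R" and Q: "Plots MD n U Q" and e: "\<And>u. u \<in> U \<Longrightarrow> same_fibre (R u) (Q u)"
  shows "lam n U R = lam n U Q"
proof (intro ext)
  fix u vs
  show "lam n U R u vs = lam n U Q u vs"
  proof (cases "u \<in> U \<and> vs \<in> vecs n 1")
    case True
    then obtain w where w: "w \<in> Rn n" "vs = [w]" and u: "u \<in> U" using mem_vecs1 by blast
    show ?thesis unfolding w(2) lam_apply[OF R u w(1)] lam_apply[OF Q u w(1)]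
      using rlog_same_fibre[of n U "\<lambda>x. fst (R x)" "\<lambda>x. fst (Q x)" "snd (R u)" u w] R Q e u w(1)
      by (simp add: Plots_MD same_fibre_def)
  qed (use form_zero[OF is_form_lam] in metis)
qed

definition mact :: "'g \<Rightarrow> 'g \<times> 'g covec \<Rightarrow> 'g \<times> 'g covec"
  where "mact g x = (g \<otimes> fst x, coad g (snd x))"

lemma mact_MD: "g \<in> carrier G \<Longrightarrow> x \<in> Pts MD \<Longrightarrow> mact g x \<in> Pts MD"
  by (auto simp: mact_def Pts_MD coad_hperp)

lemma mact_one: "x \<in> Pts MD \<Longrightarrow> mact \<one> x = x"
  by (auto simp: mact_def Pts_MD coad_one hperp_CS)

lemma mact_mult: "g \<in> carrier G \<Longrightarrow> h \<in> carrier G \<Longrightarrow> x \<in> Pts MD \<Longrightarrow> mact (g \<otimes> h) x = mact g (mact h x)"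
  by (auto simp: mact_def Pts_MD coad_mult hperp_CS m_assoc)

lemma mact_plot:
  assumes g: "LP n U g" and R: "Plots MD n U R"
  shows "Plots MD n U (\<lambda>u. mact (g u) (R u))"
  unfolding Plots_MD
proof (intro conjI ballI)
  have q: "LP n U (\<lambda>x. fst (R x))" and m: "\<And>u. u \<in> U \<Longrightarrow> snd (R u) \<in> hperp"
    and s: "\<And>Z. Z \<in> TS \<one> \<Longrightarrow> smooth_on n U (\<lambda>u. snd (R u) Z)"
    using R by (auto simp: Plots_MD)
  show "LP n U (\<lambda>u. fst (mact (g u) (R u)))" using LP_mult[OF g q] by (simp add: mact_def)
  show "snd (mact (g u) (R u)) \<in> hperp" if "u \<in> U" for u
    using coad_hperp[OF m[OF that] LP_carrier[OF g that]] by (simp add: mact_def)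
  fix Z assume Z: "Z \<in> TS \<one>"
  have "smooth_on n U (\<lambda>u. snd (R u) (Ad (inv (g u)) Z))"
    by (rule smooth_pairing[OF MD_open[OF R] hperp_CS[OF m] s Ad_tangent[OF Z LP_carrier[OF LP_inv[OF g]]]
          smooth_Ad[OF LP_inv[OF g] Z]])
  then show "smooth_on n U (\<lambda>u. snd (mact (g u) (R u)) Z)" using Z by (simp add: mact_def coad_def)
qed

text \<open>The adjoint factor produced by left translation of the base point cancels against the
  coadjoint action on the covector.\<close>

lemma lam_mact:
  assumes g: "g \<in> carrier G" and R: "Plots MD n U R"
  shows "lam n U (\<lambda>u. mact g (R u)) = lam n U R"
proof (intro ext)
  fix u vs
  have R': "Plots MD n U (\<lambda>u. mact g (R u))" by (rule mact_plot[OF LP_const[OF _ MD_open[OF R]] R]) (simp add: g)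
  have q: "LP n U (\<lambda>x. fst (R x))" using R by (simp add: Plots_MD)
  show "lam n U (\<lambda>u. mact g (R u)) u vs = lam n U R u vs"
  proof (cases "u \<in> U \<and> vs \<in> vecs n 1")
    case True
    then obtain w where w: "w \<in> Rn n" "vs = [w]" and u: "u \<in> U" using mem_vecs1 by blast
    show ?thesis unfolding w(2) lam_apply[OF R u w(1)] lam_apply[OF R' u w(1)]
      by (simp add: mact_def rlog_left_quotient[OF q u g] coad_Ad[OF rlog_tangent[OF q u] g])
  qed (use form_zero[OF is_form_lam] in metis)
qed

text \<open>The values of a one-parameter subgroup commute, so conjugation by one of them fixes the
  curve and hence its velocity. It makes the pairing of \<open>\<mu>\<close> with \<open>Z\<close>
  constant along the flow of \<open>Z\<close>.\<close>

lemma Ad_expc: assumes Z: "Z \<in> TS \<one>" shows "Ad (inv (expc Z t)) Z = Z"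
proof -
  note x = expc_facts[OF Z]
  have v: "vel 1 (\<lambda>x. expc Z (x 0)) (pt 0) (evec 0) = Z"
    using expc[OF Z] by (simp add: one_parameter_subgroup_def pt_zero)
  have i: "inv (expc Z t) = expc Z (- t)" using x(2)[of "-t" t] x(3,4) by (simp add: inv_equality)
  have "Ad (expc Z (-t)) (vel 1 (\<lambda>x. expc Z (x 0)) (pt 0) (evec 0)) =
    vel 1 (\<lambda>x. expc Z (-t) \<otimes> expc Z (x 0) \<otimes> inv (expc Z (-t))) (pt 0) (evec 0)"
    by (rule Ad_velocity[OF x(1) pt_Rn(1) _ x(3)]) (simp add: x(4))
  also have "\<dots> = vel 1 (\<lambda>x. expc Z (x 0)) (pt 0) (evec 0)"
  proof (rule velocity_cong[OF openin_Rn pt_Rn(1)])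
    fix y :: "nat \<Rightarrow> real"
    have "expc Z (-t) \<otimes> expc Z (y 0) = expc Z (y 0) \<otimes> expc Z (-t)"
      using x(2)[of "-t" "y 0"] x(2)[of "y 0" "-t"] by (simp add: add.commute)
    then show "expc Z (-t) \<otimes> expc Z (y 0) \<otimes> inv (expc Z (-t)) = expc Z (y 0)" using x(3) by (simp add: m_assoc)
  qed
  finally show ?thesis unfolding i v .
qed

text \<open>What remains to be verified for each of the two spaces: that \<open>\<kappa>\<close>
  presents it as a quotient of the model with the prescribed fibres, and that form, action and
  moment map come from the model. The potential \<open>\<theta>\<close> is quantified because only
  its differential is part of a Hamiltonian space.\<close>

definition model_quotient :: "('g \<times> 'g covec \<Rightarrow> 'y) \<Rightarrow> ('g, 'y) ham_space \<Rightarrow> bool"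
  where "model_quotient \<kappa> S \<longleftrightarrow> hspace S = quotient_diffeology MD \<kappa> \<and>
    (\<forall>x\<in>Pts MD. \<forall>y\<in>Pts MD. \<kappa> x = \<kappa> y \<longleftrightarrow> same_fibre x y) \<and>
    (\<exists>\<theta>. is_form (hspace S) 1 \<theta> \<and> pullback MD \<kappa> \<theta> = lam \<and> hform S = ext_d (hspace S) 1 \<theta>) \<and>
    (\<forall>g\<in>carrier G. \<forall>x\<in>Pts MD. hact S g (\<kappa> x) = \<kappa> (mact g x)) \<and>
    (\<forall>x\<in>Pts MD. hmoment S (\<kappa> x) = snd x)"

lemma lam_descends:
  assumes "\<And>x y. x \<in> Pts MD \<Longrightarrow> y \<in> Pts MD \<Longrightarrow> \<kappa> x = \<kappa> y \<Longrightarrow> same_fibre x y"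
  shows "\<exists>\<theta>. is_form (quotient_diffeology MD \<kappa>) 1 \<theta> \<and> pullback MD \<kappa> \<theta> = lam"
proof (rule form_descends[OF diffeological_MD is_form_lam])
  fix n U R Q assume R: "Plots MD n U R" and Q: "Plots MD n U Q" and e: "\<And>u. u \<in> U \<Longrightarrow> \<kappa> (R u) = \<kappa> (Q u)"
  show "lam n U R = lam n U Q"
    by (rule lam_same_fibre[OF R Q]) (use assms plot_in[OF diffeological_MD] R Q e in blast)
qed

section \<open>Quotients of the model are parasymplectic Hamiltonian spaces\<close>

context
  fixes \<kappa> :: "'g \<times> 'g covec \<Rightarrow> 'y" and S :: "('g, 'y) ham_space" and \<theta> :: "'y form"
  assumes space: "hspace S = quotient_diffeology MD \<kappa>"
    and \<theta>: "is_form (quotient_diffeology MD \<kappa>) 1 \<theta>" "pullback MD \<kappa> \<theta> = lam"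
    and form: "hform S = ext_d (quotient_diffeology MD \<kappa>) 1 \<theta>"
    and act: "\<And>g x. g \<in> carrier G \<Longrightarrow> x \<in> Pts MD \<Longrightarrow> hact S g (\<kappa> x) = \<kappa> (mact g x)"
    and moment: "\<And>x. x \<in> Pts MD \<Longrightarrow> hmoment S (\<kappa> x) = snd x"
begin

abbreviation "QD \<equiv> quotient_diffeology MD \<kappa>"

lemma diffeological_QD: "diffeological_space QD"
  by (rule diffeological_quotient[OF diffeological_MD])

lemma QD_action:
  assumes g: "LP n U g" and P: "Plots QD n U P"
  shows "Plots QD n U (\<lambda>u. hact S (g u) (P u))"
proof (rule plot_local[OF diffeological_QD plot_open[OF diffeological_QD P]])
  fix u assume u: "u \<in> U"
  obtain V R where V: "openin (Euclidean_space n) V" "u \<in> V" "V \<subseteq> U" "Plots MD n V R" "\<forall>v\<in>V. P v = \<kappa> (R v)"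
    using quotient_plotD[OF P u] by blast
  have gV: "LP n V g" by (rule LP_restrict[OF g V(1,3) refl])
  have "hact S (g v) (P v) = \<kappa> (mact (g v) (R v))" if "v \<in> V" for v
    using V(5) that act[OF LP_carrier[OF gV that] plot_in[OF diffeological_MD V(4) that]] by simp
  then have "Plots QD n V (\<lambda>v. hact S (g v) (P v))"
    by (rule quotient_plotI[OF diffeological_MD mact_plot[OF gV V(4)]])
  then show "\<exists>V. openin (Euclidean_space n) V \<and> u \<in> V \<and> V \<subseteq> U \<and> Plots QD n V (\<lambda>v. hact S (g v) (P v))"
    using V by blast
qed

lemma QD_form:
  assumes R: "Plots MD n U R" and P: "\<And>u. u \<in> U \<Longrightarrow> P u = \<kappa> (R u)"
  shows "\<theta> n U P = lam n U R"
proof -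
  have "\<theta> n U P = \<theta> n U (\<kappa> \<circ> R)" by (rule form_cong[OF diffeological_QD \<theta>(1)]) (simp add: P)
  also have "\<dots> = pullback MD \<kappa> \<theta> n U R" by (rule pullback_apply[OF R, symmetric])
  finally show ?thesis by (simp add: \<theta>(2))
qed

lemma QD_smooth_action: "smooth_action G QD (hact S)"
  unfolding smooth_action_def
proof (intro conjI ballI)
  fix x assume "x \<in> Pts QD"
  then obtain y where y: "y \<in> Pts MD" "x = \<kappa> y" by auto
  show "hact S \<one> x = x" using act[OF one_closed y(1)] mact_one[OF y(1)] y(2) by simp
  fix g h assume g: "g \<in> carrier G" and h: "h \<in> carrier G"
  show "hact S (g \<otimes> h) x = hact S g (hact S h x)"
    unfolding y(2) act[OF m_closed[OF g h] y(1)] act[OF h y(1)] act[OF g mact_MD[OF h y(1)]] mact_mult[OF g h y(1)] ..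
next
  show "diffeo_smooth (prod_diffeology (lie_diffeology G) QD) QD (\<lambda>(g, x). hact S g x)"
    unfolding diffeo_smooth_def
  proof (intro conjI allI impI)
    show "(\<lambda>(g, x). hact S g x) ` Pts (prod_diffeology (lie_diffeology G) QD) \<subseteq> Pts QD"
      using act mact_MD by auto
    fix n U R assume "Plots (prod_diffeology (lie_diffeology G) QD) n U R"
    then have "Plots QD n U (\<lambda>u. hact S ((fst \<circ> R) u) ((snd \<circ> R) u))"
      unfolding Plots_prod by (intro QD_action) (simp_all add: comp_def)
    then show "Plots QD n U ((\<lambda>(g, x). hact S g x) \<circ> R)" by (simp add: comp_def case_prod_beta)
  qed
qed

lemma QD_act_smooth: assumes g: "g \<in> carrier G" shows "diffeo_smooth QD QD (hact S g)"
  unfolding diffeo_smooth_def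
proof (intro conjI allI impI)
  show "hact S g ` Pts QD \<subseteq> Pts QD" using act[OF g] mact_MD[OF g] by auto
  fix n U P assume P: "Plots QD n U P"
  show "Plots QD n U (hact S g \<circ> P)"
    using QD_action[OF LP_constant[OF g plot_open[OF diffeological_QD P]] P] by (simp add: comp_def)
qed

text \<open>By uniqueness on quotients the invariance of \<open>\<theta>\<close> can be checked on
  the model, where it is \<open>lam_mact\<close>; the exterior derivative inherits it.\<close>

lemma QD_invariant:
  assumes g: "g \<in> carrier G"
  shows "pullback QD (hact S g) (hform S) = hform S"
proof -
  have "pullback QD (hact S g) \<theta> = \<theta>"
  proof (rule form_unique_quotient[OF diffeological_MD is_form_pullback[OF diffeological_QD QD_act_smooth[OF g] \<theta>(1)] \<theta>(1)], intro ext)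
    fix n U R u vs
    show "pullback MD \<kappa> (pullback QD (hact S g) \<theta>) n U R u vs = pullback MD \<kappa> \<theta> n U R u vs"
    proof (cases "Plots MD n U R")
      case True
      have kR: "Plots QD n U (\<kappa> \<circ> R)" by (rule diffeo_smoothD(1)[OF diffeo_smooth_quotient[OF diffeological_MD] True])
      have "\<theta> n U (hact S g \<circ> (\<kappa> \<circ> R)) = lam n U (\<lambda>u. mact g (R u))"
        by (rule QD_form[OF mact_plot[OF LP_constant[OF g MD_open[OF True]] True]])
           (use act[OF g plot_in[OF diffeological_MD True]] in simp)
      then show ?thesis
        using lam_mact[OF g True] pullback_apply[OF True, of \<kappa>] pullback_apply[OF kR, of "hact S g" \<theta>] \<theta>(2) by simp
    qed (simp add: pullback_def)
  qed
  then show ?thesis unfolding form using pullback_ext_d[OF QD_act_smooth[OF g], of 1 \<theta>] by simp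
qed

text \<open>Cartan's formula in disguise: \<open>\<theta>\<close> is invariant and its value on the
  field generated by \<open>Z\<close> is \<langle>\<mu>, Z\<rangle>, so contracting its differential
  with that field gives minus the differential of \<langle>\<mu>, Z\<rangle>. The computation is
  done on the plot \<open>T\<close> of the model, a lift of the flow of \<open>Z\<close> applied to
  \<open>P\<close>.\<close>

lemma QD_moment: "moment_map G QD (hform S) (hact S) (hmoment S)"
  unfolding moment_map_def
proof (intro conjI ballI allI impI)
  fix x assume "x \<in> Pts QD"
  then show "hmoment S x \<in> CS \<one>" using moment by (auto simp: Pts_MD hperp_CS)
next
  fix Z n U P assume Z: "Z \<in> TS \<one>" and P: "Plots QD n U P"
  note U = plot_open[OF diffeological_QD P]
  have mom: "hmoment S (P v) Z = snd (R v) Z" if "Plots MD n V R" "\<forall>v\<in>V. P v = \<kappa> (R v)" "v \<in> V" for V R v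
    using moment[OF plot_in[OF diffeological_MD that(1,3)]] that(2,3) by simp
  show "smooth_on n U (\<lambda>u. hmoment S (P u) Z)"
  proof (rule smooth_on_local[OF U])
    fix u assume u: "u \<in> U"
    obtain V R where V: "openin (Euclidean_space n) V" "u \<in> V" "V \<subseteq> U" "Plots MD n V R" "\<forall>v\<in>V. P v = \<kappa> (R v)"
      using quotient_plotD[OF P u] by blast
    have "smooth_on n V (\<lambda>v. snd (R v) Z)" using V(4) Z by (simp add: Plots_MD)
    then have "smooth_on n V (\<lambda>v. hmoment S (P v) Z)"
      using smooth_on_cong[OF V(1), of "\<lambda>v. hmoment S (P v) Z" "\<lambda>v. snd (R v) Z"] mom[OF V(4,5)] by simp
    then show "\<exists>V. openin (Euclidean_space n) V \<and> u \<in> V \<and> V \<subseteq> U \<and> smooth_on n V (\<lambda>u. hmoment S (P u) Z)"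
      using V by blast
  qed
  fix u w assume u: "u \<in> U" and w: "w \<in> Rn n"
  obtain V R where V: "openin (Euclidean_space n) V" "u \<in> V" "V \<subseteq> U" "Plots MD n V R" "\<forall>v\<in>V. P v = \<kappa> (R v)"
    using quotient_plotD[OF P u] by blast
  note x = expc_facts[OF Z]
  have q: "LP n V (\<lambda>v. fst (R v))" and m: "\<And>v. v \<in> V \<Longrightarrow> snd (R v) \<in> hperp" using V(4) by (auto simp: Plots_MD)
  let ?D = "prod_dom 1 n (Rn 1) U" and ?D' = "prod_dom 1 n (Rn 1) V"
  let ?\<sigma> = "\<lambda>z. hact S (lie_exp G (\<lambda>c i. z 0 * Z c i)) (P (snd_part 1 z))"
  let ?z = "join 1 (\<lambda>_. 0) u"
  let ?E = "\<lambda>x. expc Z (x 0)"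
  define T where "T = (\<lambda>z. mact (expc Z (fst_part 1 z 0)) (R (snd_part 1 z)))"
  have D: "openin (Euclidean_space (1 + n)) ?D" "openin (Euclidean_space (1 + n)) ?D'" "?D' \<subseteq> ?D"
    using openin_prod_dom[OF openin_Rn U, of 1] openin_prod_dom[OF openin_Rn V(1), of 1] V(3) by (auto simp: prod_dom_def)
  have zD': "?z \<in> ?D'" by (rule prod_dom_join[OF openin_Rn V(1) zero_mem_Rn V(2)])
  have fs: "smooth_map (1 + n) ?D' 1 (Rn 1) (fst_part 1)" and ss: "smooth_map (1 + n) ?D' n V (snd_part 1)"
    by (rule smooth_map_fst_part[OF openin_Rn V(1)], rule smooth_map_snd_part[OF openin_Rn V(1)])
  have sn: "snd_part 1 z \<in> V" if "z \<in> ?D'" for z using that by (simp add: prod_dom_def)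
  have LE: "LP (1 + n) ?D' (\<lambda>z. ?E (fst_part 1 z))" by (rule LP_fst[OF x(1) V(1)])
  have Lq: "LP (1 + n) ?D' (\<lambda>z. fst (R (snd_part 1 z)))" by (rule LP_snd[OF q openin_Rn])
  have MT: "Plots MD (1 + n) ?D' T"
    unfolding T_def by (rule mact_plot[OF LE plot_compose[OF diffeological_MD V(4) ss refl]])
  have \<sigma>T: "?\<sigma> z = \<kappa> (T z)" if "z \<in> ?D'" for z
    using act[OF x(3) plot_in[OF diffeological_MD V(4) sn[OF that]], of "z 0"] V(5) sn[OF that]
    by (simp add: T_def expc_def fst_part_def)
  have PD: "Plots QD (1 + n) ?D ?\<sigma>"
  proof -
    have "LP (1 + n) ?D (\<lambda>z. ?E (fst_part 1 z))" by (rule LP_fst[OF x(1) U])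
    moreover have "Plots QD (1 + n) ?D (\<lambda>z. P (snd_part 1 z))"
      by (rule plot_compose[OF diffeological_QD P smooth_map_snd_part[OF openin_Rn U] refl])
    ultimately have "Plots QD (1 + n) ?D (\<lambda>z. hact S (?E (fst_part 1 z)) (P (snd_part 1 z)))" by (rule QD_action)
    then show ?thesis by (simp add: expc_def fst_part_def)
  qed
  have PD': "Plots QD (1 + n) ?D' ?\<sigma>" by (rule quotient_plotI[OF diffeological_MD MT]) (rule \<sigma>T)
  have e0: "evec 0 \<in> Rn (1 + n)" by (rule evec_Rn) simp
  have jw: "join 1 (\<lambda>_. 0) w \<in> Rn (1 + n)" by (rule join_Rn[OF zero_mem_Rn w])
  have fe0: "fst_part 1 (evec 0) = evec 0" "snd_part 1 (evec 0) = (\<lambda>_. 0)" "fst_part 1 (join 1 (\<lambda>_. 0) w) = (\<lambda>_. 0)"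
    by (auto simp: fst_part_def snd_part_def evec_def join_def)
  have rl0: "rlog k A z (\<lambda>_. 0) = (\<lambda>_ _. 0)" for k A z
    using rlog_lincomb[of k A z 0 "\<lambda>_. 0" 0 "\<lambda>_. 0"] by simp
  have RT: "rlog (1 + n) (\<lambda>z. fst (T z)) z y = (\<lambda>c i. rlog 1 ?E (fst_part 1 z) (fst_part 1 y) c i +
      Ad (?E (fst_part 1 z)) (rlog n (\<lambda>v. fst (R v)) (snd_part 1 z) (snd_part 1 y)) c i)"
    if z: "z \<in> ?D'" and y: "y \<in> Rn (1 + n)" for z y
  proof -
    have "rlog (1 + n) (\<lambda>z. fst (T z)) z y = rlog (1 + n) (\<lambda>z. ?E (fst_part 1 z) \<otimes> fst (R (snd_part 1 z))) z y"
      by (simp only: T_def mact_def fst_conv)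
    also have "\<dots> = (\<lambda>c i. rlog (1 + n) (\<lambda>z. ?E (fst_part 1 z)) z y c i +
        Ad (?E (fst_part 1 z)) (rlog (1 + n) (\<lambda>z. fst (R (snd_part 1 z))) z y) c i)"
      by (rule rlog_mult[OF LE Lq z y])
    also have "rlog (1 + n) (\<lambda>z. ?E (fst_part 1 z)) z y = rlog 1 ?E (fst_part 1 z) (fst_part 1 y)"
      unfolding rlog_chain[OF x(1) fs z] jac_fst_part[OF y] ..
    also have "rlog (1 + n) (\<lambda>z. fst (R (snd_part 1 z))) z y = rlog n (\<lambda>v. fst (R v)) (snd_part 1 z) (snd_part 1 y)"
      unfolding rlog_chain[OF q ss z] jac_snd_part[OF y] ..
    finally show ?thesis .
  qed
  have Ad0: "Ad g (\<lambda>_ _. 0) = (\<lambda>_ _. 0)" for g by (simp add: Ad_def tangent_map_zero)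
  \<comment> \<open>The component along \<open>U\<close> does not involve time, because
    \<open>Ad\<close> and \<open>coad\<close> of the flow cancel; its time derivative is therefore
    0.\<close>
  have L1: "lam (1 + n) ?D' T z [join 1 (\<lambda>_. 0) w] = lam n V R (snd_part 1 z) [w]" if z: "z \<in> ?D'" for z
  proof -
    have e1: "rlog (1 + n) (\<lambda>z. fst (T z)) z (join 1 (\<lambda>_. 0) w) = Ad (?E (fst_part 1 z)) (rlog n (\<lambda>v. fst (R v)) (snd_part 1 z) w)"
      unfolding RT[OF z jw] fe0 rl0 snd_part_join by simp
    show ?thesis
      unfolding lam_apply[OF MT z jw] lam_apply[OF V(4) sn[OF z] w] e1
      unfolding T_def mact_def snd_conv by (rule coad_Ad[OF rlog_tangent[OF q sn[OF z]] x(3)])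
  qed
  \<comment> \<open>The component along time is the moment map itself: the covector is moved by
    \<open>coad\<close> of the flow, under which the pairing with \<open>Z\<close> is
    constant.\<close>
  have L2: "lam (1 + n) ?D' T z [evec 0] = snd (R (snd_part 1 z)) Z" if z: "z \<in> ?D'" for z
  proof -
    have p: "fst_part 1 z = pt (z 0)" by (auto simp: fst_part_def pt_def)
    have "rlog (1 + n) (\<lambda>z. fst (T z)) z (evec 0) = Z"
      unfolding RT[OF z e0] fe0 rl0 Ad0 p x(5) by simp
    then show ?thesis
      unfolding lam_apply[OF MT z e0] by (simp add: T_def mact_def coad_def Z Ad_expc[OF Z])
  qed
  have "hform S (1 + n) ?D ?\<sigma> ?z [evec 0, join 1 (\<lambda>_. 0) w] = hform S (1 + n) ?D' ?\<sigma> ?z [evec 0, join 1 (\<lambda>_. 0) w]"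
    using form_restrict[OF is_form_ext_d[OF diffeological_QD \<theta>(1)] PD D(2,3,1) refl zD'] unfolding form by simp
  also have "\<dots> = ext_deriv (1 + n) 1 ?D' (\<theta> (1 + n) ?D' ?\<sigma>) ?z [evec 0, join 1 (\<lambda>_. 0) w]"
    unfolding form ext_d_def using PD' by simp
  also have "\<theta> (1 + n) ?D' ?\<sigma> = lam (1 + n) ?D' T" by (rule QD_form[OF MT]) (rule \<sigma>T)
  also have "ext_deriv (1 + n) 1 ?D' (lam (1 + n) ?D' T) ?z [evec 0, join 1 (\<lambda>_. 0) w] =
      dirderiv (1 + n) (\<lambda>z. lam (1 + n) ?D' T z [join 1 (\<lambda>_. 0) w]) ?z (evec 0)
      - dirderiv (1 + n) (\<lambda>z. lam (1 + n) ?D' T z [evec 0]) ?z (join 1 (\<lambda>_. 0) w)"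
    by (rule ext_deriv1[OF zD' e0 jw])
  also have "dirderiv (1 + n) (\<lambda>z. lam (1 + n) ?D' T z [join 1 (\<lambda>_. 0) w]) ?z (evec 0) =
      dirderiv (1 + n) (\<lambda>z. lam n V R (snd_part 1 z) [w]) ?z (evec 0)"
    by (rule dirderiv_cong[OF D(2) zD']) (rule L1)
  also have "\<dots> = dirderiv n (\<lambda>v. lam n V R v [w]) (snd_part 1 ?z) (\<lambda>_. 0)"
    using dirderiv_compose[OF ss smooth_form1_smooth[OF is_formD(1)[OF is_form_lam V(4)] w] zD', of "evec 0"]
    unfolding jac_snd_part[OF e0] fe0 .
  also have "\<dots> = 0" by (simp add: dirderiv_def)
  also have "dirderiv (1 + n) (\<lambda>z. lam (1 + n) ?D' T z [evec 0]) ?z (join 1 (\<lambda>_. 0) w) =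
      dirderiv (1 + n) (\<lambda>z. snd (R (snd_part 1 z)) Z) ?z (join 1 (\<lambda>_. 0) w)"
    by (rule dirderiv_cong[OF D(2) zD']) (rule L2)
  also have "\<dots> = dirderiv n (\<lambda>v. snd (R v) Z) u w"
  proof -
    have "smooth_on n V (\<lambda>v. snd (R v) Z)" using V(4) Z by (simp add: Plots_MD)
    from dirderiv_compose[OF ss this zD', of "join 1 (\<lambda>_. 0) w"] show ?thesis
      unfolding jac_snd_part[OF jw] snd_part_join .
  qed
  also have "\<dots> = dirderiv n (\<lambda>v. hmoment S (P v) Z) u w"
    by (rule dirderiv_cong[OF V(1,2)]) (simp add: mom[OF V(4,5)])
  finally show "hform S (1 + n) ?D ?\<sigma> ?z [evec 0, join 1 (\<lambda>_. 0) w] = - dirderiv n (\<lambda>v. hmoment S (P v) Z) u w"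
    by simp
qed

lemma QD_parasymplectic: "parasymplectic_hamiltonian G S"
  unfolding parasymplectic_hamiltonian_def space
  using diffeological_QD is_form_ext_d[OF diffeological_QD \<theta>(1)] ext_d_ext_d[OF diffeological_QD \<theta>(1)]
    QD_smooth_action QD_invariant QD_moment form by simp

end

text \<open>The map sending \<open>\<kappa> x\<close> to \<open>\<kappa>' x\<close> is well defined
  and bijective because both projections have the same fibres, and smooth both ways because both
  diffeologies are quotients of the same one. Forms, actions and moment maps are compared on the
  model.\<close>

lemma model_quotient_isomorphic:
  assumes S: "model_quotient \<kappa> S" and T: "model_quotient \<kappa>' T"
  shows "ham_isomorphic G S T"
proof -
  obtain \<theta> where S': "hspace S = quotient_diffeology MD \<kappa>" "is_form (quotient_diffeology MD \<kappa>) 1 \<theta>" "pullback MD \<kappa> \<theta> = lam"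
    "hform S = ext_d (quotient_diffeology MD \<kappa>) 1 \<theta>"
    "\<And>g x. g \<in> carrier G \<Longrightarrow> x \<in> Pts MD \<Longrightarrow> hact S g (\<kappa> x) = \<kappa> (mact g x)"
    "\<And>x. x \<in> Pts MD \<Longrightarrow> hmoment S (\<kappa> x) = snd x"
    and fS: "\<And>x y. x \<in> Pts MD \<Longrightarrow> y \<in> Pts MD \<Longrightarrow> \<kappa> x = \<kappa> y \<longleftrightarrow> same_fibre x y"
    using S unfolding model_quotient_def by auto
  obtain \<theta>' where T': "hspace T = quotient_diffeology MD \<kappa>'" "is_form (quotient_diffeology MD \<kappa>') 1 \<theta>'" "pullback MD \<kappa>' \<theta>' = lam"
    "hform T = ext_d (quotient_diffeology MD \<kappa>') 1 \<theta>'"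
    "\<And>g x. g \<in> carrier G \<Longrightarrow> x \<in> Pts MD \<Longrightarrow> hact T g (\<kappa>' x) = \<kappa>' (mact g x)"
    "\<And>x. x \<in> Pts MD \<Longrightarrow> hmoment T (\<kappa>' x) = snd x"
    and fT: "\<And>x y. x \<in> Pts MD \<Longrightarrow> y \<in> Pts MD \<Longrightarrow> \<kappa>' x = \<kappa>' y \<longleftrightarrow> same_fibre x y"
    using T unfolding model_quotient_def by auto
  let ?X = "quotient_diffeology MD \<kappa>" and ?Y = "quotient_diffeology MD \<kappa>'"
  note X = diffeological_quotient[OF diffeological_MD, of \<kappa>] and Y = diffeological_quotient[OF diffeological_MD, of \<kappa>']
  define F where "F = (\<lambda>y. \<kappa>' (SOME x. x \<in> Pts MD \<and> \<kappa> x = y))"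
  have F: "F (\<kappa> x) = \<kappa>' x" if x: "x \<in> Pts MD" for x
  proof -
    let ?x = "SOME y. y \<in> Pts MD \<and> \<kappa> y = \<kappa> x"
    have "?x \<in> Pts MD \<and> \<kappa> ?x = \<kappa> x" by (rule someI[of _ x]) (simp add: x)
    then show ?thesis using fS fT x unfolding F_def by blast
  qed
  have inj: "inj_on F (Pts ?X)" using fS fT F by (auto simp: inj_on_def)
  have im: "F ` Pts ?X = Pts ?Y" using F by (force simp: image_iff)
  have Fi: "inv_into (Pts ?X) F (\<kappa>' x) = \<kappa> x" if "x \<in> Pts MD" for x
    using inv_into_f_f[OF inj, of "\<kappa> x"] F[OF that] that by simp
  \<comment> \<open>Stated for arbitrary projections \<open>k\<close> and \<open>k'\<close>, so that
    it covers both \<open>F\<close> and its inverse.\<close>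
  have smooth: "diffeo_smooth (quotient_diffeology MD k) (quotient_diffeology MD k') f"
    if f: "\<And>x. x \<in> Pts MD \<Longrightarrow> f (k x) = k' x" for k :: "'g \<times> 'g covec \<Rightarrow> 'c" and k' :: "'g \<times> 'g covec \<Rightarrow> 'd" and f
    unfolding diffeo_smooth_def
  proof (intro conjI allI impI)
    show "f ` Pts (quotient_diffeology MD k) \<subseteq> Pts (quotient_diffeology MD k')" using f by auto
    fix n U P assume P: "Plots (quotient_diffeology MD k) n U P"
    show "Plots (quotient_diffeology MD k') n U (f \<circ> P)" unfolding Plots_quotient
    proof (intro conjI ballI)
      show "openin (Euclidean_space n) U" using P by (simp add: Plots_quotient)
      fix u assume u: "u \<in> U"
      obtain V R where V: "openin (Euclidean_space n) V" "u \<in> V" "V \<subseteq> U" "Plots MD n V R" "\<forall>v\<in>V. P v = k (R v)"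
        using quotient_plotD[OF P u] by blast
      have "\<forall>v\<in>V. (f \<circ> P) v = k' (R v)" using V(5) f plot_in[OF diffeological_MD V(4)] by simp
      then show "\<exists>V Q. openin (Euclidean_space n) V \<and> u \<in> V \<and> V \<subseteq> U \<and> Plots MD n V Q \<and> (\<forall>v\<in>V. (f \<circ> P) v = k' (Q v))"
        using V(1-4) by blast
    qed
  qed
  have Fs: "diffeo_smooth ?X ?Y F" by (rule smooth) (rule F)
  have "pullback ?X F \<theta>' = \<theta>"
  proof (rule form_unique_quotient[OF diffeological_MD is_form_pullback[OF X Fs T'(2)] S'(2)], intro ext)
    fix n U R u vs
    show "pullback MD \<kappa> (pullback ?X F \<theta>') n U R u vs = pullback MD \<kappa> \<theta> n U R u vs"
    proof (cases "Plots MD n U R")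
      case True
      have kR: "Plots ?X n U (\<kappa> \<circ> R)" by (rule diffeo_smoothD(1)[OF diffeo_smooth_quotient[OF diffeological_MD] True])
      have "\<theta>' n U (F \<circ> (\<kappa> \<circ> R)) = \<theta>' n U (\<kappa>' \<circ> R)"
        by (rule form_cong[OF Y T'(2)]) (use F plot_in[OF diffeological_MD True] in simp)
      then show ?thesis
        using pullback_apply[OF True, of \<kappa>] pullback_apply[OF kR, of F \<theta>'] pullback_apply[OF True, of \<kappa>' \<theta>'] S'(3) T'(3) by simp
    qed (simp add: pullback_def)
  qed
  then have pf: "pullback ?X F (hform T) = hform S"
    unfolding S'(4) T'(4) using pullback_ext_d[OF Fs, of 1 \<theta>'] by simp
  show ?thesis unfolding ham_isomorphic_def
  proof (intro conjI exI[of _ F])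
    show "parasymplectic_hamiltonian G S" by (rule QD_parasymplectic[OF S'])
    show "parasymplectic_hamiltonian G T" by (rule QD_parasymplectic[OF T'])
    show "bij_betw F (Pts (hspace S)) (Pts (hspace T))" unfolding S'(1) T'(1) using inj im by (simp add: bij_betw_def)
    show "diffeo_smooth (hspace S) (hspace T) F" unfolding S'(1) T'(1) by (rule Fs)
    show "diffeo_smooth (hspace T) (hspace S) (inv_into (Pts (hspace S)) F)" unfolding S'(1) T'(1) by (rule smooth) (rule Fi)
    show "\<forall>g\<in>carrier G. \<forall>x\<in>Pts (hspace S). F (hact S g x) = hact T g (F x)"
      unfolding S'(1) using S'(5) T'(5) F mact_MD by auto
    show "pullback (hspace S) F (hform T) = hform S" unfolding S'(1) by (rule pf)
    show "\<forall>x\<in>Pts (hspace S). hmoment T (F x) = hmoment S x" unfolding S'(1) using S'(6) T'(6) F by auto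
  qed
qed

end

section \<open>Tangent maps of translations and conjugations\<close>

context lie
begin

definition smooth_self :: "('g \<Rightarrow> 'g) \<Rightarrow> bool"
  where "smooth_self F \<longleftrightarrow> (\<forall>n V Q. LP n V Q \<longrightarrow> LP n V (\<lambda>x. F (Q x)))"

lemma smooth_self_LP: "smooth_self F \<Longrightarrow> LP n V Q \<Longrightarrow> LP n V (\<lambda>x. F (Q x))"
  by (simp add: smooth_self_def)

lemma smooth_self_translations:
  assumes "g \<in> carrier G"
  shows "smooth_self (\<lambda>x. x \<otimes> g)" "smooth_self (\<lambda>x. g \<otimes> x)" "smooth_self (\<lambda>x. g \<otimes> x \<otimes> inv g)"
  using LP_rmult[OF assms] LP_lmult[OF assms] LP_conj[OF assms] by (auto simp: smooth_self_def)

lemma smooth_self_compose: "smooth_self F \<Longrightarrow> smooth_self F' \<Longrightarrow> smooth_self (\<lambda>x. F' (F x))"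
  by (simp add: smooth_self_def)

lemma tangent_map_smooth_self:
  assumes "smooth_self F" "LP m U P" "u \<in> U" "q = P u"
  shows "tangent_map G F q (vel m P u w) = vel m (\<lambda>x. F (P x)) u w"
  by (rule tangent_map_velocity[OF assms(2,3) _ assms(4)]) (rule smooth_self_LP[OF assms(1)])

text \<open>A tangent vector is the velocity of a chart plot, so functoriality reduces to composing
  that plot with the maps.\<close>

lemma tangent_map_compose:
  assumes v: "v \<in> TS q" and q: "q \<in> carrier G" and F: "smooth_self F" and F': "smooth_self F'"
  shows "tangent_map G F' (F q) (tangent_map G F q v) = tangent_map G (\<lambda>x. F' (F x)) q v"
    and "tangent_map G F q v \<in> TS (F q)"
proof -
  let ?c = "chart_at G q" and ?y = "snd (chart_at G q) q"
  note t = tangent_velocity_chart_at[OF v q]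
  have 1: "tangent_map G F q (vel dm (chart_inv ?c) ?y (v ?c)) = vel dm (\<lambda>x. F (chart_inv ?c x)) ?y (v ?c)"
    by (rule tangent_map_smooth_self[OF F t(2,3) t(4)[symmetric]])
  have 2: "tangent_map G (\<lambda>x. F' (F x)) q (vel dm (chart_inv ?c) ?y (v ?c)) = vel dm (\<lambda>x. F' (F (chart_inv ?c x))) ?y (v ?c)"
    by (rule tangent_map_smooth_self[OF smooth_self_compose[OF F F'] t(2,3) t(4)[symmetric]])
  have 3: "tangent_map G F' (F q) (vel dm (\<lambda>x. F (chart_inv ?c x)) ?y (v ?c)) = vel dm (\<lambda>x. F' (F (chart_inv ?c x))) ?y (v ?c)"
    by (rule tangent_map_smooth_self[OF F' smooth_self_LP[OF F t(2)] t(3)]) (simp only: t(4))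
  show "tangent_map G F' (F q) (tangent_map G F q v) = tangent_map G (\<lambda>x. F' (F x)) q v"
    using 1 2 3 t(1) by simp
  show "tangent_map G F q v \<in> TS (F q)"
    using velocity_tangent[OF smooth_self_LP[OF F t(2)] t(3), of "v ?c"] 1 t(1,4) by simp
qed

lemma tangent_map_cong:
  assumes v: "v \<in> TS q" and q: "q \<in> carrier G" and e: "\<And>x. x \<in> carrier G \<Longrightarrow> F x = F' x"
  shows "tangent_map G F q v = tangent_map G F' q v"
proof -
  note t = tangent_velocity_chart_at[OF v q]
  show ?thesis unfolding tangent_map_def Let_def
    by (rule velocity_cong[OF LP_open[OF t(2)] t(3)]) (use LP_carrier[OF t(2)] e in simp)
qed

lemma tangent_map_id:
  assumes v: "v \<in> TS q" and q: "q \<in> carrier G" and e: "\<And>x. x \<in> carrier G \<Longrightarrow> F x = x"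
  shows "tangent_map G F q v = v"
proof -
  note t = tangent_velocity_chart_at[OF v q]
  have "tangent_map G F q v = vel dm (chart_inv (chart_at G q)) (snd (chart_at G q) q) (v (chart_at G q))"
    unfolding tangent_map_def Let_def
    by (rule velocity_cong[OF LP_open[OF t(2)] t(3)]) (use LP_carrier[OF t(2)] e in simp)
  then show ?thesis using t(1) by simp
qed

lemma tangent_right_inverse:
  assumes v: "v \<in> TS q" and q: "q \<in> carrier G"
  shows "tangent_map G (\<lambda>x. x \<otimes> inv q) q v \<in> TS \<one>"
    "tangent_map G (\<lambda>x. x \<otimes> q) \<one> (tangent_map G (\<lambda>x. x \<otimes> inv q) q v) = v"
proof -
  note t = tangent_map_compose[OF v q smooth_self_translations(1)[OF inv_closed[OF q]] smooth_self_translations(1)[OF q]]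
  show "tangent_map G (\<lambda>x. x \<otimes> inv q) q v \<in> TS \<one>" using t(2) q by simp
  show "tangent_map G (\<lambda>x. x \<otimes> q) \<one> (tangent_map G (\<lambda>x. x \<otimes> inv q) q v) = v"
    using t(1) tangent_map_id[OF v q, of "\<lambda>x. x \<otimes> inv q \<otimes> q"] q by (simp add: m_assoc)
qed

lemma tangent_right:
  assumes v: "v \<in> TS \<one>" and q: "q \<in> carrier G"
  shows "tangent_map G (\<lambda>x. x \<otimes> q) \<one> v \<in> TS q"
    "tangent_map G (\<lambda>x. x \<otimes> inv q) q (tangent_map G (\<lambda>x. x \<otimes> q) \<one> v) = v"
proof -
  note t = tangent_map_compose[OF v one_closed smooth_self_translations(1)[OF q] smooth_self_translations(1)[OF inv_closed[OF q]]]
  show "tangent_map G (\<lambda>x. x \<otimes> q) \<one> v \<in> TS q" using t(2) q by simp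
  show "tangent_map G (\<lambda>x. x \<otimes> inv q) q (tangent_map G (\<lambda>x. x \<otimes> q) \<one> v) = v"
    using t(1) tangent_map_id[OF v one_closed, of "\<lambda>x. x \<otimes> q \<otimes> inv q"] q by (simp add: m_assoc)
qed

subsection \<open>Right trivialization of the cotangent bundle\<close>

text \<open>The inverse of the right trivialization: \<open>(q, \<mu>)\<close> goes to the covector
  \<mu>q at \<open>q\<close>, whose value on \<open>v\<close> is that of \<open>\<mu>\<close> on the
  right translate of \<open>v\<close> to the identity.\<close>

definition emb :: "'g \<times> 'g covec \<Rightarrow> 'g \<times> 'g covec"
  where "emb x = (fst x, \<lambda>v. if v \<in> TS (fst x) then snd x (tangent_map G (\<lambda>y. y \<otimes> inv (fst x)) (fst x) v) else 0)"

lemma fst_emb [simp]: "fst (emb x) = fst x"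
  by (simp add: emb_def)

lemma snd_emb: "v \<in> TS q \<Longrightarrow> snd (emb (q, \<mu>)) v = \<mu> (tangent_map G (\<lambda>y. y \<otimes> inv q) q v)"
  by (simp add: emb_def)

lemma emb_CS:
  assumes q: "q \<in> carrier G" and \<mu>: "\<mu> \<in> CS \<one>"
  shows "snd (emb (q, \<mu>)) \<in> CS q"
  unfolding cotangent_space_def
proof (intro CollectI conjI allI ballI impI)
  fix v w a b assume v: "v \<in> TS q" and w: "w \<in> TS q"
  then show "snd (emb (q, \<mu>)) (\<lambda>c i. a * v c i + b * w c i) = a * snd (emb (q, \<mu>)) v + b * snd (emb (q, \<mu>)) w"
    using covector_lincomb[OF \<mu> tangent_right_inverse(1)[OF v q] tangent_right_inverse(1)[OF w q]] tangent_lincomb[OF v w]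
    by (simp add: snd_emb tangent_map_lincomb)
qed (simp add: emb_def)

lemma emb_bundle: "q \<in> carrier G \<Longrightarrow> \<mu> \<in> CS \<one> \<Longrightarrow> emb (q, \<mu>) \<in> cotangent_bundle G"
  using emb_CS by (auto simp: cotangent_bundle_def emb_def)

lemma emb_one: assumes \<mu>: "\<mu> \<in> CS \<one>" shows "emb (\<one>, \<mu>) = (\<one>, \<mu>)"
proof -
  have "snd (emb (\<one>, \<mu>)) = \<mu>"
    by (rule covector_ext[OF emb_CS[OF one_closed \<mu>] \<mu>]) (simp add: snd_emb tangent_map_id)
  then show ?thesis by (simp add: prod_eq_iff)
qed

text \<open>The covector at the identity is obtained by pairing \<open>p\<close> with the right
  translates to \<open>q\<close> of vectors at the identity.\<close>

lemma bundle_emb: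
  assumes x: "x \<in> cotangent_bundle G"
  obtains q \<mu> where "q \<in> carrier G" "\<mu> \<in> CS \<one>" "x = emb (q, \<mu>)"
proof -
  obtain q p where qp: "x = (q, p)" and q: "q \<in> carrier G" and p: "p \<in> CS q"
    using x by (auto simp: cotangent_bundle_def)
  define \<mu> where "\<mu> = (\<lambda>v. if v \<in> TS \<one> then p (tangent_map G (\<lambda>x. x \<otimes> q) \<one> v) else 0)"
  have \<mu>: "\<mu> \<in> CS \<one>" unfolding cotangent_space_def
  proof (intro CollectI conjI allI ballI impI)
    fix v w a b assume v: "v \<in> TS \<one>" and w: "w \<in> TS \<one>"
    then show "\<mu> (\<lambda>c i. a * v c i + b * w c i) = a * \<mu> v + b * \<mu> w"
      using covector_lincomb[OF p tangent_right(1)[OF v q] tangent_right(1)[OF w q]] tangent_lincomb[OF v w]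
      by (simp add: \<mu>_def tangent_map_lincomb)
  qed (simp add: \<mu>_def)
  have "snd (emb (q, \<mu>)) = p"
    by (rule covector_ext[OF emb_CS[OF q \<mu>] p])
      (simp add: snd_emb \<mu>_def tangent_right_inverse[OF _ q])
  then have "x = emb (q, \<mu>)" by (simp add: qp prod_eq_iff)
  then show ?thesis using that q \<mu> by blast
qed

text \<open>Successive right translations compose, so the covector part stays put and only the base
  point moves. The \<open>H\<close>-orbits and the moment map on the induced space are both read off
  from this.\<close>

lemma right_tr_emb:
  assumes q: "q \<in> carrier G" and g: "g \<in> carrier G"
  shows "right_tr G (emb (q, \<mu>)) g = emb (q \<otimes> g, \<mu>)"
proof -
  have "snd (right_tr G (emb (q, \<mu>)) g) v = snd (emb (q \<otimes> g, \<mu>)) v" for v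
  proof (cases "v \<in> TS (q \<otimes> g)")
    case True
    note t = tangent_map_compose[OF True m_closed[OF q g] smooth_self_translations(1)[OF inv_closed[OF g]] smooth_self_translations(1)[OF inv_closed[OF q]]]
    have qg: "q \<otimes> g \<otimes> inv g = q" using q g by (simp add: m_assoc)
    have "snd (right_tr G (emb (q, \<mu>)) g) v = \<mu> (tangent_map G (\<lambda>x. x \<otimes> inv q) q (tangent_map G (\<lambda>x. x \<otimes> inv g) (q \<otimes> g) v))"
      using True t(2) unfolding qg by (simp add: right_tr_def emb_def)
    also have "\<dots> = \<mu> (tangent_map G (\<lambda>x. x \<otimes> inv g \<otimes> inv q) (q \<otimes> g) v)"
      using t(1) unfolding qg by simp
    also have "tangent_map G (\<lambda>x. x \<otimes> inv g \<otimes> inv q) (q \<otimes> g) v = tangent_map G (\<lambda>x. x \<otimes> inv (q \<otimes> g)) (q \<otimes> g) v"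
      by (rule tangent_map_cong[OF True m_closed[OF q g]]) (use q g in \<open>simp add: m_assoc inv_mult_group\<close>)
    finally show ?thesis using snd_emb[OF True] by simp
  qed (simp add: right_tr_def emb_def)
  then show ?thesis by (simp add: prod_eq_iff fun_eq_iff) (simp add: right_tr_def emb_def)
qed

lemma emb_inj:
  assumes "q \<in> carrier G" "\<mu> \<in> CS \<one>" "r \<in> carrier G" "\<nu> \<in> CS \<one>" "emb (q, \<mu>) = emb (r, \<nu>)"
  shows "q = r \<and> \<mu> = \<nu>"
proof -
  have q: "q = r" using assms(5) by (metis fst_conv fst_emb)
  then have "right_tr G (emb (q, \<mu>)) (inv q) = right_tr G (emb (q, \<nu>)) (inv q)" using assms(5) by simp
  then show ?thesis
    using q assms(1) emb_one[OF assms(2)] emb_one[OF assms(4)] by (simp add: right_tr_emb)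
qed

text \<open>Pairing a covector with a velocity becomes pairing \<open>\<mu>\<close> with the
  logarithmic derivative; this is how \<open>canonical_form\<close> turns into
  \<open>lam\<close>.\<close>

lemma tangent_map_emb:
  assumes P: "LP n U P" and u: "u \<in> U"
  shows "snd (emb (P u, \<mu>)) (vel n P u w) = \<mu> (rlog n P u w)"
  using velocity_rlog(1)[OF P u inv_closed[OF LP_carrier[OF P u]]]
  by (simp add: snd_emb velocity_tangent[OF P u] rlog_def)

end

context lie_dense
begin

text \<open>Translating by \<open>inv g\<close> on the left and then to the identity on the right
  conjugates by \<open>inv g\<close> the curve already translated to the identity; on covectors this
  is the coadjoint action.\<close>

lemma left_tr_emb:
  assumes q: "q \<in> carrier G" and g: "g \<in> carrier G" 
  shows "left_tr G g (emb (q, \<mu>)) = emb (g \<otimes> q, coad g \<mu>)"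
proof -
  have "snd (left_tr G g (emb (q, \<mu>))) v = snd (emb (g \<otimes> q, coad g \<mu>)) v" for v
  proof (cases "v \<in> TS (g \<otimes> q)")
    case True
    note gq = m_closed[OF g q]
    note t = tangent_map_compose[OF True gq smooth_self_translations(2)[OF inv_closed[OF g]] smooth_self_translations(1)[OF inv_closed[OF q]]]
    have iq: "inv g \<otimes> (g \<otimes> q) = q" using q g by (simp add: m_assoc[symmetric])
    have 1: "snd (left_tr G g (emb (q, \<mu>))) v = \<mu> (tangent_map G (\<lambda>x. inv g \<otimes> x \<otimes> inv q) (g \<otimes> q) v)"
      using True t(1,2) unfolding iq by (simp add: left_tr_def emb_def)
    note s = tangent_right_inverse(1)[OF True gq]
    note r = tangent_map_compose[OF True gq smooth_self_translations(1)[OF inv_closed[OF gq]] smooth_self_translations(3)[OF inv_closed[OF g]]]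
    have "snd (emb (g \<otimes> q, coad g \<mu>)) v = \<mu> (Ad (inv g) (tangent_map G (\<lambda>x. x \<otimes> inv (g \<otimes> q)) (g \<otimes> q) v))"
      using snd_emb[OF True] s by (simp add: coad_def)
    also have "Ad (inv g) (tangent_map G (\<lambda>x. x \<otimes> inv (g \<otimes> q)) (g \<otimes> q) v) =
      tangent_map G (\<lambda>x. inv g \<otimes> (x \<otimes> inv (g \<otimes> q)) \<otimes> inv (inv g)) (g \<otimes> q) v"
      using r(1) gq unfolding Ad_def by simp
    also have "\<dots> = tangent_map G (\<lambda>x. inv g \<otimes> x \<otimes> inv q) (g \<otimes> q) v"
      by (rule tangent_map_cong[OF True gq]) (use q g in \<open>simp add: m_assoc inv_mult_group\<close>)
    finally show ?thesis using 1 by simp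
  qed (simp add: left_tr_def emb_def)
  then show ?thesis by (simp add: prod_eq_iff fun_eq_iff) (simp add: left_tr_def emb_def)
qed

lemma psi_emb:
  assumes q: "q \<in> carrier G" and \<mu>: "\<mu> \<in> CS \<one>"
  shows "psi G H (emb (q, \<mu>)) = (\<lambda>Z. if Z \<in> subgroup_algebra G H then - \<mu> (Ad q Z) else 0)"
proof -
  have "left_tr G (inv q) (emb (q, \<mu>)) = (\<one>, coad (inv q) \<mu>)"
    using left_tr_emb[OF q inv_closed[OF q]] emb_one[OF coad_CS[OF \<mu> inv_closed[OF q]]] q by simp
  then show ?thesis using q by (auto simp: psi_def coad_def halg_TS)
qed

text \<open>The condition on \<open>emb (q, \<mu>)\<close> says that
  \<open>coad (inv q) \<mu>\<close> annihilates \<hh>. As the annihilator is stable under the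
  coadjoint action of all of \<open>G\<close>, this is the same as \<open>\<mu>\<close> annihilating
  \<hh>.\<close>

lemma psi_zero_eq: "psi_zero G H = emb ` Pts MD"
proof (intro equalityI subsetI)
  fix x assume "x \<in> psi_zero G H"
  then have x: "x \<in> cotangent_bundle G" "psi G H x = (\<lambda>_. 0)" by (auto simp: psi_zero_def)
  obtain q \<mu> where q: "q \<in> carrier G" and \<mu>: "\<mu> \<in> CS \<one>" and e: "x = emb (q, \<mu>)" using bundle_emb[OF x(1)] .
  have "\<mu> (Ad q Z) = 0" if "Z \<in> subgroup_algebra G H" for Z
    using fun_cong[OF x(2), of Z] that unfolding e psi_emb[OF q \<mu>] by simp
  then have "coad (inv q) \<mu> \<in> hperp"
    using coad_CS[OF \<mu> inv_closed[OF q]] q by (simp add: hperp_def coad_def)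
  then have "coad q (coad (inv q) \<mu>) \<in> hperp" using coad_hperp q by blast
  then have "\<mu> \<in> hperp" using coad_mult[OF \<mu> q inv_closed[OF q]] coad_one[OF \<mu>] q by simp
  then show "x \<in> emb ` Pts MD" using e q by (auto simp: Pts_MD)
next
  fix x assume "x \<in> emb ` Pts MD"
  then obtain q \<mu> where q: "q \<in> carrier G" and \<mu>: "\<mu> \<in> hperp" and e: "x = emb (q, \<mu>)" by (auto simp: Pts_MD)
  have "psi G H x = (\<lambda>_. 0)" unfolding e psi_emb[OF q hperp_CS[OF \<mu>]] using hperp_Ad[OF \<mu> _ q] by auto
  then show "x \<in> psi_zero G H" using emb_bundle[OF q hperp_CS[OF \<mu>]] e by (simp add: psi_zero_def)
qed

lemma cotangent_chart_coord:
  assumes "x \<in> cotangent_bundle G"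
  shows "snd (cotangent_chart G c) x j = (if j < dm then snd c (fst x) j
     else if j - dm < dm then snd x (vel dm (chart_inv c) (snd c (fst x)) (evec (j - dm))) else 0)"
  by (simp add: cotangent_chart_def join_def case_prod_beta)

lemma Plots_cotangent_bundle:
  assumes "R ` U \<subseteq> cotangent_bundle G"
  shows "Plots (cotangent_bundle_diffeology G) n U R \<longleftrightarrow> openin (Euclidean_space n) U \<and>
    (\<forall>c\<in>charts G. openin (Euclidean_space n) {u \<in> U. fst (R u) \<in> fst c} \<and>
      (\<forall>j. smooth_on n {u \<in> U. fst (R u) \<in> fst c} (\<lambda>u. snd (cotangent_chart G c) (R u) j)))"
proof -
  have "{u \<in> U. R u \<in> fst (cotangent_chart G c)} = {u \<in> U. fst (R u) \<in> fst c}" for c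
    using assms by (auto simp: cotangent_chart_def)
  then show ?thesis using assms by (simp add: cotangent_bundle_diffeology_def Plots_manifold)
qed

text \<open>In a cotangent chart the fibre coordinates of \<open>emb (q, \<mu>)\<close> are the
  pairings of \<open>\<mu>\<close> with the logarithmic derivatives of \<open>chart_inv c\<close>,
  hence smooth by \<open>smooth_pairing\<close>.\<close>

lemma emb_plot:
  assumes R: "Plots MD n U R"
  shows "Plots (cotangent_bundle_diffeology G) n U (\<lambda>u. emb (R u))"
proof -
  have q: "LP n U (\<lambda>u. fst (R u))" and m: "\<And>u. u \<in> U \<Longrightarrow> snd (R u) \<in> CS \<one>"
    and s: "\<And>Z. Z \<in> TS \<one> \<Longrightarrow> smooth_on n U (\<lambda>u. snd (R u) Z)"
    using R by (auto simp: Plots_MD hperp_CS)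
  have b: "emb (R u) \<in> cotangent_bundle G" if "u \<in> U" for u
    using emb_bundle[OF LP_carrier[OF q that] m[OF that]] by simp
  have im: "(\<lambda>u. emb (R u)) ` U \<subseteq> cotangent_bundle G" using b by (rule image_subsetI)
  show ?thesis unfolding Plots_cotangent_bundle[OF im]
  proof (intro conjI ballI allI)
    show "openin (Euclidean_space n) U" by (rule MD_open[OF R])
    fix c j assume c: "c \<in> charts G"
    note W = LP_chart[OF q c]
    let ?W = "{u \<in> U. fst (R u) \<in> fst c}"
    show "openin (Euclidean_space n) {u \<in> U. fst (emb (R u)) \<in> fst c}" using W(1) by simp
    \<comment> \<open>Base coordinates, fibre coordinates, and the indices beyond twice the
      dimension, where the chart is 0.\<close>
    consider "j < dm" | i where "i < dm" "j = dm + i" | "dm + dm \<le> j"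
      by (metis add_less_cancel_left le_Suc_ex not_less)
    then have "smooth_on n ?W (\<lambda>u. snd (cotangent_chart G c) (emb (R u)) j)"
    proof cases
      case 1
      then show ?thesis
        using smooth_map_coord[OF W(2), of j]
          smooth_on_cong[OF W(1), of "\<lambda>u. snd (cotangent_chart G c) (emb (R u)) j" "\<lambda>u. snd c (fst (R u)) j"]
        by (simp add: cotangent_chart_coord[OF b])
    next
      case 2
      have rs: "smooth_on n ?W (\<lambda>u. rlog dm (chart_inv c) (snd c (fst (R u))) (evec i) c1 j)" for j
        by (rule smooth_on_compose[OF W(2) smooth_rlog[OF LP_chart_inv[OF c] evec_Rn[OF 2(1)]]])
      have "smooth_on n ?W (\<lambda>u. snd (R u) (rlog dm (chart_inv c) (snd c (fst (R u))) (evec i)))"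
        by (rule smooth_pairing[OF W(1) m _ rlog_tangent[OF LP_chart_inv[OF c]] rs])
          (auto intro: smooth_on_subset[OF s])
      moreover have "snd (cotangent_chart G c) (emb (R u)) j = snd (R u) (rlog dm (chart_inv c) (snd c (fst (R u))) (evec i))"
        if u: "u \<in> ?W" for u
      proof -
        have "chart_inv c (snd c (fst (R u))) = fst (R u)" using chart_inv_eq[OF c] u by simp
        then show ?thesis
          using tangent_map_emb[OF LP_chart_inv[OF c], of "snd c (fst (R u))" "snd (R u)" "evec i"] u 2
          by (simp add: cotangent_chart_coord[OF b])
      qed
      ultimately show ?thesis
        using smooth_on_cong[OF W(1), of "\<lambda>u. snd (cotangent_chart G c) (emb (R u)) j"
            "\<lambda>u. snd (R u) (rlog dm (chart_inv c) (snd c (fst (R u))) (evec i))"] by blast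
    next
      case 3
      then show ?thesis
        using smooth_on_cong[OF W(1), of "\<lambda>u. snd (cotangent_chart G c) (emb (R u)) j" "\<lambda>_. 0"]
        by (simp add: cotangent_chart_coord[OF b])
    qed
    then show "smooth_on n {u \<in> U. fst (emb (R u)) \<in> fst c} (\<lambda>u. snd (cotangent_chart G c) (emb (R u)) j)" by simp
  qed
qed

text \<open>To recover the value of \<open>\<mu>\<close> on \<open>Z\<close>, pair the covector with
  the right-invariant field of \<open>Z\<close>: the fibre coordinates are smooth by assumption, and
  so are the coefficients of that field in a chart.\<close>

lemma emb_plot_converse:
  assumes P: "Plots (cotangent_bundle_diffeology G) n U (\<lambda>u. emb (R u))" and RM: "\<And>u. u \<in> U \<Longrightarrow> R u \<in> Pts MD"
  shows "Plots MD n U R"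
proof -
  have m: "\<And>u. u \<in> U \<Longrightarrow> snd (R u) \<in> CS \<one>" and qc: "\<And>u. u \<in> U \<Longrightarrow> fst (R u) \<in> carrier G"
    using RM by (auto simp: Pts_MD hperp_CS mem_Times_iff)
  have b: "emb (R u) \<in> cotangent_bundle G" if "u \<in> U" for u
    using emb_bundle[OF qc[OF that] m[OF that]] by simp
  have im: "(\<lambda>u. emb (R u)) ` U \<subseteq> cotangent_bundle G" using b by (rule image_subsetI)
  have U: "openin (Euclidean_space n) U"
    and W: "\<And>c. c \<in> charts G \<Longrightarrow> openin (Euclidean_space n) {u \<in> U. fst (R u) \<in> fst c}"
    and s: "\<And>c j. c \<in> charts G \<Longrightarrow> smooth_on n {u \<in> U. fst (R u) \<in> fst c} (\<lambda>u. snd (cotangent_chart G c) (emb (R u)) j)"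
    using P unfolding Plots_cotangent_bundle[OF im] by auto
  have q: "LP n U (\<lambda>u. fst (R u))"
    unfolding lie_diffeology_def Plots_manifold
  proof (intro conjI ballI allI U)
    show "(\<lambda>u. fst (R u)) ` U \<subseteq> carrier G" using qc by (rule image_subsetI)
    fix c j assume c: "c \<in> charts G"
    show "openin (Euclidean_space n) {u \<in> U. fst (R u) \<in> fst c}" by (rule W[OF c])
    show "smooth_on n {u \<in> U. fst (R u) \<in> fst c} (\<lambda>u. snd c (fst (R u)) j)"
    proof (cases "j < dm")
      case True
      then show ?thesis
        using s[OF c, of j] smooth_on_cong[OF W[OF c], of "\<lambda>u. snd (cotangent_chart G c) (emb (R u)) j" "\<lambda>u. snd c (fst (R u)) j"]
        by (simp add: cotangent_chart_coord[OF b])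
    next
      case False
      have "snd c (fst (R u)) j = 0" if "u \<in> {u \<in> U. fst (R u) \<in> fst c}" for u
      proof -
        have "snd c (fst (R u)) \<in> Rn dm" using openin_subset_Rn[OF chart_open[OF c]] that by blast
        then show ?thesis using False by (simp add: mem_Rn)
      qed
      then show ?thesis using smooth_on_cong[OF W[OF c], of "\<lambda>u. snd c (fst (R u)) j" "\<lambda>_. 0"] by simp
    qed
  qed
  show ?thesis unfolding Plots_MD
  proof (intro conjI ballI q)
    show "snd (R u) \<in> hperp" if "u \<in> U" for u using RM[OF that] by (auto simp: Pts_MD)
    fix Z assume Z: "Z \<in> TS \<one>"
    show "smooth_on n U (\<lambda>u. snd (R u) Z)"
    proof (rule smooth_on_local[OF U])
      fix u0 assume u0: "u0 \<in> U"
      obtain c where c: "c \<in> charts G" "fst (R u0) \<in> fst c" using chart_ex[OF qc[OF u0]] by blast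
      let ?W = "{u \<in> U. fst (R u) \<in> fst c}"
      have qW: "LP n ?W (\<lambda>u. fst (R u))" by (rule LP_restrict[OF q W[OF c(1)] _ refl]) auto
      define M where "M = (\<lambda>z. chart_inv c1 (snd_part n z) \<otimes> fst (R (fst_part n z)))"
      have M: "LP (n + dm) (prod_dom n dm ?W (img c1)) M"
        unfolding M_def by (rule LP_mult[OF LP_snd[OF c1(5) W[OF c(1)]] LP_fst[OF qW c1(6)]])
      have Mj: "M (join n x y) = chart_inv c1 y \<otimes> fst (R x)" if "x \<in> ?W" for x y
        using openin_subset_Rn[OF W[OF c(1)] that] by (simp add: M_def fst_part_join)
      \<comment> \<open>The value, at the moving base point, of the right-invariant field with value
        \<open>Z\<close> at the identity.\<close>
      define A where "A = (\<lambda>u. tangent_map G (\<lambda>x. x \<otimes> fst (R u)) \<one> Z)"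
      have Ae: "A u = vel (n + dm) M (join n u y1) (join n (\<lambda>_. 0) (Z c1))" if u: "u \<in> ?W" for u
      proof -
        have g: "fst (R u) \<in> carrier G" using qc u by blast
        have "A u = vel dm (\<lambda>y. chart_inv c1 y \<otimes> fst (R u)) y1 (Z c1)"
          using tangent_map_smooth_self[OF smooth_self_translations(1)[OF g] c1(5,3) c1(4)[symmetric], of "Z c1"] tangent_one(1)[OF Z]
          by (simp add: A_def)
        then show ?thesis
          unfolding velocity_pair(2)[OF M W[OF c(1)] c1(6) u c1(3) tangent_one(2)[OF Z]] by (simp only: Mj[OF u])
      qed
      have "smooth_on n ?W (\<lambda>u. vel (n + dm) M (join n u y1) (join n (\<lambda>_. 0) (Z c1)) c i)" for i
      proof (rule smooth_along_section[OF M c(1) smooth_map_join[OF smooth_map_id[OF W[OF c(1)] W[OF c(1)] order_refl] smooth_map_const[OF W[OF c(1)] c1(6,3)]]])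
        show "M (join n u y1) \<in> fst c" if "u \<in> ?W" for u
          unfolding Mj[OF that] c1(4) using that qc by simp
      qed
      then have As: "smooth_on n ?W (\<lambda>u. A u c i)" for i
        using smooth_on_cong[OF W[OF c(1)], of "\<lambda>u. A u c i" "\<lambda>u. vel (n + dm) M (join n u y1) (join n (\<lambda>_. 0) (Z c1)) c i"] Ae by simp
      have "snd (R u) Z = (\<Sum>i<dm. A u c i * snd (cotangent_chart G c) (emb (R u)) (dm + i))" if u: "u \<in> ?W" for u
      proof -
        have g: "fst (R u) \<in> carrier G" and uU: "u \<in> U" and uc: "fst (R u) \<in> fst c" using qc u by auto
        have At: "A u \<in> TS (fst (R u))" unfolding A_def by (rule tangent_right(1)[OF Z g])
        have "snd (R u) Z = snd (emb (R u)) (A u)"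
          using snd_emb[OF At, of "snd (R u)"] tangent_right(2)[OF Z g] by (simp add: A_def)
        also have "\<dots> = (\<Sum>i<dm. A u c i * snd (emb (R u)) (vel dm (chart_inv c) (snd c (fst (R u))) (evec i)))"
          by (rule covector_expansion[OF _ c(1) uc At]) (use emb_CS[OF g m[OF uU]] in simp)
        also have "\<dots> = (\<Sum>i<dm. A u c i * snd (cotangent_chart G c) (emb (R u)) (dm + i))"
          by (intro sum.cong) (simp_all add: cotangent_chart_coord[OF b[OF uU]])
        finally show ?thesis .
      qed
      moreover have "smooth_on n ?W (\<lambda>u. \<Sum>i<dm. A u c i * snd (cotangent_chart G c) (emb (R u)) (dm + i))"
        by (intro smooth_on_sum smooth_on_mult W[OF c(1)] As s[OF c(1)])
      ultimately have "smooth_on n ?W (\<lambda>u. snd (R u) Z)"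
        using smooth_on_cong[OF W[OF c(1)], of "\<lambda>u. snd (R u) Z" "\<lambda>u. \<Sum>i<dm. A u c i * snd (cotangent_chart G c) (emb (R u)) (dm + i)"] by blast
      then show "\<exists>V. openin (Euclidean_space n) V \<and> u0 \<in> V \<and> V \<subseteq> U \<and> smooth_on n V (\<lambda>u. snd (R u) Z)"
        using W[OF c(1)] u0 c(2) by (intro exI[of _ ?W]) auto
    qed
  qed
qed

subsection \<open>The induced space\<close>

abbreviation "orb \<equiv> \<lambda>x. H_orbit G H (emb x)"

lemma H_orbit_emb:
  assumes "x \<in> Pts MD"
  shows "orb x = (\<lambda>q. emb (q, snd x)) ` lcos (fst x)"
proof -
  obtain q \<mu> where x: "x = (q, \<mu>)" and q: "q \<in> carrier G" using assms by (auto simp: Pts_MD)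
  have "orb x = (\<lambda>h. emb (q \<otimes> inv h, \<mu>)) ` H"
    unfolding H_orbit_def x using right_tr_emb[OF q inv_closed] H_carrier by (intro image_cong) auto
  also have "\<dots> = (\<lambda>q. emb (q, \<mu>)) ` (\<lambda>h. q \<otimes> inv h) ` H" by (simp add: image_image)
  also have "(\<lambda>h. q \<otimes> inv h) ` H = lcos q"
  proof (intro equalityI subsetI)
    show "y \<in> lcos q" if "y \<in> (\<lambda>h. q \<otimes> inv h) ` H" for y
      using that subgroup.m_inv_closed[OF subgroup] unfolding mem_lcos by blast
    show "y \<in> (\<lambda>h. q \<otimes> inv h) ` H" if y: "y \<in> lcos q" for y
    proof -
      obtain h where h: "h \<in> H" "y = q \<otimes> h" using y unfolding mem_lcos by blast
      then show ?thesis using subgroup.m_inv_closed[OF subgroup h(1)] H_carrier[OF h(1)]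
        by (intro image_eqI[of _ _ "inv h"]) auto
    qed
  qed
  finally show ?thesis by (simp add: x)
qed

lemma orb_eq_iff:
  assumes x: "x \<in> Pts MD" and y: "y \<in> Pts MD"
  shows "orb x = orb y \<longleftrightarrow> same_fibre x y"
proof
  assume "same_fibre x y"
  then show "orb x = orb y" unfolding H_orbit_emb[OF x] H_orbit_emb[OF y] by (simp add: same_fibre_def)
next
  assume e: "orb x = orb y"
  obtain q \<mu> where xq: "x = (q, \<mu>)" and q: "q \<in> carrier G" and \<mu>: "\<mu> \<in> CS \<one>" using x by (auto simp: Pts_MD hperp_CS)
  obtain r \<nu> where yr: "y = (r, \<nu>)" and r: "r \<in> carrier G" and \<nu>: "\<nu> \<in> CS \<one>" using y by (auto simp: Pts_MD hperp_CS)
  have "q \<in> lcos q" unfolding mem_lcos using subgroup.one_closed[OF subgroup] q by (intro bexI[of _ \<one>]) auto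
  then have "emb (q, \<mu>) \<in> orb y" unfolding e[symmetric] H_orbit_emb[OF x] by (simp add: xq)
  then obtain s where s: "s \<in> lcos r" "emb (q, \<mu>) = emb (s, \<nu>)" unfolding H_orbit_emb[OF y] by (auto simp: yr)
  then obtain h where h: "h \<in> H" "s = r \<otimes> h" using mem_lcos by blast
  have sc: "s \<in> carrier G" using h r H_carrier by simp
  have "q = s \<and> \<mu> = \<nu>" by (rule emb_inj[OF q \<mu> sc \<nu> s(2)])
  then show "same_fibre x y" using lcos_right[OF r h(1)] h(2) by (simp add: same_fibre_def xq yr)
qed

lemma Plots_psi_zero:
  "Plots (psi_zero_diffeology G H) n U R \<longleftrightarrow> Plots (cotangent_bundle_diffeology G) n U R \<and> R ` U \<subseteq> psi_zero G H"
  by (simp add: psi_zero_diffeology_def subset_diffeology_def)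

lemma psi_zero_plotI: "Plots MD n U R \<Longrightarrow> Plots (psi_zero_diffeology G H) n U (\<lambda>u. emb (R u))"
  unfolding Plots_psi_zero using emb_plot plot_in[OF diffeological_MD] by (auto simp: psi_zero_eq)

lemma manifold_plot_cong:
  "(\<And>u. u \<in> U \<Longrightarrow> P u = Q u) \<Longrightarrow> Plots (cotangent_bundle_diffeology G) n U P \<longleftrightarrow> Plots (cotangent_bundle_diffeology G) n U Q"
  unfolding cotangent_bundle_diffeology_def by (rule plot_cong[OF diffeological_manifold])

lemma psi_zero_plotD:
  assumes "Plots (psi_zero_diffeology G H) n U P"
  shows "\<exists>R. Plots MD n U R \<and> (\<forall>u\<in>U. P u = emb (R u))"
proof -
  have P: "Plots (cotangent_bundle_diffeology G) n U P" "P ` U \<subseteq> emb ` Pts MD"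
    using assms unfolding Plots_psi_zero psi_zero_eq by auto
  define R where "R = (\<lambda>u. inv_into (Pts MD) emb (P u))"
  have R: "R u \<in> Pts MD" "emb (R u) = P u" if "u \<in> U" for u
  proof -
    have "P u \<in> emb ` Pts MD" using P(2) that by blast
    then show "R u \<in> Pts MD" "emb (R u) = P u" unfolding R_def by (rule inv_into_into, rule f_inv_into_f)
  qed
  have "Plots MD n U R"
    using emb_plot_converse[OF _ R(1)] manifold_plot_cong[of U P "\<lambda>u. emb (R u)"] P(1) R(2) by auto
  then show ?thesis using R(2) by (intro exI[of _ R]) simp
qed

text \<open>\<open>emb\<close> and its inverse carry plots to plots between the model and the zero
  level of \<open>psi\<close>, so the quotient by \<open>H\<close>-orbits may be taken on the
  model.\<close>

lemma induced_diffeology_eq: "induced_diffeology G H = quotient_diffeology MD orb"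
proof (rule diffeology.equality)
  show "Pts (induced_diffeology G H) = Pts (quotient_diffeology MD orb)"
    by (simp add: induced_diffeology_def psi_zero_diffeology_def subset_diffeology_def psi_zero_eq image_image)
  have "Plots (induced_diffeology G H) n U P \<longleftrightarrow> Plots (quotient_diffeology MD orb) n U P" for n U P
  proof -
    have "(\<exists>Q. Plots (psi_zero_diffeology G H) n V Q \<and> (\<forall>v\<in>V. P v = H_orbit G H (Q v))) \<longleftrightarrow>
       (\<exists>Q. Plots MD n V Q \<and> (\<forall>v\<in>V. P v = orb (Q v)))" (is "?l \<longleftrightarrow> ?r") for V
    proof
      assume ?l
      then obtain Q where Q: "Plots (psi_zero_diffeology G H) n V Q" "\<forall>v\<in>V. P v = H_orbit G H (Q v)" by blast
      obtain R where "Plots MD n V R" "\<forall>u\<in>V. Q u = emb (R u)" using psi_zero_plotD[OF Q(1)] by blast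
      then show ?r using Q(2) by (intro exI[of _ R]) simp
    next
      assume ?r
      then obtain R where R: "Plots MD n V R" "\<forall>v\<in>V. P v = orb (R v)" by blast
      then show ?l using psi_zero_plotI[OF R(1)] by (intro exI[of _ "\<lambda>u. emb (R u)"]) simp
    qed
    then show ?thesis by (simp only: induced_diffeology_def Plots_quotient ex_simps)
  qed
  then show "Plots (induced_diffeology G H) = Plots (quotient_diffeology MD orb)" by (intro ext) blast
qed simp

lemma canonical_form_emb:
  assumes R: "Plots MD n U R"
  shows "canonical_form G n U (\<lambda>u. emb (R u)) = lam n U R"
proof (intro ext)
  fix u vs
  have q: "LP n U (\<lambda>u. fst (R u))" using R by (simp add: Plots_MD)
  show "canonical_form G n U (\<lambda>u. emb (R u)) u vs = lam n U R u vs"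
  proof (cases "u \<in> U \<and> vs \<in> vecs n 1")
    case True
    then obtain w where w: "w \<in> Rn n" "vs = [w]" and u: "u \<in> U" using mem_vecs1 by blast
    have "canonical_form G n U (\<lambda>u. emb (R u)) u vs = snd (emb (R u)) (vel n (\<lambda>u. fst (R u)) u w)"
      using emb_plot[OF R] u w by (simp add: canonical_form_def comp_def)
    also have "\<dots> = snd (R u) (rlog n (\<lambda>u. fst (R u)) u w)"
      using tangent_map_emb[OF q u, of "snd (R u)" w] by simp
    finally show ?thesis using lam_apply[OF R u w(1)] w(2) by simp
  next
    case False
    then have "canonical_form G n U (\<lambda>u. emb (R u)) u vs = 0" by (auto simp: canonical_form_def)
    then show ?thesis using form_zero[OF is_form_lam False] by simp
  qed
qed

lemma descend_eq:
  assumes "s \<in> S" "\<And>t. t \<in> S \<Longrightarrow> \<pi> t = \<pi> s \<Longrightarrow> f t = f s"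
  shows "descend S \<pi> f (\<pi> s) = f s"
proof -
  have "f ` {t \<in> S. \<pi> t = \<pi> s} = {f s}"
  proof (intro equalityI subsetI)
    show "y \<in> {f s}" if "y \<in> f ` {t \<in> S. \<pi> t = \<pi> s}" for y using that assms(2) by blast
    show "y \<in> f ` {t \<in> S. \<pi> t = \<pi> s}" if "y \<in> {f s}" for y using that assms(1) by blast
  qed
  then show ?thesis by (simp add: descend_def)
qed

lemma descend_orb:
  assumes x: "x \<in> Pts MD" and f: "\<And>y. y \<in> Pts MD \<Longrightarrow> same_fibre y x \<Longrightarrow> f (emb y) = f (emb x)"
  shows "descend (psi_zero G H) (H_orbit G H) f (orb x) = f (emb x)"
proof (rule descend_eq)
  show "emb x \<in> psi_zero G H" using x psi_zero_eq by blast
  fix t assume "t \<in> psi_zero G H" and e: "H_orbit G H t = orb x"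
  then obtain y where y: "y \<in> Pts MD" "t = emb y" using psi_zero_eq by blast
  then show "f t = f (emb x)" using f[OF y(1)] e orb_eq_iff[OF y(1) x] by simp
qed

lemma same_fibre_mact:
  assumes g: "g \<in> carrier G" and x: "x \<in> Pts MD" and y: "y \<in> Pts MD" and xy: "same_fibre x y"
  shows "same_fibre (mact g x) (mact g y)"
  using lmult_lcos[OF g, of "fst x"] lmult_lcos[OF g, of "fst y"] x y xy
  by (auto simp: same_fibre_def mact_def Pts_MD)

lemma left_tr_emb_mact: "g \<in> carrier G \<Longrightarrow> x \<in> Pts MD \<Longrightarrow> left_tr G g (emb x) = emb (mact g x)"
  using left_tr_emb[of "fst x" g "snd x"] by (auto simp: mact_def Pts_MD)

text \<open>Along \<open>emb\<close> the canonical form restricts to \<open>lam\<close>, so the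
  differential of \<open>\<theta>\<close> has the defining property of the reduced form; it is the
  only solution because pull-back to the model is injective.\<close>

lemma reduced_form_eq:
  assumes \<theta>: "is_form (quotient_diffeology MD orb) 1 \<theta>" "pullback MD orb \<theta> = lam"
  shows "reduced_form G H = ext_d (quotient_diffeology MD orb) 1 \<theta>"
proof -
  let ?Q = "quotient_diffeology MD orb"
  let ?\<omega> = "ext_d ?Q 1 \<theta>"
  note Qd = diffeological_quotient[OF diffeological_MD, of orb]
  have 1: "is_form ?Q 2 ?\<omega>" by (rule is_form_ext_d[OF Qd \<theta>(1)])
  have 2: "pullback (psi_zero_diffeology G H) (H_orbit G H) ?\<omega> =
    pullback (psi_zero_diffeology G H) (\<lambda>x. x) (ext_d (cotangent_bundle_diffeology G) 1 (canonical_form G))"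
  proof (intro ext)
    fix n U P u vs
    show "pullback (psi_zero_diffeology G H) (H_orbit G H) ?\<omega> n U P u vs =
      pullback (psi_zero_diffeology G H) (\<lambda>x. x) (ext_d (cotangent_bundle_diffeology G) 1 (canonical_form G)) n U P u vs"
    proof (cases "Plots (psi_zero_diffeology G H) n U P")
      case True
      obtain R where R: "Plots MD n U R" and PR: "\<And>u. u \<in> U \<Longrightarrow> P u = emb (R u)" using psi_zero_plotD[OF True] by blast
      have PC: "Plots (cotangent_bundle_diffeology G) n U P" using True Plots_psi_zero by blast
      have oP: "Plots ?Q n U (H_orbit G H \<circ> P)"
        by (rule quotient_plotI[OF diffeological_MD R]) (simp add: PR)
      have "\<theta> n U (H_orbit G H \<circ> P) = \<theta> n U (orb \<circ> R)"
        by (rule form_cong[OF Qd \<theta>(1)]) (simp add: PR)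
      also have "\<dots> = lam n U R" using pullback_apply[OF R, of orb \<theta>] \<theta>(2) by simp
      finally have t: "\<theta> n U (H_orbit G H \<circ> P) = lam n U R" .
      have "canonical_form G n U P = canonical_form G n U (\<lambda>u. emb (R u))"
      proof (intro ext)
        fix u vs
        show "canonical_form G n U P u vs = canonical_form G n U (\<lambda>u. emb (R u)) u vs"
        proof (cases "u \<in> U")
          case u: True
          have "vel n (fst \<circ> P) u w = vel n (fst \<circ> (\<lambda>u. emb (R u))) u w" for w
            by (rule velocity_cong[OF MD_open[OF R] u]) (simp add: PR)
          then show ?thesis using PC emb_plot[OF R] PR[OF u] by (simp add: canonical_form_def)
        qed (simp add: canonical_form_def)
      qed
      then have c: "canonical_form G n U P = lam n U R" using canonical_form_emb[OF R] by simp
      have "ext_deriv n 1 U (\<theta> n U (H_orbit G H \<circ> P)) = ext_deriv n 1 U (canonical_form G n U P)"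
        unfolding t c ..
      then show ?thesis using True PC oP by (simp add: pullback_def ext_d_def comp_def)
    qed (simp add: pullback_def)
  qed
  show ?thesis unfolding reduced_form_def induced_diffeology_eq
  proof (rule the_equality)
    fix \<omega> assume w: "is_form ?Q 2 \<omega> \<and> pullback (psi_zero_diffeology G H) (H_orbit G H) \<omega> =
      pullback (psi_zero_diffeology G H) (\<lambda>x. x) (ext_d (cotangent_bundle_diffeology G) 1 (canonical_form G))"
    show "\<omega> = ?\<omega>"
    proof (rule form_unique_quotient[OF diffeological_MD _ 1], use w in blast, intro ext)
      fix n U R u vs
      show "pullback MD orb \<omega> n U R u vs = pullback MD orb ?\<omega> n U R u vs"
      proof (cases "Plots MD n U R")
        case True
        have e: "orb \<circ> R = H_orbit G H \<circ> (\<lambda>u. emb (R u))" by (simp add: comp_def)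
        have "pullback (psi_zero_diffeology G H) (H_orbit G H) \<omega> = pullback (psi_zero_diffeology G H) (H_orbit G H) ?\<omega>"
          using w 2 by simp
        then have "\<omega> n U (orb \<circ> R) = ?\<omega> n U (orb \<circ> R)"
          unfolding e using pullback_apply[OF psi_zero_plotI[OF True]] by metis
        then show ?thesis by (simp add: pullback_def)
      qed (simp add: pullback_def)
    qed
  qed (use 1 2 in blast)
qed

lemma model_quotient_induced: "model_quotient orb (induced_space G H)"
  unfolding model_quotient_def
proof (intro conjI ballI)
  show "hspace (induced_space G H) = quotient_diffeology MD orb"
    by (simp add: induced_space_def induced_diffeology_eq)
  obtain \<theta> where \<theta>: "is_form (quotient_diffeology MD orb) 1 \<theta>" "pullback MD orb \<theta> = lam"
    using lam_descends[of orb] orb_eq_iff by blast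
  show "\<exists>\<theta>. is_form (hspace (induced_space G H)) 1 \<theta> \<and> pullback MD orb \<theta> = lam \<and>
    hform (induced_space G H) = ext_d (hspace (induced_space G H)) 1 \<theta>"
    using \<theta> reduced_form_eq[OF \<theta>] by (intro exI[of _ \<theta>]) (simp add: induced_space_def induced_diffeology_eq)
  fix x assume x: "x \<in> Pts MD"
  show "orb x = orb y \<longleftrightarrow> same_fibre x y" if "y \<in> Pts MD" for y by (rule orb_eq_iff[OF x that])
  show "hact (induced_space G H) g (orb x) = orb (mact g x)" if g: "g \<in> carrier G" for g
  proof -
    have "descend (psi_zero G H) (H_orbit G H) (\<lambda>x. H_orbit G H (left_tr G g x)) (orb x) = H_orbit G H (left_tr G g (emb x))"
    proof (rule descend_orb[OF x])
      fix y assume y: "y \<in> Pts MD" "same_fibre y x"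
      then show "H_orbit G H (left_tr G g (emb y)) = H_orbit G H (left_tr G g (emb x))"
        using orb_eq_iff[OF mact_MD[OF g y(1)] mact_MD[OF g x]] same_fibre_mact[OF g y(1) x y(2)]
        by (simp add: left_tr_emb_mact[OF g] x)
    qed
    then show ?thesis by (simp add: induced_space_def left_tr_emb_mact[OF g x])
  qed
  have m: "snd (right_tr G (emb y) (inv (fst (emb y)))) = snd y" if y: "y \<in> Pts MD" for y
  proof -
    have q: "fst y \<in> carrier G" and \<mu>: "snd y \<in> CS \<one>" using y by (auto simp: Pts_MD hperp_CS)
    then show ?thesis using right_tr_emb[OF q inv_closed[OF q], of "snd y"] emb_one[OF \<mu>] by simp
  qed
  have "descend (psi_zero G H) (H_orbit G H) (\<lambda>x. snd (right_tr G x (inv (fst x)))) (orb x) = snd (right_tr G (emb x) (inv (fst (emb x))))"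
    by (rule descend_orb[OF x]) (use m x in \<open>auto simp: same_fibre_def simp del: fst_emb\<close>)
  then show "hmoment (induced_space G H) (orb x) = snd x" using m[OF x] by (simp add: induced_space_def)
qed

end

subsection \<open>One-forms on the coset space\<close>

context lie_dense
begin

abbreviation "CX \<equiv> coset_diffeology G H"

lemma coset_diffeology_eq: "CX = quotient_diffeology (lie_diffeology G) lcos"
  by (simp add: coset_diffeology_def)

lemma diffeological_CX: "diffeological_space CX"
  unfolding coset_diffeology_eq by (rule diffeological_quotient[OF diffeological_lie])

lemma Pts_CX: "Pts CX = lcos ` carrier G"
  by (simp add: coset_diffeology_eq)

lemma CX_plotI: "LP n U q \<Longrightarrow> Plots CX n U (\<lambda>u. lcos (q u))"
  unfolding coset_diffeology_eq by (rule quotient_plotI[OF diffeological_lie]) auto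

lemma CX_plotD:
  assumes "Plots CX n U P" "u \<in> U"
  shows "\<exists>V q. openin (Euclidean_space n) V \<and> u \<in> V \<and> V \<subseteq> U \<and> LP n V q \<and> (\<forall>v\<in>V. P v = lcos (q v))"
  using quotient_plotD[OF assms[unfolded coset_diffeology_eq]] .

lemma MD_plot_const: "\<mu> \<in> hperp \<Longrightarrow> LP n U q \<Longrightarrow> Plots MD n U (\<lambda>u. (q u, \<mu>))"
  by (simp add: Plots_MD)

text \<open>The right-invariant one-form on \<open>G\<close> with value \<open>\<mu>\<close> at the
  identity.\<close>

definition beta :: "'g covec \<Rightarrow> 'g form"
  where "beta \<mu> = pullback (lie_diffeology G) (\<lambda>g. (g, \<mu>)) lam"

lemma beta_eq: "LP n U q \<Longrightarrow> beta \<mu> n U q = lam n U (\<lambda>u. (q u, \<mu>))"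
  by (simp add: beta_def pullback_def comp_def)

text \<open>For \<open>\<mu>\<close> in \<open>hperp\<close> such a form exists by descent and is
  unique by \<open>form_unique_quotient\<close>, so the choice is harmless.\<close>

definition alpha :: "'g covec \<Rightarrow> 'g set form"
  where "alpha \<mu> = (SOME \<alpha>. is_form CX 1 \<alpha> \<and> pullback (lie_diffeology G) lcos \<alpha> = beta \<mu>)"

lemma alpha:
  assumes \<mu>: "\<mu> \<in> hperp"
  shows "is_form CX 1 (alpha \<mu>)" "pullback (lie_diffeology G) lcos (alpha \<mu>) = beta \<mu>"
proof -
  have s: "diffeo_smooth (lie_diffeology G) MD (\<lambda>g. (g, \<mu>))"
    using MD_plot_const[OF \<mu>] \<mu> by (auto simp: diffeo_smooth_def comp_def Pts_MD)
  have "\<exists>\<alpha>. is_form (quotient_diffeology (lie_diffeology G) lcos) 1 \<alpha> \<and> pullback (lie_diffeology G) lcos \<alpha> = beta \<mu>"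
  proof (rule form_descends[OF diffeological_lie])
    show "is_form (lie_diffeology G) 1 (beta \<mu>)"
      unfolding beta_def by (rule is_form_pullback[OF diffeological_lie s is_form_lam])
    fix n U P Q assume P: "LP n U P" and Q: "LP n U Q" and e: "\<And>u. u \<in> U \<Longrightarrow> lcos (P u) = lcos (Q u)"
    show "beta \<mu> n U P = beta \<mu> n U Q" unfolding beta_eq[OF P] beta_eq[OF Q]
      by (rule lam_same_fibre[OF MD_plot_const[OF \<mu> P] MD_plot_const[OF \<mu> Q]]) (simp add: same_fibre_def e)
  qed
  then have "is_form CX 1 (alpha \<mu>) \<and> pullback (lie_diffeology G) lcos (alpha \<mu>) = beta \<mu>"
    unfolding alpha_def coset_diffeology_eq by (rule someI_ex)
  then show "is_form CX 1 (alpha \<mu>)" "pullback (lie_diffeology G) lcos (alpha \<mu>) = beta \<mu>" by auto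
qed

lemma alpha_apply:
  assumes \<mu>: "\<mu> \<in> hperp" and q: "LP n U q" and P: "\<And>x. x \<in> U \<Longrightarrow> P x = lcos (q x)" and u: "u \<in> U" and w: "w \<in> Rn n"
  shows "alpha \<mu> n U P u [w] = \<mu> (rlog n q u w)"
proof -
  have "alpha \<mu> n U P = alpha \<mu> n U (lcos \<circ> q)"
    by (rule form_cong[OF diffeological_CX alpha(1)[OF \<mu>]]) (simp add: P)
  also have "\<dots> = beta \<mu> n U q" using pullback_apply[OF q, of lcos "alpha \<mu>"] alpha(2)[OF \<mu>] by simp
  finally show ?thesis using beta_eq[OF q] lam_apply[OF MD_plot_const[OF \<mu> q] u w] by simp
qed

lemma alpha_unique:
  assumes \<mu>: "\<mu> \<in> hperp" and \<alpha>: "is_form CX 1 \<alpha>"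
    and e: "\<And>n U q u w. LP n U q \<Longrightarrow> u \<in> U \<Longrightarrow> w \<in> Rn n \<Longrightarrow> \<alpha> n U (\<lambda>x. lcos (q x)) u [w] = \<mu> (rlog n q u w)"
  shows "\<alpha> = alpha \<mu>"
proof (rule form_unique_quotient[OF diffeological_lie \<alpha>[unfolded coset_diffeology_eq] alpha(1)[OF \<mu>, unfolded coset_diffeology_eq]], intro ext)
  fix n U q u vs
  show "pullback (lie_diffeology G) lcos \<alpha> n U q u vs = pullback (lie_diffeology G) lcos (alpha \<mu>) n U q u vs"
  proof (cases "LP n U q")
    case q: True
    have "\<alpha> n U (\<lambda>x. lcos (q x)) u vs = alpha \<mu> n U (\<lambda>x. lcos (q x)) u vs"
    proof (cases "u \<in> U \<and> vs \<in> vecs n 1")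
      case True
      then obtain w where w: "w \<in> Rn n" "vs = [w]" and u: "u \<in> U" using mem_vecs1 by blast
      show ?thesis unfolding w(2) e[OF q u w(1)] alpha_apply[OF \<mu> q refl u w(1)] ..
    next
      case False
      then show ?thesis using form_zero[OF \<alpha> False] form_zero[OF alpha(1)[OF \<mu>] False] by simp
    qed
    then show ?thesis by (simp add: pullback_def comp_def)
  qed (simp add: pullback_def)
qed

text \<open>Pulled back to \<open>G\<close>, a form on the coset space is determined by its values on the right-invariant
  vector fields. These values are right \<open>H\<close>-invariant functions, hence constant by density.\<close>

context
  fixes \<alpha> :: "'g set form"
  assumes \<alpha>: "is_form CX 1 \<alpha>"
begin

text \<open>The right translate of \<open>Z\<close> to \<open>g\<close> is represented by the chart
  at the identity multiplied by \<open>g\<close>; projected to cosets this is a plot on which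
  \<open>\<alpha>\<close> can be evaluated directly.\<close>

definition rval :: "'g tvec \<Rightarrow> 'g \<Rightarrow> real"
  where "rval Z g = \<alpha> dm (img c1) (\<lambda>y. lcos (chart_inv c1 y \<otimes> g)) y1 [Z c1]"

lemma rval_plot: "g \<in> carrier G \<Longrightarrow> Plots CX dm (img c1) (\<lambda>y. lcos (chart_inv c1 y \<otimes> g))"
  by (rule CX_plotI[OF LP_rmult[OF _ c1(5)]])

lemma rval_lincomb:
  assumes g: "g \<in> carrier G" and v: "v \<in> TS \<one>" and w: "w \<in> TS \<one>"
  shows "rval (\<lambda>c i. a * v c i + b * w c i) g = a * rval v g + b * rval w g"
  unfolding rval_def
  by (rule smooth_form1_linear[OF is_formD(1)[OF \<alpha> rval_plot[OF g]] c1(3) tangent_one(2)[OF v] tangent_one(2)[OF w]])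

text \<open>Near \<open>u\<close>, factor \<open>q x\<close> as
  \<open>(q x \<otimes> inv (q u)) \<otimes> q u\<close>. The first factor stays in the chart at the
  identity, so naturality compares the plot with the one in \<open>rval\<close>.\<close>

lemma form_rval:
  assumes q: "LP n U q" and u: "u \<in> U" and w: "w \<in> Rn n"
  shows "\<alpha> n U (\<lambda>x. lcos (q x)) u [w] = rval (rlog n q u w) (q u)"
proof -
  note qu = LP_carrier[OF q u]
  let ?Q = "\<lambda>x. q x \<otimes> inv (q u)"
  let ?W = "{x \<in> U. ?Q x \<in> fst c1}"
  note W = LP_chart[OF LP_right_quotient[OF q u] c1(1)]
  have uW: "u \<in> ?W" using u qu c1(2) by simp
  have "\<alpha> n U (\<lambda>x. lcos (q x)) u [w] = \<alpha> n ?W (\<lambda>x. lcos (q x)) u [w]"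
    by (rule form_restrict[OF \<alpha> CX_plotI[OF q] W(1) _ LP_open[OF q] refl uW, symmetric]) auto
  also have "\<dots> = \<alpha> dm (img c1) (\<lambda>y. lcos (chart_inv c1 y \<otimes> q u)) (snd c1 (?Q u)) [jac n (\<lambda>x. snd c1 (?Q x)) u w]"
  proof (rule form_natural1[OF \<alpha> rval_plot[OF qu] W(2) _ uW w])
    fix v assume v: "v \<in> ?W"
    then have "chart_inv c1 (snd c1 (?Q v)) \<otimes> q u = q v"
      using chart_inv_eq[OF c1(1)] LP_carrier[OF q] qu by (simp add: m_assoc)
    then show "lcos (q v) = lcos (chart_inv c1 (snd c1 (?Q v)) \<otimes> q u)" by simp
  qed
  also have "snd c1 (?Q u) = y1" using qu by simp
  also have "jac n (\<lambda>x. snd c1 (?Q x)) u w = rlog n q u w c1"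
    using uW c1(1) by (simp add: rlog_def velocity_def comp_def)
  finally show ?thesis by (simp add: rval_def)
qed

text \<open>The parameter \<open>g\<close> becomes an extra variable of a plot of the coset space,
  and a form is smooth in all the variables of a plot.\<close>

lemma rval_continuous:
  assumes Z: "Z \<in> TS \<one>" and c: "c \<in> charts G"
  shows "continuous_on (img c) (\<lambda>x. rval Z (chart_inv c x))"
proof -
  let ?D = "prod_dom dm dm (img c1) (img c)"
  note co = chart_open[OF c]
  define M where "M = (\<lambda>z. chart_inv c1 (fst_part dm z) \<otimes> chart_inv c (snd_part dm z))"
  have M: "LP (dm + dm) ?D M"
    unfolding M_def by (rule LP_mult[OF LP_fst[OF c1(5) co] LP_snd[OF LP_chart_inv[OF c] c1(6)]])
  have Mj: "M (join dm y x) = chart_inv c1 y \<otimes> chart_inv c x" if "y \<in> img c1" for x y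
    using openin_subset_Rn[OF c1(6) that] by (simp add: M_def fst_part_join)
  let ?w = "join dm (Z c1) (\<lambda>_. 0)"
  have w: "?w \<in> Rn (dm + dm)" by (rule join_Rn[OF tangent_one(2)[OF Z] zero_mem_Rn])
  have "smooth_on dm (img c) (\<lambda>x. \<alpha> (dm + dm) ?D (\<lambda>z. lcos (M z)) (join dm y1 x) [?w])"
    by (rule smooth_on_compose[OF smooth_map_join[OF smooth_map_const[OF co c1(6,3)] smooth_map_id[OF co co order_refl]]
          smooth_form1_smooth[OF is_formD(1)[OF \<alpha> CX_plotI[OF M]] w]])
  moreover have "rval Z (chart_inv c x) = \<alpha> (dm + dm) ?D (\<lambda>z. lcos (M z)) (join dm y1 x) [?w]" if x: "x \<in> img c" for x
  proof -
    have "rval Z (chart_inv c x) = \<alpha> (dm + dm) ?D (\<lambda>z. lcos (M z)) (join dm y1 x) [jac dm (\<lambda>y. join dm y x) y1 (Z c1)]"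
      unfolding rval_def
      by (rule form_natural1[OF \<alpha> CX_plotI[OF M] smooth_map_join[OF smooth_map_id[OF c1(6,6) order_refl] smooth_map_const[OF c1(6) co x]] _ c1(3) tangent_one(2)[OF Z]])
        (simp add: Mj)
    then show ?thesis by (simp add: jac_join jac_id[OF tangent_one(2)[OF Z]])
  qed
  ultimately show ?thesis
    using smooth_on_continuous smooth_on_cong[OF co, of "\<lambda>x. rval Z (chart_inv c x)"
        "\<lambda>x. \<alpha> (dm + dm) ?D (\<lambda>z. lcos (M z)) (join dm y1 x) [?w]"] by blast
qed

lemma rval_const:
  assumes Z: "Z \<in> TS \<one>" and g: "g \<in> carrier G"
  shows "rval Z g = rval Z \<one>"
proof (rule dense_constant[OF dense rval_continuous[OF Z] _ g])
  fix h assume h: "h \<in> H"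
  have "\<alpha> dm (img c1) (\<lambda>y. lcos (chart_inv c1 y \<otimes> h)) = \<alpha> dm (img c1) (\<lambda>y. lcos (chart_inv c1 y \<otimes> \<one>))"
    by (rule form_cong[OF diffeological_CX \<alpha>]) (use lcos_right[OF _ h] LP_carrier[OF c1(5)] in simp)
  then show "rval Z h = rval Z \<one>" by (simp add: rval_def)
qed

lemma form_is_alpha: "\<exists>\<mu>\<in>hperp. \<alpha> = alpha \<mu>"
proof -
  define \<mu> where "\<mu> = (\<lambda>Z. if Z \<in> TS \<one> then rval Z \<one> else 0)"
  have C: "\<mu> \<in> CS \<one>" unfolding cotangent_space_def
  proof (intro CollectI conjI allI ballI impI)
    fix v w a b assume v: "v \<in> TS \<one>" and w: "w \<in> TS \<one>"
    then show "\<mu> (\<lambda>c i. a * v c i + b * w c i) = a * \<mu> v + b * \<mu> w"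
      using tangent_lincomb[OF v w] rval_lincomb[OF one_closed v w] by (simp add: \<mu>_def)
  qed (simp add: \<mu>_def)
  \<comment> \<open>For \<open>Z\<close> in \<hh> the curve \<open>expc Z\<close> stays in
    \<open>H\<close> and projects to a constant plot, on which every one-form vanishes.\<close>
  have "\<mu> Z = 0" if ZH: "Z \<in> subgroup_algebra G H" for Z
  proof -
    have Z: "Z \<in> TS \<one>" and EH: "\<And>t. expc Z t \<in> H" using ZH by (auto simp: mem_subgroup_algebra)
    note x = expc_facts[OF Z]
    have "lcos (expc Z t) = lcos \<one>" for t
      using lcos_right[OF one_closed EH, of t] x(3) by simp
    then have "\<alpha> 1 (Rn 1) (\<lambda>x. lcos (expc Z (x 0))) = \<alpha> 1 (Rn 1) (\<lambda>x. lcos \<one>)" by simp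
    moreover have "\<alpha> 1 (Rn 1) (\<lambda>x. lcos (expc Z (x 0))) (pt 0) [evec 0] = rval Z \<one>"
      using form_rval[OF x(1) pt_Rn(1) evec0_Rn, of 0] x(4) unfolding x(5) by simp
    moreover have "\<alpha> 1 (Rn 1) (\<lambda>x. lcos \<one>) (pt 0) [evec 0] = rval (\<lambda>_ _. 0) \<one>"
      using form_rval[OF LP_constant[OF one_closed openin_Rn] pt_Rn(1) evec0_Rn, of 0] by simp
    moreover have "rval (\<lambda>_ _. 0) \<one> = 0" using rval_lincomb[OF one_closed Z Z, of 0 0] by simp
    ultimately show ?thesis using Z by (simp add: \<mu>_def)
  qed
  then have \<mu>: "\<mu> \<in> hperp" using C by (simp add: hperp_def)
  have "\<alpha> = alpha \<mu>"
  proof (rule alpha_unique[OF \<mu> \<alpha>])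
    fix n U q u w assume q: "LP n U q" and u: "u \<in> U" and w: "w \<in> Rn n"
    show "\<alpha> n U (\<lambda>x. lcos (q x)) u [w] = \<mu> (rlog n q u w)"
      unfolding form_rval[OF q u w] using rval_const[OF rlog_tangent[OF q u] LP_carrier[OF q u]] rlog_tangent[OF q u]
      by (simp add: \<mu>_def)
  qed
  then show ?thesis using \<mu> by blast
qed

end

text \<open>A test plot through the coset of \<open>q\<close> that detects the value of
  \<open>\<mu>\<close> on \<open>Z\<close>. It yields the injectivity of \<open>alpha\<close>, the
  triviality of forms vanishing at a point, and the smoothness of \<open>\<mu>\<close> in smooth
  families of forms.\<close>

lemma alpha_eval:
  assumes \<mu>: "\<mu> \<in> hperp" and Z: "Z \<in> TS \<one>" and q: "q \<in> carrier G"
  shows "Plots CX 1 (Rn 1) (\<lambda>x. lcos (expc Z (x 0) \<otimes> q))"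
    "alpha \<mu> 1 (Rn 1) (\<lambda>x. lcos (expc Z (x 0) \<otimes> q)) (\<lambda>_. 0) [evec 0] = \<mu> Z"
proof -
  note x = expc_facts[OF Z]
  have L: "LP 1 (Rn 1) (\<lambda>x. expc Z (x 0) \<otimes> q)" by (rule LP_rmult[OF q x(1)])
  show "Plots CX 1 (Rn 1) (\<lambda>x. lcos (expc Z (x 0) \<otimes> q))" by (rule CX_plotI[OF L])
  have "alpha \<mu> 1 (Rn 1) (\<lambda>x. lcos (expc Z (x 0) \<otimes> q)) (pt 0) [evec 0] = \<mu> (rlog 1 (\<lambda>x. expc Z (x 0) \<otimes> q) (pt 0) (evec 0))"
    by (rule alpha_apply[OF \<mu> L refl pt_Rn(1) evec0_Rn])
  also have "\<dots> = \<mu> Z" unfolding rlog_right_translate[OF x(1) pt_Rn(1) q] x(5) ..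
  finally show "alpha \<mu> 1 (Rn 1) (\<lambda>x. lcos (expc Z (x 0) \<otimes> q)) (\<lambda>_. 0) [evec 0] = \<mu> Z" by (simp add: pt_zero)
qed

lemma alpha_inj:
  assumes "\<mu> \<in> hperp" "\<nu> \<in> hperp" "alpha \<mu> = alpha \<nu>"
  shows "\<mu> = \<nu>"
  by (rule covector_ext[OF hperp_CS[OF assms(1)] hperp_CS[OF assms(2)]])
    (use alpha_eval(2)[OF assms(1) _ one_closed] alpha_eval(2)[OF assms(2) _ one_closed] assms(3) in metis)

section \<open>The cotangent space of the coset space as a quotient of the model\<close>

lemma Pts_Omega1: "Pts (Omega1 X) = {\<alpha>. is_form X 1 \<alpha>}"
  by (simp add: Omega1_def)

lemma Plots_Omega1: "Plots (Omega1 X) m U A \<longleftrightarrow> openin (Euclidean_space m) U \<and> A ` U \<subseteq> {\<alpha>. is_form X 1 \<alpha>} \<and>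
       (\<forall>n V P. Plots X n V P \<longrightarrow> (\<forall>w\<in>Rn n. smooth_on (m + n) (prod_dom m n U V)
          (\<lambda>z. A (fst_part m z) n V P (snd_part m z) [w])))"
  by (simp add: Omega1_def)

text \<open>The test plots of \<open>alpha_eval\<close> start at any prescribed coset, so two forms
  whose difference vanishes there have the same \<open>\<mu>\<close>. The cotangent classes are thus
  singletons.\<close>

lemma cot_proj_alpha:
  assumes q: "q \<in> carrier G" and \<mu>: "\<mu> \<in> hperp"
  shows "cot_proj CX (lcos q, alpha \<mu>) = (lcos q, {alpha \<mu>})"
proof -
  have "\<beta> = alpha \<mu>" if fb: "is_form CX 1 \<beta>" and v: "vanishes_at CX (\<lambda>n U P u vs. \<beta> n U P u vs - alpha \<mu> n U P u vs) (lcos q)" for \<beta>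
  proof -
    obtain \<nu> where \<nu>: "\<nu> \<in> hperp" "\<beta> = alpha \<nu>" using form_is_alpha[OF fb] by blast
    have "\<nu> Z = \<mu> Z" if Z: "Z \<in> TS \<one>" for Z
    proof -
      have "lcos (expc Z ((\<lambda>_. 0) 0) \<otimes> q) = lcos q" using expc_facts(4)[OF Z] q by simp
      then have "\<beta> 1 (Rn 1) (\<lambda>x. lcos (expc Z (x 0) \<otimes> q)) (\<lambda>_. 0) [evec 0] - alpha \<mu> 1 (Rn 1) (\<lambda>x. lcos (expc Z (x 0) \<otimes> q)) (\<lambda>_. 0) [evec 0] = 0"
        using v alpha_eval(1)[OF \<mu> Z q] evec0_Rn zero_mem_Rn unfolding vanishes_at_def by blast
      then show ?thesis unfolding \<nu>(2) alpha_eval(2)[OF \<mu> Z q] alpha_eval(2)[OF \<nu>(1) Z q] by simp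
    qed
    then have "\<nu> = \<mu>" by (rule covector_ext[OF hperp_CS[OF \<nu>(1)] hperp_CS[OF \<mu>]])
    then show ?thesis using \<nu>(2) by simp
  qed
  moreover have "vanishes_at CX (\<lambda>n U P u vs. alpha \<mu> n U P u vs - alpha \<mu> n U P u vs) (lcos q)"
    by (simp add: vanishes_at_def)
  ultimately have "{\<beta> \<in> Pts (Omega1 CX). vanishes_at CX (\<lambda>n U P u vs. \<beta> n U P u vs - alpha \<mu> n U P u vs) (lcos q)} = {alpha \<mu>}"
    using alpha(1)[OF \<mu>] by (auto simp: Pts_Omega1)
  then show ?thesis by (simp add: cot_proj_def)
qed

definition lift_pair :: "'g \<times> 'g covec \<Rightarrow> 'g set \<times> 'g set form"
  where "lift_pair x = (lcos (fst x), alpha (snd x))"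

abbreviation "kap \<equiv> \<lambda>x. cot_proj CX (lift_pair x)"

lemma kap_eq: "x \<in> Pts MD \<Longrightarrow> kap x = (lcos (fst x), {alpha (snd x)})"
  using cot_proj_alpha[of "fst x" "snd x"] by (auto simp: lift_pair_def Pts_MD)

lemma kap_eq_iff: "x \<in> Pts MD \<Longrightarrow> y \<in> Pts MD \<Longrightarrow> kap x = kap y \<longleftrightarrow> same_fibre x y"
  using alpha_inj[of "snd x" "snd y"] by (auto simp: kap_eq same_fibre_def Pts_MD)

lemma lift_pair_range: "lift_pair ` Pts MD = Pts (XOmega1 CX)"
proof (intro equalityI subsetI)
  show "y \<in> Pts (XOmega1 CX)" if "y \<in> lift_pair ` Pts MD" for y
    using that alpha(1) by (auto simp: lift_pair_def Pts_MD Pts_CX Pts_Omega1)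
  fix y assume "y \<in> Pts (XOmega1 CX)"
  then obtain q \<alpha> where y: "y = (lcos q, \<alpha>)" and q: "q \<in> carrier G" and \<alpha>: "is_form CX 1 \<alpha>"
    by (auto simp: Pts_CX Pts_Omega1)
  then obtain \<mu> where \<mu>: "\<mu> \<in> hperp" "\<alpha> = alpha \<mu>" using form_is_alpha by blast
  show "y \<in> lift_pair ` Pts MD"
    by (rule image_eqI[of _ _ "(q, \<mu>)"]) (use q \<mu> in \<open>simp_all add: y lift_pair_def Pts_MD\<close>)
qed

text \<open>The functional diffeology is tested on arbitrary plots \<open>P\<close> of the coset
  space. Over a local lift of \<open>P\<close> to \<open>G\<close> the value is the pairing of a
  covector with a logarithmic derivative, smooth in both parameters.\<close>

lemma lift_pair_plot:
  assumes R: "Plots MD n U R"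
  shows "Plots (XOmega1 CX) n U (\<lambda>u. lift_pair (R u))"
proof -
  have q: "LP n U (\<lambda>u. fst (R u))" and m: "\<And>u. u \<in> U \<Longrightarrow> snd (R u) \<in> hperp"
    and s: "\<And>Z. Z \<in> TS \<one> \<Longrightarrow> smooth_on n U (\<lambda>u. snd (R u) Z)"
    using R by (auto simp: Plots_MD)
  note U = MD_open[OF R]
  have "Plots (Omega1 CX) n U (\<lambda>u. alpha (snd (R u)))"
    unfolding Plots_Omega1
  proof (intro conjI allI impI ballI U)
    show "(\<lambda>u. alpha (snd (R u))) ` U \<subseteq> {\<alpha>. is_form CX 1 \<alpha>}" using alpha(1) m by auto
    fix k V P w assume P: "Plots CX k V P" and w: "w \<in> Rn k"
    note V = plot_open[OF diffeological_CX P]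
    let ?f = "\<lambda>z. alpha (snd (R (fst_part n z))) k V P (snd_part n z) [w]"
    show "smooth_on (n + k) (prod_dom n k U V) ?f"
    proof (rule smooth_on_local[OF openin_prod_dom[OF U V]])
      fix z assume z: "z \<in> prod_dom n k U V"
      then have zV: "snd_part n z \<in> V" by (simp add: prod_dom_def)
      then obtain W r where W: "openin (Euclidean_space k) W" "snd_part n z \<in> W" "W \<subseteq> V" "LP k W r" "\<forall>v\<in>W. P v = lcos (r v)"
        using CX_plotD[OF P zV] by blast
      let ?D = "prod_dom n k U W"
      note D = openin_prod_dom[OF U W(1)]
      have fst_in: "fst_part n y \<in> U" and snd_in: "snd_part n y \<in> W" if "y \<in> ?D" for y
        using that by (auto simp: prod_dom_def)
      note sf = smooth_map_fst_part[OF U W(1)] and ss = smooth_map_snd_part[OF U W(1)]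
      have "smooth_on (n + k) ?D (\<lambda>y. snd (R (fst_part n y)) (rlog k r (snd_part n y) w))"
      proof (rule smooth_pairing[OF D, of "\<lambda>y. snd (R (fst_part n y))" "\<lambda>y. rlog k r (snd_part n y) w"])
        show "snd (R (fst_part n y)) \<in> CS \<one>" if "y \<in> ?D" for y using hperp_CS[OF m[OF fst_in[OF that]]] .
        show "smooth_on (n + k) ?D (\<lambda>y. snd (R (fst_part n y)) Z)" if "Z \<in> TS \<one>" for Z
          by (rule smooth_on_compose[OF sf s[OF that]])
        show "rlog k r (snd_part n y) w \<in> TS \<one>" if "y \<in> ?D" for y by (rule rlog_tangent[OF W(4) snd_in[OF that]])
        show "smooth_on (n + k) ?D (\<lambda>y. rlog k r (snd_part n y) w c1 j)" for j
          by (rule smooth_on_compose[OF ss smooth_rlog[OF W(4) w]])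
      qed
      moreover have "?f y = snd (R (fst_part n y)) (rlog k r (snd_part n y) w)" if y: "y \<in> ?D" for y
      proof -
        note my = m[OF fst_in[OF y]]
        have "alpha (snd (R (fst_part n y))) k W P (snd_part n y) [w] = ?f y"
          by (rule form_restrict[OF alpha(1)[OF my] P W(1,3) V refl snd_in[OF y]])
        then show ?thesis using alpha_apply[OF my W(4) _ snd_in[OF y] w, of P] W(5) by simp
      qed
      ultimately have "smooth_on (n + k) ?D ?f"
        using smooth_on_cong[OF D, of ?f "\<lambda>y. snd (R (fst_part n y)) (rlog k r (snd_part n y) w)"] by blast
      moreover have "z \<in> ?D" "?D \<subseteq> prod_dom n k U V" using z W(2,3) by (auto simp: prod_dom_def)
      ultimately show "\<exists>V'. openin (Euclidean_space (n + k)) V' \<and> z \<in> V' \<and> V' \<subseteq> prod_dom n k U V \<and> smooth_on (n + k) V' ?f"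
        using D by blast
    qed
  qed
  then show ?thesis unfolding Plots_prod using CX_plotI[OF q] by (simp add: lift_pair_def comp_def)
qed

text \<open>A smooth family of forms has a smooth family of covectors: evaluate it on the fixed test
  plot of \<open>alpha_eval\<close>. The base point lifts by the definition of the quotient.\<close>

lemma lift_pair_plotD:
  assumes S: "Plots (XOmega1 CX) n U S" and u: "u \<in> U"
  shows "\<exists>V R. openin (Euclidean_space n) V \<and> u \<in> V \<and> V \<subseteq> U \<and> Plots MD n V R \<and> (\<forall>v\<in>V. S v = lift_pair (R v))"
proof -
  have P: "Plots CX n U (fst \<circ> S)" and A: "Plots (Omega1 CX) n U (snd \<circ> S)" using S by (auto simp: Plots_prod)
  note U = plot_open[OF diffeological_CX P]
  obtain V q where V: "openin (Euclidean_space n) V" "u \<in> V" "V \<subseteq> U" "LP n V q" "\<forall>v\<in>V. (fst \<circ> S) v = lcos (q v)"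
    using CX_plotD[OF P u] by blast
  define \<mu> where "\<mu> = (\<lambda>v. SOME \<mu>. \<mu> \<in> hperp \<and> snd (S v) = alpha \<mu>)"
  have \<mu>: "\<mu> v \<in> hperp \<and> snd (S v) = alpha (\<mu> v)" if "v \<in> U" for v
  proof -
    have "is_form CX 1 (snd (S v))" using A that by (auto simp: Plots_Omega1)
    then have "\<exists>\<mu>. \<mu> \<in> hperp \<and> snd (S v) = alpha \<mu>" using form_is_alpha by blast
    then show ?thesis unfolding \<mu>_def by (rule someI_ex)
  qed
  have "smooth_on n V (\<lambda>v. \<mu> v Z)" if Z: "Z \<in> TS \<one>" for Z
  proof -
    let ?P = "\<lambda>x. lcos (expc Z (x 0) \<otimes> \<one>)"
    have "Plots CX 1 (Rn 1) ?P" using alpha_eval(1)[OF _ Z one_closed] \<mu>[OF u] by blast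
    with A[unfolded Plots_Omega1] have "smooth_on (n + 1) (prod_dom n 1 U (Rn 1)) (\<lambda>z. snd (S (fst_part n z)) 1 (Rn 1) ?P (snd_part n z) [evec 0])"
      using evec0_Rn by (elim conjE allE[of _ 1] allE[of _ "Rn 1"] allE[of _ ?P]) (drule (1) mp, drule (1) bspec, simp only: comp_def)
    \<comment> \<open>Restricts to the slice on which the variable of the test plot is 0.\<close>
    from smooth_on_compose[OF smooth_map_join[OF smooth_map_id[OF U U order_refl] smooth_map_const[OF U openin_Rn zero_mem_Rn]] this]
    have sm: "smooth_on n U (\<lambda>v. snd (S (fst_part n (join n v (\<lambda>_. 0)))) 1 (Rn 1) ?P (snd_part n (join n v (\<lambda>_. 0))) [evec 0])" .
    have "snd (S (fst_part n (join n v (\<lambda>_. 0)))) 1 (Rn 1) ?P (snd_part n (join n v (\<lambda>_. 0))) [evec 0] = \<mu> v Z" if v: "v \<in> U" for v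
      unfolding snd_part_join fst_part_join[OF openin_subset_Rn[OF U v]]
      using alpha_eval(2)[OF _ Z one_closed, of "\<mu> v"] \<mu>[OF v] by simp
    then have "smooth_on n U (\<lambda>v. \<mu> v Z)"
      using smooth_on_cong[OF U, of "\<lambda>v. \<mu> v Z" "\<lambda>v. snd (S (fst_part n (join n v (\<lambda>_. 0)))) 1 (Rn 1) ?P (snd_part n (join n v (\<lambda>_. 0))) [evec 0]"] sm by simp
    then show ?thesis using smooth_on_subset V(3) by blast
  qed
  then have "Plots MD n V (\<lambda>v. (q v, \<mu> v))" using V(3,4) \<mu> by (auto simp: Plots_MD)
  moreover have "\<forall>v\<in>V. S v = lift_pair (q v, \<mu> v)"
    using V(3,5) \<mu> by (auto simp: lift_pair_def prod_eq_iff)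
  ultimately show ?thesis using V(1-3) by blast
qed

text \<open>Two successive quotients are one quotient: plots of pairs of a coset and a form lift
  locally to the model, and \<open>cot_proj\<close> is applied afterwards.\<close>

lemma cot_diffeology_eq: "cot_diffeology CX = quotient_diffeology MD kap"
proof (rule diffeology.equality)
  show "Pts (cot_diffeology CX) = Pts (quotient_diffeology MD kap)"
    unfolding cot_diffeology_def Pts_quotient lift_pair_range[symmetric] by (simp add: image_image)
  have "Plots (cot_diffeology CX) n U P \<longleftrightarrow> Plots (quotient_diffeology MD kap) n U P" for n U P
  proof
    assume P: "Plots (cot_diffeology CX) n U P"
    show "Plots (quotient_diffeology MD kap) n U P" unfolding Plots_quotient
    proof (intro conjI ballI)
      show "openin (Euclidean_space n) U" using P by (simp add: cot_diffeology_def Plots_quotient)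
      fix u assume u: "u \<in> U"
      obtain V S where V: "u \<in> V" "V \<subseteq> U" "Plots (XOmega1 CX) n V S" "\<forall>v\<in>V. P v = cot_proj CX (S v)"
        using quotient_plotD[OF P[unfolded cot_diffeology_def] u] by blast
      obtain W R where W: "openin (Euclidean_space n) W" "u \<in> W" "W \<subseteq> V" "Plots MD n W R" "\<forall>v\<in>W. S v = lift_pair (R v)"
        using lift_pair_plotD[OF V(3,1)] by blast
      have "\<forall>v\<in>W. P v = kap (R v)" using V(4) W(3,5) by auto
      then show "\<exists>V Q. openin (Euclidean_space n) V \<and> u \<in> V \<and> V \<subseteq> U \<and> Plots MD n V Q \<and> (\<forall>v\<in>V. P v = kap (Q v))"
        using W V(2) by blast
    qed
  next
    assume P: "Plots (quotient_diffeology MD kap) n U P"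
    show "Plots (cot_diffeology CX) n U P" unfolding cot_diffeology_def Plots_quotient
    proof (intro conjI ballI)
      show "openin (Euclidean_space n) U" using P by (simp add: Plots_quotient)
      fix u assume u: "u \<in> U"
      obtain V R where V: "openin (Euclidean_space n) V" "u \<in> V" "V \<subseteq> U" "Plots MD n V R" "\<forall>v\<in>V. P v = kap (R v)"
        using quotient_plotD[OF P u] by blast
      then show "\<exists>V Q. openin (Euclidean_space n) V \<and> u \<in> V \<and> V \<subseteq> U \<and> Plots (XOmega1 CX) n V Q \<and> (\<forall>v\<in>V. P v = cot_proj CX (Q v))"
        using lift_pair_plot[OF V(4)] by blast
    qed
  qed
  then show "Plots (cot_diffeology CX) = Plots (quotient_diffeology MD kap)" by (intro ext) blast
qed simp

section \<open>The Liouville form\<close>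

context
  fixes \<theta> :: "('g set \<times> 'g set form set) form"
  assumes \<theta>: "is_form (quotient_diffeology MD kap) 1 \<theta>" "pullback MD kap \<theta> = lam"
begin

lemma kap_form:
  assumes R: "Plots MD n U R" and P: "\<And>u. u \<in> U \<Longrightarrow> P u = kap (R u)"
  shows "\<theta> n U P = lam n U R"
proof -
  have "\<theta> n U P = \<theta> n U (kap \<circ> R)"
    by (rule form_cong[OF diffeological_quotient[OF diffeological_MD] \<theta>(1)]) (simp add: P)
  also have "\<dots> = pullback MD kap \<theta> n U R" by (rule pullback_apply[OF R, symmetric])
  finally show ?thesis by (simp add: \<theta>(2))
qed

text \<open>Both sides are local, and on a lift to the model both are the covector applied to the
  logarithmic derivative of the base point: \<open>\<theta>\<close> because it pulls back to
  \<open>lam\<close>, and \<open>Taut\<close> by the formula for \<open>alpha\<close>.\<close>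

lemma Taut_lam:
  assumes S: "Plots (XOmega1 CX) n U S"
  shows "\<theta> n U (cot_proj CX \<circ> S) = Taut CX n U S"
proof (intro ext)
  fix u vs
  have P: "Plots CX n U (fst \<circ> S)" and A: "Plots (Omega1 CX) n U (snd \<circ> S)" using S by (auto simp: Plots_prod)
  note U = plot_open[OF diffeological_CX P]
  note Q = diffeological_quotient[OF diffeological_MD, of kap]
  have kS: "Plots (quotient_diffeology MD kap) n U (cot_proj CX \<circ> S)"
    unfolding cot_diffeology_eq[symmetric] cot_diffeology_def Plots_quotient using S U by auto
  show "\<theta> n U (cot_proj CX \<circ> S) u vs = Taut CX n U S u vs"
  proof (cases "u \<in> U \<and> vs \<in> vecs n 1")
    case True
    then obtain w where w: "w \<in> Rn n" "vs = [w]" and u: "u \<in> U" using mem_vecs1 by blast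
    obtain V R where V: "openin (Euclidean_space n) V" "u \<in> V" "V \<subseteq> U" "Plots MD n V R" "\<forall>v\<in>V. S v = lift_pair (R v)"
      using lift_pair_plotD[OF S u] by blast
    have q: "LP n V (\<lambda>x. fst (R x))" and m: "snd (R u) \<in> hperp" using V(2,4) by (auto simp: Plots_MD)
    have "\<theta> n U (cot_proj CX \<circ> S) u [w] = \<theta> n V (cot_proj CX \<circ> S) u [w]"
      by (rule form_restrict[OF \<theta>(1) kS V(1,3) U refl V(2), symmetric])
    also have "\<theta> n V (cot_proj CX \<circ> S) = lam n V R" by (rule kap_form[OF V(4)]) (use V(5) in simp)
    also have "lam n V R u [w] = snd (R u) (rlog n (\<lambda>x. fst (R x)) u w)" by (rule lam_apply[OF V(4,2) w(1)])
    also have "\<dots> = alpha (snd (R u)) n V (fst \<circ> S) u [w]"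
      by (rule alpha_apply[OF m q _ V(2) w(1), symmetric]) (use V(5) in \<open>simp add: lift_pair_def\<close>)
    also have "\<dots> = alpha (snd (R u)) n U (fst \<circ> S) u [w]"
      by (rule form_restrict[OF alpha(1)[OF m] P V(1,3) U refl V(2)])
    also have "\<dots> = Taut CX n U S u [w]" using S u V(2,5) by (simp add: Taut_def lift_pair_def)
    finally show ?thesis by (simp add: w(2) comp_def)
  next
    case False
    have "Taut CX n U S u vs = 0"
    proof (cases "u \<in> U")
      case u: True
      then have "is_form CX 1 (snd (S u))" using A by (auto simp: Plots_Omega1)
      then show ?thesis using form_zero[OF _ False, of CX "snd (S u)"] S by (simp add: Taut_def)
    qed (simp add: Taut_def)
    then show ?thesis using form_zero[OF \<theta>(1) False] by simp
  qed
qed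

text \<open>\<open>Taut_lam\<close> provides the defining property, and any other solution agrees
  with \<open>\<theta>\<close> after pulling back to the model.\<close>

lemma Liouv_eq: "Liouv CX = \<theta>"
  unfolding Liouv_def cot_diffeology_eq
proof (rule the_equality)
  have "pullback (XOmega1 CX) (cot_proj CX) \<theta> = Taut CX"
  proof (intro ext)
    fix n U S u vs
    show "pullback (XOmega1 CX) (cot_proj CX) \<theta> n U S u vs = Taut CX n U S u vs"
      using Taut_lam[of n U S] by (simp add: pullback_def Taut_def)
  qed
  then show "is_form (quotient_diffeology MD kap) 1 \<theta> \<and> pullback (XOmega1 CX) (cot_proj CX) \<theta> = Taut CX"
    using \<theta>(1) by simp
  fix \<eta> assume e: "is_form (quotient_diffeology MD kap) 1 \<eta> \<and> pullback (XOmega1 CX) (cot_proj CX) \<eta> = Taut CX"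
  show "\<eta> = \<theta>"
  proof (rule form_unique_quotient[OF diffeological_MD _ \<theta>(1)], use e in blast, intro ext)
    fix n U R u vs
    show "pullback MD kap \<eta> n U R u vs = pullback MD kap \<theta> n U R u vs"
    proof (cases "Plots MD n U R")
      case True
      note S = lift_pair_plot[OF True]
      have c: "kap \<circ> R = cot_proj CX \<circ> (\<lambda>u. lift_pair (R u))" by (simp add: comp_def)
      have "\<eta> n U (kap \<circ> R) = Taut CX n U (\<lambda>u. lift_pair (R u))"
        unfolding c using pullback_apply[OF S] e by metis
      also have "\<dots> = \<theta> n U (kap \<circ> R)" unfolding c by (rule Taut_lam[OF S, symmetric])
      finally show ?thesis by (simp add: pullback_def)
    qed (simp add: pullback_def)
  qed
qed

end

text \<open>Representatives are translated by \<open>inv g\<close> on the left, so their logarithmic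
  derivatives pick up \<open>Ad (inv g)\<close>; on \<open>\<mu>\<close> this is the coadjoint
  action of \<open>g\<close>.\<close>

lemma pullback_alpha:
  assumes g: "g \<in> carrier G" and \<mu>: "\<mu> \<in> hperp"
  shows "pullback CX (\<lambda>C. inv g <# C) (alpha \<mu>) = alpha (coad g \<mu>)"
proof (rule alpha_unique[OF coad_hperp[OF \<mu> g]])
  note ig = inv_closed[OF g]
  have L: "Plots CX n U (\<lambda>u. inv g <# P u)" if P: "Plots CX n U P" for n U P
  proof (rule plot_local[OF diffeological_CX plot_open[OF diffeological_CX P]])
    fix u assume u: "u \<in> U"
    obtain V q where V: "openin (Euclidean_space n) V" "u \<in> V" "V \<subseteq> U" "LP n V q" "\<forall>v\<in>V. P v = lcos (q v)"
      using CX_plotD[OF P u] by blast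
    have "inv g <# P v = lcos (inv g \<otimes> q v)" if "v \<in> V" for v
      using V(5) that lmult_lcos[OF ig LP_carrier[OF V(4) that]] by simp
    then have "Plots CX n V (\<lambda>v. inv g <# P v)"
      using plot_cong[OF diffeological_CX, of V "\<lambda>v. inv g <# P v" "\<lambda>v. lcos (inv g \<otimes> q v)"] CX_plotI[OF LP_lmult[OF ig V(4)]] by simp
    then show "\<exists>V. openin (Euclidean_space n) V \<and> u \<in> V \<and> V \<subseteq> U \<and> Plots CX n V (\<lambda>v. inv g <# P v)"
      using V by blast
  qed
  have s: "diffeo_smooth CX CX (\<lambda>C. inv g <# C)"
    using L lmult_lcos[OF ig] ig by (auto simp: diffeo_smooth_def comp_def Pts_CX)
  show "is_form CX 1 (pullback CX (\<lambda>C. inv g <# C) (alpha \<mu>))"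
    by (rule is_form_pullback[OF diffeological_CX s alpha(1)[OF \<mu>]])
  fix n U q u w assume q: "LP n U q" and u: "u \<in> U" and w: "w \<in> Rn n"
  have "pullback CX (\<lambda>C. inv g <# C) (alpha \<mu>) n U (\<lambda>x. lcos (q x)) u [w] = alpha \<mu> n U (\<lambda>x. inv g <# lcos (q x)) u [w]"
    using CX_plotI[OF q] by (simp add: pullback_def comp_def)
  also have "\<dots> = \<mu> (rlog n (\<lambda>x. inv g \<otimes> q x) u w)"
    by (rule alpha_apply[OF \<mu> LP_lmult[OF ig q] _ u w]) (rule lmult_lcos[OF ig LP_carrier[OF q]])
  also have "\<dots> = coad g \<mu> (rlog n q u w)"
    unfolding rlog_left_quotient[OF q u ig] using rlog_tangent[OF q u] by (simp add: coad_def)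
  finally show "pullback CX (\<lambda>C. inv g <# C) (alpha \<mu>) n U (\<lambda>x. lcos (q x)) u [w] = coad g \<mu> (rlog n q u w)" .
qed

lemma cot_action_kap:
  assumes g: "g \<in> carrier G" and x: "x \<in> Pts MD"
  shows "cot_action G CX (\<lambda>g C. g <# C) g (kap x) = kap (mact g x)"
proof -
  let ?f = "\<lambda>(C, \<alpha>). cot_proj CX (g <# C, pullback CX (\<lambda>C. inv g <# C) \<alpha>)"
  have f: "?f (lift_pair y) = kap (mact g y)" if "y \<in> Pts MD" for y
    using that pullback_alpha[OF g, of "snd y"] lmult_lcos[OF g, of "fst y"]
    by (auto simp: lift_pair_def mact_def Pts_MD)
  have "descend (Pts (XOmega1 CX)) (cot_proj CX) ?f (kap x) = ?f (lift_pair x)"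
  proof (rule descend_eq)
    show "lift_pair x \<in> Pts (XOmega1 CX)" using x lift_pair_range by blast
    fix t assume "t \<in> Pts (XOmega1 CX)" and e: "cot_proj CX t = kap x"
    then obtain y where y: "y \<in> Pts MD" "t = lift_pair y" using lift_pair_range by blast
    then have "same_fibre y x" using e kap_eq_iff[OF y(1) x] by simp
    then show "?f t = ?f (lift_pair x)"
      unfolding y(2) f[OF y(1)] f[OF x]
      using kap_eq_iff[OF mact_MD[OF g y(1)] mact_MD[OF g x]] same_fibre_mact[OF g y(1) x] by simp
  qed
  then show ?thesis unfolding cot_action_def f[OF x] by simp
qed

lemma model_quotient_cotangent: "model_quotient kap (cotangent_of_quotient G H)"
  unfolding model_quotient_def
proof (intro conjI ballI)
  let ?T = "cotangent_of_quotient G H"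
  note T = cotangent_of_quotient_def diffeological_cotangent_def
  show hs: "hspace ?T = quotient_diffeology MD kap" by (simp add: T cot_diffeology_eq)
  obtain \<theta> where \<theta>: "is_form (quotient_diffeology MD kap) 1 \<theta>" "pullback MD kap \<theta> = lam"
    using lam_descends[of kap] kap_eq_iff by blast
  note Le = Liouv_eq[OF \<theta>]
  show "\<exists>\<theta>. is_form (hspace ?T) 1 \<theta> \<and> pullback MD kap \<theta> = lam \<and> hform ?T = ext_d (hspace ?T) 1 \<theta>"
    using \<theta> by (intro exI[of _ \<theta>]) (simp add: T cot_diffeology_eq Le)
  fix x assume x: "x \<in> Pts MD"
  show "kap x = kap y \<longleftrightarrow> same_fibre x y" if "y \<in> Pts MD" for y by (rule kap_eq_iff[OF x that])
  show "hact ?T g (kap x) = kap (mact g x)" if "g \<in> carrier G" for g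
    using cot_action_kap[OF that x] by (simp add: T)
  show "hmoment ?T (kap x) = snd x"
  proof
    fix v
    have q: "fst x \<in> carrier G" and m: "snd x \<in> CS \<one>" using x by (auto simp: Pts_MD hperp_CS)
    \<comment> \<open>The orbit map of \<open>x\<close> in the chart at the identity, lifted to the
      model. At the identity the Liouville form on it is the covector of \<open>x\<close> paired
      with the velocity of the group variable, since the right factor \<open>fst x\<close> does not
      affect the logarithmic derivative.\<close>
    let ?R = "\<lambda>y. mact (chart_inv c1 y) x"
    have R: "Plots MD dm (img c1) ?R"
      by (rule mact_plot[OF c1(5) plot_const[OF diffeological_MD x c1(6)]])
    show "hmoment ?T (kap x) v = snd x v"
    proof (cases "v \<in> TS \<one>")
      case True
      have "hmoment ?T (kap x) v = \<theta> dm (img c1) (\<lambda>y. cot_action G CX (\<lambda>g C. g <# C) (chart_inv c1 y) (kap x)) y1 [v c1]"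
        using True c1(5) by (simp add: T form_value_def Let_def pullback_def comp_def Le)
      also have "\<theta> dm (img c1) (\<lambda>y. cot_action G CX (\<lambda>g C. g <# C) (chart_inv c1 y) (kap x)) = lam dm (img c1) ?R"
        by (rule kap_form[OF \<theta> R]) (rule cot_action_kap[OF LP_carrier[OF c1(5)] x])
      also have "lam dm (img c1) ?R y1 [v c1] = snd (?R y1) (rlog dm (\<lambda>y. fst (?R y)) y1 (v c1))"
        by (rule lam_apply[OF R c1(3) tangent_one(2)[OF True]])
      also have "\<dots> = coad \<one> (snd x) (rlog dm (\<lambda>y. chart_inv c1 y \<otimes> fst x) y1 (v c1))"
        by (simp only: mact_def fst_conv snd_conv c1(4))
      also have "\<dots> = snd x (rlog dm (chart_inv c1) y1 (v c1))"
        unfolding coad_one[OF m] rlog_right_translate[OF c1(5,3) q] ..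
      also have "rlog dm (chart_inv c1) y1 (v c1) = vel dm (chart_inv c1) y1 (v c1)"
        unfolding rlog_def c1(4)
        by (rule velocity_cong[OF c1(6,3)]) (use LP_carrier[OF c1(5)] in simp)
      also have "\<dots> = v" using tangent_one(1)[OF True] by simp
      finally show ?thesis .
    next
      case False
      then show ?thesis using covector_outside[OF m False] by (simp add: T form_value_def)
    qed
  qed
qed

end

theorem theorem9p8:
  fixes G :: "('g, 'm) lie_scheme" and H :: "'g set"
  assumes "lie_group G"
    and "subgroup H G"
    and "lie_topology G closure_of H = carrier G"
  shows "ham_isomorphic G (induced_space G H) (cotangent_of_quotient G H)"
proof -
  interpret lie_dense G H
    by (intro lie_dense.intro lie.intro lie_dense_axioms.intro assms)
  show ?thesis
    by (rule model_quotient_isomorphic[OF model_quotient_induced model_quotient_cotangent])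
qed

end
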